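(* Let $\alpha>1$ be irrational and $\beta=1/\alpha$. Define, for $\mathrm{Re}(s)>1$, $$\zeta_\alpha(s)=\sum_{n=1}^\infty\frac{1}{\lfloor\alpha n\rfloor^s},\qquad S_\alpha(s)=\sum_{n=1}^\infty\frac{\lceil\beta n\rceil-\lceil\beta(n-1)\rceil}{n^s}.$$ Then $\zeta_\alpha$ and $S_\alpha$ can be continued analytically to the half-plane $\{s\in\mathbb{C}:\mathrm{Re}(s)>-\frac{1}{\tau_\alpha}\}$ except for a simple pole at $s=1$ with residue $\beta$. If $\tau_\alpha>1$, the vertical line $-\frac{1}{\tau_\alpha}+i\mathbb{R}$ is the natural boundary for $\zeta_\alpha$ and for $S_\alpha$. Moreover, if $\alpha$ is a positive quadratic irrational, both $\zeta_\alpha$ and $S_\alpha$ have a meromorphic continuation to the whole complex plane with a simple pole at $s=1$ and at most simple poles at the points $s=-k\pm\frac{2\pi i n}{\log\eta_\alpha}$, $(k,n)\in\mathbb{N}\times\mathbb{N}_0$.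
   Context: $\lfloor x\rfloor$ is the largest integer $\le x$, $\lceil x\rceil$ the smallest integer $\ge x$; $\mathbb{N}=\{1,2,\dots\}$, $\mathbb{N}_0=\{0,1,2,\dots\}$. For irrational $\alpha=[a_0,a_1,a_2,\dots]$ (continued fraction expansion) with convergents $p_n/q_n=[a_0,\dots,a_n]$, define $\tau_\alpha=\limsup_{n\to\infty}\frac{\log q_{n+1}}{\log q_n}\in[1,\infty]$ (with $-1/\tau_\alpha=0$ if $\tau_\alpha=\infty$). The $n$-th complete quotient is $\theta_n=[a_n,a_{n+1},\dots]$. For a quadratic irrational $\alpha$, whose continued fraction is eventually periodic with periodic part $(a_p,a_{p+1},\dots,a_{p+q-1})$, define $\eta_\alpha$ by $\eta_\alpha^{-1}=\theta_{p+1}\theta_{p+2}\cdots\theta_{p+q}$. For a Dirichlet series $f$, $\sigma_\mu(f)$ denotes the infimum of the real numbers $x$ such that $f$ has a meromorphic continuation to $\{\mathrm{Re}(s)>x\}$; when finite, the line $\sigma_\mu(f)+i\mathbb{R}$ is called the natural boundary of $f$.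
   Formalization: The periodic part defining η_α is taken to be the shortest period of even length (an odd shortest period is written twice); with a single odd period the claim fails, e.g. for the golden ratio, which has poles at s = -1 + (odd)·πi/log α. *)

theory Defs
  imports "HOL-Complex_Analysis.Complex_Analysis"
begin

section \<open>Continued fractions\<close>

text \<open>
  All notions in this section are meant for irrational \<open>\<alpha>\<close>, for which no complete quotient is an
  integer, so the expansion is infinite.
\<close>

primrec complete_quotient :: "real \<Rightarrow> nat \<Rightarrow> real" where
  "complete_quotient \<alpha> 0 = \<alpha>"
| "complete_quotient \<alpha> (Suc n) = 1 / frac (complete_quotient \<alpha> n)"

definition cf_digit :: "real \<Rightarrow> nat \<Rightarrow> int" where
  "cf_digit \<alpha> n = \<lfloor>complete_quotient \<alpha> n\<rfloor>"

fun conv_num :: "real \<Rightarrow> nat \<Rightarrow> int" where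
  "conv_num \<alpha> 0 = cf_digit \<alpha> 0"
| "conv_num \<alpha> (Suc 0) = cf_digit \<alpha> 1 * cf_digit \<alpha> 0 + 1"
| "conv_num \<alpha> (Suc (Suc n)) = cf_digit \<alpha> (Suc (Suc n)) * conv_num \<alpha> (Suc n) + conv_num \<alpha> n"

fun conv_denom :: "real \<Rightarrow> nat \<Rightarrow> int" where
  "conv_denom \<alpha> 0 = 1"
| "conv_denom \<alpha> (Suc 0) = cf_digit \<alpha> 1"
| "conv_denom \<alpha> (Suc (Suc n)) = cf_digit \<alpha> (Suc (Suc n)) * conv_denom \<alpha> (Suc n) + conv_denom \<alpha> n"

text \<open>
  The recurrences do give the convergents in lowest terms: \<open>p\<^sub>n / q\<^sub>n = [a\<^sub>0, \<dots>, a\<^sub>n]\<close> with \<open>p\<^sub>n\<close> and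
  \<open>q\<^sub>n\<close> coprime and \<open>q\<^sub>n > 0\<close>; see \<open>conv_eq_cf_value\<close>, \<open>coprime_conv\<close> and \<open>conv_denom_pos\<close> below.
\<close>

fun cf_value :: "real list \<Rightarrow> real" where
  "cf_value [] = 0"
| "cf_value [x] = x"
| "cf_value (x # y # xs) = x + 1 / cf_value (y # xs)"

lemma complete_quotient_irrational:
  assumes "\<alpha> \<notin> \<rat>"
  shows "complete_quotient \<alpha> n \<notin> \<rat>"
proof (induction n)
  case (Suc n)
  show ?case
  proof
    assume "complete_quotient \<alpha> (Suc n) \<in> \<rat>"
    then have "1 / complete_quotient \<alpha> (Suc n) \<in> \<rat>"
      by (intro Rats_divide) auto
    then have "frac (complete_quotient \<alpha> n) \<in> \<rat>"
      by simp
    then have "frac (complete_quotient \<alpha> n) + of_int \<lfloor>complete_quotient \<alpha> n\<rfloor> \<in> \<rat>"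
      by (intro Rats_add) auto
    then show False
      using Suc by (simp add: frac_def)
  qed
qed (use assms in simp)

lemma cf_digit_pos:
  assumes "\<alpha> \<notin> \<rat>"
  shows "cf_digit \<alpha> (Suc n) \<ge> 1"
proof -
  have "complete_quotient \<alpha> n \<notin> \<int>"
    using complete_quotient_irrational[OF assms, of n] Ints_subset_Rats by blast
  then have "frac (complete_quotient \<alpha> n) > 0"
    using frac_ge_0[of "complete_quotient \<alpha> n"] by (metis frac_eq_0_iff order_le_less)
  moreover have "frac (complete_quotient \<alpha> n) < 1"
    by (rule frac_lt_1)
  ultimately have "complete_quotient \<alpha> (Suc n) \<ge> 1"
    by simp
  then show ?thesis
    by (simp add: cf_digit_def le_floor_iff)
qed

lemma conv_denom_pos:
  assumes "\<alpha> \<notin> \<rat>"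
  shows "conv_denom \<alpha> n > 0"
proof (induction n rule: induct_nat_012)
  case (ge2 n)
  then show ?case
    using cf_digit_pos[OF assms, of "Suc n"] by (simp add: add_pos_pos)
qed (use cf_digit_pos[OF assms, of 0] in auto)

lemma conv_det:
  "conv_num \<alpha> (Suc n) * conv_denom \<alpha> n - conv_num \<alpha> n * conv_denom \<alpha> (Suc n) = (-1) ^ n"
  by (induction n) (auto simp: algebra_simps)

lemma coprime_conv: "coprime (conv_num \<alpha> n) (conv_denom \<alpha> n)"
proof (rule coprimeI)
  fix d assume "d dvd conv_num \<alpha> n" "d dvd conv_denom \<alpha> n"
  then have "d dvd (-1) ^ n"
    unfolding conv_det[of \<alpha> n, symmetric] by simp
  moreover have "is_unit ((-1 :: int) ^ n)"
    by simp
  ultimately show "is_unit d"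
    by (rule dvd_trans)
qed

lemma cf_value_snoc2:
  "cf_value (xs @ [x, y]) = cf_value (xs @ [x + 1 / y])"
proof (induction xs rule: cf_value.induct)
  case (2 z)
  then show ?case by simp
qed auto

lemma cf_value_conv:
  assumes "\<alpha> \<notin> \<rat>" "x > 0"
  shows "cf_value (map (\<lambda>i. of_int (cf_digit \<alpha> i)) [0..<Suc (Suc n)] @ [x]) =
           (x * conv_num \<alpha> (Suc n) + conv_num \<alpha> n) / (x * conv_denom \<alpha> (Suc n) + conv_denom \<alpha> n)"
  using assms(2)
proof (induction n arbitrary: x)
  case 0
  have "real_of_int (cf_digit \<alpha> (Suc 0)) > 0"
    using cf_digit_pos[OF assms(1), of 0] by linarith
  then have "x * cf_digit \<alpha> (Suc 0) + 1 \<noteq> 0"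
    using 0 by (smt (verit) mult_pos_pos)
  then show ?case
    using 0 by (simp add: field_simps)
next
  case (Suc n)
  define a :: real where "a = cf_digit \<alpha> (Suc (Suc n))"
  have a: "a > 0"
    using cf_digit_pos[OF assms(1), of "Suc n"] unfolding a_def by linarith
  have q: "real_of_int (conv_denom \<alpha> (Suc n)) > 0" "real_of_int (conv_denom \<alpha> n) > 0"
    using conv_denom_pos[OF assms(1)] by auto
  have pos: "a + 1 / x > 0"
    using a Suc.prems by (simp add: add_pos_pos)
  have "cf_value (map (\<lambda>i. of_int (cf_digit \<alpha> i)) [0..<Suc (Suc (Suc n))] @ [x]) =
          cf_value (map (\<lambda>i. of_int (cf_digit \<alpha> i)) [0..<Suc (Suc n)] @ [a, x])"
    by (simp add: a_def)
  also have "\<dots> = cf_value (map (\<lambda>i. of_int (cf_digit \<alpha> i)) [0..<Suc (Suc n)] @ [a + 1 / x])"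
    by (rule cf_value_snoc2)
  also have "\<dots> = ((a + 1 / x) * conv_num \<alpha> (Suc n) + conv_num \<alpha> n) /
                  ((a + 1 / x) * conv_denom \<alpha> (Suc n) + conv_denom \<alpha> n)"
    by (rule Suc.IH[OF pos])
  also have "\<dots> = (x * ((a + 1 / x) * conv_num \<alpha> (Suc n) + conv_num \<alpha> n)) /
                  (x * ((a + 1 / x) * conv_denom \<alpha> (Suc n) + conv_denom \<alpha> n))"
    using Suc.prems by simp
  also have "\<dots> = (x * conv_num \<alpha> (Suc (Suc n)) + conv_num \<alpha> (Suc n)) /
                  (x * conv_denom \<alpha> (Suc (Suc n)) + conv_denom \<alpha> (Suc n))"
  proof -
    have "x * ((a + 1 / x) * conv_num \<alpha> (Suc n) + conv_num \<alpha> n) =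
            x * conv_num \<alpha> (Suc (Suc n)) + conv_num \<alpha> (Suc n)"
      using Suc.prems by (simp add: a_def field_simps)
    moreover have "x * ((a + 1 / x) * conv_denom \<alpha> (Suc n) + conv_denom \<alpha> n) =
            x * conv_denom \<alpha> (Suc (Suc n)) + conv_denom \<alpha> (Suc n)"
      using Suc.prems by (simp add: a_def field_simps)
    ultimately show ?thesis by simp
  qed
  finally show ?case .
qed

lemma conv_eq_cf_value:
  assumes "\<alpha> \<notin> \<rat>"
  shows "conv_num \<alpha> n / conv_denom \<alpha> n = cf_value (map (\<lambda>i. of_int (cf_digit \<alpha> i)) [0..<Suc n])"
proof -
  consider "n = 0" | "n = 1" | m where "n = Suc (Suc m)"
    by (metis One_nat_def not0_implies_Suc)
  then show ?thesis
  proof cases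
    case 2
    have "real_of_int (cf_digit \<alpha> (Suc 0)) > 0"
      using cf_digit_pos[OF assms, of 0] by linarith
    then show ?thesis
      using 2 by (simp add: field_simps)
  next
    case (3 m)
    have "real_of_int (cf_digit \<alpha> (Suc (Suc m))) > 0"
      using cf_digit_pos[OF assms, of "Suc m"] by linarith
    from cf_value_conv[OF assms this, of m] show ?thesis
      using 3 by simp
  qed simp
qed

text \<open>The first few quotients, where the denominator \<open>ln q\<^sub>n\<close> may vanish, do not affect the limes superior.\<close>

definition tau :: "real \<Rightarrow> ereal" where
  "tau \<alpha> = limsup (\<lambda>n. ereal (ln (conv_denom \<alpha> (Suc n)) / ln (conv_denom \<alpha> n)))"

definition quadratic_irrational :: "real \<Rightarrow> bool" where
  "quadratic_irrational \<alpha> \<longleftrightarrow>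
     \<alpha> \<notin> \<rat> \<and> (\<exists>a b c :: int. a \<noteq> 0 \<and> of_int a * \<alpha>\<^sup>2 + of_int b * \<alpha> + of_int c = 0)"

definition cf_periodic_part :: "real \<Rightarrow> nat \<Rightarrow> nat \<Rightarrow> bool" where
  "cf_periodic_part \<alpha> p q \<longleftrightarrow> q > 0 \<and> (\<forall>i\<ge>p. cf_digit \<alpha> (i + q) = cf_digit \<alpha> i)"

text \<open>
  The periodic part \<open>(a\<^sub>p, \<dots>, a\<^bsub>p+q-1\<^esub>)\<close> of the expansion is the shortest one of \<^emph>\<open>even\<close> length:
  a shortest period of odd length is written twice. With this choice \<open>1 / eta \<alpha>\<close> is the
  fundamental automorph of norm \<open>+1\<close>. A single odd period has norm \<open>-1\<close> and is not enough: for the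
  golden ratio (shortest period \<open>(1)\<close>), the series \<open>\<Sum>\<^sub>n (frac (\<alpha> n) - 1/2) n\<^bsup>-s\<^esup>\<close> has poles at
  odd multiples of \<open>\<pi> \<i> / ln \<alpha>\<close>, hence the Beatty zeta function has poles with real part \<open>-1\<close> whose
  imaginary parts are not multiples of \<open>2 \<pi> / ln \<alpha>\<close>.
  The choice of the starting index \<open>p\<close> is immaterial, since the product runs over a whole period.
\<close>

definition cf_period :: "real \<Rightarrow> nat" where
  "cf_period \<alpha> = (LEAST q. even q \<and> (\<exists>p. cf_periodic_part \<alpha> p q))"

definition cf_preperiod :: "real \<Rightarrow> nat" where
  "cf_preperiod \<alpha> = (LEAST p. cf_periodic_part \<alpha> p (cf_period \<alpha>))"

definition eta :: "real \<Rightarrow> real" where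
  "eta \<alpha> = inverse (\<Prod>j = 1..cf_period \<alpha>. complete_quotient \<alpha> (cf_preperiod \<alpha> + j))"

section \<open>Dirichlet series and meromorphic continuation\<close>

definition beatty_zeta :: "real \<Rightarrow> complex \<Rightarrow> complex" where
  "beatty_zeta \<alpha> s = (\<Sum>n. 1 / of_int \<lfloor>\<alpha> * real (Suc n)\<rfloor> powr s)"

text \<open>The parameter is the slope \<open>\<beta> = 1/\<alpha>\<close>; the summation index is shifted by one.\<close>

definition sturmian_series :: "real \<Rightarrow> complex \<Rightarrow> complex" where
  "sturmian_series \<beta> s =
     (\<Sum>n. of_int (\<lceil>\<beta> * real (Suc n)\<rceil> - \<lceil>\<beta> * real n\<rceil>) / of_nat (Suc n) powr s)"

text \<open>
  Below, \<open>f\<close> is the sum function of a Dirichlet series, whose values are only meaningful in some right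
  half-plane. A continuation is therefore required to agree with \<open>f\<close> for all large real parts.
\<close>

definition merom_continuation :: "(complex \<Rightarrow> complex) \<Rightarrow> real \<Rightarrow> (complex \<Rightarrow> complex) \<Rightarrow> bool" where
  "merom_continuation f x g \<longleftrightarrow>
     g meromorphic_on {s. Re s > x} \<and> (\<exists>c. \<forall>s. Re s > c \<longrightarrow> g s = f s)"

definition sigma_mu :: "(complex \<Rightarrow> complex) \<Rightarrow> ereal" where
  "sigma_mu f = Inf (ereal ` {x. \<exists>g. merom_continuation f x g})"

definition natural_boundary :: "(complex \<Rightarrow> complex) \<Rightarrow> complex set \<Rightarrow> bool" where
  "natural_boundary f L \<longleftrightarrow> (\<exists>x::real. sigma_mu f = ereal x \<and> L = {s. Re s = x})"

definition simple_pole :: "(complex \<Rightarrow> complex) \<Rightarrow> complex \<Rightarrow> bool" where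
  "simple_pole g z \<longleftrightarrow> is_pole g z \<and> zorder g z = -1"

definition quadratic_poles :: "real \<Rightarrow> complex set" where
  "quadratic_poles \<alpha> =
     {- of_nat k + e * (2 * of_real pi * \<i> * of_nat n / of_real (ln (eta \<alpha>))) | k n e.
        k \<ge> 1 \<and> e \<in> {1, -1}}"

end

theory Submission
  imports Defs
begin

text \<open>
  Let \<open>Q\<^sub>0 = 1\<close> and \<open>Q\<^sub>k\<^sub>+\<^sub>1 = p\<^sub>k\<close>, the numerators of the convergents of \<open>\<alpha>\<close>. Both Dirichlet series are, up to a
  constant, Mellin transforms of \<open>e\<^bsup>-wt\<^esup> \<Sum>\<^sub>m e\<^bsup>-\<lfloor>\<alpha>m\<rfloor>t\<^esup>\<close> with \<open>w = 0\<close> resp. \<open>w = 1\<close>. Writing the sum as a sum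
  over the lattice points in a cone and cutting off quadrants along the continued fraction algorithm gives
  \<open>\<Sum>\<^sub>m e\<^bsup>-\<lfloor>\<alpha>m\<rfloor>t\<^esup> = (e\<^sup>t - 1) \<Sum>\<^sub>k (-1)\<^sup>k / ((e\<^bsup>Q\<^sub>k t\<^esup> - 1) (e\<^bsup>Q\<^sub>k\<^sub>+\<^sub>1 t\<^esup> - 1))\<close>.
  Expanding \<open>(e\<^sup>t - 1) / (e\<^bsup>Q\<^sub>k t\<^esup> - 1)\<close> to second order at \<open>t = 0\<close> splits off the main term
  \<open>\<zeta>(s) L(s)\<close> with \<open>L(s) = \<Sum>\<^sub>k (-1)\<^sup>k Q\<^sub>k\<^sub>+\<^sub>1\<^bsup>-s\<^esup> / Q\<^sub>k\<close>, and leaves a remainder that is holomorphic for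
  \<open>Re s > -1\<close>. The series \<open>L\<close> converges for \<open>Re s > -1 / \<tau>\<close>, and \<open>L(1) = 1 / \<alpha>\<close>. If \<open>\<tau> > 1\<close>, then the terms of
  \<open>L\<close> with \<open>Q\<^sub>k\<^sub>+\<^sub>1\<close> much larger than \<open>Q\<^sub>k\<close> form a Hadamard-lacunary series with this abscissa, which
  has no continuation across any point of the boundary line, while the other terms converge
  further to the left.

  For a quadratic irrational, \<open>Q\<^bsub>k+lj\<^esub> = A\<^sub>k \<lambda>\<^sup>j + B\<^sub>k \<lambda>\<^bsup>-j\<^esup>\<close> with \<open>\<lambda> = 1 / \<eta>\<close>. The substitution
  \<open>t \<mapsto> t / \<lambda>\<^sup>j\<close> turns the sum over \<open>k\<close> into finitely many series \<open>\<Sum>\<^sub>j r\<^bsup>js\<^esup> h(s, r\<^sup>j)\<close> with \<open>r = 1 / \<lambda>\<close>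
  and \<open>h\<close> entire in \<open>s\<close>, holomorphic near \<open>z = 0\<close> and vanishing there; the \<open>p\<close>-th Taylor
  coefficient of \<open>h(s, \<cdot>)\<close> contributes poles where \<open>r\<^bsup>s+p\<^esup> = 1\<close>.
\<close>

section \<open>Parametric integrals and Mellin transforms\<close>

text \<open>Second order is what the half-plane requires. The remainder of the k-th term is
  O(\<open>Q k\<close> t^2) times 1 / (exp (\<open>Q (Suc k)\<close> t) - 1), so its Mellin
  transform at s is O(\<open>Q k\<close> \<open>Q (Suc k)\<close>^(-Re s - 2)). As \<open>Q\<close>
  is nondecreasing, this is summable for Re s > -1 whatever \<alpha> is, and \<tau> \<ge> 1 keeps
  the boundary line from lying left of -1. All arithmetic of \<alpha> sits in L.

  The obstacle at the boundary is that a hypothetical continuation shows only \<zeta>(s) L(s). Its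
  poles and the zeros of \<zeta> are isolated, so some boundary point avoids both, and one such
  point suffices to exclude a larger half-plane.

  In the quadratic case the even period does two things: the alternating sign does not depend on j,
  and the conjugate solution of the numerator recursion shrinks by +1/\<lambda>, not by
  -1/\<lambda>. Hence each residue class of indices gives the values of one function of z at the
  points r^j. It vanishes at z = 0 because the rescaled numerator exp (z t) - 1 does; this is why
  the lattice of poles only begins at real part -1.\<close>

lemma holomorphic_on_integral:
  fixes f :: "complex \<Rightarrow> 'a \<Rightarrow> complex"
  assumes "open S"
    and holo: "\<And>t. t \<in> space M \<Longrightarrow> (\<lambda>s. f s t) holomorphic_on S"
    and meas: "\<And>s. s \<in> S \<Longrightarrow> f s \<in> borel_measurable M"
    and dom: "\<And>s. s \<in> S \<Longrightarrow> \<exists>e>0. \<exists>g. integrable M g \<and>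
                (\<forall>w\<in>ball s e \<inter> S. \<forall>t\<in>space M. norm (f w t) \<le> g t)"
  shows "(\<lambda>s. \<integral>t. f s t \<partial>M) holomorphic_on S"
proof -
  have "(\<lambda>s. \<integral>t. f s t \<partial>M) field_differentiable (at s)" if s: "s \<in> S" for s
  proof -
    obtain e1 g where e1: "e1 > 0" and g: "integrable M g"
      and bd1: "\<And>w t. w \<in> ball s e1 \<inter> S \<Longrightarrow> t \<in> space M \<Longrightarrow> norm (f w t) \<le> g t"
      using dom[OF s] by blast
    obtain e2 where e2: "e2 > 0" "ball s e2 \<subseteq> S"
      using assms(1) s open_contains_ball by blast
    define e where "e = min e1 e2"
    have e: "e > 0" "ball s e \<subseteq> S" using e1 e2 by (auto simp: e_def)
    have bd: "norm (f w t) \<le> g t" if "w \<in> ball s e" "t \<in> space M" for w t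
      using bd1[of w t] that e by (auto simp: e_def)
    \<comment> \<open>Closed discs of radius r about points of \<open>ball s r\<close> stay inside
      \<open>ball s e\<close>, so Cauchy's estimate turns the majorant g of f into the majorant g /
      r of the derivatives. It then bounds the difference quotients as well, and dominated
      convergence applies to them.\<close>
    define r where "r = e / 4"
    have r: "r > 0" using e by (simp add: r_def)
    have subr: "ball s r \<subseteq> ball s e" using r by (intro subset_ball) (simp add: r_def)
    have subS: "ball s r \<subseteq> S" using subr e by blast
    have dbd: "norm (deriv (\<lambda>w. f w t) w) \<le> g t / r" if w: "w \<in> ball s r" and t: "t \<in> space M" for w t
    proof -
      have sub: "cball w r \<subseteq> ball s e"
      proof
        fix x assume "x \<in> cball w r"
        then have "dist s x < r + r"
          using w dist_triangle[of s x w] by (simp add: dist_commute)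
        then show "x \<in> ball s e" using e by (simp add: r_def)
      qed
      have "norm ((deriv ^^ 1) (\<lambda>w. f w t) w) \<le> fact 1 * g t / r ^ 1"
      proof (rule Cauchy_inequality)
        have h: "(\<lambda>w. f w t) holomorphic_on cball w r"
          using holo[OF t] sub e holomorphic_on_subset by blast
        then show "continuous_on (cball w r) (\<lambda>w. f w t)"
          by (rule holomorphic_on_imp_continuous_on)
        show "(\<lambda>w. f w t) holomorphic_on ball w r"
          using h ball_subset_cball holomorphic_on_subset by blast
        show "norm (f x t) \<le> g t" if "norm (w - x) = r" for x
        proof (rule bd)
          have "x \<in> cball w r" using that by (simp add: dist_norm)
          with sub show "x \<in> ball s e" by blast
        qed (rule t)
      qed (use r in auto)
      then show ?thesis by simp
    qed
    have lip: "norm (f w t - f s t) \<le> g t / r * norm (w - s)" if w: "w \<in> ball s r" and t: "t \<in> space M" for w t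
    proof (rule field_differentiable_bound[of "ball s r" "\<lambda>w. f w t" "deriv (\<lambda>w. f w t)"])
      fix z assume z: "z \<in> ball s r"
      then have "z \<in> S" using subS by blast
      then show "((\<lambda>w. f w t) has_field_derivative deriv (\<lambda>w. f w t) z) (at z within ball s r)"
        using holomorphic_derivI[OF holo[OF t] assms(1)] by blast
      show "norm (deriv (\<lambda>w. f w t) z) \<le> g t / r" by (rule dbd[OF z t])
    qed (use w r in auto)
    have "((\<lambda>s. \<integral>t. f s t \<partial>M) has_field_derivative (\<integral>t. deriv (\<lambda>w. f w t) s \<partial>M)) (at s within ball s r)"
      unfolding has_field_derivative_iff tendsto_at_iff_sequentially
    proof (intro allI impI)
      fix X :: "nat \<Rightarrow> complex"
      assume X: "\<forall>i. X i \<in> ball s r - {s}" and lim: "X \<longlonglongrightarrow> s"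
      have XS: "X i \<in> S" for i using X subS by blast
      have intf: "integrable M (f w)" if "w \<in> ball s e" for w
      proof (rule Bochner_Integration.integrable_bound[OF g])
        show "f w \<in> borel_measurable M" using that e by (intro meas) auto
        show "AE t in M. norm (f w t) \<le> norm (g t)"
          using bd[OF that] by (intro AE_I2) (simp add: order_trans[OF _ abs_ge_self])
      qed
      have ptw: "(\<lambda>i. (f (X i) t - f s t) / (X i - s)) \<longlonglongrightarrow> deriv (\<lambda>w. f w t) s"
        if t: "t \<in> space M" for t
      proof -
        have "((\<lambda>w. f w t) has_field_derivative deriv (\<lambda>w. f w t) s) (at s within ball s r)"
          by (rule holomorphic_derivI[OF holo[OF t] assms(1) s])
        then have "\<forall>X. (\<forall>i. X i \<in> ball s r - {s}) \<longrightarrow> X \<longlonglongrightarrow> s \<longrightarrow>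
            ((\<lambda>y. (f y t - f s t) / (y - s)) \<circ> X) \<longlonglongrightarrow> deriv (\<lambda>w. f w t) s"
          unfolding has_field_derivative_iff tendsto_at_iff_sequentially .
        with X lim show ?thesis by (simp add: comp_def)
      qed
      have *: "(\<lambda>i. \<integral>t. (f (X i) t - f s t) / (X i - s) \<partial>M) \<longlonglongrightarrow> (\<integral>t. deriv (\<lambda>w. f w t) s \<partial>M)"
      proof (rule integral_dominated_convergence)
        show lim2: "AE t in M. (\<lambda>i. (f (X i) t - f s t) / (X i - s)) \<longlonglongrightarrow> deriv (\<lambda>w. f w t) s"
        proof (rule AE_I2)
          fix t assume t: "t \<in> space M"
          show "(\<lambda>i. (f (X i) t - f s t) / (X i - s)) \<longlonglongrightarrow> deriv (\<lambda>w. f w t) s"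
            by (rule ptw[OF t])
        qed
        show m: "(\<lambda>t. (f (X i) t - f s t) / (X i - s)) \<in> borel_measurable M" for i
          using meas[OF XS] meas[OF s] by measurable
        show "(\<lambda>t. deriv (\<lambda>w. f w t) s) \<in> borel_measurable M"
        proof (rule borel_measurable_LIMSEQ_metric[OF m])
          fix t assume t: "t \<in> space M"
          show "(\<lambda>i. (f (X i) t - f s t) / (X i - s)) \<longlonglongrightarrow> deriv (\<lambda>w. f w t) s"
            by (rule ptw[OF t])
        qed
        show "integrable M (\<lambda>t. g t / r)" using g by simp
        show "AE t in M. norm ((f (X i) t - f s t) / (X i - s)) \<le> g t / r" for i
        proof (rule AE_I2)
          fix t assume t: "t \<in> space M"
          have "X i \<in> ball s r" "X i \<noteq> s" using X by auto
          with lip[OF this(1) t] show "norm ((f (X i) t - f s t) / (X i - s)) \<le> g t / r"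
            by (simp add: norm_divide divide_le_eq)
        qed
      qed
      have "X i \<in> ball s e" for i using X subr by blast
      then show "((\<lambda>y. ((\<integral>t. f y t \<partial>M) - (\<integral>t. f s t \<partial>M)) / (y - s)) \<circ> X) \<longlonglongrightarrow> (\<integral>t. deriv (\<lambda>w. f w t) s \<partial>M)"
        using * e intf by (simp add: comp_def)
    qed
    then show ?thesis
      using r at_within_open[of s "ball s r"] unfolding field_differentiable_def by auto
  qed
  then show ?thesis
    using assms(1) by (simp add: holomorphic_on_def field_differentiable_at_within)
qed

text \<open>A series is an integral over counting measure, so local domination by a summable
  sequence suffices.\<close>

lemma holomorphic_on_suminf:
  fixes f :: "nat \<Rightarrow> complex \<Rightarrow> complex"
  assumes "open S"
    and holo: "\<And>n. f n holomorphic_on S"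
    and dom: "\<And>s. s \<in> S \<Longrightarrow> \<exists>e>0. \<exists>g. summable g \<and> (\<forall>w\<in>ball s e \<inter> S. \<forall>n. norm (f n w) \<le> g n)"
  shows "(\<lambda>s. \<Sum>n. f n s) holomorphic_on S"
proof -
  have "(\<lambda>s. \<integral>n. f n s \<partial>count_space UNIV) holomorphic_on S"
  proof (rule holomorphic_on_integral[OF assms(1)])
    fix s assume "s \<in> S"
    then obtain e g where e: "e > 0" "summable g" "\<And>w n. w \<in> ball s e \<inter> S \<Longrightarrow> norm (f n w) \<le> g n"
      using dom[OF \<open>s \<in> S\<close>] by blast
    have "g n \<ge> 0" for n using norm_ge_zero e(3)[of s n] e(1) \<open>s \<in> S\<close>
      by (meson IntI centre_in_ball order_trans)
    then have "integrable (count_space UNIV) g"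
      using e(2) by (simp add: integrable_count_space_nat_iff)
    then show "\<exists>e>0. \<exists>g. integrable (count_space UNIV) g \<and>
        (\<forall>w\<in>ball s e \<inter> S. \<forall>n\<in>space (count_space UNIV). norm (f n w) \<le> g n)"
      using e by (intro exI[of _ e] conjI exI[of _ g]) auto
  qed (use holo in auto)
  moreover have "(\<integral>n. f n s \<partial>count_space UNIV) = (\<Sum>n. f n s)" if "s \<in> S" for s
  proof (rule integral_count_space_nat)
    obtain e g where e: "e > 0" "summable g" "\<And>w n. w \<in> ball s e \<inter> S \<Longrightarrow> norm (f n w) \<le> g n"
      using dom[OF \<open>s \<in> S\<close>] by blast
    have "summable (\<lambda>n. norm (f n s))"
      by (rule summable_comparison_test[OF _ e(2)]) (use e(1,3) that in auto)
    then show "integrable (count_space UNIV) (\<lambda>n. f n s)"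
      by (simp add: integrable_count_space_nat_iff)
  qed
  ultimately show ?thesis
    by (rule holomorphic_transform)
qed

section \<open>The Mellin transform on the positive half-line\<close>

abbreviation pos_lborel :: "real measure" where
  "pos_lborel \<equiv> restrict_space lborel {0<..}"

definition mellin :: "(real \<Rightarrow> complex) \<Rightarrow> complex \<Rightarrow> complex" where
  "mellin \<phi> s = (\<integral>t. of_real t powr (s - 1) * \<phi> t \<partial>pos_lborel)"

text \<open>Since the modulus of t^(s - 1) depends on Re s alone, absolute convergence is a property
  of a real abscissa. Measurability is part of the notion because integrability of the norm would
  not imply it.\<close>

definition mellin_conv :: "(real \<Rightarrow> complex) \<Rightarrow> real \<Rightarrow> bool" where
  "mellin_conv \<phi> \<sigma> \<longleftrightarrow> \<phi> \<in> borel_measurable pos_lborel \<and>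
     integrable pos_lborel (\<lambda>t. t powr (\<sigma> - 1) * norm (\<phi> t))"

lemma AE_pos_lborelI: "(\<And>t. t > 0 \<Longrightarrow> P t) \<Longrightarrow> AE t in pos_lborel. P t"
  by (rule AE_I2) simp

lemma norm_of_real_powr: "t > 0 \<Longrightarrow> norm (of_real t powr s :: complex) = t powr Re s"
  by (simp add: norm_powr_real_powr)

lemma measurable_of_real_powr [measurable]:
  "(\<lambda>t. of_real t powr s :: complex) \<in> borel_measurable pos_lborel"
proof -
  have "(\<lambda>t. exp (s * of_real (ln t)) :: complex) \<in> borel_measurable pos_lborel"
    by (rule measurable_restrict_space1) measurable
  also have "?this \<longleftrightarrow> ?thesis"
    by (rule measurable_cong) (auto simp: powr_def Ln_of_real)
  finally show ?thesis .
qed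

lemma measurable_powr_pos [measurable]: "(\<lambda>t. t powr x :: real) \<in> borel_measurable pos_lborel"
  by (rule measurable_restrict_space1) measurable

lemma mellin_conv_measurable: "mellin_conv \<phi> \<sigma> \<Longrightarrow> \<phi> \<in> borel_measurable pos_lborel"
  by (simp add: mellin_conv_def)

lemma mellin_integrable:
  assumes "mellin_conv \<phi> (Re s)"
  shows "integrable pos_lborel (\<lambda>t. of_real t powr (s - 1) * \<phi> t)"
proof (rule Bochner_Integration.integrable_bound)
  show "integrable pos_lborel (\<lambda>t. t powr (Re s - 1) * norm (\<phi> t))"
    using assms by (simp add: mellin_conv_def)
  show "(\<lambda>t. of_real t powr (s - 1) * \<phi> t) \<in> borel_measurable pos_lborel"
    using mellin_conv_measurable[OF assms] by measurable
  show "AE t in pos_lborel. norm (of_real t powr (s - 1) * \<phi> t) \<le> norm (t powr (Re s - 1) * norm (\<phi> t))"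
    by (rule AE_pos_lborelI) (simp add: norm_mult norm_of_real_powr)
qed

lemma norm_mellin_le:
  "norm (mellin \<phi> s) \<le> (\<integral>t. t powr (Re s - 1) * norm (\<phi> t) \<partial>pos_lborel)"
proof -
  have "norm (mellin \<phi> s) \<le> (\<integral>t. norm (of_real t powr (s - 1) * \<phi> t) \<partial>pos_lborel)"
    unfolding mellin_def by (rule integral_norm_bound)
  also have "\<dots> = (\<integral>t. t powr (Re s - 1) * norm (\<phi> t) \<partial>pos_lborel)"
    by (rule Bochner_Integration.integral_cong) (auto simp: norm_mult norm_of_real_powr)
  finally show ?thesis .
qed

lemma mellin_conv_bound:
  assumes "mellin_conv \<phi> \<sigma>" "\<psi> \<in> borel_measurable pos_lborel"
    and le: "\<And>t. t > 0 \<Longrightarrow> norm (\<psi> t) \<le> C * norm (\<phi> t)"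
  shows "mellin_conv \<psi> \<sigma>"
  unfolding mellin_conv_def
proof (rule conjI[OF assms(2)], rule Bochner_Integration.integrable_bound)
  show "integrable pos_lborel (\<lambda>t. C * (t powr (\<sigma> - 1) * norm (\<phi> t)))"
    using assms(1) by (simp add: mellin_conv_def)
  show "(\<lambda>t. t powr (\<sigma> - 1) * norm (\<psi> t)) \<in> borel_measurable pos_lborel"
    using assms(2) by measurable
  show "AE t in pos_lborel. norm (t powr (\<sigma> - 1) * norm (\<psi> t)) \<le> norm (C * (t powr (\<sigma> - 1) * norm (\<phi> t)))"
  proof (rule AE_pos_lborelI)
    fix t :: real assume "t > 0"
    have "norm (t powr (\<sigma> - 1) * norm (\<psi> t)) \<le> t powr (\<sigma> - 1) * (C * norm (\<phi> t))"
      using le[OF \<open>t > 0\<close>] by (simp add: mult_left_mono)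
    also have "\<dots> \<le> norm (C * (t powr (\<sigma> - 1) * norm (\<phi> t)))"
      by (simp add: mult_ac abs_mult)  (simp add: mult_right_mono abs_ge_self mult_left_mono)
    finally show "norm (t powr (\<sigma> - 1) * norm (\<psi> t)) \<le> norm (C * (t powr (\<sigma> - 1) * norm (\<phi> t)))" .
  qed
qed

lemma mellin_integral_bound:
  fixes \<psi> :: "real \<Rightarrow> complex"
  assumes "mellin_conv \<phi> \<sigma>" "\<psi> \<in> borel_measurable pos_lborel"
    and le: "\<And>t. t > 0 \<Longrightarrow> norm (\<psi> t) \<le> C * norm (\<phi> t)"
  shows "(\<integral>t. t powr (\<sigma> - 1) * norm (\<psi> t) \<partial>pos_lborel) \<le>
           C * (\<integral>t. t powr (\<sigma> - 1) * norm (\<phi> t) \<partial>pos_lborel)"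
proof -
  have "(\<integral>t. t powr (\<sigma> - 1) * norm (\<psi> t) \<partial>pos_lborel) \<le>
           (\<integral>t. C * (t powr (\<sigma> - 1) * norm (\<phi> t)) \<partial>pos_lborel)"
  proof (rule integral_mono)
    show "integrable pos_lborel (\<lambda>t. t powr (\<sigma> - 1) * norm (\<psi> t))"
      using mellin_conv_bound[OF assms] by (simp add: mellin_conv_def)
    show "integrable pos_lborel (\<lambda>t. C * (t powr (\<sigma> - 1) * norm (\<phi> t)))"
      using assms(1) by (simp add: mellin_conv_def)
    fix t :: real assume "t \<in> space pos_lborel"
    then have "t > 0" by simp
    from mult_left_mono[OF le[OF this], of "t powr (\<sigma> - 1)"]
    show "t powr (\<sigma> - 1) * norm (\<psi> t) \<le> C * (t powr (\<sigma> - 1) * norm (\<phi> t))"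
      by (simp add: mult_ac)
  qed
  then show ?thesis by simp
qed

lemma mellin_cong: "(\<And>t. t > 0 \<Longrightarrow> \<phi> t = \<psi> t) \<Longrightarrow> mellin \<phi> s = mellin \<psi> s"
  unfolding mellin_def by (rule Bochner_Integration.integral_cong) auto

lemma mellin_conv_cong:
  assumes "\<And>t. t > 0 \<Longrightarrow> \<phi> t = \<psi> t"
  shows "mellin_conv \<phi> \<sigma> \<longleftrightarrow> mellin_conv \<psi> \<sigma>"
proof -
  have "\<phi> \<in> borel_measurable pos_lborel \<longleftrightarrow> \<psi> \<in> borel_measurable pos_lborel"
    by (rule measurable_cong) (simp add: assms)
  moreover have "integrable pos_lborel (\<lambda>t. t powr (\<sigma> - 1) * norm (\<phi> t)) \<longleftrightarrow>
      integrable pos_lborel (\<lambda>t. t powr (\<sigma> - 1) * norm (\<psi> t))"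
    by (rule Bochner_Integration.integrable_cong) (auto simp: assms)
  ultimately show ?thesis by (simp add: mellin_conv_def)
qed

lemma mellin_conv_diff:
  assumes "mellin_conv \<phi> \<sigma>" "mellin_conv \<psi> \<sigma>"
  shows "mellin_conv (\<lambda>t. \<phi> t - \<psi> t) \<sigma>"
  unfolding mellin_conv_def
proof (rule conjI, rule_tac [2] Bochner_Integration.integrable_bound)
  note [measurable] = assms[THEN mellin_conv_measurable]
  show "(\<lambda>t. \<phi> t - \<psi> t) \<in> borel_measurable pos_lborel"
    "(\<lambda>t. t powr (\<sigma> - 1) * norm (\<phi> t - \<psi> t)) \<in> borel_measurable pos_lborel" by measurable
  show "integrable pos_lborel (\<lambda>t. t powr (\<sigma> - 1) * norm (\<phi> t) + t powr (\<sigma> - 1) * norm (\<psi> t))"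
    using assms by (simp add: mellin_conv_def)
  show "AE t in pos_lborel. norm (t powr (\<sigma> - 1) * norm (\<phi> t - \<psi> t)) \<le>
          norm (t powr (\<sigma> - 1) * norm (\<phi> t) + t powr (\<sigma> - 1) * norm (\<psi> t))"
    by (rule AE_pos_lborelI)
      (simp add: norm_triangle_ineq4 mult_left_mono flip: distrib_left)
qed

lemma mellin_conv_cmult: "mellin_conv \<phi> \<sigma> \<Longrightarrow> mellin_conv (\<lambda>t. c * \<phi> t) \<sigma>"
  by (rule mellin_conv_bound[where C = "norm c"])
     (auto simp: norm_mult mellin_conv_def)

lemma mellin_conv_add:
  assumes "mellin_conv \<phi> \<sigma>" "mellin_conv \<psi> \<sigma>"
  shows "mellin_conv (\<lambda>t. \<phi> t + \<psi> t) \<sigma>"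
  using mellin_conv_diff[OF assms(1) mellin_conv_cmult[OF assms(2), of "-1"]] by simp

lemma mellin_diff:
  assumes "mellin_conv \<phi> (Re s)" "mellin_conv \<psi> (Re s)"
  shows "mellin (\<lambda>t. \<phi> t - \<psi> t) s = mellin \<phi> s - mellin \<psi> s"
  using Bochner_Integration.integral_diff[OF assms[THEN mellin_integrable]]
  by (simp add: mellin_def ring_distribs)

lemma mellin_add:
  assumes "mellin_conv \<phi> (Re s)" "mellin_conv \<psi> (Re s)"
  shows "mellin (\<lambda>t. \<phi> t + \<psi> t) s = mellin \<phi> s + mellin \<psi> s"
  using Bochner_Integration.integral_add[OF assms[THEN mellin_integrable]]
  by (simp add: mellin_def ring_distribs)

lemma mellin_cmult: "mellin (\<lambda>t. c * \<phi> t) s = c * mellin \<phi> s"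
  unfolding mellin_def
  by (subst integral_mult_right_zero[symmetric]) (simp add: mult_ac)

text \<open>A single majorant for a whole vertical strip: the right end controls large t, the left
  end small t. It provides the local uniformity in s that holomorphy needs.\<close>

lemma powr_le_endpoints:
  fixes t :: real
  assumes "t > 0" "l \<le> x" "x \<le> u"
  shows "t powr x \<le> t powr l + t powr u"
proof (cases "t \<ge> 1")
  case True
  then have "t powr x \<le> t powr u" using assms by (intro powr_mono) auto
  then show ?thesis by (simp add: add_increasing)
next
  case False
  then have "t powr x \<le> t powr l" using assms by (intro powr_mono') auto
  then show ?thesis by (simp add: add_increasing2)
qed

lemma mellin_holomorphic:
  assumes conv: "\<And>\<sigma>. \<sigma> > a \<Longrightarrow> mellin_conv \<phi> \<sigma>"
  shows "mellin \<phi> holomorphic_on {s. Re s > a}"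
  unfolding mellin_def
proof (rule holomorphic_on_integral)
  show "open {s. Re s > a}" by (rule open_halfspace_Re_gt)
  show "(\<lambda>s. of_real t powr (s - 1) * \<phi> t) holomorphic_on {s. Re s > a}" if "t \<in> space pos_lborel" for t
    using that by (auto intro!: holomorphic_intros)
  show "(\<lambda>t. of_real t powr (s - 1) * \<phi> t) \<in> borel_measurable pos_lborel" for s
    using mellin_conv_measurable[OF conv[of "a + 1"]] by measurable
  fix s assume "s \<in> {s. Re s > a}"
  then have s: "Re s > a" by simp
  define e where "e = (Re s - a) / 2"
  have e: "e > 0" using s by (simp add: e_def)
  have c: "mellin_conv \<phi> (Re s - e)" "mellin_conv \<phi> (Re s + e)"
    using s e by (auto intro!: conv simp: e_def field_simps)
  have "norm (of_real t powr (w - 1) * \<phi> t) \<le>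
      t powr (Re s - e - 1) * norm (\<phi> t) + t powr (Re s + e - 1) * norm (\<phi> t)"
    if w: "w \<in> ball s e" and t: "t > 0" for w t
  proof -
    have "\<bar>Re w - Re s\<bar> < e" using w abs_Re_le_cmod[of "w - s"] by (simp add: dist_norm norm_minus_commute)
    then have "t powr (Re w - 1) \<le> t powr (Re s - e - 1) + t powr (Re s + e - 1)"
      using t by (intro powr_le_endpoints) auto
    then show ?thesis
      using t by (simp add: norm_mult norm_of_real_powr mult_right_mono flip: distrib_right)
  qed
  then show "\<exists>e>0. \<exists>g. integrable pos_lborel g \<and> (\<forall>w\<in>ball s e \<inter> {s. Re s > a}. \<forall>t\<in>space pos_lborel.
      norm (of_real t powr (w - 1) * \<phi> t) \<le> g t)"
    using c e by (intro exI[of _ e] conjI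
        exI[of _ "\<lambda>t. t powr (Re s - e - 1) * norm (\<phi> t) + t powr (Re s + e - 1) * norm (\<phi> t)"])
      (auto simp: mellin_conv_def)
qed

lemma integral_pos_lborel_scale:
  fixes f :: "real \<Rightarrow> 'a :: {banach, second_countable_topology}"
  assumes "c > 0"
  shows "(\<integral>t. f (c * t) \<partial>pos_lborel) = (\<integral>t. f t \<partial>pos_lborel) /\<^sub>R c"
proof -
  have *: "indicat_real {0<..} (c * t) = indicator {0<..} t" for t
    using assms by (auto simp: indicator_def zero_less_mult_iff)
  show ?thesis
    using lborel_integral_real_affine[of c "\<lambda>t. indicator {0<..} t *\<^sub>R f t" 0] assms
    by (simp add: integral_restrict_space *)
qed

lemma integrable_pos_lborel_scale:
  fixes f :: "real \<Rightarrow> 'a :: {banach, second_countable_topology}"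
  assumes "c > 0" "integrable pos_lborel f"
  shows "integrable pos_lborel (\<lambda>t. f (c * t))"
proof -
  have *: "indicat_real {0<..} (c * t) = indicator {0<..} t" for t
    using assms by (auto simp: indicator_def zero_less_mult_iff)
  show ?thesis
    using lborel_integrable_real_affine[of "\<lambda>t. indicator {0<..} t *\<^sub>R f t" c 0] assms
    by (simp add: integrable_restrict_space *)
qed

lemma measurable_pos_lborel_scale:
  assumes "c > 0" "\<phi> \<in> borel_measurable pos_lborel"
  shows "(\<lambda>t. \<phi> (c * t)) \<in> borel_measurable pos_lborel"
proof -
  have "(\<lambda>t. c * t) \<in> pos_lborel \<rightarrow>\<^sub>M pos_lborel"
    using assms(1) by (intro measurable_restrict_space3) auto
  from measurable_compose[OF this assms(2)] show ?thesis .
qed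

lemma mellin_conv_scale:
  assumes "c > 0" "mellin_conv \<phi> \<sigma>"
  shows "mellin_conv (\<lambda>t. \<phi> (c * t)) \<sigma>"
    and "(\<integral>t. t powr (\<sigma> - 1) * norm (\<phi> (c * t)) \<partial>pos_lborel) =
           c powr (-\<sigma>) * (\<integral>t. t powr (\<sigma> - 1) * norm (\<phi> t) \<partial>pos_lborel)"
proof -
  have eq: "t powr (\<sigma> - 1) * norm (\<phi> (c * t)) =
      c powr (1 - \<sigma>) * ((c * t) powr (\<sigma> - 1) * norm (\<phi> (c * t)))" if "t > 0" for t
    using assms(1) that by (simp add: powr_mult powr_diff divide_simps)
  have i: "integrable pos_lborel (\<lambda>t. (c * t) powr (\<sigma> - 1) * norm (\<phi> (c * t)))"
    using integrable_pos_lborel_scale[OF assms(1), of "\<lambda>t. t powr (\<sigma> - 1) * norm (\<phi> t)"] assms(2)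
    by (simp add: mellin_conv_def)
  have "integrable pos_lborel (\<lambda>t. t powr (\<sigma> - 1) * norm (\<phi> (c * t))) \<longleftrightarrow>
     integrable pos_lborel (\<lambda>t. c powr (1 - \<sigma>) * ((c * t) powr (\<sigma> - 1) * norm (\<phi> (c * t))))"
    by (rule Bochner_Integration.integrable_cong) (auto simp: eq)
  with i show "mellin_conv (\<lambda>t. \<phi> (c * t)) \<sigma>"
    using measurable_pos_lborel_scale[OF assms(1) mellin_conv_measurable[OF assms(2)]]
    by (simp add: mellin_conv_def)
  have "(\<integral>t. t powr (\<sigma> - 1) * norm (\<phi> (c * t)) \<partial>pos_lborel) =
        (\<integral>t. c powr (1 - \<sigma>) * ((c * t) powr (\<sigma> - 1) * norm (\<phi> (c * t))) \<partial>pos_lborel)"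
    by (rule Bochner_Integration.integral_cong) (auto simp: eq)
  also have "\<dots> = c powr (1 - \<sigma>) / c * (\<integral>t. t powr (\<sigma> - 1) * norm (\<phi> t) \<partial>pos_lborel)"
    using integral_pos_lborel_scale[OF assms(1), of "\<lambda>t. t powr (\<sigma> - 1) * norm (\<phi> t)"]
    by (simp add: divide_inverse)
  also have "c powr (1 - \<sigma>) / c = c powr (-\<sigma>)"
    using assms(1) powr_diff[of c "1 - \<sigma>" 1] by simp
  finally show "(\<integral>t. t powr (\<sigma> - 1) * norm (\<phi> (c * t)) \<partial>pos_lborel) =
           c powr (-\<sigma>) * (\<integral>t. t powr (\<sigma> - 1) * norm (\<phi> t) \<partial>pos_lborel)" .
qed

lemma mellin_scale:
  assumes "c > 0"
  shows "mellin (\<lambda>t. \<phi> (c * t)) s = of_real c powr (-s) * mellin \<phi> s"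
proof -
  have eq: "of_real t powr (s - 1) * \<phi> (c * t) =
      of_real c powr (1 - s) * (of_real (c * t) powr (s - 1) * \<phi> (c * t))" if "t > 0" for t
  proof -
    have "of_real (c * t) powr (s - 1) = (of_real c powr (s - 1) * of_real t powr (s - 1) :: complex)"
      using assms that by (simp add: powr_times_real)
    moreover have "of_real c powr (1 - s) * of_real c powr (s - 1) = (1 :: complex)"
      using assms by (simp flip: powr_add)
    ultimately show ?thesis by (simp flip: mult.assoc)
  qed
  have "mellin (\<lambda>t. \<phi> (c * t)) s =
      (\<integral>t. of_real c powr (1 - s) * (of_real (c * t) powr (s - 1) * \<phi> (c * t)) \<partial>pos_lborel)"
    unfolding mellin_def by (rule Bochner_Integration.integral_cong) (auto simp: eq)
  also have "\<dots> = of_real c powr (1 - s) * (mellin \<phi> s /\<^sub>R c)"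
    unfolding mellin_def
    using integral_pos_lborel_scale[OF assms, of "\<lambda>t. of_real t powr (s - 1) * \<phi> t"] by simp
  also have "\<dots> = of_real c powr (-s) * mellin \<phi> s"
    using assms powr_diff[of "of_real c :: complex" "1 - s" 1] powr_minus
    by (simp add: scaleR_conv_of_real field_simps powr_diff powr_minus)
  finally show ?thesis .
qed

lemma mellin_conv_times_iff:
  "mellin_conv (\<lambda>t. of_real t * \<phi> t) \<sigma> \<longleftrightarrow> mellin_conv \<phi> (\<sigma> + 1)"
proof -
  have [measurable]: "(\<lambda>t. complex_of_real t) \<in> borel_measurable pos_lborel"
    by (rule measurable_restrict_space1) measurable
  have "\<phi> \<in> borel_measurable pos_lborel" if [measurable]: "(\<lambda>t. of_real t * \<phi> t) \<in> borel_measurable pos_lborel"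
  proof -
    have "(\<lambda>t. (of_real t * \<phi> t) / of_real t) \<in> borel_measurable pos_lborel" by measurable
    also have "?this \<longleftrightarrow> ?thesis" by (rule measurable_cong) auto
    finally show ?thesis .
  qed
  moreover have "(\<lambda>t. of_real t * \<phi> t) \<in> borel_measurable pos_lborel" if [measurable]: "\<phi> \<in> borel_measurable pos_lborel"
    by measurable
  ultimately have "(\<lambda>t. of_real t * \<phi> t) \<in> borel_measurable pos_lborel \<longleftrightarrow> \<phi> \<in> borel_measurable pos_lborel"
    by (rule iffI)
  moreover have "integrable pos_lborel (\<lambda>t. t powr (\<sigma> - 1) * norm (of_real t * \<phi> t)) \<longleftrightarrow>
      integrable pos_lborel (\<lambda>t. t powr (\<sigma> + 1 - 1) * norm (\<phi> t))"
    by (rule Bochner_Integration.integrable_cong) (auto simp: norm_mult powr_diff)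
  ultimately show ?thesis by (simp add: mellin_conv_def)
qed

lemma mellin_times: "mellin (\<lambda>t. of_real t * \<phi> t) s = mellin \<phi> (s + 1)"
  unfolding mellin_def
  by (rule Bochner_Integration.integral_cong) (auto simp: powr_diff)

text \<open>The interchange of sum and integral is reduced to a summable sequence B of bounds for
  the weighted L1 norms of the terms.\<close>

lemma mellin_sums:
  assumes conv: "\<And>n. mellin_conv (f n) (Re s)"
    and sums: "\<And>t. t > 0 \<Longrightarrow> (\<lambda>n. f n t) sums \<phi> t"
    and abs: "\<And>t. t > 0 \<Longrightarrow> summable (\<lambda>n. norm (f n t))"
    and le: "\<And>n. (\<integral>t. t powr (Re s - 1) * norm (f n t) \<partial>pos_lborel) \<le> B n" and "summable B"
  shows "(\<lambda>n. mellin (f n) s) sums mellin \<phi> s"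
proof -
  have eq: "(\<integral>t. norm (of_real t powr (s - 1) * f n t) \<partial>pos_lborel) =
      (\<integral>t. t powr (Re s - 1) * norm (f n t) \<partial>pos_lborel)" for n
    by (rule Bochner_Integration.integral_cong) (auto simp: norm_mult norm_of_real_powr)
  have "(\<lambda>n. \<integral>t. of_real t powr (s - 1) * f n t \<partial>pos_lborel) sums
          (\<integral>t. (\<Sum>n. of_real t powr (s - 1) * f n t) \<partial>pos_lborel)"
  proof (rule sums_integral)
    show "integrable pos_lborel (\<lambda>t. of_real t powr (s - 1) * f n t)" for n
      by (rule mellin_integrable[OF conv])
    show "AE t in pos_lborel. summable (\<lambda>n. norm (of_real t powr (s - 1) * f n t))"
      by (rule AE_pos_lborelI) (auto simp: norm_mult intro!: summable_mult abs)
    show "summable (\<lambda>n. \<integral>t. norm (of_real t powr (s - 1) * f n t) \<partial>pos_lborel)"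
      unfolding eq
    proof (rule summable_comparison_test'[OF \<open>summable B\<close>])
      fix n
      have "(\<integral>t. t powr (Re s - 1) * norm (f n t) \<partial>pos_lborel) \<ge> 0"
        by (rule integral_nonneg_AE) (rule AE_pos_lborelI, simp)
      with le[of n] show "norm (\<integral>t. t powr (Re s - 1) * norm (f n t) \<partial>pos_lborel) \<le> B n" by simp
    qed
  qed
  also have "(\<integral>t. (\<Sum>n. of_real t powr (s - 1) * f n t) \<partial>pos_lborel) = mellin \<phi> s"
    unfolding mellin_def
    by (rule Bochner_Integration.integral_cong) (auto intro!: sums_unique[symmetric] sums_mult sums)
  finally show ?thesis by (simp add: mellin_def)
qed

lemma mellin_exp:
  shows "\<sigma> > 0 \<Longrightarrow> mellin_conv (\<lambda>t. of_real (exp (-t))) \<sigma>"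
    and "Re s > 0 \<Longrightarrow> mellin (\<lambda>t. of_real (exp (-t))) s = Gamma s"
proof -
  have m: "(\<lambda>t. of_real (exp (-t)) :: complex) \<in> borel_measurable pos_lborel"
    by (rule measurable_restrict_space1) measurable
  have *: "integrable pos_lborel (\<lambda>t. of_real t powr (s - 1) * of_real (exp (-t)) :: complex)"
      "mellin (\<lambda>t. of_real (exp (-t))) s = Gamma s" if s: "Re s > 0" for s
  proof -
    let ?f = "\<lambda>t. of_real t powr (s - 1) / of_real (exp t) :: complex"
    have abs: "?f absolutely_integrable_on {0<..}"
      by (rule absolutely_integrable_Gamma_integral'[OF s])
    have mf: "?f \<in> borel_measurable pos_lborel"
      using m by (simp add: exp_minus divide_inverse) (measurable)
    then have mf': "(\<lambda>t. indicator {0<..} t *\<^sub>R ?f t) \<in> borel_measurable lborel"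
      by (simp add: borel_measurable_restrict_space_iff)
    \<comment> \<open>Absolute integrability refers to the completed Lebesgue measure; Borel
      measurability of the integrand brings it down to \<open>lborel\<close>.\<close>
    have i: "integrable lborel (\<lambda>t. indicator {0<..} t *\<^sub>R ?f t)"
      using abs integrable_completion[OF mf'] by (simp add: set_integrable_def)
    then have i': "set_integrable lborel {0<..} ?f" by (simp add: set_integrable_def)
    show "integrable pos_lborel (\<lambda>t. of_real t powr (s - 1) * of_real (exp (-t)) :: complex)"
      using i by (simp add: integrable_restrict_space exp_minus divide_inverse)
    have "mellin (\<lambda>t. of_real (exp (-t))) s = (LINT t : {0<..} | lborel. ?f t)"
      unfolding mellin_def
      by (simp add: integral_restrict_space set_lebesgue_integral_def exp_minus divide_inverse)
    also have "\<dots> = integral {0<..} ?f"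
      by (rule set_borel_integral_eq_integral(2)[OF i'])
    also have "\<dots> = Gamma s"
      by (rule integral_unique[OF Gamma_integral_complex'[OF s]])
    finally show "mellin (\<lambda>t. of_real (exp (-t))) s = Gamma s" .
  qed
  show "mellin (\<lambda>t. of_real (exp (-t))) s = Gamma s" if "Re s > 0" using *(2)[OF that] .
  show "mellin_conv (\<lambda>t. of_real (exp (-t))) \<sigma>" if "\<sigma> > 0"
    unfolding mellin_conv_def
  proof (intro conjI m)
    have "integrable pos_lborel (\<lambda>t. norm (of_real t powr (of_real \<sigma> - 1) * of_real (exp (-t)) :: complex))"
      using *(1)[of "of_real \<sigma>"] that by (intro integrable_norm) auto
    also have "?this \<longleftrightarrow> integrable pos_lborel (\<lambda>t. t powr (\<sigma> - 1) * norm (complex_of_real (exp (-t))))"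
      by (rule Bochner_Integration.integrable_cong) (auto simp: norm_mult norm_of_real_powr)
    finally show "integrable pos_lborel (\<lambda>t. t powr (\<sigma> - 1) * norm (complex_of_real (exp (-t))))" .
  qed
qed

lemma complex_powr_integral_unit_interval:
  assumes "Re s > 0"
  shows "((\<lambda>t. of_real t powr (s - 1)) has_integral (1 / s)) {0..1}"
proof -
  have s: "s \<noteq> 0" using assms by auto
  have "((\<lambda>t. of_real t powr (s - 1)) has_integral (of_real 1 powr s / s - of_real 0 powr s / s)) {0..1}"
  proof (rule fundamental_theorem_of_calculus_interior)
    have "isCont (\<lambda>t. complex_of_real t powr s / s) t" if "t > 0" for t
      using that s by (intro continuous_intros) auto
    moreover have "((\<lambda>t. complex_of_real t powr s / s) \<longlongrightarrow> of_real 0 powr s / s) (at 0 within {0..1})"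
    proof -
      have "((\<lambda>t. complex_of_real t powr s) \<longlongrightarrow> 0) (at 0 within {0..1})"
        by (rule tendsto_powr_complex_0) (use assms in \<open>auto intro!: tendsto_eq_intros\<close>)
      from tendsto_divide[OF this tendsto_const[of s] s] show ?thesis by simp
    qed
    ultimately show "continuous_on {0..1} (\<lambda>t. complex_of_real t powr s / s)"
      unfolding continuous_on_def
      by (metis atLeastAtMost_iff continuous_within isCont_def continuous_at_imp_continuous_at_within order_le_less)
    fix t :: real assume t: "t \<in> {0<..<1}"
    have "((\<lambda>z. z powr s / s) has_field_derivative (of_real t powr (s - 1))) (at (of_real t))"
      using t s by (auto intro!: derivative_eq_intros)
    then show "((\<lambda>t. of_real t powr s / s) has_vector_derivative of_real t powr (s - 1)) (at t)"
      using has_vector_derivative_real_field by blast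
  qed auto
  then show ?thesis using s by simp
qed

lemma mellin_indicator_unit:
  shows "\<sigma> > 0 \<Longrightarrow> mellin_conv (\<lambda>t. if t \<le> 1 then 1 else 0) \<sigma>"
    and "Re s > 0 \<Longrightarrow> mellin (\<lambda>t. if t \<le> 1 then 1 else 0) s = 1 / s"
proof -
  have m: "(\<lambda>t. if t \<le> (1::real) then 1 else 0 :: complex) \<in> borel_measurable pos_lborel"
    by (rule measurable_restrict_space1) measurable
  show *: "mellin_conv (\<lambda>t. if t \<le> 1 then 1 else 0) \<sigma>" if "\<sigma> > 0" for \<sigma>
  proof -
    have "mellin_conv (\<lambda>t. of_real (exp (-t))) \<sigma>" by (rule mellin_exp(1)[OF that])
    then show ?thesis
    proof (rule mellin_conv_bound[OF _ m])
      fix t :: real assume "t > 0"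
      show "norm (if t \<le> 1 then 1 else 0 :: complex) \<le> exp 1 * norm (complex_of_real (exp (- t)))"
        by (auto simp flip: exp_add)
    qed
  qed
  show "mellin (\<lambda>t. if t \<le> 1 then 1 else 0) s = 1 / s" if s: "Re s > 0"
  proof -
    have "integrable pos_lborel (\<lambda>t. of_real t powr (s - 1) * (if t \<le> 1 then 1 else 0))"
      by (rule mellin_integrable[OF *[OF s]])
    also have "?this \<longleftrightarrow> integrable lborel (\<lambda>t. indicator {0<..1} t *\<^sub>R (of_real t powr (s - 1) :: complex))"
      by (simp add: integrable_restrict_space)
        (rule Bochner_Integration.integrable_cong, auto simp: indicator_def)
    finally have i: "set_integrable lborel {0<..1} (\<lambda>t. of_real t powr (s - 1) :: complex)"
      by (simp add: set_integrable_def)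
    have "mellin (\<lambda>t. if t \<le> 1 then 1 else 0) s = (LINT t : {0<..1} | lborel. (of_real t powr (s - 1) :: complex))"
      unfolding mellin_def set_lebesgue_integral_def
      by (simp add: integral_restrict_space)
        (rule Bochner_Integration.integral_cong, auto simp: indicator_def)
    also have "\<dots> = integral {0<..1} (\<lambda>t. of_real t powr (s - 1))"
      by (rule set_borel_integral_eq_integral(2)[OF i])
    also have "\<dots> = integral {0..1} (\<lambda>t. of_real t powr (s - 1))"
      by (rule integral_subset_negligible) (auto intro: negligible_subset[of "{0}"])
    also have "\<dots> = 1 / s"
      by (rule integral_unique[OF complex_powr_integral_unit_interval[OF s]])
    finally show ?thesis .
  qed
qed

lemma mellin_conv_power_iff:
  "mellin_conv (\<lambda>t. of_real t ^ m * \<phi> t) \<sigma> \<longleftrightarrow> mellin_conv \<phi> (\<sigma> + of_nat m)"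
proof (induction m arbitrary: \<sigma>)
  case (Suc m)
  have "mellin_conv (\<lambda>t. of_real t ^ Suc m * \<phi> t) \<sigma> \<longleftrightarrow> mellin_conv (\<lambda>t. of_real t * (of_real t ^ m * \<phi> t)) \<sigma>"
    by (simp add: mult_ac)
  then show ?case by (simp add: mellin_conv_times_iff Suc add_ac)
qed simp

lemma mellin_power: "mellin (\<lambda>t. of_real t ^ m * \<phi> t) s = mellin \<phi> (s + of_nat m)"
proof (induction m arbitrary: s)
  case (Suc m)
  have "mellin (\<lambda>t. of_real t ^ Suc m * \<phi> t) s = mellin (\<lambda>t. of_real t * (of_real t ^ m * \<phi> t)) s"
    by (simp add: mult_ac)
  then show ?case by (simp add: mellin_times Suc add_ac)
qed simp

lemma mellin_integral_power:
  fixes \<phi> :: "real \<Rightarrow> complex"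
  shows "(\<integral>t. t powr (\<sigma> - 1) * norm (of_real t ^ m * \<phi> t) \<partial>pos_lborel) =
   (\<integral>t. t powr (\<sigma> + of_nat m - 1) * norm (\<phi> t) \<partial>pos_lborel)"
  by (rule Bochner_Integration.integral_cong)
    (auto simp: norm_mult norm_power powr_diff powr_add powr_realpow)

lemma mellin_truncated_power:
  assumes "\<rho> > 0"
  shows "\<sigma> > 0 \<Longrightarrow> mellin_conv (\<lambda>t. of_real t ^ m * (if t \<le> \<rho> then 1 else 0)) \<sigma>"
    and "Re s > 0 \<Longrightarrow> mellin (\<lambda>t. of_real t ^ m * (if t \<le> \<rho> then 1 else 0)) s =
           of_real \<rho> powr (s + of_nat m) / (s + of_nat m)"
    and "\<sigma> > 0 \<Longrightarrow> (\<integral>t. t powr (\<sigma> - 1) * norm (of_real t ^ m * (if t \<le> \<rho> then 1 else 0 :: complex)) \<partial>pos_lborel) \<le>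
           \<rho> powr \<sigma> * \<rho> ^ m * (\<integral>t. t powr (\<sigma> - 1) * norm (if t \<le> 1 then 1 else 0 :: complex) \<partial>pos_lborel)"
proof -
  have eq: "(if t \<le> \<rho> then 1 else 0 :: complex) = (if (1/\<rho>) * t \<le> 1 then 1 else 0)" for t
    using assms by (simp add: field_simps)
  have c: "mellin_conv (\<lambda>t. if t \<le> \<rho> then 1 else 0) \<sigma>" if "\<sigma> > 0" for \<sigma>
    unfolding eq using assms that
    by (intro mellin_conv_scale(1)[of "1/\<rho>" "\<lambda>t. if t \<le> 1 then 1 else 0"] mellin_indicator_unit) auto
  then show c': "\<sigma> > 0 \<Longrightarrow> mellin_conv (\<lambda>t. of_real t ^ m * (if t \<le> \<rho> then 1 else 0)) \<sigma>"
    unfolding mellin_conv_power_iff by simp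
  have inv: "inverse (complex_of_real \<rho>) powr (- s) = of_real \<rho> powr s" for s
    using assms by (simp add: powr_def Ln_inverse exp_minus Ln_of_real flip: of_real_inverse)
      (simp add: ln_inverse exp_minus)
  show "mellin (\<lambda>t. of_real t ^ m * (if t \<le> \<rho> then 1 else 0)) s =
           of_real \<rho> powr (s + of_nat m) / (s + of_nat m)" if "Re s > 0"
    unfolding mellin_power unfolding eq
    using mellin_scale[of "1/\<rho>" "\<lambda>t. if t \<le> 1 then 1 else 0" "s + of_nat m"] assms that
    by (subst mellin_scale[of "1/\<rho>" "\<lambda>t. if t \<le> 1 then 1 else 0" "s + of_nat m"])
       (auto simp: mellin_indicator_unit inv[of "s + of_nat m", simplified] divide_inverse)
  show "(\<integral>t. t powr (\<sigma> - 1) * norm (of_real t ^ m * (if t \<le> \<rho> then 1 else 0 :: complex)) \<partial>pos_lborel) \<le>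
           \<rho> powr \<sigma> * \<rho> ^ m * (\<integral>t. t powr (\<sigma> - 1) * norm (if t \<le> 1 then 1 else 0 :: complex) \<partial>pos_lborel)"
    if "\<sigma> > 0"
  proof -
    have "(\<integral>t. t powr (\<sigma> - 1) * norm (of_real t ^ m * (if t \<le> \<rho> then 1 else 0 :: complex)) \<partial>pos_lborel) \<le>
       \<rho> ^ m * (\<integral>t. t powr (\<sigma> - 1) * norm (if t \<le> \<rho> then 1 else 0 :: complex) \<partial>pos_lborel)"
      using assms
      by (intro mellin_integral_bound[OF c[OF that] mellin_conv_measurable[OF c'[OF that]]])
        (auto simp: norm_power intro: power_mono)
    also have "(\<integral>t. t powr (\<sigma> - 1) * norm (if t \<le> \<rho> then 1 else 0 :: complex) \<partial>pos_lborel) =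
      \<rho> powr \<sigma> * (\<integral>t. t powr (\<sigma> - 1) * norm (if t \<le> 1 then 1 else 0 :: complex) \<partial>pos_lborel)"
      unfolding eq using assms that
      by (subst mellin_conv_scale(2)[of "1/\<rho>" "\<lambda>t. if t \<le> 1 then 1 else 0"])
        (auto simp: mellin_indicator_unit powr_divide powr_minus)
    finally show ?thesis by (simp add: mult_ac)
  qed
qed

text \<open>No condition on \<sigma> is needed: away from 0, lowering the exponent of t costs only a
  constant factor, so a Gamma integral with \<sigma>' \<ge> 1 dominates. This is why the tail of a
  Mellin transform contributes an entire function.\<close>

lemma mellin_truncated_exp:
  assumes "\<rho> > 0"
  shows "mellin_conv (\<lambda>t. if t > \<rho> then of_real (exp (-t/2)) else 0) \<sigma>"
proof -
  define \<sigma>' where "\<sigma>' = max 1 \<sigma>"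
  have "mellin_conv (\<lambda>t. of_real (exp (-(1/2*t)))) \<sigma>'"
    by (rule mellin_conv_scale(1)[of "1/2" "\<lambda>t. of_real (exp (-t))", OF _ mellin_exp(1)]) (auto simp: \<sigma>'_def)
  then have i: "integrable pos_lborel (\<lambda>t. t powr (\<sigma>' - 1) * norm (complex_of_real (exp (-t/2))))"
    by (simp add: mellin_conv_def)
  have m: "(\<lambda>t. if t > \<rho> then of_real (exp (-t/2)) else 0 :: complex) \<in> borel_measurable pos_lborel"
    by (rule measurable_restrict_space1) measurable
  show ?thesis
    unfolding mellin_conv_def
  proof (rule conjI[OF m], rule Bochner_Integration.integrable_bound)
    show "integrable pos_lborel (\<lambda>t. \<rho> powr (\<sigma> - \<sigma>') * (t powr (\<sigma>' - 1) * norm (complex_of_real (exp (-t/2)))))"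
      using i by simp
    show "(\<lambda>t. t powr (\<sigma> - 1) * norm (if t > \<rho> then of_real (exp (-t/2)) else 0 :: complex)) \<in> borel_measurable pos_lborel"
      using m by measurable
    show "AE t in pos_lborel. norm (t powr (\<sigma> - 1) * norm (if t > \<rho> then of_real (exp (-t/2)) else 0 :: complex))
         \<le> norm (\<rho> powr (\<sigma> - \<sigma>') * (t powr (\<sigma>' - 1) * norm (complex_of_real (exp (-t/2)))))"
    proof (rule AE_pos_lborelI)
      fix t :: real assume t: "t > 0"
      have "t powr (\<sigma> - 1) \<le> \<rho> powr (\<sigma> - \<sigma>') * t powr (\<sigma>' - 1)" if "t > \<rho>"
      proof -
        have "t powr (\<sigma> - 1) = t powr (\<sigma> - \<sigma>') * t powr (\<sigma>' - 1)" by (simp flip: powr_add)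
        also have "\<dots> \<le> \<rho> powr (\<sigma> - \<sigma>') * t powr (\<sigma>' - 1)"
          using that assms by (intro mult_right_mono powr_mono2') (auto simp: \<sigma>'_def)
        finally show ?thesis .
      qed
      then show "norm (t powr (\<sigma> - 1) * norm (if t > \<rho> then of_real (exp (-t/2)) else 0 :: complex))
         \<le> norm (\<rho> powr (\<sigma> - \<sigma>') * (t powr (\<sigma>' - 1) * norm (complex_of_real (exp (-t/2)))))"
        by (auto simp: abs_mult simp flip: mult.assoc)
    qed
  qed
qed

section \<open>Regularised Mellin transforms\<close>

text \<open>
  If \<open>\<psi>\<close> is holomorphic at the origin, then \<open>s \<mapsto> mellin \<psi> s / \<Gamma>(s)\<close> is entire: the poles produced
  by the Taylor coefficients of \<open>\<psi>\<close> are cancelled by the zeros of \<open>rGamma\<close>, since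
  \<open>rGamma s / (s + m) = pochhammer s m * rGamma (s + m + 1)\<close>.
\<close>

definition reg_mellin :: "real \<Rightarrow> (complex \<Rightarrow> complex) \<Rightarrow> complex \<Rightarrow> complex" where
  "reg_mellin \<rho> \<psi> s = rGamma s * mellin (\<lambda>t. if t > \<rho> then \<psi> (of_real t) else 0) s +
     (\<Sum>m. (deriv ^^ m) \<psi> 0 / fact m *
        (of_real \<rho> powr (s + of_nat m) * (pochhammer s m * rGamma (s + of_nat m + 1))))"

text \<open>Holomorphy on twice the radius gives the Taylor series a geometric margin on the
  interval from 0 to \<rho>. One constant B governs both the disc and the tail, so that bounds can
  be carried linearly through differences of such functions.\<close>

definition reg_adm :: "real \<Rightarrow> real \<Rightarrow> (complex \<Rightarrow> complex) \<Rightarrow> bool" where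
  "reg_adm \<rho> B \<psi> \<longleftrightarrow> \<psi> holomorphic_on ball 0 (2 * \<rho>) \<and> (\<forall>\<tau>\<in>ball 0 (2 * \<rho>). norm (\<psi> \<tau>) \<le> B) \<and>
     (\<lambda>t. \<psi> (of_real t)) \<in> borel_measurable pos_lborel \<and>
     (\<forall>t>\<rho>. norm (\<psi> (of_real t)) \<le> B * exp (-t/2))"

lemma reg_adm_coeff_le:
  assumes "reg_adm \<rho> B \<psi>" "\<rho> > 0"
  shows "norm ((deriv ^^ m) \<psi> 0 / fact m) * \<rho> ^ m \<le> B * (2/3) ^ m"
proof -
  \<comment> \<open>A radius strictly between \<rho> and 2 \<rho>; this choice produces the ratio
    2/3.\<close>
  have "norm ((deriv ^^ m) \<psi> 0) \<le> fact m * B / (3/2 * \<rho>) ^ m"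
  proof (rule Cauchy_inequality)
    have sub: "cball 0 (3/2*\<rho>) \<subseteq> ball (0::complex) (2*\<rho>)" using assms(2) by auto
    have h: "\<psi> holomorphic_on ball 0 (2*\<rho>)" using assms(1) by (simp add: reg_adm_def)
    show "\<psi> holomorphic_on ball 0 (3/2*\<rho>)"
      by (rule holomorphic_on_subset[OF h]) (use sub ball_subset_cball in blast)
    show "continuous_on (cball 0 (3/2*\<rho>)) \<psi>"
      by (rule holomorphic_on_imp_continuous_on, rule holomorphic_on_subset[OF h sub])
    show "norm (\<psi> x) \<le> B" if "norm (0 - x) = 3/2*\<rho>" for x
      using assms that by (auto simp: reg_adm_def)
  qed (use assms in auto)
  then have "norm ((deriv ^^ m) \<psi> 0 / fact m) \<le> B / (3/2 * \<rho>) ^ m"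
    using divide_right_mono[of "norm ((deriv ^^ m) \<psi> 0)" "fact m * B / (3/2 * \<rho>) ^ m" "fact m"]
    by (simp add: norm_divide)
  then have "norm ((deriv ^^ m) \<psi> 0 / fact m) * \<rho> ^ m \<le> B / (3/2 * \<rho>) ^ m * \<rho> ^ m"
    using assms(2) by (intro mult_right_mono) auto
  also have "\<dots> = B * (2/3) ^ m"
    using assms(2) by (simp add: power_mult_distrib power_divide)
  finally show ?thesis .
qed

lemma pochhammer_rGamma_times: "pochhammer s m * rGamma (s + of_nat m + 1) * (s + of_nat m) = (rGamma s :: complex)"
  using pochhammer_rGamma[of s "Suc m"] by (simp add: pochhammer_Suc add_ac mult_ac)

text \<open>Uniformity in m is the point. For m \<ge> R + 1 the modulus of s + m is at least 1, so
  that \<open>pochhammer_rGamma_times\<close> bounds the kernel by that of \<open>rGamma s\<close>;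
  the finitely many smaller m are covered by compactness.\<close>

lemma reg_mellin_kernel_bound:
  assumes "\<rho> > 0"
  shows "\<exists>C\<ge>0. \<forall>m s. norm s \<le> R \<longrightarrow>
    norm (of_real \<rho> powr (s + of_nat m) * (pochhammer s m * rGamma (s + of_nat m + 1) :: complex)) \<le> C * \<rho> ^ m"
proof -
  have bdd: "\<exists>K\<ge>0. \<forall>s. norm s \<le> R \<longrightarrow> norm (f s) \<le> K" if "continuous_on UNIV f" for f :: "complex \<Rightarrow> complex"
  proof -
    have "compact (f ` cball 0 R)"
      by (rule compact_continuous_image[OF continuous_on_subset[OF that]]) auto
    then have "bounded (f ` cball 0 R)" by (rule compact_imp_bounded)
    then obtain K where "\<forall>y\<in>f ` cball 0 R. norm y \<le> K" unfolding bounded_iff by blast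
    then show ?thesis by (intro exI[of _ "max K 0"]) (auto simp: le_max_iff_disj)
  qed
  have cont: "continuous_on UNIV (\<lambda>s. pochhammer s m * rGamma (s + of_nat m + 1) :: complex)" for m
    by (intro holomorphic_on_imp_continuous_on holomorphic_intros)
  have "\<forall>m. \<exists>K\<ge>0. \<forall>s. norm s \<le> R \<longrightarrow> norm (pochhammer s m * rGamma (s + of_nat m + 1) :: complex) \<le> K"
    using bdd[OF cont] by blast
  then obtain K where K: "\<And>m. K m \<ge> 0"
      "\<And>m s. norm s \<le> R \<Longrightarrow> norm (pochhammer s m * rGamma (s + of_nat m + 1) :: complex) \<le> K m"
    by metis
  obtain K0 where K0: "K0 \<ge> 0" "\<And>s. norm s \<le> R \<Longrightarrow> norm (rGamma s :: complex) \<le> K0"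
    using bdd[of rGamma] by (auto intro: holomorphic_on_imp_continuous_on holomorphic_intros)
  define m0 where "m0 = nat \<lceil>R + 1\<rceil>"
  define C where "C = K0 + (\<Sum>m<m0. K m)"
  have bd: "norm (pochhammer s m * rGamma (s + of_nat m + 1) :: complex) \<le> C" if s: "norm s \<le> R" for s m
  proof (cases "m < m0")
    case True
    have "K m \<le> (\<Sum>m<m0. K m)" using True K(1) by (intro member_le_sum) auto
    then show ?thesis using K(2)[OF s, of m] K0(1) by (simp add: C_def)
  next
    case False
    then have "real m \<ge> R + 1" unfolding m0_def by linarith
    then have ge1: "norm (s + of_nat m) \<ge> 1"
      using norm_triangle_ineq2[of "of_nat m" "-s"] s by (simp add: add_ac)
    have "norm (pochhammer s m * rGamma (s + of_nat m + 1)) * 1 \<le>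
        norm (pochhammer s m * rGamma (s + of_nat m + 1)) * norm (s + of_nat m)"
      using ge1 by (intro mult_left_mono) auto
    also have "\<dots> = norm (rGamma s)"
      using pochhammer_rGamma_times[of s m] by (simp flip: norm_mult)
    finally have "norm (pochhammer s m * rGamma (s + of_nat m + 1)) \<le> K0" using K0(2)[OF s] by simp
    then show ?thesis using K(1) by (simp add: C_def add_increasing2 sum_nonneg)
  qed
  have C: "C \<ge> 0" using K K0 by (simp add: C_def sum_nonneg)
  define D where "D = \<rho> powr (-R) + \<rho> powr R"
  have "norm (of_real \<rho> powr (s + of_nat m) * (pochhammer s m * rGamma (s + of_nat m + 1) :: complex)) \<le> D * C * \<rho> ^ m"
    if s: "norm s \<le> R" for s m
  proof -
    have "\<bar>Re s\<bar> \<le> R" using s abs_Re_le_cmod[of s] by linarith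
    then have "\<rho> powr Re s \<le> D" unfolding D_def using assms by (intro powr_le_endpoints) auto
    then have "\<rho> powr Re s * \<rho> ^ m \<le> D * \<rho> ^ m" using assms by (intro mult_right_mono) auto
    then have "norm (of_real \<rho> powr (s + of_nat m) :: complex) \<le> D * \<rho> ^ m"
      using assms by (subst norm_of_real_powr) (simp_all add: powr_add powr_realpow del: powr_nat')
    from mult_mono[OF this bd[OF s, of m]] show ?thesis
      using assms by (simp add: norm_mult D_def mult_ac)
  qed
  moreover have "D * C \<ge> 0" using C assms by (simp add: D_def)
  ultimately show ?thesis by blast
qed

lemma reg_mellin_tail:
  assumes "reg_adm \<rho> B \<psi>" "\<rho> > 0"
  shows "mellin_conv (\<lambda>t. if t > \<rho> then \<psi> (of_real t) else 0) \<sigma>"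
    and "(\<integral>t. t powr (\<sigma> - 1) * norm (if t > \<rho> then \<psi> (of_real t) else 0) \<partial>pos_lborel) \<le>
      B * (\<integral>t. t powr (\<sigma> - 1) * norm (if t > \<rho> then of_real (exp (-t/2)) else 0 :: complex) \<partial>pos_lborel)"
proof -
  have [measurable]: "(\<lambda>t. \<psi> (of_real t)) \<in> borel_measurable pos_lborel" using assms by (simp add: reg_adm_def)
  have [measurable]: "Measurable.pred pos_lborel (\<lambda>t. t > \<rho>)"
    by (rule measurable_restrict_space1) measurable
  have m: "(\<lambda>t. if t > \<rho> then \<psi> (of_real t) else 0) \<in> borel_measurable pos_lborel" by measurable
  have le: "norm (if t > \<rho> then \<psi> (of_real t) else 0) \<le> B * norm (if t > \<rho> then of_real (exp (-t/2)) else 0 :: complex)" for t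
    using assms(1) by (auto simp: reg_adm_def)
  show "mellin_conv (\<lambda>t. if t > \<rho> then \<psi> (of_real t) else 0) \<sigma>"
    by (rule mellin_conv_bound[OF mellin_truncated_exp[OF assms(2)] m le])
  show "(\<integral>t. t powr (\<sigma> - 1) * norm (if t > \<rho> then \<psi> (of_real t) else 0) \<partial>pos_lborel) \<le>
      B * (\<integral>t. t powr (\<sigma> - 1) * norm (if t > \<rho> then of_real (exp (-t/2)) else 0 :: complex) \<partial>pos_lborel)"
    by (rule mellin_integral_bound[OF mellin_truncated_exp[OF assms(2)] m le])
qed

lemma reg_adm_bound_nonneg: "reg_adm \<rho> B \<psi> \<Longrightarrow> \<rho> > 0 \<Longrightarrow> B \<ge> 0"
  by (auto simp: reg_adm_def intro: order_trans[OF norm_ge_zero[of "\<psi> 0"]])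

lemma reg_mellin_series_term_le:
  assumes "reg_adm \<rho> B \<psi>" "\<rho> > 0" "C \<ge> 0"
    and "norm (of_real \<rho> powr (s + of_nat m) * (pochhammer s m * rGamma (s + of_nat m + 1) :: complex)) \<le> C * \<rho> ^ m"
  shows "norm ((deriv ^^ m) \<psi> 0 / fact m *
        (of_real \<rho> powr (s + of_nat m) * (pochhammer s m * rGamma (s + of_nat m + 1)))) \<le> C * B * (2/3) ^ m"
proof -
  have "norm ((deriv ^^ m) \<psi> 0 / fact m *
        (of_real \<rho> powr (s + of_nat m) * (pochhammer s m * rGamma (s + of_nat m + 1)))) \<le>
      norm ((deriv ^^ m) \<psi> 0 / fact m) * (C * \<rho> ^ m)"
    unfolding norm_mult[of "(deriv ^^ m) \<psi> 0 / fact m"] by (intro mult_left_mono assms(4)) auto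
  also have "\<dots> = C * (norm ((deriv ^^ m) \<psi> 0 / fact m) * \<rho> ^ m)" by simp
  also have "\<dots> \<le> C * (B * (2/3) ^ m)"
    by (intro mult_left_mono reg_adm_coeff_le[OF assms(1,2)] assms(3))
  finally show ?thesis by (simp add: mult_ac)
qed

lemma reg_mellin_holomorphic:
  assumes "reg_adm \<rho> B \<psi>" "\<rho> > 0"
  shows "reg_mellin \<rho> \<psi> holomorphic_on UNIV"
proof -
  have 1: "mellin (\<lambda>t. if t > \<rho> then \<psi> (of_real t) else 0) holomorphic_on A" for A
  proof -
    have "mellin (\<lambda>t. if t > \<rho> then \<psi> (of_real t) else 0) holomorphic_on {s. Re s > a}" for a
      by (rule mellin_holomorphic) (rule reg_mellin_tail[OF assms])
    then have "mellin (\<lambda>t. if t > \<rho> then \<psi> (of_real t) else 0) holomorphic_on (\<Union>a. {s. Re s > a})"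
      by (intro holomorphic_on_UN_open open_halfspace_Re_gt)
    moreover have "(\<Union>a. {s. Re s > a}) = UNIV" by (auto intro: lt_ex)
    ultimately show ?thesis using holomorphic_on_subset by (metis subset_UNIV)
  qed
  have 2: "(\<lambda>s. \<Sum>m. (deriv ^^ m) \<psi> 0 / fact m *
        (of_real \<rho> powr (s + of_nat m) * (pochhammer s m * rGamma (s + of_nat m + 1)))) holomorphic_on UNIV"
  proof (rule holomorphic_on_suminf)
    show "(\<lambda>s. (deriv ^^ m) \<psi> 0 / fact m *
        (of_real \<rho> powr (s + of_nat m) * (pochhammer s m * rGamma (s + of_nat m + 1)))) holomorphic_on UNIV" for m
      using assms(2) by (auto intro!: holomorphic_intros simp: pochhammer_prod)
    fix s :: complex
    obtain C where C: "C \<ge> 0" "\<And>m w. norm w \<le> norm s + 1 \<Longrightarrow>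
        norm (of_real \<rho> powr (w + of_nat m) * (pochhammer w m * rGamma (w + of_nat m + 1) :: complex)) \<le> C * \<rho> ^ m"
      using reg_mellin_kernel_bound[OF assms(2), of "norm s + 1"] by blast
    have "norm ((deriv ^^ m) \<psi> 0 / fact m *
        (of_real \<rho> powr (w + of_nat m) * (pochhammer w m * rGamma (w + of_nat m + 1)))) \<le> C * B * (2/3) ^ m"
      if "w \<in> ball s 1" for w m
    proof (rule reg_mellin_series_term_le[OF assms C])
      show "norm w \<le> norm s + 1"
        using that norm_triangle_ineq2[of w s] by (simp add: dist_norm norm_minus_commute)
    qed
    moreover have "summable (\<lambda>m. C * B * (2/3) ^ m)" by (intro summable_mult summable_geometric) auto
    ultimately show "\<exists>e>0. \<exists>g. summable g \<and> (\<forall>w\<in>ball s e \<inter> UNIV. \<forall>m. norm ((deriv ^^ m) \<psi> 0 / fact m *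
        (of_real \<rho> powr (w + of_nat m) * (pochhammer w m * rGamma (w + of_nat m + 1)))) \<le> g m)"
      by (intro exI[of _ 1] conjI exI[of _ "\<lambda>m. C * B * (2/3) ^ m"]) auto
  qed auto
  show ?thesis
    unfolding reg_mellin_def by (intro holomorphic_intros 1 2)
qed

text \<open>C depends on \<rho> and R but not on the function. Linearity in B is what later converts
  smallness of a family in its parameter z into smallness of its transforms.\<close>

lemma reg_mellin_bound:
  assumes "\<rho> > 0"
  shows "\<exists>C\<ge>0. \<forall>\<psi> B s. reg_adm \<rho> B \<psi> \<longrightarrow> norm s \<le> R \<longrightarrow> norm (reg_mellin \<rho> \<psi> s) \<le> C * B"
proof -
  let ?e = "\<lambda>t. if t > \<rho> then of_real (exp (-t/2)) else 0 :: complex"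
  define I where "I \<sigma> = (\<integral>t. t powr (\<sigma> - 1) * norm (?e t) \<partial>pos_lborel)" for \<sigma>
  have conv: "integrable pos_lborel (\<lambda>t. t powr (\<sigma> - 1) * norm (?e t))" for \<sigma>
    using mellin_truncated_exp[OF assms, of \<sigma>] unfolding mellin_conv_def by (rule conjunct2)
  have I0: "I \<sigma> \<ge> 0" for \<sigma> unfolding I_def by (rule integral_nonneg_AE) (rule AE_pos_lborelI, simp)
  have I_le: "I \<sigma> \<le> I (-R) + I R" if "\<bar>\<sigma>\<bar> \<le> R" for \<sigma>
  proof -
    have "I \<sigma> \<le> (\<integral>t. t powr (-R - 1) * norm (?e t) + t powr (R - 1) * norm (?e t) \<partial>pos_lborel)"
      unfolding I_def
    proof (rule integral_mono[OF conv Bochner_Integration.integrable_add[OF conv conv]])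
      fix t assume "t \<in> space pos_lborel"
      then have "t powr (\<sigma> - 1) \<le> t powr (-R - 1) + t powr (R - 1)"
        using that by (intro powr_le_endpoints) auto
      from mult_right_mono[OF this norm_ge_zero[of "?e t"]]
      show "t powr (\<sigma> - 1) * norm (?e t) \<le> t powr (-R - 1) * norm (?e t) + t powr (R - 1) * norm (?e t)"
        by (simp add: ring_distribs)
    qed
    also have "\<dots> = I (-R) + I R"
      unfolding I_def by (rule Bochner_Integration.integral_add[OF conv conv])
    finally show ?thesis .
  qed
  obtain C where C: "C \<ge> 0" "\<And>m w. norm w \<le> R \<Longrightarrow>
        norm (of_real \<rho> powr (w + of_nat m) * (pochhammer w m * rGamma (w + of_nat m + 1) :: complex)) \<le> C * \<rho> ^ m"
    using reg_mellin_kernel_bound[OF assms, of R] by blast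
  have "bounded (rGamma ` cball (0::complex) R)"
    by (intro compact_imp_bounded compact_continuous_image holomorphic_on_imp_continuous_on holomorphic_intros) auto
  then obtain G where "\<forall>y\<in>rGamma ` cball (0::complex) R. norm y \<le> G" unfolding bounded_iff by blast
  then have G: "norm (rGamma s :: complex) \<le> max G 0" if "norm s \<le> R" for s
    using that by (auto simp: le_max_iff_disj)
  \<comment> \<open>The 3 is the sum of the geometric series with ratio 2/3 from the Taylor
    coefficients.\<close>
  define D where "D = max G 0 * (I (-R) + I R) + C * 3"
  have "norm (reg_mellin \<rho> \<psi> s) \<le> D * B" if adm: "reg_adm \<rho> B \<psi>" and s: "norm s \<le> R" for \<psi> B s
  proof -
    have B: "B \<ge> 0" by (rule reg_adm_bound_nonneg[OF adm assms])
    have "norm (mellin (\<lambda>t. if t > \<rho> then \<psi> (of_real t) else 0) s) \<le> B * I (Re s)"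
      using order_trans[OF norm_mellin_le reg_mellin_tail(2)[OF adm assms]] by (simp add: I_def)
    also have "\<dots> \<le> B * (I (-R) + I R)"
      using s abs_Re_le_cmod[of s] B by (intro mult_left_mono I_le) auto
    finally have "norm (rGamma s * mellin (\<lambda>t. if t > \<rho> then \<psi> (of_real t) else 0) s) \<le>
        max G 0 * (B * (I (-R) + I R))"
      unfolding norm_mult using G[OF s] by (intro mult_mono) auto
    moreover have "norm (\<Sum>m. (deriv ^^ m) \<psi> 0 / fact m *
        (of_real \<rho> powr (s + of_nat m) * (pochhammer s m * rGamma (s + of_nat m + 1)))) \<le> (\<Sum>m. C * B * (2/3) ^ m)"
      by (intro norm_suminf_le reg_mellin_series_term_le[OF adm assms C(1) C(2)[OF s]]
            summable_mult summable_geometric) auto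
    moreover have "(\<Sum>m. C * B * (2/3::real) ^ m) = C * B * 3"
      by (subst suminf_mult) (auto simp: suminf_geometric intro: summable_geometric)
    ultimately show ?thesis
      unfolding reg_mellin_def D_def
      by (intro order_trans[OF norm_triangle_ineq]) (auto simp: algebra_simps)
  qed
  moreover have "D \<ge> 0" using C I0[of R] I0[of "-R"] by (simp add: D_def)
  ultimately show ?thesis by blast
qed

text \<open>The integral over the interval from 0 to \<rho> is evaluated termwise from the Taylor
  series at 0, the m-th power giving \<rho>^(s + m) / (s + m); the rest of the half-line is
  literally the first summand of \<open>reg_mellin\<close>.\<close>

lemma reg_mellin_eq:
  assumes "reg_adm \<rho> B \<psi>" "\<rho> > 0"
  shows "\<sigma> > 0 \<Longrightarrow> mellin_conv (\<lambda>t. \<psi> (of_real t)) \<sigma>"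
    and "Re s > 0 \<Longrightarrow> rGamma s * mellin (\<lambda>t. \<psi> (of_real t)) s = reg_mellin \<rho> \<psi> s"
proof -
  let ?f = "\<lambda>t. if t \<le> \<rho> then \<psi> (of_real t) else 0" and ?g = "\<lambda>t. if t > \<rho> then \<psi> (of_real t) else 0"
  have split: "(\<lambda>t. \<psi> (of_real t)) = (\<lambda>t. ?f t + ?g t)" by auto
  have [measurable]: "(\<lambda>t. \<psi> (of_real t)) \<in> borel_measurable pos_lborel" using assms by (simp add: reg_adm_def)
  have [measurable]: "Measurable.pred pos_lborel (\<lambda>t. t \<le> \<rho>)"
    by (rule measurable_restrict_space1) measurable
  have m: "?f \<in> borel_measurable pos_lborel" by measurable
  have f_conv: "mellin_conv ?f \<sigma>" if "\<sigma> > 0" for \<sigma>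
    using mellin_truncated_power(1)[OF assms(2) that, of 0]
    by (rule mellin_conv_bound[OF _ m, where C = B]) (use assms in \<open>auto simp: reg_adm_def\<close>)
  show c: "mellin_conv (\<lambda>t. \<psi> (of_real t)) \<sigma>" if "\<sigma> > 0" for \<sigma>
    by (subst split, rule mellin_conv_add[OF f_conv[OF that] reg_mellin_tail(1)[OF assms]])
  show "rGamma s * mellin (\<lambda>t. \<psi> (of_real t)) s = reg_mellin \<rho> \<psi> s" if s: "Re s > 0"
  proof -
    let ?c = "\<lambda>m. (deriv ^^ m) \<psi> 0 / fact m"
    have "(\<lambda>m. mellin (\<lambda>t. ?c m * (of_real t ^ m * (if t \<le> \<rho> then 1 else 0))) s) sums mellin ?f s"
    proof (rule mellin_sums)
      show "mellin_conv (\<lambda>t. ?c m * (of_real t ^ m * (if t \<le> \<rho> then 1 else 0))) (Re s)" for m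
        by (rule mellin_conv_cmult[OF mellin_truncated_power(1)[OF assms(2) s]])
      fix t :: real assume t: "t > 0"
      show "(\<lambda>m. ?c m * (of_real t ^ m * (if t \<le> \<rho> then 1 else 0))) sums ?f t"
      proof (cases "t \<le> \<rho>")
        case True
        have "\<psi> holomorphic_on ball 0 (2 * \<rho>)" using assms by (simp add: reg_adm_def)
        from holomorphic_power_series[OF this, of "of_real t"] True t show ?thesis by simp
      qed simp
      show "summable (\<lambda>m. norm (?c m * (of_real t ^ m * (if t \<le> \<rho> then 1 else 0))))"
      proof (rule summable_comparison_test')
        show "summable (\<lambda>m. B * (2/3) ^ m)" by (intro summable_mult summable_geometric) auto
        have "norm (?c m * (of_real t ^ m * (if t \<le> \<rho> then 1 else 0))) \<le> norm (?c m) * \<rho> ^ m" for m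
          using t assms(2) by (auto simp: norm_mult norm_power norm_divide intro!: mult_left_mono divide_right_mono power_mono)
        then show "norm (norm (?c m * (of_real t ^ m * (if t \<le> \<rho> then 1 else 0)))) \<le> B * (2/3) ^ m" for m
          unfolding real_norm_def abs_norm_cancel by (rule order_trans[OF _ reg_adm_coeff_le[OF assms, of m]])
      qed
    next
      define J where "J = (\<integral>t. t powr (Re s - 1) * norm (if t \<le> 1 then 1 else 0 :: complex) \<partial>pos_lborel)"
      have J: "J \<ge> 0" unfolding J_def by (rule integral_nonneg_AE) (rule AE_pos_lborelI, simp)
      show "(\<integral>t. t powr (Re s - 1) * norm (?c m * (of_real t ^ m * (if t \<le> \<rho> then 1 else 0))) \<partial>pos_lborel) \<le>
          (\<rho> powr (Re s) * J) * (B * (2/3) ^ m)" for m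
      proof -
        have "(\<integral>t. t powr (Re s - 1) * norm (?c m * (of_real t ^ m * (if t \<le> \<rho> then 1 else 0))) \<partial>pos_lborel) \<le>
          norm (?c m) * (\<integral>t. t powr (Re s - 1) * norm (of_real t ^ m * (if t \<le> \<rho> then 1 else 0 :: complex)) \<partial>pos_lborel)"
          by (rule mellin_integral_bound[OF mellin_truncated_power(1)[OF assms(2) s]
               mellin_conv_measurable[OF mellin_conv_cmult[OF mellin_truncated_power(1)[OF assms(2) s]]]])
             (simp only: norm_mult[of "?c m"] order.refl)
        also have "\<dots> \<le> norm (?c m) * (\<rho> powr Re s * \<rho> ^ m * J)"
          using mellin_truncated_power(3)[OF assms(2) s, of m] by (intro mult_left_mono) (auto simp: J_def)
        also have "\<dots> = (\<rho> powr (Re s) * J) * (norm (?c m) * \<rho> ^ m)" by (simp add: mult_ac)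
        also have "\<dots> \<le> (\<rho> powr (Re s) * J) * (B * (2/3) ^ m)"
          by (intro mult_left_mono reg_adm_coeff_le[OF assms]) (use J in auto)
        finally show ?thesis .
      qed
      show "summable (\<lambda>m. (\<rho> powr (Re s) * J) * (B * (2/3) ^ m))"
        by (intro summable_mult summable_geometric) auto
    qed
    then have "(\<lambda>m. rGamma s * (?c m * (of_real \<rho> powr (s + of_nat m) / (s + of_nat m)))) sums (rGamma s * mellin ?f s)"
      unfolding mellin_cmult mellin_truncated_power(2)[OF assms(2) s] by (rule sums_mult)
    also have "(\<lambda>m. rGamma s * (?c m * (of_real \<rho> powr (s + of_nat m) / (s + of_nat m)))) =
       (\<lambda>m. ?c m * (of_real \<rho> powr (s + of_nat m) * (pochhammer s m * rGamma (s + of_nat m + 1))))"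
    proof
      fix m
      have nz: "s + of_nat m \<noteq> 0" using s by (auto simp: complex_eq_iff)
      then have "rGamma s / (s + of_nat m) = pochhammer s m * rGamma (s + of_nat m + 1)"
        using pochhammer_rGamma_times[of s m] by (simp add: field_simps)
      moreover have "rGamma s * (?c m * (of_real \<rho> powr (s + of_nat m) / (s + of_nat m))) =
          ?c m * (of_real \<rho> powr (s + of_nat m) * (rGamma s / (s + of_nat m)))" by simp
      ultimately show "rGamma s * (?c m * (of_real \<rho> powr (s + of_nat m) / (s + of_nat m))) =
        ?c m * (of_real \<rho> powr (s + of_nat m) * (pochhammer s m * rGamma (s + of_nat m + 1)))" by simp
    qed
    finally have "rGamma s * mellin ?f s = (\<Sum>m. ?c m * (of_real \<rho> powr (s + of_nat m) * (pochhammer s m * rGamma (s + of_nat m + 1))))"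
      by (rule sums_unique)
    moreover have "mellin (\<lambda>t. \<psi> (of_real t)) s = mellin ?f s + mellin ?g s"
      by (subst split, rule mellin_add[OF f_conv[OF s] reg_mellin_tail(1)[OF assms]])
    ultimately show ?thesis by (simp add: reg_mellin_def ring_distribs)
  qed
qed

text \<open>For Re s > 0 linearity is that of an integral; it extends to all s because both sides
  are entire.\<close>

lemma reg_adm_diff_cmult:
  assumes "reg_adm \<rho> B \<psi>" "reg_adm \<rho> B' \<psi>'" "\<rho> > 0"
  shows "reg_adm \<rho> (B + norm c * B') (\<lambda>\<tau>. \<psi> \<tau> - c * \<psi>' \<tau>)"
    and "reg_mellin \<rho> (\<lambda>\<tau>. \<psi> \<tau> - c * \<psi>' \<tau>) s = reg_mellin \<rho> \<psi> s - c * reg_mellin \<rho> \<psi>' s"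
proof -
  note [measurable] = assms(1,2)[unfolded reg_adm_def, THEN conjunct2, THEN conjunct2, THEN conjunct1]
  have m: "(\<lambda>t. \<psi> (of_real t) - c * \<psi>' (of_real t)) \<in> borel_measurable pos_lborel" by measurable
  have "norm (\<psi> \<tau> - c * \<psi>' \<tau>) \<le> (B + norm c * B') * K"
    if "norm (\<psi> \<tau>) \<le> B * K" "norm (\<psi>' \<tau>) \<le> B' * K" for \<tau> K
  proof -
    have "norm (\<psi> \<tau> - c * \<psi>' \<tau>) \<le> norm (\<psi> \<tau>) + norm c * norm (\<psi>' \<tau>)"
      using norm_triangle_ineq4[of "\<psi> \<tau>" "c * \<psi>' \<tau>"] by (simp add: norm_mult)
    also have "\<dots> \<le> B * K + norm c * (B' * K)" using that by (intro add_mono mult_left_mono) auto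
    finally show ?thesis by (simp add: algebra_simps)
  qed
  note le = this this[where K = 1, simplified]
  show adm: "reg_adm \<rho> (B + norm c * B') (\<lambda>\<tau>. \<psi> \<tau> - c * \<psi>' \<tau>)"
    unfolding reg_adm_def
  proof (intro conjI m ballI allI impI)
    show "(\<lambda>\<tau>. \<psi> \<tau> - c * \<psi>' \<tau>) holomorphic_on ball 0 (2 * \<rho>)"
      using assms by (intro holomorphic_intros) (auto simp: reg_adm_def)
  next
    fix \<tau> :: complex assume "\<tau> \<in> ball 0 (2 * \<rho>)"
    then show "norm (\<psi> \<tau> - c * \<psi>' \<tau>) \<le> B + norm c * B'"
      using assms by (intro le(2)) (auto simp: reg_adm_def)
  next
    fix t assume "t > \<rho>"
    then show "norm (\<psi> (of_real t) - c * \<psi>' (of_real t)) \<le> (B + norm c * B') * exp (-t/2)"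
      using assms by (intro le(1)) (auto simp: reg_adm_def)
  qed
  have entire: "reg_mellin \<rho> (\<lambda>\<tau>. \<psi> \<tau> - c * \<psi>' \<tau>) holomorphic_on UNIV"
       "(\<lambda>s. reg_mellin \<rho> \<psi> s - c * reg_mellin \<rho> \<psi>' s) holomorphic_on UNIV"
    using reg_mellin_holomorphic[OF adm assms(3)] reg_mellin_holomorphic[OF assms(1,3)]
      reg_mellin_holomorphic[OF assms(2,3)] by (auto intro!: holomorphic_intros)
  show "reg_mellin \<rho> (\<lambda>\<tau>. \<psi> \<tau> - c * \<psi>' \<tau>) s = reg_mellin \<rho> \<psi> s - c * reg_mellin \<rho> \<psi>' s"
  proof (rule analytic_continuation_open[of "{s. Re s > 0}" UNIV, OF _ _ _ _ _ entire(1) entire(2)])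
    show "{s. Re s > 0} \<noteq> {}" by (auto intro: exI[of _ 1])
    fix s :: complex assume "s \<in> {s. Re s > 0}"
    then have s: "Re s > 0" by simp
    show "reg_mellin \<rho> (\<lambda>\<tau>. \<psi> \<tau> - c * \<psi>' \<tau>) s = reg_mellin \<rho> \<psi> s - c * reg_mellin \<rho> \<psi>' s"
      using mellin_diff[OF reg_mellin_eq(1)[OF assms(1,3) s] mellin_conv_cmult[OF reg_mellin_eq(1)[OF assms(2,3) s]], of c]
      unfolding reg_mellin_eq(2)[OF adm assms(3) s, symmetric] reg_mellin_eq(2)[OF assms(1,3) s, symmetric]
            reg_mellin_eq(2)[OF assms(2,3) s, symmetric]
      by (simp add: mellin_cmult right_diff_distrib)
  qed (auto intro: open_halfspace_Re_gt)
qed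

section \<open>The functions (e^u - 1) / u and 1 / (e^t - 1), and Riemann's zeta function\<close>

definition expm1_quot :: "complex \<Rightarrow> complex" where
  "expm1_quot u = (if u = 0 then 1 else (exp u - 1) / u)"

lemma expm1_quot_mult: "u * expm1_quot u = exp u - 1"
  by (simp add: expm1_quot_def)

lemma expm1_quot_0 [simp]: "expm1_quot 0 = 1"
  by (simp add: expm1_quot_def)

lemma holomorphic_expm1_quot: "expm1_quot holomorphic_on UNIV"
proof -
  have d: "deriv (\<lambda>u::complex. exp u - 1) 0 = 1"
    by (rule DERIV_imp_deriv) (auto intro!: derivative_eq_intros)
  have "(\<lambda>u. if u = 0 then deriv (\<lambda>u. exp u - 1) 0 else (exp u - 1) / u - (exp 0 - 1) / (u - 0)) holomorphic_on (UNIV :: complex set)"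
    by (rule pole_theorem[where f = "\<lambda>u. (exp u - 1) / u"]) (auto intro!: holomorphic_intros)
  also have "(\<lambda>u. if u = 0 then deriv (\<lambda>u. exp u - 1) 0 else (exp u - 1) / u - (exp 0 - 1) / (u - 0)) = expm1_quot"
    by (auto simp: expm1_quot_def d fun_eq_iff)
  finally show ?thesis .
qed

lemma holomorphic_expm1_quot' [holomorphic_intros]:
  "f holomorphic_on A \<Longrightarrow> (\<lambda>x. expm1_quot (f x)) holomorphic_on A"
  using holomorphic_on_compose[OF _ holomorphic_on_subset[OF holomorphic_expm1_quot], of f A]
  by (auto simp: comp_def)

lemma expm1_quot_nonzero:
  assumes "norm u < 2 * pi \<or> Re u > 0"
  shows "expm1_quot u \<noteq> 0"
proof
  assume "expm1_quot u = 0"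
  then have "u \<noteq> 0" "exp u = 1" by (auto simp: expm1_quot_def split: if_splits)
  then obtain n :: int where n: "Re u = 0" "Im u = of_int (2 * n) * pi"
    by (auto simp: exp_eq_1)
  with \<open>u \<noteq> 0\<close> have "n \<noteq> 0" by (auto simp: complex_eq_iff)
  then have "\<bar>real_of_int n\<bar> \<ge> 1" by linarith
  then have "2 * pi * 1 \<le> 2 * pi * \<bar>real_of_int n\<bar>" by (intro mult_left_mono) auto
  also have "\<dots> = \<bar>Im u\<bar>" using n by (simp add: abs_mult)
  also have "\<dots> \<le> norm u" by (rule abs_Im_le_cmod)
  finally have "norm u \<ge> 2 * pi" by simp
  with assms n show False by simp
qed

lemma expm1_quot_bounds:
  obtains c C where "c > 0" "\<And>u. norm u \<le> 1 \<Longrightarrow> c \<le> norm (expm1_quot u)" "\<And>u. norm u \<le> 1 \<Longrightarrow> norm (expm1_quot u) \<le> C"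
proof -
  have cont: "continuous_on (cball 0 1) (\<lambda>u. norm (expm1_quot u))"
    by (intro continuous_on_norm holomorphic_on_imp_continuous_on holomorphic_on_subset[OF holomorphic_expm1_quot]) auto
  obtain x where x: "x \<in> cball 0 1" "\<And>y. y \<in> cball 0 1 \<Longrightarrow> norm (expm1_quot x) \<le> norm (expm1_quot y)"
    using continuous_attains_inf[OF _ _ cont] by auto
  obtain x' where x': "x' \<in> cball 0 1" "\<And>y. y \<in> cball 0 1 \<Longrightarrow> norm (expm1_quot y) \<le> norm (expm1_quot x')"
    using continuous_attains_sup[OF _ _ cont] by auto
  have "norm x \<le> 1" using x(1) by simp
  also have "1 < 2 * pi" using pi_ge_two by linarith
  finally have "expm1_quot x \<noteq> 0" by (intro expm1_quot_nonzero) auto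
  then show ?thesis
    by (intro that[of "norm (expm1_quot x)" "norm (expm1_quot x')"]) (use x x' in auto)
qed

text \<open>This is x / 2 \<le> sinh (x / 2). The gain of exp (x / 2) over the tangent bound
  supplies the decay exp (-t / 2) demanded by \<open>reg_adm\<close>.\<close>

lemma exp_minus_one_ge: "x * exp (x/2) \<le> exp x - (1::real)" if "x \<ge> 0"
proof -
  define g where "g = (\<lambda>x::real. exp (x/2) - exp (-x/2) - x)"
  have "g 0 \<le> g x"
  proof (rule DERIV_nonneg_imp_nondecreasing[OF that])
    fix y :: real
    have "(g has_real_derivative (exp (y/2) / 2 + exp (-y/2) / 2 - 1)) (at y)"
      unfolding g_def by (auto intro!: derivative_eq_intros)
    moreover have "exp (y/2) / 2 + exp (-y/2) / 2 - 1 \<ge> 0"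
    proof -
      have "0 \<le> (exp (y/4) - exp (-y/4))\<^sup>2 / 2" by simp
      also have "\<dots> = exp (y/2) / 2 + exp (-y/2) / 2 - 1"
        by (simp add: power2_eq_square field_simps flip: exp_add)
      finally show ?thesis .
    qed
    ultimately show "\<exists>y'. (g has_real_derivative y') (at y) \<and> y' \<ge> 0" by blast
  qed
  then have "x \<le> exp (x/2) - exp (-x/2)" by (simp add: g_def)
  then have "x * exp (x/2) \<le> (exp (x/2) - exp (-x/2)) * exp (x/2)" by (intro mult_right_mono) auto
  also have "\<dots> = exp x - 1" by (simp add: algebra_simps flip: exp_add)
  finally show ?thesis .
qed

lemma norm_expm1_quot_ge: "Re u > 0 \<Longrightarrow> norm (expm1_quot u) \<ge> Re u / norm u * exp (Re u / 2)"
proof -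
  assume u: "Re u > 0"
  then have "u \<noteq> 0" by auto
  have "Re u * exp (Re u / 2) \<le> exp (Re u) - 1" using u by (intro exp_minus_one_ge) simp
  also have "\<dots> \<le> norm (exp u - 1)" using norm_triangle_ineq2[of "exp u" 1] by simp
  finally show ?thesis using \<open>u \<noteq> 0\<close> by (simp add: expm1_quot_def norm_divide divide_right_mono)
qed

text \<open>The Bose-Einstein kernel, whose Mellin transform is \<Gamma>(s) \<zeta>(s).\<close>

definition bose :: "real \<Rightarrow> complex" where
  "bose t = 1 / (exp (of_real t) - 1)"

lemma bose_eq: "t \<noteq> 0 \<Longrightarrow> bose t = inverse (expm1_quot (of_real t)) / of_real t"
  by (simp add: bose_def expm1_quot_def)

lemma bose_real: "bose t = of_real (1 / (exp t - 1))"
  by (simp add: bose_def exp_of_real)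

lemma bose_measurable [measurable]: "bose \<in> borel_measurable pos_lborel"
  unfolding bose_real by (rule measurable_restrict_space1) measurable

lemma norm_bose: "t > 0 \<Longrightarrow> norm (bose t) = 1 / (exp t - 1)"
  unfolding bose_real norm_of_real by simp

lemma norm_bose_le:
  assumes t: "t > 0"
  shows "norm (bose t) \<le> exp (-t/2) / t"
proof -
  have "1 / (exp t - 1) \<le> 1 / (t * exp (t/2))"
    using exp_minus_one_ge[of t] t by (intro divide_left_mono) simp_all
  also have "exp (t/2) = inverse (exp (-t/2))" by (simp flip: exp_minus)
  also have "1 / (t * inverse (exp (-t/2))) = exp (-t/2) / t" by (simp only: divide_inverse inverse_mult_distrib inverse_inverse_eq mult_1_left mult.commute)
  finally show ?thesis using t by (simp add: norm_bose)
qed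

lemma reg_adm_bose: "\<exists>B. reg_adm 1 B (\<lambda>\<tau>. inverse (expm1_quot \<tau>))"
proof -
  \<comment> \<open>The zeros of \<open>expm1_quot\<close> nearest to 0 have modulus 2 \<pi>, so the
    closed disc of radius 2 is free of them and \<rho> = 1 is admissible.\<close>
  have pi: "3 < 2 * pi" using pi_gt3 by simp
  have holo: "(\<lambda>\<tau>. inverse (expm1_quot \<tau>)) holomorphic_on cball 0 2"
    using pi by (intro holomorphic_intros expm1_quot_nonzero) auto
  then have "bounded ((\<lambda>\<tau>. inverse (expm1_quot \<tau>)) ` cball 0 2)"
    by (intro compact_imp_bounded compact_continuous_image holomorphic_on_imp_continuous_on) auto
  then obtain K where K: "\<forall>y\<in>(\<lambda>\<tau>. inverse (expm1_quot \<tau>)) ` cball 0 2. norm y \<le> K" unfolding bounded_iff by blast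
  have m: "(\<lambda>t. inverse (expm1_quot (complex_of_real t))) \<in> borel_measurable pos_lborel"
  proof -
    have "(\<lambda>t. complex_of_real t * bose t) \<in> borel_measurable pos_lborel"
    proof -
      have [measurable]: "complex_of_real \<in> borel_measurable pos_lborel"
        by (rule measurable_restrict_space1) measurable
      show ?thesis by measurable
    qed
    also have "?this \<longleftrightarrow> ?thesis" by (rule measurable_cong) (simp add: bose_eq)
    finally show ?thesis .
  qed
  have "norm (inverse (expm1_quot (complex_of_real t))) \<le> 1 * exp (-t/2)" if "t > 0" for t
  proof -
    have "exp (t/2) \<le> norm (expm1_quot (complex_of_real t))"
      using norm_expm1_quot_ge[of "of_real t"] that by simp
    then have "inverse (norm (expm1_quot (complex_of_real t))) \<le> inverse (exp (t/2))"
      by (intro le_imp_inverse_le) auto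
    then show ?thesis by (simp add: norm_inverse exp_minus)
  qed
  note decay = this
  have "norm (inverse (expm1_quot (complex_of_real t))) \<le> max K 1 * exp (-t/2)" if "t > 1" for t
    using decay[of t] that by (intro order_trans[OF decay] mult_right_mono) auto
  moreover have "(\<lambda>\<tau>. inverse (expm1_quot \<tau>)) holomorphic_on ball 0 2"
    by (rule holomorphic_on_subset[OF holo]) auto
  ultimately have "reg_adm 1 (max K 1) (\<lambda>\<tau>. inverse (expm1_quot \<tau>))"
    unfolding reg_adm_def using m K by (auto simp: le_max_iff_disj)
  then show ?thesis by blast
qed

text \<open>In terms of Riemann's zeta function, \<open>zeta_reg s = s \<zeta>(s + 1)\<close>.\<close>

definition zeta_reg :: "complex \<Rightarrow> complex" where
  "zeta_reg = reg_mellin 1 (\<lambda>\<tau>. inverse (expm1_quot \<tau>))"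

lemma zeta_reg_holomorphic: "zeta_reg holomorphic_on A"
  using reg_adm_bose reg_mellin_holomorphic[of 1] unfolding zeta_reg_def
  by (meson holomorphic_on_subset subset_UNIV zero_less_one)

lemma zeta_reg_holomorphic' [holomorphic_intros]:
  "f holomorphic_on A \<Longrightarrow> (\<lambda>x. zeta_reg (f x)) holomorphic_on A"
  using holomorphic_on_compose[OF _ zeta_reg_holomorphic, of f A] by (auto simp: comp_def)

text \<open>The residue of \<zeta> at 1. At s = 0 the factor \<open>rGamma s\<close> removes the
  tail integral, and \<open>pochhammer 0 m\<close> removes every term except m = 0.\<close>

lemma zeta_reg_0: "zeta_reg 0 = 1"
proof -
  have "(\<Sum>m. (deriv ^^ m) (\<lambda>\<tau>. inverse (expm1_quot \<tau>)) 0 / fact m *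
          (complex_of_real 1 powr (0 + of_nat m) * (pochhammer 0 m * rGamma (0 + of_nat m + 1)))) =
        (\<Sum>m\<in>{0}. (deriv ^^ m) (\<lambda>\<tau>. inverse (expm1_quot \<tau>)) 0 / fact m *
          (complex_of_real 1 powr (0 + of_nat m) * (pochhammer 0 m * rGamma (0 + of_nat m + 1))))"
    by (rule suminf_finite) (auto simp: pochhammer_0_left)
  then show ?thesis by (simp add: zeta_reg_def reg_mellin_def)
qed

text \<open>The function t / (e^t - 1) is regular at 0, and the factor t moves s by one;
  \<open>rGamma (s - 1) = (s - 1) * rGamma s\<close> then produces the division by s - 1.\<close>

lemma mellin_bose:
  shows "\<sigma> > 1 \<Longrightarrow> mellin_conv bose \<sigma>"
    and "Re s > 1 \<Longrightarrow> rGamma s * mellin bose s = zeta_reg (s - 1) / (s - 1)"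
proof -
  obtain B where B: "reg_adm 1 B (\<lambda>\<tau>. inverse (expm1_quot \<tau>))" using reg_adm_bose by blast
  have eq: "inverse (expm1_quot (of_real t)) = of_real t * bose t" if "t > 0" for t
    using that by (simp add: bose_eq)
  show "mellin_conv bose \<sigma>" if "\<sigma> > 1" for \<sigma>
    using reg_mellin_eq(1)[OF B, of "\<sigma> - 1"] that mellin_conv_cong[OF eq, where \<sigma> = "\<sigma> - 1"]
    by (simp add: mellin_conv_times_iff)
  show "rGamma s * mellin bose s = zeta_reg (s - 1) / (s - 1)" if s: "Re s > 1"
  proof -
    have nz: "s - 1 \<noteq> 0" using s by auto
    have "zeta_reg (s - 1) = rGamma (s - 1) * mellin bose s"
      using reg_mellin_eq(2)[OF B, of "s - 1"] s mellin_cong[OF eq, where s = "s - 1"]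
      by (simp add: mellin_times zeta_reg_def)
    also have "rGamma (s - 1) = (s - 1) * rGamma s"
      using rGamma_plus1[of "s - 1"] by simp
    finally show ?thesis using nz by simp
  qed
qed

lemma mellin_bose_scale:
  assumes "q > 0"
  shows "\<sigma> > 1 \<Longrightarrow> mellin_conv (\<lambda>t. bose (q * t)) \<sigma>"
    and "Re s > 1 \<Longrightarrow> rGamma s * mellin (\<lambda>t. bose (q * t)) s =
           of_real q powr (-s) * (zeta_reg (s - 1) / (s - 1))"
    and "\<sigma> > 1 \<Longrightarrow> (\<integral>t. t powr (\<sigma> - 1) * norm (bose (q * t)) \<partial>pos_lborel) =
           q powr (-\<sigma>) * (\<integral>t. t powr (\<sigma> - 1) * norm (bose t) \<partial>pos_lborel)"
  using mellin_conv_scale[OF assms mellin_bose(1)] mellin_scale[OF assms, of bose s] mellin_bose(2)[of s]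
  by (auto simp: mult.left_commute simp flip: times_divide_eq_right)

section \<open>The generating function of a Beatty sequence\<close>

declare complete_quotient.simps(2) [simp del]

text \<open>
  The index is shifted by one, so that \<open>num_seq \<alpha> 0\<close> is the numerator \<open>p\<^sub>-\<^sub>1 = 1\<close>.
\<close>

definition num_seq :: "real \<Rightarrow> nat \<Rightarrow> real" where
  "num_seq \<alpha> k = (case k of 0 \<Rightarrow> 1 | Suc n \<Rightarrow> of_int (conv_num \<alpha> n))"

lemma num_seq_0 [simp]: "num_seq \<alpha> 0 = 1"
  and num_seq_Suc: "num_seq \<alpha> (Suc n) = of_int (conv_num \<alpha> n)"
  by (simp_all add: num_seq_def)

lemma num_seq_Suc_Suc:
  "num_seq \<alpha> (Suc (Suc k)) = of_int (cf_digit \<alpha> (Suc k)) * num_seq \<alpha> (Suc k) + num_seq \<alpha> k"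
  by (cases k) (simp_all add: num_seq_Suc)

locale beatty =
  fixes \<alpha> :: real
  assumes gt1: "\<alpha> > 1" and irrational: "\<alpha> \<notin> \<rat>"
begin

abbreviation \<theta> :: "nat \<Rightarrow> real" where "\<theta> \<equiv> complete_quotient \<alpha>"

abbreviation Q :: "nat \<Rightarrow> real" where "Q \<equiv> num_seq \<alpha>"

lemma frac_theta: "frac (\<theta> n) > 0" "frac (\<theta> n) < 1"
proof -
  have "\<theta> n \<notin> \<int>"
    using complete_quotient_irrational[OF irrational, of n] Ints_subset_Rats by blast
  then show "frac (\<theta> n) > 0" using frac_ge_0[of "\<theta> n"] by (metis frac_eq_0_iff order_le_less)
qed (rule frac_lt_1)

lemma theta_gt1: "\<theta> n > 1"
  using gt1 frac_theta by (cases n) (auto simp: complete_quotient.simps)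

lemma theta_eq: "\<theta> n = of_int (cf_digit \<alpha> n) + 1 / \<theta> (Suc n)"
  by (simp add: cf_digit_def frac_def complete_quotient.simps)

lemma digit_ge1: "cf_digit \<alpha> n \<ge> 1"
  using theta_gt1[of n] by (simp add: cf_digit_def le_floor_iff)

lemma Q_ge1: "Q k \<ge> 1"
proof (induction k rule: induct_nat_012)
  case 1
  then show ?case using digit_ge1[of 0] by (simp add: num_seq_Suc)
next
  case (ge2 k)
  have "1 * 1 \<le> of_int (cf_digit \<alpha> (Suc k)) * Q (Suc k)"
    using digit_ge1[of "Suc k"] ge2 by (intro mult_mono) auto
  then show ?case using ge2 by (simp add: num_seq_Suc_Suc)
qed auto

lemma Q_pos [simp]: "Q k > 0"
  using Q_ge1[of k] by linarith

lemma Q_nonneg [simp]: "Q k \<ge> 0"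
  by (simp add: less_imp_le)

lemma Q_Suc_Suc_ge: "Q (Suc (Suc k)) \<ge> Q (Suc k) + Q k"
proof -
  have "1 * Q (Suc k) \<le> of_int (cf_digit \<alpha> (Suc k)) * Q (Suc k)"
    using digit_ge1[of "Suc k"] by (intro mult_right_mono) (auto simp: less_imp_le)
  then show ?thesis by (simp add: num_seq_Suc_Suc)
qed

lemma Q_mono_Suc: "Q k \<le> Q (Suc k)"
proof (cases k)
  case 0
  then show ?thesis using Q_ge1[of 1] by simp
next
  case (Suc m)
  then show ?thesis using Q_Suc_Suc_ge[of m] Q_ge1[of m] by simp
qed

lemma Q_mono: "i \<le> j \<Longrightarrow> Q i \<le> Q j"
  by (rule lift_Suc_mono_le[of Q, OF Q_mono_Suc])

text \<open>Two steps of the recursion at least double \<open>Q\<close>. The factor sqrt 2 on the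
  left allows for the start with an odd index.\<close>

lemma Q_ge_power: "Q k * sqrt 2 \<ge> sqrt 2 ^ k"
proof (induction k rule: induct_nat_012)
  case 0
  then show ?case by simp
next
  case 1
  then show ?case using Q_ge1[of 1] by simp
next
  case (ge2 k)
  have "sqrt 2 ^ Suc (Suc k) = 2 * sqrt 2 ^ k" by simp
  also have "\<dots> \<le> 2 * (Q k * sqrt 2)" using ge2 by simp
  also have "2 * Q k \<le> Q (Suc (Suc k))" using Q_Suc_Suc_ge[of k] Q_mono_Suc[of k] by simp
  then have "2 * (Q k * sqrt 2) \<le> Q (Suc (Suc k)) * sqrt 2" by simp
  finally show ?case .
qed

lemma summable_Q_powr:
  assumes "\<epsilon> > 0"
  shows "summable (\<lambda>k. Q k powr (-\<epsilon>))"
proof (rule summable_comparison_test')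
  have "(sqrt 2 powr (-\<epsilon>)) < 1" using assms by (simp add: powr_less_one)
  then show "summable (\<lambda>k. sqrt 2 powr \<epsilon> * (sqrt 2 powr (-\<epsilon>)) ^ k)"
    by (intro summable_mult summable_geometric) auto
  fix k
  have "sqrt 2 ^ k / sqrt 2 \<le> Q k" using Q_ge_power[of k] by (simp add: field_simps)
  then have "Q k powr (-\<epsilon>) \<le> (sqrt 2 ^ k / sqrt 2) powr (-\<epsilon>)"
    using assms by (intro powr_mono2') auto
  also have "\<dots> = (sqrt 2 ^ k) powr (-\<epsilon>) * sqrt 2 powr \<epsilon>"
    by (subst powr_divide) (simp_all add: powr_minus field_simps)
  also have "(sqrt 2 ^ k) powr (-\<epsilon>) = (sqrt 2 powr (-\<epsilon>)) ^ k"
    by (simp add: powr_powr mult_ac flip: powr_realpow)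
  finally show "norm (Q k powr (-\<epsilon>)) \<le> sqrt 2 powr \<epsilon> * (sqrt 2 powr (-\<epsilon>)) ^ k" by (simp add: mult_ac)
qed

lemma Q_at_top: "filterlim Q at_top sequentially"
proof -
  have "(\<lambda>k. Q k powr (-1)) \<longlonglongrightarrow> 0" by (rule summable_LIMSEQ_zero[OF summable_Q_powr]) simp
  then have "filterlim (\<lambda>k. inverse (Q k powr (-1))) at_top sequentially"
    by (rule filterlim_inverse_at_top) (simp add: less_imp_neq[THEN not_sym])
  then show ?thesis by (simp add: powr_minus abs_of_pos)
qed

end

section \<open>Exponential sums over the lattice points of a cone\<close>

definition cone_sum :: "real \<Rightarrow> real \<Rightarrow> real \<Rightarrow> real" where
  "cone_sum \<theta> x y = (\<Sum>\<^sub>\<infinity>(a, b)\<in>{(a, b). 1 \<le> a \<and> 1 \<le> b \<and> real a < \<theta> * real b}. exp (-(real a * x + real b * y)))"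

lemma has_sum_exp_from_1:
  assumes "x > (0::real)"
  shows "((\<lambda>a::nat. exp (-(real a * x))) has_sum (1 / (exp x - 1))) {1..}"
proof -
  have "((\<lambda>a::nat. exp (-x) ^ a) has_sum (exp (-x) / (1 - exp (-x)))) {1..}"
    using assms by (intro has_sum_geometric_from_1) auto
  also have "exp (-x) / (1 - exp (-x)) = 1 / (exp x - 1)"
    using assms by (simp add: exp_minus field_simps)
  finally show ?thesis by (simp add: exp_of_nat_mult[symmetric])
qed

lemma has_sum_quadrant:
  assumes "x > (0::real)" "y > (0::real)"
  shows "((\<lambda>(a::nat, b::nat). exp (-(real a * x + real b * y))) has_sum (1 / (exp x - 1) * (1 / (exp y - 1)))) ({1..} \<times> {1..})"
proof -
  have 1: "((\<lambda>b. exp (-(real a * x + real b * y))) has_sum (exp (-(real a * x)) * (1 / (exp y - 1)))) {1..}" for a :: nat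
    using has_sum_cmult_right[OF has_sum_exp_from_1[OF assms(2)], of "exp (-(real a * x))"] by (simp add: exp_add exp_diff exp_minus divide_inverse)
  have 2: "((\<lambda>a::nat. exp (-(real a * x)) * (1 / (exp y - 1))) has_sum (1 / (exp x - 1) * (1 / (exp y - 1)))) {1..}"
    by (rule has_sum_cmult_left[OF has_sum_exp_from_1[OF assms(1)]])
  show ?thesis
  proof (rule has_sum_SigmaI[OF _ 2])
    show "((\<lambda>b. case (a, b) of (a, b) \<Rightarrow> exp (-(real a * x + real b * y))) has_sum (exp (-(real a * x)) * (1 / (exp y - 1)))) {1..}" for a
      using 1[of a] by simp
    show "(\<lambda>(a::nat, b::nat). exp (-(real a * x + real b * y))) summable_on {1..} \<times> {1..}"
      by (rule summable_on_SigmaI[OF _ has_sum_imp_summable[OF 2]]) (use 1 in auto)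
  qed
qed

lemma summable_on_cone:
  assumes "x > 0" "y > 0" "A \<subseteq> {1..} \<times> {1..}"
  shows "(\<lambda>(a::nat, b::nat). exp (-(real a * x + real b * y))) summable_on A"
  using summable_on_subset_banach[OF has_sum_imp_summable[OF has_sum_quadrant[OF assms(1,2)]] assms(3)] .

lemma cone_sum_nonneg: "cone_sum \<theta> x y \<ge> 0"
  unfolding cone_sum_def by (rule infsum_nonneg) auto

lemma cone_sum_le:
  assumes "x > 0" "y > 0"
  shows "cone_sum \<theta> x y \<le> 1 / (exp x - 1) * (1 / (exp y - 1))"
proof -
  have "cone_sum \<theta> x y \<le> (\<Sum>\<^sub>\<infinity>(a, b)\<in>{1..}\<times>{1..}. exp (-(real a * x + real b * y)))"
    unfolding cone_sum_def by (rule infsum_mono2; (rule summable_on_cone[OF assms])?) auto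
  also have "\<dots> = 1 / (exp x - 1) * (1 / (exp y - 1))"
    by (rule infsumI[OF has_sum_quadrant[OF assms]])
  finally show ?thesis .
qed

text \<open>One step of the continued fraction algorithm. The quadrant points with a > \<theta> b
  are the image of the cone of slope \<theta>' under (a, b) \<mapsto> (d a + b, a), and
  irrationality of \<theta> leaves no point on the line between the two cones.\<close>

lemma cone_sum_recurrence:
  fixes d :: nat
  assumes "x > 0" "y > 0" "\<theta> = real d + 1 / \<theta>'" "\<theta>' > 0" "\<theta> \<notin> \<rat>"
  shows "cone_sum \<theta> x y = 1 / (exp x - 1) * (1 / (exp y - 1)) - cone_sum \<theta>' (y + real d * x) x"
proof -
  let ?f = "\<lambda>(a::nat, b::nat). exp (-(real a * x + real b * y))"
  let ?A = "{(a::nat, b::nat). 1 \<le> a \<and> 1 \<le> b \<and> real a < \<theta> * real b}"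
  let ?B = "{(a::nat, b::nat). 1 \<le> a \<and> 1 \<le> b \<and> real a > \<theta> * real b}"
  let ?B' = "{(a::nat, b::nat). 1 \<le> a \<and> 1 \<le> b \<and> real a < \<theta>' * real b}"
  have A: "(?f has_sum cone_sum \<theta> x y) ?A"
    unfolding cone_sum_def by (rule has_sum_infsum, rule summable_on_cone[OF assms(1,2)]) auto
  have "((\<lambda>(a, b). exp (-(real a * (y + real d * x) + real b * x))) has_sum cone_sum \<theta>' (y + real d * x) x) ?B'"
    unfolding cone_sum_def using assms by (intro has_sum_infsum summable_on_cone) (auto simp: add_pos_nonneg)
  also have "(\<lambda>(a, b). exp (-(real a * (y + real d * x) + real b * x))) = (\<lambda>p. ?f (case p of (a, b) \<Rightarrow> (d * a + b, a)))"
    by (auto simp: fun_eq_iff algebra_simps)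
  also have "((\<lambda>p. ?f (case p of (a, b) \<Rightarrow> (d * a + b, a))) has_sum cone_sum \<theta>' (y + real d * x) x) ?B' \<longleftrightarrow>
     (?f has_sum cone_sum \<theta>' (y + real d * x) x) ?B"
  proof (rule has_sum_reindex_bij_betw, rule bij_betw_byWitness[where f' = "\<lambda>(a, b). (b, a - d * b)"])
    have iff: "real a < \<theta>' * real b \<longleftrightarrow> \<theta> * real a < real (d * a + b)" for a b
      using assms(4) by (simp add: assms(3) field_simps)
    show "(\<lambda>(a, b). (d * a + b, a)) ` ?B' \<subseteq> ?B" using iff by auto
    \<comment> \<open>Guarantees that the subtraction of natural numbers in the inverse map does not
      truncate and has a positive result.\<close>
    have gt: "d * b < a" if "\<theta> * real b < real a" "1 \<le> b" for a b
    proof -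
      have "real d * real b \<le> \<theta> * real b" using assms by (intro mult_right_mono) auto
      also note that(1)
      finally have "real (d * b) < real a" by simp
      then show ?thesis by (simp only: of_nat_less_iff)
    qed
    show "(\<lambda>(a, b). (b, a - d * b)) ` ?B \<subseteq> ?B'"
    proof safe
      fix a b :: nat assume ab: "1 \<le> a" "1 \<le> b" "\<theta> * real b < real a"
      have "real b < \<theta>' * real (a - d * b)"
        using iff[of b "a - d * b"] gt[OF ab(3,2)] ab by simp
      then show "real b < \<theta>' * real (a - d * b)" .
      show "1 \<le> a - d * b" using gt[OF ab(3,2)] by simp
    qed
    show "\<forall>p\<in>?B. (case case p of (a, b) \<Rightarrow> (b, a - d * b) of (a, b) \<Rightarrow> (d * a + b, a)) = p"
      using gt by (auto simp: less_imp_le)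
  qed auto
  finally have B: "(?f has_sum cone_sum \<theta>' (y + real d * x) x) ?B" .
  have "(?f has_sum (cone_sum \<theta> x y + cone_sum \<theta>' (y + real d * x) x)) (?A \<union> ?B)"
    by (rule has_sum_Un_disjoint[OF A B]) auto
  moreover have "?A \<union> ?B = {1..} \<times> {1..}"
  proof -
    have "real a \<noteq> \<theta> * real b" if "1 \<le> b" for a b :: nat
    proof
      assume "real a = \<theta> * real b"
      then have "\<theta> = real a / real b" using that by simp
      then show False using assms(5) by simp
    qed
    then show ?thesis by (auto simp: neq_iff)
  qed
  ultimately have "cone_sum \<theta> x y + cone_sum \<theta>' (y + real d * x) x = 1 / (exp x - 1) * (1 / (exp y - 1))"
    using has_sum_unique[OF _ has_sum_quadrant[OF assms(1,2)]] by simp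
  then show ?thesis by simp
qed

context beatty begin

text \<open>For fixed a the admissible b are those beyond \<lfloor>a / \<theta> 1\<rfloor>, and
  \<lfloor>\<alpha> a\<rfloor> is a times the first digit plus this floor. The inner geometric
  series therefore equals exp (-\<lfloor>\<alpha> a\<rfloor> t) / (e^t - 1).\<close>

lemma beatty_theta_sums:
  assumes t: "t > 0"
  shows "(\<lambda>m. exp (-(of_int \<lfloor>\<alpha> * real (Suc m)\<rfloor> * t))) sums ((exp t - 1) * cone_sum (\<theta> 1) (Q 1 * t) (Q 0 * t))"
proof -
  let ?f = "\<lambda>(a::nat, b::nat). exp (-(real a * (Q 1 * t) + real b * t))"
  let ?B = "\<lambda>a::nat. {b::nat. 1 \<le> b \<and> real a < \<theta> 1 * real b}"
  let ?d = "nat (cf_digit \<alpha> 0)"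
  have d: "Q 1 = real ?d" using digit_ge1[of 0] by (simp add: num_seq_Suc)
  have eq: "{(a, b). 1 \<le> a \<and> 1 \<le> b \<and> real a < \<theta> 1 * real b} = Sigma {1..} ?B" by auto
  have S: "(?f has_sum cone_sum (\<theta> 1) (Q 1 * t) (Q 0 * t)) (Sigma {1..} ?B)"
    unfolding cone_sum_def eq num_seq_0 mult_1_left using t
    by (intro has_sum_infsum summable_on_cone) auto
  have inner: "((\<lambda>b. ?f (a, b)) has_sum (exp (-(of_int \<lfloor>\<alpha> * real a\<rfloor> * t)) / (exp t - 1))) (?B a)" if a: "a \<ge> 1" for a
  proof -
    define k where "k = nat \<lfloor>real a / \<theta> 1\<rfloor>"
    have k0: "real a / \<theta> 1 \<ge> 0" using theta_gt1[of 1] by simp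
    have th: "\<theta> 1 > 0" using theta_gt1[of 1] by linarith
    have mem: "b \<in> ?B a \<longleftrightarrow> b \<in> (\<lambda>j. k + j) ` {1..}" for b
    proof -
      have "b \<in> ?B a \<longleftrightarrow> real a / \<theta> 1 < real b"
      proof
        assume "real a / \<theta> 1 < real b"
        moreover from this k0 have "b \<ge> 1" by linarith
        ultimately show "b \<in> ?B a" using th by (simp add: divide_less_eq mult.commute)
      qed (use th in \<open>simp add: divide_less_eq mult.commute\<close>)
      also have "\<dots> \<longleftrightarrow> \<lfloor>real a / \<theta> 1\<rfloor> < int b" by (simp add: floor_less_iff)
      also have "\<dots> \<longleftrightarrow> k < b" using k0 unfolding k_def by (simp add: nat_less_iff)
      also have "\<dots> \<longleftrightarrow> b \<in> (\<lambda>j. k + j) ` {1..}"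
        by (auto simp: image_iff intro!: bexI[of _ "b - k"])
      finally show ?thesis .
    qed
    have fl: "of_int \<lfloor>\<alpha> * real a\<rfloor> = real (?d * a + k)"
    proof -
      have "\<alpha> = real ?d + 1 / \<theta> 1"
        using theta_eq[of 0] digit_ge1[of 0] by simp
      then have "\<alpha> * real a = (real ?d + 1 / \<theta> 1) * real a" by (rule arg_cong)
      then have "\<alpha> * real a = of_int (int (?d * a)) + real a / \<theta> 1"
        by (simp add: algebra_simps)
      then have "\<lfloor>\<alpha> * real a\<rfloor> = int (?d * a) + \<lfloor>real a / \<theta> 1\<rfloor>"
        by (simp only: floor_add_int[symmetric] add.commute)
      also have "\<dots> = int (?d * a + k)" using k0 by (simp add: k_def)
      finally show ?thesis by simp
    qed
    have "((\<lambda>j::nat. exp (-(real (?d * a + k) * t)) * exp (-(real j * t))) has_sum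
        (exp (-(real (?d * a + k) * t)) * (1 / (exp t - 1)))) {1..}"
      by (rule has_sum_cmult_right[OF has_sum_exp_from_1[OF t]])
    also have "(\<lambda>j::nat. exp (-(real (?d * a + k) * t)) * exp (-(real j * t))) = (\<lambda>j. ?f (a, k + j))"
      by (auto simp: fun_eq_iff d[unfolded One_nat_def] algebra_simps simp flip: exp_add)
    also have "((\<lambda>j. ?f (a, k + j)) has_sum (exp (-(real (?d * a + k) * t)) * (1 / (exp t - 1)))) {1..} \<longleftrightarrow>
       ((\<lambda>b. ?f (a, b)) has_sum (exp (-(real (?d * a + k) * t)) * (1 / (exp t - 1)))) (?B a)"
      by (rule has_sum_reindex_bij_betw) (use mem in \<open>auto simp: bij_betw_def inj_on_def\<close>)
    finally show ?thesis unfolding fl by simp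
  qed
  have "((\<lambda>a::nat. exp (-(of_int \<lfloor>\<alpha> * real a\<rfloor> * t)) / (exp t - 1)) has_sum cone_sum (\<theta> 1) (Q 1 * t) (Q 0 * t)) {1..}"
    by (rule has_sum_SigmaD[OF S]) (use inner in auto)
  also have "?this \<longleftrightarrow> ((\<lambda>m. exp (-(of_int \<lfloor>\<alpha> * real (Suc m)\<rfloor> * t)) / (exp t - 1)) has_sum cone_sum (\<theta> 1) (Q 1 * t) (Q 0 * t)) UNIV"
    by (rule has_sum_reindex_bij_betw[symmetric])
       (auto simp: bij_betw_def image_iff Suc_le_eq gr0_conv_Suc)
  finally have "(\<lambda>m. exp (-(of_int \<lfloor>\<alpha> * real (Suc m)\<rfloor> * t)) / (exp t - 1)) sums cone_sum (\<theta> 1) (Q 1 * t) (Q 0 * t)"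
    by (rule has_sum_imp_sums)
  from sums_mult[OF this, of "exp t - 1"] show ?thesis using t by simp
qed

lemma alternating_telescope:
  fixes K V :: "nat \<Rightarrow> real"
  assumes "\<And>k. V k = K k - V (Suc k)"
  shows "(\<Sum>k<n. (-1) ^ k * K k) = V 0 - (-1) ^ n * V n"
proof (induction n)
  case (Suc n)
  then show ?case using assms[of n] by (simp add: algebra_simps)
qed simp

text \<open>Iterating the recurrence moves the pair of weights through consecutive values of
  \<open>Q\<close>, since y + d x is precisely the numerator recursion. What is left after n steps
  is at most a full quadrant sum, which tends to 0 as \<open>Q\<close> grows.\<close>

lemma cone_sum_expansion:
  assumes t: "t > 0"
  shows "(\<lambda>k. (-1) ^ k * (1 / (exp (Q k * t) - 1) * (1 / (exp (Q (Suc k) * t) - 1)))) sums cone_sum (\<theta> 1) (Q 1 * t) (Q 0 * t)"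
proof -
  let ?k = "\<lambda>k. 1 / (exp (Q k * t) - 1) * (1 / (exp (Q (Suc k) * t) - 1))"
  let ?V = "\<lambda>k. cone_sum (\<theta> (Suc k)) (Q (Suc k) * t) (Q k * t)"
  have rec: "?V k = ?k k - ?V (Suc k)" for k
  proof -
    have d: "real (nat (cf_digit \<alpha> (Suc k))) = of_int (cf_digit \<alpha> (Suc k))" using digit_ge1[of "Suc k"] by simp
    have "?V k = 1 / (exp (Q (Suc k) * t) - 1) * (1 / (exp (Q k * t) - 1)) -
        cone_sum (\<theta> (Suc (Suc k))) (Q k * t + real (nat (cf_digit \<alpha> (Suc k))) * (Q (Suc k) * t)) (Q (Suc k) * t)"
      using theta_eq[of "Suc k"] theta_gt1[of "Suc (Suc k)"] complete_quotient_irrational[OF irrational, of "Suc k"] d t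
      by (intro cone_sum_recurrence) auto
    also have "Q k * t + real (nat (cf_digit \<alpha> (Suc k))) * (Q (Suc k) * t) = Q (Suc (Suc k)) * t"
      unfolding d by (simp add: num_seq_Suc_Suc algebra_simps)
    finally show ?thesis by (simp add: mult.commute)
  qed
  have partial: "(\<Sum>k<n. (-1) ^ k * ?k k) = ?V 0 - (-1) ^ n * ?V n" for n
    by (rule alternating_telescope[of ?V ?k, OF rec])
  have "(\<lambda>n. ?k n) \<longlonglongrightarrow> 0"
  proof (rule tendsto_sandwich[OF _ _ tendsto_const])
    have pos: "exp (Q n * t) - 1 \<ge> Q n * t" for n using exp_ge_add_one_self[of "Q n * t"] by linarith
    show "\<forall>\<^sub>F n in sequentially. 0 \<le> ?k n" using t
      by (intro always_eventually allI mult_nonneg_nonneg) (auto simp: less_imp_le)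
    have "?k n \<le> 1 / t\<^sup>2 * (Q n powr (-1))" for n
    proof -
      have "?k n \<le> 1 / (Q n * t) * (1 / (Q (Suc n) * t))"
        using t pos[of n] pos[of "Suc n"] by (intro mult_mono divide_left_mono mult_pos_pos) (auto intro: less_le_trans)
      also have "\<dots> \<le> 1 / (Q n * t) * (1 / (1 * t))"
        using t Q_ge1[of "Suc n"] by (intro mult_left_mono divide_left_mono mult_pos_pos mult_right_mono) auto
      also have "\<dots> = 1 / t\<^sup>2 * (Q n powr (-1))"
        by (simp add: powr_minus power2_eq_square divide_inverse)
      finally show ?thesis .
    qed
    then show "\<forall>\<^sub>F n in sequentially. ?k n \<le> 1 / t\<^sup>2 * (Q n powr (-1))" by simp
    show "(\<lambda>n. 1 / t\<^sup>2 * (Q n powr (-1))) \<longlonglongrightarrow> 0"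
      using summable_LIMSEQ_zero[OF summable_Q_powr[of 1]] by (intro tendsto_mult_right_zero) auto
  qed
  then have "(\<lambda>n. ?V n) \<longlonglongrightarrow> 0"
    by (rule tendsto_sandwich[OF _ _ tendsto_const, rotated 2])
      (use t cone_sum_le[of "Q (Suc _) * t" "Q _ * t"] in \<open>auto simp: cone_sum_nonneg mult.commute\<close>)
  then have "(\<lambda>n. (-1) ^ n * ?V n) \<longlonglongrightarrow> 0"
    by (rule tendsto_0_le[where K = 1]) (simp add: abs_mult)
  then have "(\<lambda>n. ?V 0 - (-1) ^ n * ?V n) \<longlonglongrightarrow> ?V 0 - 0" by (intro tendsto_intros)
  then show ?thesis unfolding sums_def partial by simp
qed

end

section \<open>Expansion of the Dirichlet series\<close>

text \<open>One term of the alternating expansion without its sign; x and y will be consecutive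
  values of \<open>Q\<close>.\<close>

definition cone_kernel :: "real \<Rightarrow> real \<Rightarrow> real \<Rightarrow> real \<Rightarrow> complex" where
  "cone_kernel w x y t = of_real (exp (-(w * t)) * (exp t - 1)) * (bose (x * t) * bose (y * t))"

definition cone_zeta :: "real \<Rightarrow> real \<Rightarrow> real \<Rightarrow> complex \<Rightarrow> complex" where
  "cone_zeta w x y s = rGamma s * mellin (cone_kernel w x y) s"

lemma norm_bose_le_inverse: "t > 0 \<Longrightarrow> norm (bose t) \<le> 1 / t"
  using norm_bose_le[of t] by (rule order_trans) (auto intro!: divide_right_mono)

lemma cone_kernel_measurable [measurable]:
  assumes "x > 0" "y > 0"
  shows "cone_kernel w x y \<in> borel_measurable pos_lborel"
proof -
  note [measurable] = measurable_pos_lborel_scale[OF assms(1) bose_measurable]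
    measurable_pos_lborel_scale[OF assms(2) bose_measurable]
  have [measurable]: "(\<lambda>t. complex_of_real (exp (-(w * t)) * (exp t - 1))) \<in> borel_measurable pos_lborel"
    by (rule measurable_restrict_space1) measurable
  show ?thesis unfolding cone_kernel_def by measurable
qed

text \<open>For x \<ge> 1 the denominator exp (x t) - 1 dominates the numerator exp t - 1. Only the
  Bose factor belonging to y survives, and it carries the summability in k.\<close>

lemma damped_bose_le_1:
  assumes "x \<ge> 1" "w \<ge> 0" "t > 0"
  shows "norm (of_real (exp (-(w * t)) * (exp t - 1)) * bose (x * t)) \<le> 1"
proof -
  have "exp t \<le> exp (x * t)" using assms by simp
  then have "(exp t - 1) * (1 / (exp (x * t) - 1)) \<le> 1" using assms by (simp add: divide_le_eq)
  then have "exp (-(w * t)) * ((exp t - 1) * (1 / (exp (x * t) - 1))) \<le> 1 * 1"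
    using assms by (intro mult_mono) auto
  then show ?thesis
    using assms unfolding bose_real of_real_mult[symmetric] norm_of_real
    by (simp add: abs_mult mult.assoc)
qed

lemma norm_cone_kernel_le:
  assumes "x \<ge> 1" "w \<ge> 0" "t > 0"
  shows "norm (cone_kernel w x y t) \<le> 1 * norm (bose (y * t))"
proof -
  have "norm (cone_kernel w x y t) = norm (of_real (exp (-(w * t)) * (exp t - 1)) * bose (x * t)) * norm (bose (y * t))"
    by (simp only: cone_kernel_def norm_mult mult.assoc)
  also have "\<dots> \<le> 1 * norm (bose (y * t))"
    by (intro mult_right_mono damped_bose_le_1 assms) auto
  finally show ?thesis .
qed

context beatty begin

definition shifted_zeta :: "real \<Rightarrow> complex \<Rightarrow> complex" where
  "shifted_zeta w s = (\<Sum>m. 1 / of_real (of_int \<lfloor>\<alpha> * real (Suc m)\<rfloor> + w) powr s)"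

lemma floor_ge: "of_int \<lfloor>\<alpha> * real (Suc m)\<rfloor> \<ge> real (Suc m)"
proof -
  have "1 * real (Suc m) \<le> \<alpha> * real (Suc m)" using gt1 by (intro mult_right_mono) auto
  then have "int (Suc m) \<le> \<lfloor>\<alpha> * real (Suc m)\<rfloor>" by (subst le_floor_iff) simp
  then show ?thesis by linarith
qed

lemma shifted_zeta_sums_mellin:
  assumes s: "Re s > 1" and w: "w \<ge> 0"
  shows "(\<lambda>m. 1 / of_real (of_int \<lfloor>\<alpha> * real (Suc m)\<rfloor> + w) powr s) sums
           (rGamma s * mellin (\<lambda>t. of_real (exp (-(w * t)) * ((exp t - 1) * cone_sum (\<theta> 1) (Q 1 * t) (Q 0 * t)))) s)"
proof -
  define c where "c m = of_int \<lfloor>\<alpha> * real (Suc m)\<rfloor> + w" for m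
  have c: "c m \<ge> real (Suc m)" "c m > 0" for m using floor_ge[of m] w by (auto simp: c_def)
  let ?e = "\<lambda>t. complex_of_real (exp (-t))"
  have conv: "mellin_conv ?e (Re s)" using s by (intro mellin_exp) auto
  define J where "J = (\<integral>t. t powr (Re s - 1) * norm (?e t) \<partial>pos_lborel)"
  have J: "J \<ge> 0" unfolding J_def by (rule integral_nonneg_AE) (rule AE_pos_lborelI, simp)
  have scaled: "mellin (\<lambda>t. ?e (c m * t)) s = of_real (c m) powr (-s) * Gamma s" for m
    using mellin_scale[OF c(2)[of m], of ?e s] mellin_exp(2)[of s] s by simp
  have "(\<lambda>m. mellin (\<lambda>t. ?e (c m * t)) s) sums
     mellin (\<lambda>t. of_real (exp (-(w * t)) * ((exp t - 1) * cone_sum (\<theta> 1) (Q 1 * t) (Q 0 * t)))) s"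
  proof (rule mellin_sums)
    show "mellin_conv (\<lambda>t. ?e (c m * t)) (Re s)" for m
      by (rule mellin_conv_scale(1)[OF c(2) conv])
    show "(\<integral>t. t powr (Re s - 1) * norm (?e (c m * t)) \<partial>pos_lborel) \<le> real (Suc m) powr (-Re s) * J" for m
      unfolding mellin_conv_scale(2)[OF c(2) conv] J_def[symmetric]
      using J c s by (intro mult_right_mono powr_mono2') auto
    have "summable (\<lambda>m. real (Suc m) powr (-Re s))"
      using s summable_real_powr_iff[of "-Re s"] by (subst summable_Suc_iff) auto
    then show "summable (\<lambda>m. real (Suc m) powr (-Re s) * J)" by (rule summable_mult2)
    fix t :: real assume t: "t > 0"
    have "(\<lambda>m. exp (-(w * t)) * exp (-(of_int \<lfloor>\<alpha> * real (Suc m)\<rfloor> * t))) sums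
        (exp (-(w * t)) * ((exp t - 1) * cone_sum (\<theta> 1) (Q 1 * t) (Q 0 * t)))"
      by (rule sums_mult[OF beatty_theta_sums[OF t]])
    also have "(\<lambda>m. exp (-(w * t)) * exp (-(of_int \<lfloor>\<alpha> * real (Suc m)\<rfloor> * t))) = (\<lambda>m. exp (-(c m * t)))"
      by (auto simp: c_def algebra_simps fun_eq_iff simp flip: exp_add)
    finally have sums: "(\<lambda>m. exp (-(c m * t))) sums (exp (-(w * t)) * ((exp t - 1) * cone_sum (\<theta> 1) (Q 1 * t) (Q 0 * t)))" .
    then show "(\<lambda>m. ?e (c m * t)) sums of_real (exp (-(w * t)) * ((exp t - 1) * cone_sum (\<theta> 1) (Q 1 * t) (Q 0 * t)))"
      by (rule sums_of_real)
    show "summable (\<lambda>m. norm (?e (c m * t)))"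
      using sums_summable[OF sums] by simp
  qed
  then have "(\<lambda>m. rGamma s * (of_real (c m) powr (-s) * Gamma s)) sums
     (rGamma s * mellin (\<lambda>t. of_real (exp (-(w * t)) * ((exp t - 1) * cone_sum (\<theta> 1) (Q 1 * t) (Q 0 * t)))) s)"
    unfolding scaled by (rule sums_mult)
  also have "(\<lambda>m. rGamma s * (of_real (c m) powr (-s) * Gamma s)) = (\<lambda>m. 1 / of_real (c m) powr s)"
  proof
    fix m
    have "s \<notin> \<int>\<^sub>\<le>\<^sub>0" using s by (auto elim!: nonpos_Ints_cases)
    then have "rGamma s * Gamma s = 1" by (simp add: Gamma_def rGamma_eq_zero_iff)
    then show "rGamma s * (of_real (c m) powr (-s) * Gamma s) = 1 / of_real (c m) powr s"
      by (simp add: powr_minus divide_inverse mult_ac)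
  qed
  finally show ?thesis by (simp add: c_def)
qed

text \<open>Bounding the k-th kernel by its second Bose factor makes the L1 norms
  O(\<open>Q (Suc k)\<close>^(-Re s)), so the alternating expansion may be transformed termwise with
  absolute convergence.\<close>

lemma shifted_zeta_sums:
  assumes s: "Re s > 1" and w: "w \<ge> 0"
  shows "(\<lambda>k. (-1) ^ k * cone_zeta w (Q k) (Q (Suc k)) s) sums shifted_zeta w s"
proof -
  have kern: "mellin_conv (cone_kernel w (Q k) (Q (Suc k))) (Re s)" for k
    using mellin_bose_scale(1)[OF Q_pos s, of "Suc k"]
    by (rule mellin_conv_bound[OF _ cone_kernel_measurable norm_cone_kernel_le]) (use Q_ge1 w in auto)
  have "(\<lambda>k. mellin (\<lambda>t. (-1) ^ k * cone_kernel w (Q k) (Q (Suc k)) t) s) sums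
     mellin (\<lambda>t. of_real (exp (-(w * t)) * ((exp t - 1) * cone_sum (\<theta> 1) (Q 1 * t) (Q 0 * t)))) s"
  proof (rule mellin_sums)
    show conv: "mellin_conv (\<lambda>t. (-1) ^ k * cone_kernel w (Q k) (Q (Suc k)) t) (Re s)" for k
      by (rule mellin_conv_cmult[OF kern])
    let ?J = "\<integral>t. t powr (Re s - 1) * norm (bose t) \<partial>pos_lborel"
    show "(\<integral>t. t powr (Re s - 1) * norm ((-1) ^ k * cone_kernel w (Q k) (Q (Suc k)) t) \<partial>pos_lborel) \<le>
        Q (Suc k) powr (-Re s) * ?J" for k
    proof -
      have "(\<integral>t. t powr (Re s - 1) * norm ((-1) ^ k * cone_kernel w (Q k) (Q (Suc k)) t) \<partial>pos_lborel) \<le>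
        1 * (\<integral>t. t powr (Re s - 1) * norm (bose (Q (Suc k) * t)) \<partial>pos_lborel)"
      proof (rule mellin_integral_bound[OF mellin_bose_scale(1)[OF Q_pos s] mellin_conv_measurable[OF conv]])
        fix t :: real assume "t > 0"
        then show "norm ((-1) ^ k * cone_kernel w (Q k) (Q (Suc k)) t) \<le> 1 * norm (bose (Q (Suc k) * t))"
          using norm_cone_kernel_le[of "Q k" w t "Q (Suc k)"] Q_ge1 w by (simp add: norm_mult norm_power)
      qed
      then show ?thesis using mellin_bose_scale(3)[OF Q_pos s, of "Suc k"] by simp
    qed
    have "summable (\<lambda>k. Q (Suc k) powr (-Re s))"
      using summable_Q_powr[of "Re s"] s by (subst summable_Suc_iff) auto
    then show "summable (\<lambda>k. Q (Suc k) powr (-Re s) * ?J)" by (rule summable_mult2)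
    fix t :: real assume t: "t > 0"
    have "(\<lambda>k. (exp (-(w * t)) * (exp t - 1)) * ((-1) ^ k * (1 / (exp (Q k * t) - 1) * (1 / (exp (Q (Suc k) * t) - 1))))) sums
       ((exp (-(w * t)) * (exp t - 1)) * cone_sum (\<theta> 1) (Q 1 * t) (Q 0 * t))"
      by (rule sums_mult[OF cone_sum_expansion[OF t]])
    then have "(\<lambda>k. complex_of_real ((exp (-(w * t)) * (exp t - 1)) * ((-1) ^ k * (1 / (exp (Q k * t) - 1) * (1 / (exp (Q (Suc k) * t) - 1)))))) sums
       of_real ((exp (-(w * t)) * (exp t - 1)) * cone_sum (\<theta> 1) (Q 1 * t) (Q 0 * t))"
      by (rule sums_of_real)
    then show "(\<lambda>k. (-1) ^ k * cone_kernel w (Q k) (Q (Suc k)) t) sums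
        of_real (exp (-(w * t)) * ((exp t - 1) * cone_sum (\<theta> 1) (Q 1 * t) (Q 0 * t)))"
      by (simp add: cone_kernel_def bose_real mult_ac)
    show "summable (\<lambda>k. norm ((-1) ^ k * cone_kernel w (Q k) (Q (Suc k)) t))"
    proof (rule summable_comparison_test')
      have "summable (\<lambda>k. Q (Suc k) powr (-1))"
        using summable_Q_powr[of 1] by (subst summable_Suc_iff) auto
      then show "summable (\<lambda>k. (1 / t) * Q (Suc k) powr (-1))" by (rule summable_mult)
      fix k
      have "norm (cone_kernel w (Q k) (Q (Suc k)) t) \<le> norm (bose (Q (Suc k) * t))"
        using norm_cone_kernel_le[of "Q k" w t "Q (Suc k)"] Q_ge1 w t by simp
      also have "\<dots> \<le> 1 / (Q (Suc k) * t)" using t by (intro norm_bose_le_inverse) auto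
      also have "\<dots> = (1 / t) * Q (Suc k) powr (-1)" by (simp add: powr_minus divide_inverse mult.commute)
      finally show "norm (norm ((-1) ^ k * cone_kernel w (Q k) (Q (Suc k)) t)) \<le> (1 / t) * Q (Suc k) powr (-1)"
        by (simp add: norm_mult norm_power)
    qed
  qed
  then have "(\<lambda>k. rGamma s * ((-1) ^ k * mellin (cone_kernel w (Q k) (Q (Suc k))) s)) sums
     (rGamma s * mellin (\<lambda>t. of_real (exp (-(w * t)) * ((exp t - 1) * cone_sum (\<theta> 1) (Q 1 * t) (Q 0 * t)))) s)"
    unfolding mellin_cmult by (rule sums_mult)
  also have "rGamma s * mellin (\<lambda>t. of_real (exp (-(w * t)) * ((exp t - 1) * cone_sum (\<theta> 1) (Q 1 * t) (Q 0 * t)))) s =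
      shifted_zeta w s"
    using sums_unique[OF shifted_zeta_sums_mellin[OF assms]] by (simp add: shifted_zeta_def)
  finally show ?thesis by (simp add: cone_zeta_def mult.left_commute)
qed

lemma beatty_zeta_eq: "beatty_zeta \<alpha> s = shifted_zeta 0 s"
  by (simp add: beatty_zeta_def shifted_zeta_def)

text \<open>As 0 < 1 / \<alpha> < 1, each increment of the ceilings is 0 or 1, and the one from n to
  n + 1 is 1 exactly for n = \<lfloor>\<alpha> m\<rfloor> with m \<ge> 0. The case m = 0 is the
  summand 1; the remaining m give the Beatty sequence shifted by one.\<close>

lemma sturmian_series_eq:
  assumes s: "Re s > 1"
  shows "sturmian_series (1 / \<alpha>) s = 1 + shifted_zeta 1 s"
proof -
  define g where "g m = nat \<lfloor>\<alpha> * real m\<rfloor>" for m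
  define f where "f n = of_int (\<lceil>1 / \<alpha> * real (Suc n)\<rceil> - \<lceil>1 / \<alpha> * real n\<rceil>) / (of_nat (Suc n) powr s :: complex)" for n
  have g: "int (g m) = \<lfloor>\<alpha> * real m\<rfloor>" for m using gt1 by (simp add: g_def)
  have mono: "strict_mono g"
  proof (rule strict_monoI_Suc)
    fix m
    have "\<alpha> * real m + 1 \<le> \<alpha> * real (Suc m)" using gt1 by (simp add: algebra_simps)
    then have "\<lfloor>\<alpha> * real m\<rfloor> + 1 \<le> \<lfloor>\<alpha> * real (Suc m)\<rfloor>" by linarith
    then show "g m < g (Suc m)" using g[of m] g[of "Suc m"] by linarith
  qed
  have step: "0 \<le> \<lceil>1 / \<alpha> * real (Suc n)\<rceil> - \<lceil>1 / \<alpha> * real n\<rceil>" "\<lceil>1 / \<alpha> * real (Suc n)\<rceil> - \<lceil>1 / \<alpha> * real n\<rceil> \<le> 1" for n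
  proof -
    have "1 / \<alpha> * real (Suc n) = 1 / \<alpha> * real n + 1 / \<alpha>" by (simp add: algebra_simps add_divide_distrib)
    moreover have "0 < 1 / \<alpha>" "1 / \<alpha> < 1" using gt1 by auto
    ultimately show "0 \<le> \<lceil>1 / \<alpha> * real (Suc n)\<rceil> - \<lceil>1 / \<alpha> * real n\<rceil>" "\<lceil>1 / \<alpha> * real (Suc n)\<rceil> - \<lceil>1 / \<alpha> * real n\<rceil> \<le> 1"
      by linarith+
  qed
  have range: "f (g m) = 1 / of_nat (Suc (g m)) powr s" for m
  proof -
    have "real (g m) \<le> \<alpha> * real m" "\<alpha> * real m < real (Suc (g m))"
      using g[of m] by linarith+
    then have "1 / \<alpha> * real (g m) \<le> real m" "real m < 1 / \<alpha> * real (Suc (g m))"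
      using gt1 by (auto simp: field_simps)
    then have "\<lceil>1 / \<alpha> * real (g m)\<rceil> \<le> int m" "int m < \<lceil>1 / \<alpha> * real (Suc (g m))\<rceil>"
      by (auto simp: ceiling_le_iff less_ceiling_iff)
    then have "\<lceil>1 / \<alpha> * real (Suc (g m))\<rceil> - \<lceil>1 / \<alpha> * real (g m)\<rceil> = 1" using step(2)[of "g m"] by linarith
    then show ?thesis by (simp only: f_def of_int_1)
  qed
  have zero: "f n = 0" if n: "n \<notin> range g" for n
  proof (rule ccontr)
    assume "f n \<noteq> 0"
    then have "\<lceil>1 / \<alpha> * real (Suc n)\<rceil> - \<lceil>1 / \<alpha> * real n\<rceil> \<noteq> 0" by (auto simp: f_def)
    then have less: "\<lceil>1 / \<alpha> * real n\<rceil> < \<lceil>1 / \<alpha> * real (Suc n)\<rceil>" using step(1)[of n] by linarith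
    define m where "m = nat \<lceil>1 / \<alpha> * real n\<rceil>"
    have "0 \<le> 1 / \<alpha> * real n" using gt1 by simp
    then have m: "int m = \<lceil>1 / \<alpha> * real n\<rceil>" unfolding m_def by linarith
    have "1 / \<alpha> * real n \<le> real m" "real m < 1 / \<alpha> * real (Suc n)"
      using m less by (auto simp: less_ceiling_iff) linarith
    then have "real n \<le> \<alpha> * real m" "\<alpha> * real m < real n + 1" using gt1 by (auto simp: field_simps)
    then have "\<lfloor>\<alpha> * real m\<rfloor> = int n" by (simp add: floor_unique)
    then have "n = g m" by (simp add: g_def)
    with n show False by blast
  qed
  have "sturmian_series (1 / \<alpha>) s = suminf f"
    unfolding sturmian_series_def f_def ..
  also have "\<dots> = (\<Sum>m. f (g m))" by (rule suminf_mono_reindex[OF mono zero, symmetric])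
  also have "(\<lambda>m. f (g m)) = (\<lambda>m. 1 / of_nat (Suc (g m)) powr s)" using range by blast
  also have "(\<Sum>m. 1 / of_nat (Suc (g m)) powr s :: complex) =
      1 / of_nat (Suc (g 0)) powr s + (\<Sum>m. 1 / of_nat (Suc (g (Suc m))) powr s)"
  proof -
    have eq: "(1 / of_nat (Suc (g (Suc m))) powr s :: complex) = 1 / of_real (of_int \<lfloor>\<alpha> * real (Suc m)\<rfloor> + 1) powr s" for m
    proof -
      have "real (Suc (g (Suc m))) = of_int \<lfloor>\<alpha> * real (Suc m)\<rfloor> + 1" using g[of "Suc m"] by linarith
      then show ?thesis by (metis of_real_of_nat_eq)
    qed
    have "summable (\<lambda>m. 1 / of_nat (Suc (g (Suc m))) powr s :: complex)"
      unfolding eq using sums_summable[OF shifted_zeta_sums_mellin[OF s, of 1]] by simp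
    then have "summable (\<lambda>m. 1 / of_nat (Suc (g m)) powr s :: complex)" by (subst (asm) summable_Suc_iff)
    from suminf_split_head[OF this] show ?thesis by simp
  qed
  also have "(\<Sum>m. 1 / of_nat (Suc (g (Suc m))) powr s :: complex) = shifted_zeta 1 s"
    unfolding shifted_zeta_def
  proof (rule suminf_cong)
    fix m
    have "real (Suc (g (Suc m))) = of_int \<lfloor>\<alpha> * real (Suc m)\<rfloor> + 1" using g[of "Suc m"] by linarith
    then show "(1 / of_nat (Suc (g (Suc m))) powr s :: complex) = 1 / of_real (of_int \<lfloor>\<alpha> * real (Suc m)\<rfloor> + 1) powr s"
      by (metis of_real_of_nat_eq)
  qed
  finally show ?thesis by (simp add: g_def)
qed

end

section \<open>The expansion of the kernel to second order\<close>

lemma exp_Taylor2: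
  assumes "\<bar>u\<bar> \<le> (1::real)"
  shows "\<bar>exp u - 1 - u - u\<^sup>2 / 2\<bar> \<le> 2 * \<bar>u\<bar> ^ 3"
proof -
  have "norm (exp (complex_of_real u) - (\<Sum>k\<le>2. of_real u ^ k / fact k)) \<le>
      exp \<bar>Re (of_real u)\<bar> * norm (complex_of_real u) ^ Suc 2 / fact 2"
    by (rule Taylor_exp)
  also have "exp (complex_of_real u) - (\<Sum>k\<le>2. of_real u ^ k / fact k) = of_real (exp u - 1 - u - u\<^sup>2 / 2)"
    by (simp add: exp_of_real numeral_2_eq_2)
  finally have "\<bar>exp u - 1 - u - u\<^sup>2 / 2\<bar> \<le> exp \<bar>u\<bar> * \<bar>u\<bar> ^ 3 / 2"
    unfolding norm_of_real by (simp add: numeral_3_eq_3 fact_2)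
  also have "exp \<bar>u\<bar> * \<bar>u\<bar> ^ 3 / 2 \<le> 4 * \<bar>u\<bar> ^ 3 / 2"
  proof -
    have "exp \<bar>u\<bar> \<le> exp 1" using assms by simp
    also have "\<dots> \<le> 4" using exp_le by simp
    finally show ?thesis by (intro divide_right_mono mult_right_mono) auto
  qed
  finally show ?thesis by simp
qed

text \<open>The error bound 4 u is meant for all u > 0: near 0 it comes from the Taylor polynomial
  of exp, and for u > 1 the left-hand side is at most 3/2.\<close>

lemma bose_Laurent:
  assumes "u > (0::real)"
  shows "\<bar>1 / (exp u - 1) - 1 / u + 1 / 2\<bar> \<le> 4 * u"
proof (cases "u \<le> 1")
  case True
  define r where "r = exp u - 1 - u - u\<^sup>2 / 2"
  have r: "\<bar>r\<bar> \<le> 2 * u ^ 3" using exp_Taylor2[of u] True assms by (simp add: r_def)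
  have e: "exp u - 1 = u + u\<^sup>2 / 2 + r" by (simp add: r_def)
  have pos: "exp u - 1 \<ge> u" using exp_ge_add_one_self[of u] by linarith
  have "1 / (exp u - 1) - 1 / u + 1 / 2 = (2 * u - 2 * (exp u - 1) + u * (exp u - 1)) / (2 * u * (exp u - 1))"
    using pos assms by (simp add: field_simps)
  also have "2 * u - 2 * (exp u - 1) + u * (exp u - 1) = u ^ 3 / 2 - 2 * r + u * r"
    unfolding e by (simp add: power2_eq_square power3_eq_cube algebra_simps)
  finally have eq: "1 / (exp u - 1) - 1 / u + 1 / 2 = (u ^ 3 / 2 - 2 * r + u * r) / (2 * u * (exp u - 1))" .
  have "\<bar>u * r\<bar> \<le> 1 * \<bar>r\<bar>" unfolding abs_mult using True assms by (intro mult_right_mono) auto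
  then have "\<bar>u ^ 3 / 2 - 2 * r + u * r\<bar> \<le> u ^ 3 / 2 + 3 * \<bar>r\<bar>"
    using zero_le_power[of u 3] assms by linarith
  also have "\<dots> \<le> 8 * u ^ 3" using r by simp
  finally have num: "\<bar>u ^ 3 / 2 - 2 * r + u * r\<bar> \<le> 8 * u ^ 3" .
  have "\<bar>1 / (exp u - 1) - 1 / u + 1 / 2\<bar> \<le> 8 * u ^ 3 / (2 * u * u)"
    unfolding eq abs_divide using num pos assms by (intro frac_le) (auto simp: abs_mult)
  also have "\<dots> = 4 * u" using assms by (simp add: power3_eq_cube)
  finally show ?thesis .
next
  case False
  have "exp u - 1 \<ge> u" using exp_ge_add_one_self[of u] by linarith
  then have "0 \<le> 1 / (exp u - 1)" "1 / (exp u - 1) \<le> 1" "0 \<le> 1 / u" "1 / u \<le> 1"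
    using False by (simp_all add: divide_le_eq)
  then show ?thesis using False by linarith
qed

text \<open>The numerator is t + \<omega> t^2 + O(t^3) with \<omega> = (1 - 2 w) / 2; multiplying by
  1 / (x t) - 1 / 2 + O(x t) gives the two main terms. Measuring the error by x t^2 makes the bound
  global: for t > 1 every term is O(t), and t \<le> x t^2.\<close>

lemma damped_bose_expansion:
  fixes x t w :: real
  assumes x: "x \<ge> 1" and t: "t > 0" and w: "0 \<le> w" "w \<le> 1"
  shows "\<bar>exp (-(w * t)) * (exp t - 1) * (1 / (exp (x * t) - 1)) - 1 / x - ((1 - 2 * w) / (2 * x) - 1 / 2) * t\<bar>
           \<le> 12 * (x * t\<^sup>2)"
proof (cases "t \<le> 1")
  case True
  define \<omega> where "\<omega> = (1 - 2 * w) / 2"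
  define b where "b = 1 / (exp (x * t) - 1)"
  define r where "r = exp (-(w * t)) * (exp t - 1) - t - \<omega> * t\<^sup>2"
  define r2 where "r2 = b - 1 / (x * t) + 1 / 2"
  have xt: "x * t > 0" using x t by simp
  have r2: "\<bar>r2\<bar> \<le> 4 * (x * t)" unfolding r2_def b_def by (rule bose_Laurent[OF xt])
  have b: "0 \<le> b" "b \<le> 1 / (x * t)"
  proof -
    have "x * t \<le> exp (x * t) - 1" using exp_ge_add_one_self[of "x * t"] by linarith
    then show "0 \<le> b" "b \<le> 1 / (x * t)" using xt unfolding b_def by (auto intro!: divide_left_mono simp del: zero_less_mult_iff)
  qed
  have "\<bar>r\<bar> \<le> 4 * t ^ 3"
  proof -
    define u v where "u = (1 - w) * t" and "v = -(w * t)"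
    have uv: "\<bar>u\<bar> \<le> t" "\<bar>v\<bar> \<le> t" using w t by (auto simp: u_def v_def abs_mult mult_left_le_one_le)
    have "r = (exp u - 1 - u - u\<^sup>2 / 2) - (exp v - 1 - v - v\<^sup>2 / 2)"
      unfolding r_def \<omega>_def u_def v_def by (simp add: algebra_simps power2_eq_square flip: exp_add) (simp add: field_simps)
    then have "\<bar>r\<bar> \<le> 2 * \<bar>u\<bar> ^ 3 + 2 * \<bar>v\<bar> ^ 3"
      using exp_Taylor2[of u] exp_Taylor2[of v] uv True by linarith
    also have "\<dots> \<le> 2 * t ^ 3 + 2 * t ^ 3" using uv by (intro add_mono mult_left_mono power_mono) auto
    finally show ?thesis by simp
  qed
  then have "\<bar>r * b\<bar> \<le> 4 * t ^ 3 * (1 / (x * t))"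
    unfolding abs_mult using b t by (intro mult_mono) auto
  also have "\<dots> = 4 * (t\<^sup>2 / x)" using x t by (simp add: power2_eq_square power3_eq_cube)
  also have "\<dots> \<le> 4 * (x * t\<^sup>2)"
  proof -
    have "1 * 1 \<le> x * x" using x by (intro mult_mono) auto
    then have "t\<^sup>2 * 1 \<le> t\<^sup>2 * (x * x)" by (intro mult_left_mono) auto
    then show ?thesis using x by (simp add: divide_le_eq mult_ac)
  qed
  finally have rb: "\<bar>r * b\<bar> \<le> 4 * (x * t\<^sup>2)" .
  have tr: "\<bar>t * r2\<bar> \<le> 4 * (x * t\<^sup>2)"
    using mult_left_mono[OF r2, of t] t by (simp add: abs_mult power2_eq_square mult_ac)
  have w2: "\<bar>\<omega>\<bar> \<le> 1 / 2" using w by (auto simp: \<omega>_def abs_if field_simps)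
  have t2: "t\<^sup>2 \<le> x * t\<^sup>2" using mult_right_mono[OF x, of "t\<^sup>2"] by simp
  have "\<bar>\<omega> * t\<^sup>2 / 2\<bar> \<le> 1 / 2 * t\<^sup>2 / 2"
    using mult_right_mono[OF w2, of "t\<^sup>2"] by (simp add: abs_mult)
  then have wt: "\<bar>\<omega> * t\<^sup>2 / 2\<bar> \<le> x * t\<^sup>2" using t2 zero_le_power2[of t] by linarith
  have "\<bar>\<omega> * t * (t * r2)\<bar> \<le> 1 / 2 * \<bar>t * r2\<bar>"
  proof -
    have "\<bar>\<omega> * t\<bar> \<le> 1 / 2 * 1" unfolding abs_mult using w2 t True by (intro mult_mono) auto
    then show ?thesis unfolding abs_mult[of "\<omega> * t"] by (intro mult_right_mono) auto
  qed
  then have wr: "\<bar>\<omega> * t * (t * r2)\<bar> \<le> 2 * (x * t\<^sup>2)" using tr by linarith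
  have "exp (-(w * t)) * (exp t - 1) * b = (t + \<omega> * t\<^sup>2 + r) * b" by (simp add: r_def)
  also have "\<dots> = (t + \<omega> * t\<^sup>2) * (1 / (x * t) - 1 / 2 + r2) + r * b" by (simp add: r2_def algebra_simps)
  also have "\<dots> = 1 / x + (\<omega> / x - 1 / 2) * t - \<omega> * t\<^sup>2 / 2 + t * r2 + \<omega> * t * (t * r2) + r * b"
    using x t by (simp add: field_simps power2_eq_square)
  finally have "exp (-(w * t)) * (exp t - 1) * b - 1 / x - (\<omega> / x - 1 / 2) * t =
      - (\<omega> * t\<^sup>2 / 2) + t * r2 + \<omega> * t * (t * r2) + r * b" by simp
  \<comment> \<open>The four errors contribute 1, 4, 2 and 4 times x t^2.\<close>
  then have "\<bar>exp (-(w * t)) * (exp t - 1) * b - 1 / x - (\<omega> / x - 1 / 2) * t\<bar> \<le> 12 * (x * t\<^sup>2)"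
    using rb tr wt wr by linarith
  then show ?thesis by (simp add: b_def \<omega>_def)
next
  case False
  have "norm (of_real (exp (-(w * t)) * (exp t - 1)) * bose (x * t)) \<le> 1"
    by (rule damped_bose_le_1[OF x w(1) t])
  then have 1: "\<bar>exp (-(w * t)) * (exp t - 1) * (1 / (exp (x * t) - 1))\<bar> \<le> 1"
    unfolding bose_real of_real_mult[symmetric] norm_of_real .
  have 2: "0 \<le> 1 / x" "1 / x \<le> 1" using x by auto
  have "\<bar>(1 - 2 * w) / (2 * x)\<bar> \<le> 1 / (2 * 1)"
    unfolding abs_divide using w x by (intro frac_le) auto
  then have "\<bar>(1 - 2 * w) / (2 * x) - 1 / 2\<bar> \<le> 1" by linarith
  then have 3: "\<bar>((1 - 2 * w) / (2 * x) - 1 / 2) * t\<bar> \<le> 1 * t"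
    unfolding abs_mult using t by (intro mult_mono) auto
  have "1 * t \<le> t * t" using False by (intro mult_right_mono) auto
  then have "t \<le> t\<^sup>2" by (simp add: power2_eq_square)
  also have "t\<^sup>2 \<le> x * t\<^sup>2" using mult_right_mono[OF x, of "t\<^sup>2"] by simp
  finally have 4: "t \<le> x * t\<^sup>2" .
  have triangle: "\<bar>a - b - c\<bar> \<le> 12 * d" if "\<bar>a\<bar> \<le> 1" "0 \<le> b" "b \<le> 1" "\<bar>c\<bar> \<le> 1 * t" "t \<le> d" for a b c d :: real
    using that False by linarith
  show ?thesis by (rule triangle[OF 1 2 3 4])
qed

lemma of_real_lincomb_mult:
  "complex_of_real (a * b - p - c * t) * z = of_real a * (of_real b * z) - of_real p * z - of_real c * (of_real t * z)"
  by (simp add: algebra_simps)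

text \<open>The subtracted multiples of \<open>bose (y * t)\<close> and
  \<open>t * bose (y * t)\<close> are chosen for their known transforms, which involve \<zeta> at s
  and at s + 1.\<close>

definition cone_rem :: "real \<Rightarrow> real \<Rightarrow> real \<Rightarrow> real \<Rightarrow> complex" where
  "cone_rem w x y t = cone_kernel w x y t - of_real (1 / x) * bose (y * t)
     - of_real ((1 - 2 * w) / (2 * x) - 1 / 2) * (of_real t * bose (y * t))"

definition bose_moment :: "real \<Rightarrow> real" where
  "bose_moment \<sigma> = (\<integral>t. t powr (\<sigma> - 1) * norm (bose t) \<partial>pos_lborel)"

lemma bose_moment_nonneg: "bose_moment \<sigma> \<ge> 0"
  unfolding bose_moment_def by (rule integral_nonneg_AE) (rule AE_pos_lborelI, simp)

lemma bose_moment_le: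
  assumes "1 < l" "l \<le> \<sigma>" "\<sigma> \<le> u"
  shows "bose_moment \<sigma> \<le> bose_moment l + bose_moment u"
proof -
  have i: "integrable pos_lborel (\<lambda>t. t powr (\<sigma> - 1) * norm (bose t))" if "\<sigma> > 1" for \<sigma>
    using mellin_bose(1)[OF that] by (simp add: mellin_conv_def)
  have "bose_moment \<sigma> \<le> (\<integral>t. t powr (l - 1) * norm (bose t) + t powr (u - 1) * norm (bose t) \<partial>pos_lborel)"
    unfolding bose_moment_def
  proof (rule integral_mono)
    fix t assume "t \<in> space pos_lborel"
    then have "t powr (\<sigma> - 1) \<le> t powr (l - 1) + t powr (u - 1)"
      using assms by (intro powr_le_endpoints) auto
    from mult_right_mono[OF this norm_ge_zero[of "bose t"]]
    show "t powr (\<sigma> - 1) * norm (bose t) \<le> t powr (l - 1) * norm (bose t) + t powr (u - 1) * norm (bose t)"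
      by (simp add: ring_distribs)
  qed (use assms i in auto)
  also have "\<dots> = bose_moment l + bose_moment u"
    unfolding bose_moment_def using assms i by (intro Bochner_Integration.integral_add) auto
  finally show ?thesis .
qed

text \<open>The remainder is O(x t^2) times \<open>bose (y * t)\<close>; the two extra powers of t
  move the abscissa of convergence from 1 to -1.\<close>

lemma cone_rem_bounds:
  assumes x: "x \<ge> 1" and y: "y > 0" and w: "0 \<le> w" "w \<le> 1" and \<sigma>: "\<sigma> > -1"
  shows "mellin_conv (cone_rem w x y) \<sigma>"
    and "(\<integral>t. t powr (\<sigma> - 1) * norm (cone_rem w x y t) \<partial>pos_lborel) \<le> 12 * x * (y powr (-\<sigma> - 2) * bose_moment (\<sigma> + 2))"
proof -
  have b2: "mellin_conv (\<lambda>t. bose (y * t)) (\<sigma> + of_nat 2)"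
    using \<sigma> by (intro mellin_bose_scale(1)[OF y]) auto
  then have conv: "mellin_conv (\<lambda>t. of_real t ^ 2 * bose (y * t)) \<sigma>"
    unfolding mellin_conv_power_iff .
  have [measurable]: "cone_kernel w x y \<in> borel_measurable pos_lborel"
    using x y by (intro cone_kernel_measurable) auto
  note [measurable] = measurable_pos_lborel_scale[OF y bose_measurable]
  have [measurable]: "complex_of_real \<in> borel_measurable pos_lborel"
    by (rule measurable_restrict_space1) measurable
  have m: "cone_rem w x y \<in> borel_measurable pos_lborel"
    unfolding cone_rem_def by measurable
  have le: "norm (cone_rem w x y t) \<le> 12 * x * norm (of_real t ^ 2 * bose (y * t))" if t: "t > 0" for t
  proof -
    have "cone_rem w x y t = of_real (exp (-(w * t)) * (exp t - 1) * (1 / (exp (x * t) - 1)) - 1 / x - ((1 - 2 * w) / (2 * x) - 1 / 2) * t) * bose (y * t)"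
      unfolding cone_rem_def cone_kernel_def bose_real[of "x * t"]
      by (rule of_real_lincomb_mult[symmetric])
    then have "norm (cone_rem w x y t) = \<bar>exp (-(w * t)) * (exp t - 1) * (1 / (exp (x * t) - 1)) - 1 / x - ((1 - 2 * w) / (2 * x) - 1 / 2) * t\<bar> * norm (bose (y * t))"
      by (simp only: norm_mult norm_of_real)
    also have "\<dots> \<le> 12 * (x * t\<^sup>2) * norm (bose (y * t))"
      by (intro mult_right_mono damped_bose_expansion x t w) auto
    finally show ?thesis by (simp add: norm_mult norm_power mult_ac)
  qed
  show "mellin_conv (cone_rem w x y) \<sigma>"
    by (rule mellin_conv_bound[OF conv m le])
  have "(\<integral>t. t powr (\<sigma> - 1) * norm (cone_rem w x y t) \<partial>pos_lborel) \<le>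
     12 * x * (\<integral>t. t powr (\<sigma> - 1) * norm (of_real t ^ 2 * bose (y * t)) \<partial>pos_lborel)"
    by (rule mellin_integral_bound[OF conv m le])
  also have "(\<integral>t. t powr (\<sigma> - 1) * norm (of_real t ^ 2 * bose (y * t)) \<partial>pos_lborel) = y powr (-(\<sigma> + 2)) * bose_moment (\<sigma> + 2)"
    unfolding mellin_integral_power bose_moment_def using mellin_bose_scale(3)[OF y, of "\<sigma> + 2"] \<sigma> by simp
  finally show "(\<integral>t. t powr (\<sigma> - 1) * norm (cone_rem w x y t) \<partial>pos_lborel) \<le> 12 * x * (y powr (-\<sigma> - 2) * bose_moment (\<sigma> + 2))"
    by simp
qed

text \<open>In the second term \<open>rGamma s = s * rGamma (s + 1)\<close> cancels the pole of
  \<zeta>(s + 1) at s = 0, so that the regular function \<open>zeta_reg s\<close> appears without a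
  denominator.\<close>

lemma cone_zeta_expansion:
  assumes x: "x \<ge> 1" and y: "y > 0" and w: "0 \<le> w" "w \<le> 1" and s: "Re s > 1"
  shows "cone_zeta w x y s = of_real (1 / x) * of_real y powr (-s) * (zeta_reg (s - 1) / (s - 1)) +
     of_real ((1 - 2 * w) / (2 * x) - 1 / 2) * of_real y powr (-s - 1) * zeta_reg s + rGamma s * mellin (cone_rem w x y) s"
proof -
  define c where "c = complex_of_real ((1 - 2 * w) / (2 * x) - 1 / 2)"
  let ?b = "\<lambda>t. of_real (1 / x) * bose (y * t)" and ?tb = "\<lambda>t. c * (of_real t * bose (y * t))"
  have s1: "Re (s + 1) > 1" using s by simp
  have s_nz: "s \<noteq> 0" using s by auto
  have b: "mellin_conv ?b (Re s)"
    by (rule mellin_conv_cmult[OF mellin_bose_scale(1)[OF y s]])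
  have tb: "mellin_conv ?tb (Re s)"
    using mellin_bose_scale(1)[OF y, of "Re s + 1"] s
    by (intro mellin_conv_cmult) (simp add: mellin_conv_times_iff)
  have r: "mellin_conv (cone_rem w x y) (Re s)"
    using s by (intro cone_rem_bounds assms) auto
  have "cone_kernel w x y = (\<lambda>t. (cone_rem w x y t + ?b t) + ?tb t)"
    by (auto simp: cone_rem_def c_def fun_eq_iff)
  then have "mellin (cone_kernel w x y) s = mellin (cone_rem w x y) s + mellin ?b s + mellin ?tb s"
    using mellin_add[OF mellin_conv_add[OF r b] tb] mellin_add[OF r b] by simp
  then have "cone_zeta w x y s = rGamma s * mellin (cone_rem w x y) s +
      of_real (1 / x) * (rGamma s * mellin (\<lambda>t. bose (y * t)) s) + c * (rGamma s * mellin (\<lambda>t. bose (y * t)) (s + 1))"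
    unfolding cone_zeta_def mellin_cmult mellin_times by (simp add: algebra_simps)
  also have "rGamma s * mellin (\<lambda>t. bose (y * t)) s = of_real y powr (-s) * (zeta_reg (s - 1) / (s - 1))"
    by (rule mellin_bose_scale(2)[OF y s])
  also have "rGamma s * mellin (\<lambda>t. bose (y * t)) (s + 1) = of_real y powr (-s - 1) * zeta_reg s"
  proof -
    have "rGamma s = s * rGamma (s + 1)" by (simp add: rGamma_plus1)
    then have "rGamma s * mellin (\<lambda>t. bose (y * t)) (s + 1) = s * (of_real y powr (-(s + 1)) * (zeta_reg s / s))"
      using mellin_bose_scale(2)[OF y s1] by (simp add: mult.assoc)
    then show ?thesis using s_nz by simp
  qed
  finally show ?thesis by (simp add: c_def algebra_simps)
qed

section \<open>The leading Dirichlet series and the decomposition of the shifted zeta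
  function\<close>

context beatty begin

text \<open>The full index set gives L. Other sets serve to split L into a lacunary part and a part
  converging further to the left.\<close>

definition lead_sum :: "nat set \<Rightarrow> complex \<Rightarrow> complex" where
  "lead_sum I s = (\<Sum>k. if k \<in> I then (-1) ^ k * of_real (Q (Suc k)) powr (-s) / of_real (Q k) else 0)"

definition lead_bound :: "nat set \<Rightarrow> real \<Rightarrow> bool" where
  "lead_bound I \<sigma> \<longleftrightarrow> summable (\<lambda>k. if k \<in> I then Q (Suc k) powr (-\<sigma>) / Q k else 0)"

lemma norm_lead_term:
  "norm (if k \<in> I then (-1) ^ k * of_real (Q (Suc k)) powr (-s) / of_real (Q k) else 0 :: complex) =
     (if k \<in> I then Q (Suc k) powr (-Re s) / Q k else 0)"
  by (auto simp: norm_mult norm_divide norm_power norm_of_real_powr)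

lemma lead_term_mono:
  "l \<le> \<sigma> \<Longrightarrow> (if k \<in> I then Q (Suc k) powr (-\<sigma>) / Q k else 0) \<le> (if k \<in> I then Q (Suc k) powr (-l) / Q k else 0)"
  using Q_ge1[of "Suc k"] by (auto intro!: divide_right_mono powr_mono)

lemma lead_sum_summable:
  assumes "lead_bound I l" "l \<le> Re s"
  shows "summable (\<lambda>k. if k \<in> I then (-1) ^ k * of_real (Q (Suc k)) powr (-s) / of_real (Q k) else 0 :: complex)"
  by (rule summable_comparison_test'[OF assms(1)[unfolded lead_bound_def]])
     (simp only: norm_lead_term lead_term_mono[OF assms(2)])

lemma lead_sum_holomorphic:
  assumes "open S" "\<And>s. s \<in> S \<Longrightarrow> \<exists>l<Re s. lead_bound I l"
  shows "lead_sum I holomorphic_on S"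
  unfolding lead_sum_def
proof (rule holomorphic_on_suminf[OF assms(1)])
  show "(\<lambda>s. if k \<in> I then (-1) ^ k * of_real (Q (Suc k)) powr (-s) / of_real (Q k) else 0 :: complex) holomorphic_on S" for k
    using Q_pos[of "Suc k"] Q_pos[of k] by (cases "k \<in> I") (auto intro!: holomorphic_intros simp del: Q_pos)
  fix s assume "s \<in> S"
  then obtain l where l: "l < Re s" "lead_bound I l" using assms(2) by blast
  have "l \<le> Re u" if "u \<in> ball s (Re s - l)" for u
    using that abs_Re_le_cmod[of "u - s"] by (simp add: dist_norm norm_minus_commute)
  then show "\<exists>e>0. \<exists>g. summable g \<and> (\<forall>w\<in>ball s e \<inter> S. \<forall>k. norm (if k \<in> I then (-1) ^ k * of_real (Q (Suc k)) powr (-w) / of_real (Q k) else 0 :: complex) \<le> g k)"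
    using l by (intro exI[of _ "Re s - l"] conjI exI[of _ "\<lambda>k. if k \<in> I then Q (Suc k) powr (-l) / Q k else 0"])
       (auto simp only: norm_lead_term lead_term_mono lead_bound_def Int_iff diff_gt_0_iff_gt)
qed

lemma summable_Q_Suc_powr: "\<epsilon> > 0 \<Longrightarrow> summable (\<lambda>k. Q (Suc k) powr (-\<epsilon>))"
  using summable_Q_powr[of \<epsilon>] by (subst summable_Suc_iff) auto

lemma lead_bound_pos:
  assumes "\<sigma> \<ge> 0"
  shows "lead_bound I \<sigma>"
  unfolding lead_bound_def
proof (rule summable_comparison_test'[OF summable_Q_powr[of 1]])
  fix k
  have "Q (Suc k) powr (-\<sigma>) \<le> Q (Suc k) powr 0" using Q_ge1[of "Suc k"] assms by (intro powr_mono) auto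
  then have "Q (Suc k) powr (-\<sigma>) / Q k \<le> 1 / Q k" by (intro divide_right_mono) (auto simp: less_imp_neq[THEN not_sym])
  then show "norm (if k \<in> I then Q (Suc k) powr (-\<sigma>) / Q k else 0) \<le> Q k powr (-1)"
    by (auto simp: powr_minus divide_inverse)
qed simp

text \<open>A collects the coefficients of \<zeta>(s + 1), B the remainders. The terms of both are
  O(\<open>Q (Suc k)\<close>^(-(Re s + 1))) locally uniformly, for the remainders because one factor
  \<open>Q k\<close> is at most \<open>Q (Suc k)\<close>.\<close>

lemma shifted_zeta_structure:
  assumes w: "0 \<le> w" "w \<le> 1"
  obtains A B where "A holomorphic_on {s. Re s > -1}" "B holomorphic_on {s. Re s > -1}"
    "\<And>s. Re s > 1 \<Longrightarrow> shifted_zeta w s = lead_sum UNIV s * (zeta_reg (s - 1) / (s - 1)) + A s * zeta_reg s + B s"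
proof -
  define c where "c k = (1 - 2 * w) / (2 * Q k) - 1 / 2" for k
  have c: "\<bar>c k\<bar> \<le> 1" for k
  proof -
    have "\<bar>(1 - 2 * w) / (2 * Q k)\<bar> \<le> 1 / (2 * 1)"
      unfolding abs_divide using w Q_ge1[of k] by (intro frac_le) auto
    then show ?thesis unfolding c_def by linarith
  qed
  define a where "a k s = (-1) ^ k * (of_real (c k) * complex_of_real (Q (Suc k)) powr (-s - 1))" for k s
  define b where "b k s = (-1) ^ k * mellin (cone_rem w (Q k) (Q (Suc k))) s" for k s
  have na: "norm (a k s) \<le> Q (Suc k) powr (-(l + 1))" if "l \<le> Re s" for k s l
  proof -
    have "norm (a k s) = \<bar>c k\<bar> * Q (Suc k) powr (-Re s - 1)"
      by (simp add: a_def norm_mult norm_power norm_of_real_powr)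
    also have "\<dots> \<le> 1 * Q (Suc k) powr (-(l + 1))"
      using c[of k] that Q_ge1[of "Suc k"] by (intro mult_mono powr_mono) auto
    finally show ?thesis by simp
  qed
  have nb: "norm (b k s) \<le> 12 * (bose_moment (l + 2) + bose_moment (u + 2)) * Q (Suc k) powr (-(l + 1))"
    if "-1 < l" "l \<le> Re s" "Re s \<le> u" for k s l u
  proof -
    have "norm (b k s) \<le> (\<integral>t. t powr (Re s - 1) * norm (cone_rem w (Q k) (Q (Suc k)) t) \<partial>pos_lborel)"
      using norm_mellin_le[of "cone_rem w (Q k) (Q (Suc k))" s] by (simp add: b_def norm_mult norm_power)
    also have "\<dots> \<le> 12 * Q k * (Q (Suc k) powr (-Re s - 2) * bose_moment (Re s + 2))"
      using that by (intro cone_rem_bounds w Q_ge1) auto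
    also have "\<dots> \<le> 12 * Q (Suc k) * (Q (Suc k) powr (-l - 2) * (bose_moment (l + 2) + bose_moment (u + 2)))"
      using that Q_mono_Suc[of k] Q_ge1[of "Suc k"] Q_ge1[of k] bose_moment_nonneg[of "Re s + 2"]
      by (intro mult_mono powr_mono bose_moment_le) auto
    also have "\<dots> = 12 * (bose_moment (l + 2) + bose_moment (u + 2)) * (Q (Suc k) powr 1 * Q (Suc k) powr (-l - 2))"
      by (simp add: mult_ac)
    also have "Q (Suc k) powr 1 * Q (Suc k) powr (-l - 2) = Q (Suc k) powr (-(l + 1))"
      unfolding powr_add[symmetric] by (rule arg_cong[where f = "\<lambda>e. Q (Suc k) powr e"]) simp
    finally show ?thesis .
  qed
  let ?H = "{s. Re s > -1}"
  have H: "open ?H" by (rule open_halfspace_Re_gt)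
  have near: "l \<le> Re v \<and> Re v \<le> Re s + (Re s - l)" if "v \<in> ball s (Re s - l)" for v s l
    using that abs_Re_le_cmod[of "v - s"] by (simp add: dist_norm norm_minus_commute) linarith
  have A: "(\<lambda>s. \<Sum>k. a k s) holomorphic_on ?H"
  proof (rule holomorphic_on_suminf[OF H])
    show "a k holomorphic_on ?H" for k
      unfolding a_def using Q_pos[of "Suc k"] by (auto intro!: holomorphic_intros simp del: Q_pos)
    fix s assume s: "s \<in> ?H"
    \<comment> \<open>The midpoint between -1 and Re s.\<close>
    define l where "l = (Re s - 1) / 2"
    have l: "-1 < l" "l < Re s" using s by (auto simp: l_def)
    show "\<exists>e>0. \<exists>g. summable g \<and> (\<forall>v\<in>ball s e \<inter> ?H. \<forall>k. norm (a k v) \<le> g k)"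
      using l near summable_Q_Suc_powr[of "l + 1"]
      by (intro exI[of _ "Re s - l"] conjI exI[of _ "\<lambda>k. Q (Suc k) powr (-(l + 1))"] ballI allI na) auto
  qed
  have B: "(\<lambda>s. \<Sum>k. b k s) holomorphic_on ?H"
  proof (rule holomorphic_on_suminf[OF H])
    show "b k holomorphic_on ?H" for k
      unfolding b_def by (intro holomorphic_intros mellin_holomorphic cone_rem_bounds w Q_ge1) auto
    fix s assume s: "s \<in> ?H"
    define l where "l = (Re s - 1) / 2"
    have l: "-1 < l" "l < Re s" using s by (auto simp: l_def)
    define C where "C = 12 * (bose_moment (l + 2) + bose_moment ((Re s + (Re s - l)) + 2))"
    have "summable (\<lambda>k. C * Q (Suc k) powr (-(l + 1)))"
      using l by (intro summable_mult summable_Q_Suc_powr) auto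
    moreover have "norm (b k v) \<le> C * Q (Suc k) powr (-(l + 1))" if "v \<in> ball s (Re s - l)" for k v
      unfolding C_def using near[OF that] l by (intro nb) auto
    ultimately show "\<exists>e>0. \<exists>g. summable g \<and> (\<forall>v\<in>ball s e \<inter> ?H. \<forall>k. norm (b k v) \<le> g k)"
      using l by (intro exI[of _ "Re s - l"] conjI exI[of _ "\<lambda>k. C * Q (Suc k) powr (-(l + 1))"]) auto
  qed
  show ?thesis
  proof (rule that[OF A])
    show "(\<lambda>s. rGamma s * (\<Sum>k. b k s)) holomorphic_on ?H" by (intro holomorphic_intros B)
    fix s assume s: "Re s > 1"
    have 1: "(\<lambda>k. (-1) ^ k * of_real (Q (Suc k)) powr (-s) / of_real (Q k) :: complex) sums lead_sum UNIV s"
      using summable_sums[OF lead_sum_summable[OF lead_bound_pos[of 0 UNIV], of s]] s by (simp add: lead_sum_def)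
    have 2: "(\<lambda>k. a k s) sums (\<Sum>k. a k s)"
    proof (rule summable_sums, rule summable_comparison_test'[OF summable_Q_Suc_powr[of 1]])
      show "norm (a k s) \<le> Q (Suc k) powr (-1)" for k using na[of 0 s k] s by simp
    qed simp
    have 3: "(\<lambda>k. b k s) sums (\<Sum>k. b k s)"
    proof (rule summable_sums, rule summable_comparison_test'[OF summable_mult[OF summable_Q_Suc_powr[of 1]]])
      show "norm (b k s) \<le> 12 * (bose_moment (0 + 2) + bose_moment (Re s + 2)) * Q (Suc k) powr (-1)" for k
        using nb[of 0 s "Re s" k] s by simp
    qed simp
    have "(\<lambda>k. (-1) ^ k * cone_zeta w (Q k) (Q (Suc k)) s) sums
        (lead_sum UNIV s * (zeta_reg (s - 1) / (s - 1)) + (\<Sum>k. a k s) * zeta_reg s + rGamma s * (\<Sum>k. b k s))"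
    proof (rule sums_cong[THEN iffD1, OF _ sums_add[OF sums_add[OF sums_mult2[OF 1] sums_mult2[OF 2]] sums_mult[OF 3]]])
      show "(-1) ^ k * of_real (Q (Suc k)) powr (-s) / of_real (Q k) * (zeta_reg (s - 1) / (s - 1)) + a k s * zeta_reg s + rGamma s * b k s =
         (-1) ^ k * cone_zeta w (Q k) (Q (Suc k)) s" for k
        unfolding cone_zeta_expansion[OF Q_ge1 Q_pos w s] a_def b_def c_def by (simp add: algebra_simps)
    qed
    from sums_unique2[OF shifted_zeta_sums[OF s w(1)] this]
    show "shifted_zeta w s = lead_sum UNIV s * (zeta_reg (s - 1) / (s - 1)) + (\<Sum>k. a k s) * zeta_reg s + rGamma s * (\<Sum>k. b k s)" .
  qed
qed

end

section \<open>Continuation to the half-plane and the natural boundary\<close>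

lemma simple_pole_divide:
  assumes "open S" "z \<in> S" "F holomorphic_on S" "F z \<noteq> 0" "\<And>w. w \<in> S - {z} \<Longrightarrow> g w = F w / (w - z)"
  shows "simple_pole g z" "residue g z = F z"
proof -
  have ev: "\<forall>\<^sub>F w in at z. g w = F w / (w - z)"
    using eventually_at_in_open[OF assms(1,2)] by eventually_elim (rule assms(5))
  have "is_pole (\<lambda>w. F w / (w - z) ^ 1) z"
    by (rule is_pole_basic[OF assms(3,1,2,4)]) simp
  then have "is_pole g z" using is_pole_cong[OF ev refl] by simp
  moreover have "zorder g z = -1"
    by (rule zorder_eqI[OF assms(1-4)]) (use assms(5) in \<open>auto simp: field_simps power_int_minus\<close>)
  ultimately show "simple_pole g z" by (simp add: simple_pole_def)
  have "residue g z = residue (\<lambda>w. F w / (w - z)) z" by (rule residue_cong[OF ev refl])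
  also have "\<dots> = F z" by (rule residue_simple[OF assms(1-3)])
  finally show "residue g z = F z" .
qed

section \<open>The exponent tau, the edge of the half-plane and the residue at 1\<close>

context beatty begin

abbreviation (input) q :: "nat \<Rightarrow> real" where "q k \<equiv> of_int (conv_denom \<alpha> k)"

lemma q_ge1: "q k \<ge> 1"
  using conv_denom_pos[OF irrational, of k] by linarith

text \<open>The exponent \<open>tau\<close> refers to denominators, the expansion to numerators.
  Both obey the same recursion, so together with the next lemma they differ at most by the constant
  factor a_0 + 1, which is invisible in the limit of the quotients of logarithms.\<close>

lemma q_le_Q: "q k \<le> Q (Suc k)"
proof (induction k rule: induct_nat_012)
  case 0
  then show ?case using Q_ge1[of 1] by simp
next
  case 1
  have "1 * q 1 \<le> of_int (cf_digit \<alpha> 0) * q 1"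
    using digit_ge1[of 0] digit_ge1[of 1] by (intro mult_right_mono) auto
  then show ?case by (simp add: num_seq_Suc mult.commute)
next
  case (ge2 k)
  have "of_int (cf_digit \<alpha> (Suc (Suc k))) * q (Suc k) \<le> of_int (cf_digit \<alpha> (Suc (Suc k))) * Q (Suc (Suc k))"
    using ge2 digit_ge1[of "Suc (Suc k)"] by (intro mult_left_mono) auto
  then show ?case using ge2 by (simp add: num_seq_Suc_Suc)
qed

lemma Q_le_q: "Q (Suc k) \<le> (of_int (cf_digit \<alpha> 0) + 1) * q k"
proof (induction k rule: induct_nat_012)
  case 0
  then show ?case by (simp add: num_seq_Suc)
next
  case 1
  then show ?case using digit_ge1[of 1] by (simp add: num_seq_Suc algebra_simps)
next
  case (ge2 k)
  have "of_int (cf_digit \<alpha> (Suc (Suc k))) * Q (Suc (Suc k)) \<le>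
      of_int (cf_digit \<alpha> (Suc (Suc k))) * ((of_int (cf_digit \<alpha> 0) + 1) * q (Suc k))"
    using ge2 digit_ge1[of "Suc (Suc k)"] by (intro mult_left_mono) auto
  then show ?case using ge2 by (simp add: num_seq_Suc_Suc algebra_simps)
qed

lemma ln_Q_at_top: "filterlim (\<lambda>k. ln (Q k)) at_top sequentially"
  by (rule filterlim_compose[OF ln_at_top Q_at_top])

lemma ln_q_bounds: "ln (q k) \<le> ln (Q (Suc k))" "ln (Q (Suc k)) \<le> ln (of_int (cf_digit \<alpha> 0) + 1) + ln (q k)"
proof -
  show "ln (q k) \<le> ln (Q (Suc k))" using q_le_Q[of k] q_ge1[of k] by (subst ln_le_cancel_iff) auto
  have c: "of_int (cf_digit \<alpha> 0) + 1 > (0::real)" using digit_ge1[of 0] by linarith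
  have "ln (Q (Suc k)) \<le> ln ((of_int (cf_digit \<alpha> 0) + 1) * q k)"
    using Q_le_q[of k] q_ge1[of k] c by (subst ln_le_cancel_iff) auto
  also have "\<dots> = ln (of_int (cf_digit \<alpha> 0) + 1) + ln (q k)" using c q_ge1[of k] by (intro ln_mult_pos) auto
  finally show "ln (Q (Suc k)) \<le> ln (of_int (cf_digit \<alpha> 0) + 1) + ln (q k)" .
qed

lemma ln_q_pos: "\<forall>\<^sub>F k in sequentially. ln (q k) > 0"
proof -
  have "filterlim (\<lambda>k. ln (Q (Suc k))) at_top sequentially"
    using ln_Q_at_top by (subst filterlim_sequentially_Suc)
  then have "\<forall>\<^sub>F k in sequentially. ln (Q (Suc k)) > ln (of_int (cf_digit \<alpha> 0) + 1)"
    by (simp add: filterlim_at_top_dense)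
  then show ?thesis by eventually_elim (use ln_q_bounds(2) in \<open>smt (verit)\<close>)
qed

lemma q_mono_Suc: "q k \<le> q (Suc k)"
proof (cases k)
  case 0
  then show ?thesis using digit_ge1[of 1] by simp
next
  case (Suc m)
  have "1 * conv_denom \<alpha> (Suc m) \<le> cf_digit \<alpha> (Suc (Suc m)) * conv_denom \<alpha> (Suc m)"
    using digit_ge1[of "Suc (Suc m)"] conv_denom_pos[OF irrational, of "Suc m"] by (intro mult_right_mono) auto
  then have "conv_denom \<alpha> (Suc m) \<le> conv_denom \<alpha> (Suc (Suc m))"
    using conv_denom_pos[OF irrational, of m] by simp
  then show ?thesis unfolding Suc of_int_le_iff .
qed

lemma tau_ge1: "tau \<alpha> \<ge> 1"
  unfolding tau_def
proof (rule le_Limsup)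
  show "\<forall>\<^sub>F k in sequentially. 1 \<le> ereal (ln (q (Suc k)) / ln (q k))"
    using ln_q_pos
  proof eventually_elim
    case (elim k)
    have "ln (q k) \<le> ln (q (Suc k))" using q_mono_Suc[of k] q_ge1[of k] by (subst ln_le_cancel_iff) auto
    then show ?case using elim by (simp add: one_ereal_def le_divide_eq)
  qed
qed simp

text \<open>Choosing T' strictly between \<open>tau \<alpha>\<close> and T leaves the slack (T - T')
  ln \<open>Q\<close>, which eventually absorbs the additive constant from the comparison of
  numerators with denominators.\<close>

lemma tau_upper:
  assumes "ereal T > tau \<alpha>"
  shows "\<forall>\<^sub>F k in sequentially. ln (Q (Suc k)) \<le> T * ln (Q k)"
proof -
  define C where "C = ln (of_int (cf_digit \<alpha> 0) + 1 :: real)"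
  obtain T' where T': "tau \<alpha> < ereal T'" "T' < T" using ereal_dense2[OF assms] by auto
  have T'0: "T' > 0" proof -
    have "ereal 1 < ereal T'" using le_less_trans[OF tau_ge1 T'(1)] by (simp add: one_ereal_def)
    then show ?thesis by simp
  qed
  have ev: "\<forall>\<^sub>F k in sequentially. ereal (ln (q (Suc k)) / ln (q k)) < ereal T'"
    using T'(1) unfolding tau_def by (rule Limsup_lessD)
  have "filterlim (\<lambda>k. ln (Q (Suc k))) at_top sequentially"
    using ln_Q_at_top by (subst filterlim_sequentially_Suc)
  then have ev2: "\<forall>\<^sub>F k in sequentially. ln (Q (Suc k)) > C / (T - T')"
    by (simp add: filterlim_at_top_dense)
  have "\<forall>\<^sub>F k in sequentially. ln (Q (Suc (Suc k))) \<le> T * ln (Q (Suc k))"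
    using ev ev2 ln_q_pos
  proof eventually_elim
    case (elim k)
    have "ln (Q (Suc (Suc k))) \<le> C + ln (q (Suc k))" using ln_q_bounds(2)[of "Suc k"] by (simp add: C_def)
    also have "ln (q (Suc k)) \<le> T' * ln (q k)" using elim by (simp add: divide_less_eq)
    also have "T' * ln (q k) \<le> T' * ln (Q (Suc k))" using T'0 ln_q_bounds(1)[of k] by (intro mult_left_mono) auto
    also have "C \<le> (T - T') * ln (Q (Suc k))" using elim T'(2) by (simp add: divide_less_eq mult.commute)
    finally show ?case by (simp add: algebra_simps)
  qed
  then show ?thesis by (subst (asm) eventually_sequentially_Suc)
qed

lemma tau_lower:
  assumes "ereal T < tau \<alpha>" "T > 0"
  shows "\<exists>\<^sub>F k in sequentially. ln (Q (Suc k)) > T * ln (Q k)"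
proof -
  define C where "C = ln (of_int (cf_digit \<alpha> 0) + 1 :: real)"
  obtain T' where T': "T < T'" "ereal T' < tau \<alpha>" using ereal_dense2[OF assms(1)] by auto
  have fr: "\<exists>\<^sub>F k in sequentially. ln (q (Suc k)) / ln (q k) > T'"
  proof (rule ccontr)
    assume "\<not> ?thesis"
    then have "\<forall>\<^sub>F k in sequentially. ereal (ln (q (Suc k)) / ln (q k)) \<le> ereal T'"
      by (simp add: not_frequently not_less)
    then have "tau \<alpha> \<le> ereal T'" unfolding tau_def by (rule Limsup_bounded)
    with T'(2) show False by simp
  qed
  have "filterlim (\<lambda>k. ln (Q (Suc k))) at_top sequentially"
    using ln_Q_at_top by (subst filterlim_sequentially_Suc)
  then have ev2: "\<forall>\<^sub>F k in sequentially. ln (Q (Suc k)) > T' * C / (T' - T)"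
    by (simp add: filterlim_at_top_dense)
  have "\<exists>\<^sub>F k in sequentially. ln (Q (Suc (Suc k))) > T * ln (Q (Suc k))"
    using frequently_eventually_frequently[OF fr eventually_conj[OF ev2 ln_q_pos]]
  proof (rule frequently_elim1, elim conjE)
    fix k assume k: "ln (q (Suc k)) / ln (q k) > T'" "ln (Q (Suc k)) > T' * C / (T' - T)" "ln (q k) > 0"
    have "T' * C < (T' - T) * ln (Q (Suc k))" using k(2) T'(1) by (simp add: divide_less_eq mult.commute)
    then have "T * ln (Q (Suc k)) < T' * (ln (Q (Suc k)) - C)" by (simp add: algebra_simps)
    also have "\<dots> \<le> T' * ln (q k)"
      using ln_q_bounds(2)[of k] T' assms(2) by (intro mult_left_mono) (auto simp: C_def)
    also have "\<dots> < ln (q (Suc k))" using k by (simp add: less_divide_eq)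
    also have "\<dots> \<le> ln (Q (Suc (Suc k)))" by (rule ln_q_bounds(1))
    finally show "ln (Q (Suc (Suc k))) > T * ln (Q (Suc k))" .
  qed
  then have "\<exists>k\<ge>n. ln (Q (Suc k)) > T * ln (Q k)" for n
    unfolding frequently_sequentially by (meson le_Suc_eq)
  then show ?thesis unfolding frequently_sequentially by blast
qed

text \<open>The abscissa -1 / \<tau> as a real number; for \<tau> = \<infinity> the extended
  quotient is 0, so the edge is the imaginary axis.\<close>

definition edge :: real where "edge = real_of_ereal (- (1 / tau \<alpha>))"

lemma edge: "- (1 / tau \<alpha>) = ereal edge" "-1 \<le> edge" "edge \<le> 0" "tau \<alpha> > 1 \<Longrightarrow> edge > -1"
proof -
  have "- (1 / tau \<alpha>) = ereal edge \<and> -1 \<le> edge \<and> edge \<le> 0 \<and> (tau \<alpha> > 1 \<longrightarrow> edge > -1)"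
  proof (cases "tau \<alpha>")
    case (real r)
    then have r: "r \<ge> 1" using tau_ge1 by simp
    have "- (1 / tau \<alpha>) = ereal (- (1 / r))" using real r by (simp add: one_ereal_def)
    then have "edge = - (1 / r)" by (simp add: edge_def)
    then show ?thesis using real r by (auto simp: one_ereal_def)
  next
    case PInf
    then show ?thesis by (simp add: edge_def)
  next
    case MInf
    then show ?thesis using tau_ge1 by simp
  qed
  then show "- (1 / tau \<alpha>) = ereal edge" "-1 \<le> edge" "edge \<le> 0" "tau \<alpha> > 1 \<Longrightarrow> edge > -1" by auto
qed

lemma tau_less_of_edge_less: "edge < \<sigma> \<Longrightarrow> \<sigma> < 0 \<Longrightarrow> tau \<alpha> < ereal (- 1 / \<sigma>)"
proof (cases "tau \<alpha>")
  case (real r)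
  assume \<sigma>: "edge < \<sigma>" "\<sigma> < 0"
  have r: "r \<ge> 1" using tau_ge1 real by simp
  have "edge = - (1 / r)" using real r by (simp add: edge_def one_ereal_def)
  then have "- \<sigma> < 1 / r" using \<sigma> by simp
  then have "r < 1 / (- \<sigma>)" using r \<sigma> by (simp add: field_simps)
  then show ?thesis using real by simp
next
  case PInf
  assume \<sigma>: "edge < \<sigma>" "\<sigma> < 0"
  then show ?thesis using PInf by (simp add: edge_def)
next
  case MInf
  then show ?thesis using tau_ge1 by simp
qed

text \<open>If \<open>Q (Suc k)\<close> \<le> \<open>Q k\<close>^T, then for \<sigma> \<le> 0 the
  k-th term is at most \<open>Q k\<close>^(-(1 + T \<sigma>)), and the exponent is negative because
  \<sigma> > -1 / T.\<close>

lemma lead_boundI: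
  assumes T: "\<forall>\<^sub>F k in sequentially. k \<in> I \<longrightarrow> ln (Q (Suc k)) \<le> T * ln (Q k)" and "T > 0" and \<sigma>: "\<sigma> > - 1 / T" "\<sigma> \<le> 0"
  shows "lead_bound I \<sigma>"
  unfolding lead_bound_def
proof (rule summable_comparison_test_ev)
  define e where "e = 1 + T * \<sigma>"
  have "e > 0" using \<sigma>(1) assms(2) by (simp add: e_def field_simps)
  then show "summable (\<lambda>k. Q k powr (-e))" by (rule summable_Q_powr)
  show "\<forall>\<^sub>F k in sequentially. norm (if k \<in> I then Q (Suc k) powr (-\<sigma>) / Q k else 0) \<le> Q k powr (-e)"
    using T
  proof eventually_elim
    case (elim k)
    have "Q (Suc k) powr (-\<sigma>) / Q k \<le> Q k powr (-e)" if "k \<in> I"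
    proof -
      have "-\<sigma> * ln (Q (Suc k)) \<le> -\<sigma> * (T * ln (Q k))" using elim that \<sigma> by (intro mult_left_mono) auto
      then have "exp (-\<sigma> * ln (Q (Suc k)) - ln (Q k)) \<le> exp (-e * ln (Q k))" by (simp add: e_def algebra_simps)
      moreover have "Q (Suc k) powr (-\<sigma>) / Q k = exp (-\<sigma> * ln (Q (Suc k)) - ln (Q k))"
        using Q_pos[of k] Q_pos[of "Suc k"] by (simp add: powr_def exp_diff less_imp_neq[THEN not_sym] del: Q_pos)
      ultimately show ?thesis using Q_pos[of k] by (simp add: powr_def less_imp_neq[THEN not_sym] del: Q_pos)
    qed
    then show ?case by auto
  qed
qed

lemma lead_bound_edge:
  assumes "\<sigma> > edge"
  shows "lead_bound I \<sigma>"
proof (cases "\<sigma> \<ge> 0")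
  case True
  then show ?thesis by (rule lead_bound_pos)
next
  case False
  then obtain T where T: "tau \<alpha> < ereal T" "T < - 1 / \<sigma>"
    using ereal_dense2[OF tau_less_of_edge_less[OF assms]] by auto
  have "T > 0" proof -
    have "ereal 1 < ereal T" using le_less_trans[OF tau_ge1 T(1)] by (simp add: one_ereal_def)
    then show ?thesis by simp
  qed
  moreover have "\<sigma> > - 1 / T" using T(2) False \<open>T > 0\<close> by (simp add: field_simps)
  ultimately show ?thesis
    using False tau_upper[OF T(1)] by (intro lead_boundI[of I T]) (auto elim: eventually_mono)
qed

lemma lead_sum_holomorphic_edge: "lead_sum I holomorphic_on {s. Re s > edge}"
proof (rule lead_sum_holomorphic[OF open_halfspace_Re_gt])
  fix s assume "s \<in> {s. Re s > edge}"
  then have "edge < Re s" by simp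
  then obtain l where "edge < l" "l < Re s" using dense by blast
  then show "\<exists>l<Re s. lead_bound I l" using lead_bound_edge by blast
qed

text \<open>The classical formula for \<alpha> as the Moebius image of a complete quotient, with
  denominators cleared.\<close>

lemma alpha_eq: "\<alpha> * (\<theta> (Suc (Suc k)) * q (Suc k) + q k) = \<theta> (Suc (Suc k)) * Q (Suc (Suc k)) + Q (Suc k)"
proof (induction k)
  case 0
  have e: "\<theta> 1 = of_int (cf_digit \<alpha> 1) + 1 / \<theta> 2" "\<alpha> = of_int (cf_digit \<alpha> 0) + 1 / \<theta> 1"
    using theta_eq[of 1] theta_eq[of 0] by (simp_all add: numeral_2_eq_2)
  have nz: "\<theta> 1 \<noteq> 0" "\<theta> 2 \<noteq> 0" using theta_gt1[of 1] theta_gt1[of 2] by auto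
  have 1: "\<theta> 2 * of_int (cf_digit \<alpha> 1) + 1 = \<theta> 2 * \<theta> 1" using arg_cong[OF e(1), of "\<lambda>x. \<theta> 2 * x"] nz by (simp add: algebra_simps)
  have "\<alpha> * (\<theta> 2 * q 1 + q 0) = \<alpha> * (\<theta> 2 * \<theta> 1)" using 1 by simp
  also have "\<dots> = \<theta> 2 * (\<alpha> * \<theta> 1)" by simp
  also have "\<alpha> * \<theta> 1 = of_int (cf_digit \<alpha> 0) * \<theta> 1 + 1"
    using arg_cong[OF e(2), of "\<lambda>x. x * \<theta> 1"] nz by (simp add: algebra_simps)
  also have "\<theta> 2 * (of_int (cf_digit \<alpha> 0) * \<theta> 1 + 1) = of_int (cf_digit \<alpha> 0) * (\<theta> 2 * \<theta> 1) + \<theta> 2" by (simp add: algebra_simps)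
  also have "\<dots> = \<theta> 2 * Q 2 + Q 1" unfolding 1[symmetric] by (simp add: num_seq_Suc numeral_2_eq_2 algebra_simps)
  finally show ?case by (simp add: numeral_2_eq_2)
next
  case (Suc k)
  let ?t = "\<theta> (Suc (Suc (Suc k)))"
  define a where "a = real_of_int (cf_digit \<alpha> (Suc (Suc k)))"
  have t: "?t \<noteq> 0" using theta_gt1[of "Suc (Suc (Suc k))"] by auto
  have e: "\<theta> (Suc (Suc k)) = a + 1 / ?t" using theta_eq[of "Suc (Suc k)"] by (simp add: a_def)
  have q: "q (Suc (Suc k)) = a * q (Suc k) + q k" by (simp add: a_def)
  have Q: "Q (Suc (Suc (Suc k))) = a * Q (Suc (Suc k)) + Q (Suc k)" by (simp add: a_def num_seq_Suc_Suc)
  have "\<alpha> * (?t * q (Suc (Suc k)) + q (Suc k)) = ?t * (\<alpha> * (\<theta> (Suc (Suc k)) * q (Suc k) + q k))"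
    unfolding q e using t by (simp add: field_simps)
  also have "\<dots> = ?t * (\<theta> (Suc (Suc k)) * Q (Suc (Suc k)) + Q (Suc k))" by (simp only: Suc)
  also have "\<dots> = ?t * Q (Suc (Suc (Suc k))) + Q (Suc (Suc k))"
    unfolding Q e using t by (simp add: field_simps)
  finally show ?case .
qed

lemma conv_det_real: "Q (Suc (Suc k)) * q k - Q (Suc k) * q (Suc k) = (-1) ^ k"
  unfolding num_seq_Suc using arg_cong[OF conv_det[of \<alpha> k], of real_of_int] by simp

text \<open>By \<open>alpha_eq\<close> and the determinant identity, the error times \<theta>
  q_(k+1) + q_k has modulus exactly 1, and \<theta> > 1.\<close>

lemma conv_error_bound: "\<bar>\<alpha> * q (Suc k) - Q (Suc (Suc k))\<bar> \<le> 1 / q (Suc k)"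
proof -
  let ?t = "\<theta> (Suc (Suc k))"
  have t: "?t > 1" by (rule theta_gt1)
  have "(\<alpha> * q (Suc k) - Q (Suc (Suc k))) * (?t * q (Suc k) + q k) =
      q (Suc k) * (\<alpha> * (?t * q (Suc k) + q k)) - Q (Suc (Suc k)) * (?t * q (Suc k) + q k)" by (simp add: algebra_simps)
  also have "\<dots> = - ((-1) ^ k)" unfolding alpha_eq using conv_det_real[of k] by (simp add: algebra_simps)
  finally have "\<bar>\<alpha> * q (Suc k) - Q (Suc (Suc k))\<bar> * \<bar>?t * q (Suc k) + q k\<bar> = 1"
    by (simp flip: abs_mult add: power_abs)
  moreover have "q (Suc k) \<le> \<bar>?t * q (Suc k) + q k\<bar>"
  proof -
    have "1 * q (Suc k) \<le> ?t * q (Suc k)" using t q_ge1[of "Suc k"] by (intro mult_right_mono) auto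
    then show ?thesis using q_ge1[of k] by linarith
  qed
  ultimately have "\<bar>\<alpha> * q (Suc k) - Q (Suc (Suc k))\<bar> * q (Suc k) \<le> 1"
    by (metis abs_ge_zero mult_left_mono)
  then show ?thesis using q_ge1[of "Suc k"] by (simp add: le_divide_eq)
qed

text \<open>At s = 1 the series telescopes: by the determinant identity its terms are the
  differences of consecutive reciprocals of convergents, which tend to 1 / \<alpha>. This value is
  the residue.\<close>

lemma lead_sum_1: "lead_sum UNIV 1 = of_real (1 / \<alpha>)"
proof -
  have partial: "(\<Sum>k<Suc n. (-1) ^ k / (Q (Suc k) * Q k)) = q n / Q (Suc n)" for n
  proof (induction n)
    case (Suc n)
    have "q (Suc n) / Q (Suc (Suc n)) - q n / Q (Suc n) = (-1) ^ Suc n / (Q (Suc (Suc n)) * Q (Suc n))"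
      using conv_det_real[of n] Q_pos[of "Suc n"] Q_pos[of "Suc (Suc n)"]
      by (simp add: field_simps less_imp_neq[THEN not_sym] del: Q_pos)
    then show ?case using Suc by simp
  qed simp
  have "(\<lambda>n. \<alpha> * (q (Suc n) / Q (Suc (Suc n)))) \<longlonglongrightarrow> 1"
  proof (rule LIM_zero_cancel, rule Lim_null_comparison)
    show "(\<lambda>n. Q (Suc (Suc n)) powr (-1)) \<longlonglongrightarrow> 0"
      by (intro LIMSEQ_Suc[of "\<lambda>n. Q (Suc n) powr (-1)"] LIMSEQ_Suc[of "\<lambda>n. Q n powr (-1)"]
            summable_LIMSEQ_zero summable_Q_powr) simp
    have "norm (\<alpha> * (q (Suc n) / Q (Suc (Suc n))) - 1) \<le> Q (Suc (Suc n)) powr (-1)" for n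
    proof -
      have "\<alpha> * (q (Suc n) / Q (Suc (Suc n))) - 1 = (\<alpha> * q (Suc n) - Q (Suc (Suc n))) / Q (Suc (Suc n))"
        using Q_pos[of "Suc (Suc n)"] by (simp add: field_simps less_imp_neq[THEN not_sym] del: Q_pos)
      moreover have "\<bar>\<alpha> * q (Suc n) - Q (Suc (Suc n))\<bar> \<le> 1"
      proof -
        have "1 / q (Suc n) \<le> 1" using q_ge1[of "Suc n"] by (simp add: divide_le_eq)
        then show ?thesis using conv_error_bound[of n] by linarith
      qed
      ultimately show ?thesis by (simp add: powr_minus divide_inverse abs_mult)
    qed
    then show "\<forall>\<^sub>F n in sequentially. norm (\<alpha> * (q (Suc n) / Q (Suc (Suc n))) - 1) \<le> Q (Suc (Suc n)) powr (-1)" by simp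
  qed
  then have "(\<lambda>n. (1 / \<alpha>) * (\<alpha> * (q (Suc n) / Q (Suc (Suc n))))) \<longlonglongrightarrow> (1 / \<alpha>) * 1" by (intro tendsto_mult_left)
  then have "(\<lambda>n. q (Suc n) / Q (Suc (Suc n))) \<longlonglongrightarrow> 1 / \<alpha>" using gt1 by simp
  then have "(\<lambda>n. \<Sum>k<Suc (Suc n). (-1) ^ k / (Q (Suc k) * Q k)) \<longlonglongrightarrow> 1 / \<alpha>" unfolding partial .
  then have "(\<lambda>k. (-1) ^ k / (Q (Suc k) * Q k)) sums (1 / \<alpha>)"
    unfolding sums_def by (rule LIMSEQ_imp_Suc[OF LIMSEQ_imp_Suc])
  then have "(\<lambda>k. complex_of_real ((-1) ^ k / (Q (Suc k) * Q k))) sums of_real (1 / \<alpha>)" by (rule sums_of_real)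
  then show ?thesis
    unfolding lead_sum_def by (simp add: sums_iff powr_minus divide_inverse mult_ac)
qed

text \<open>The constant c provides for the summand 1 of the Sturmian series and is absorbed into B.
  The explicit formula is among the conclusions because the boundary argument has to solve it for
  the leading series.\<close>

lemma continuation_half_plane:
  assumes w: "0 \<le> w" "w \<le> 1" and f: "\<And>s. Re s > 1 \<Longrightarrow> f s = c + shifted_zeta w s"
  obtains g A B where "\<And>s. Re s > 1 \<Longrightarrow> g s = f s" "g holomorphic_on {s. Re s > edge} - {1}"
    "simple_pole g 1" "residue g 1 = of_real (1 / \<alpha>)"
    "A holomorphic_on {s. Re s > -1}" "B holomorphic_on {s. Re s > -1}"
    "\<And>s. g s = lead_sum UNIV s * (zeta_reg (s - 1) / (s - 1)) + A s * zeta_reg s + B s"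
proof -
  obtain A B where AB: "A holomorphic_on {s. Re s > -1}" "B holomorphic_on {s. Re s > -1}"
    "\<And>s. Re s > 1 \<Longrightarrow> shifted_zeta w s = lead_sum UNIV s * (zeta_reg (s - 1) / (s - 1)) + A s * zeta_reg s + B s"
    using shifted_zeta_structure[OF w] by metis
  let ?S = "{s. Re s > edge}"
  have hAB: "A holomorphic_on ?S" "B holomorphic_on ?S"
    using edge(2) by (auto intro!: holomorphic_on_subset[OF AB(1)] holomorphic_on_subset[OF AB(2)])
  define B' where "B' s = B s + c" for s
  define g where "g s = lead_sum UNIV s * (zeta_reg (s - 1) / (s - 1)) + A s * zeta_reg s + B' s" for s
  define F where "F s = lead_sum UNIV s * zeta_reg (s - 1) + (s - 1) * (A s * zeta_reg s + B' s)" for s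
  have F: "F holomorphic_on ?S" unfolding F_def B'_def
    by (intro holomorphic_intros lead_sum_holomorphic_edge hAB)
  have F1: "F 1 = of_real (1 / \<alpha>)" by (simp add: F_def zeta_reg_0 lead_sum_1)
  have gF: "g s = F s / (s - 1)" if "s \<noteq> 1" for s
    using that by (simp add: g_def F_def field_simps)
  have pole: "simple_pole g 1" "residue g 1 = F 1"
  proof -
    have "1 \<in> ?S" "F 1 \<noteq> 0" using edge(3) gt1 F1 by auto
    from simple_pole_divide[OF open_halfspace_Re_gt[of edge] this(1) F this(2), of g] gF
    show "simple_pole g 1" "residue g 1 = F 1" by auto
  qed
  have "(\<lambda>s. F s / (s - 1)) holomorphic_on ?S - {1}"
    by (intro holomorphic_intros holomorphic_on_subset[OF F]) auto
  then have "g holomorphic_on ?S - {1}" by (rule holomorphic_transform) (auto simp: gF)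
  moreover have "B' holomorphic_on {s. Re s > -1}" unfolding B'_def by (intro holomorphic_intros AB)
  moreover have "g s = f s" if "Re s > 1" for s using f[OF that] AB(3)[OF that] by (simp add: g_def B'_def)
  ultimately show ?thesis using that[of g A B'] pole F1 AB(1) by (simp add: g_def)
qed

end

section \<open>Lacunary exponential series\<close>

lemma fact_le_Stirling: "n \<ge> 1 \<Longrightarrow> fact n \<le> exp 1 * real n * (real n ^ n * exp (- real n))"
proof (induction n rule: dec_induct)
  case (step n)
  have n: "real n > 0" using step by simp
  \<comment> \<open>The induction step amounts to (n / (n + 1))^(n + 1) \<le> 1 / e.\<close>
  have "ln (real n / real (Suc n)) \<le> real n / real (Suc n) - 1" using n by (intro ln_le_minus_one) auto
  also have "\<dots> = - (1 / real (Suc n))" using n by (simp add: field_simps)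
  finally have "real (Suc n) * ln (real n / real (Suc n)) \<le> real (Suc n) * (- (1 / real (Suc n)))"
    by (intro mult_left_mono) auto
  then have "real (Suc n) * ln (real n / real (Suc n)) \<le> -1" by simp
  then have "exp (real (Suc n) * ln (real n / real (Suc n))) \<le> exp (-1)" by simp
  also have "exp (real (Suc n) * ln (real n / real (Suc n))) = (real n / real (Suc n)) ^ Suc n"
    using n by (simp add: exp_of_nat_mult del: of_nat_Suc power_Suc)
  finally have "real n ^ Suc n \<le> exp (-1) * real (Suc n) ^ Suc n"
    using n by (simp add: power_divide divide_le_eq del: power_Suc of_nat_Suc)
  then have *: "real n * real n ^ n \<le> exp (-1) * (real (Suc n) * real (Suc n) ^ n)" by simp
  have "fact (Suc n) = real (Suc n) * fact n" by simp
  also have "\<dots> \<le> real (Suc n) * (exp 1 * real n * (real n ^ n * exp (- real n)))"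
    using step by (intro mult_left_mono) auto
  also have "\<dots> = exp 1 * real (Suc n) * exp (- real n) * (real n * real n ^ n)" by (simp add: mult_ac)
  also have "\<dots> \<le> exp 1 * real (Suc n) * exp (- real n) * (exp (-1) * (real (Suc n) * real (Suc n) ^ n))"
    using * by (intro mult_left_mono) auto
  also have "\<dots> = exp 1 * real (Suc n) * (real (Suc n) ^ Suc n * exp (- real (Suc n)))"
    by (simp add: exp_diff exp_minus field_simps exp_add)
  finally show ?case .
qed (simp flip: exp_add)

text \<open>The convex function x - 1 - ln x has its only zero at 1, so away from 1 it is bounded
  below by a positive constant and, for large x, by a multiple of x. Multiplied by \<mu>, it is the
  logarithm of the ratio between the peak of u^\<mu> e^(-u) at u = \<mu> and its value at u = x
  \<mu>.\<close>

lemma entropy_gap: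
  fixes y :: real
  assumes "y > 1"
  shows "\<exists>c>0. \<forall>x>0. x \<ge> y \<or> x \<le> 1 / y \<longrightarrow> x - 1 - ln x \<ge> c * (1 + x)"
proof -
  define c1 where "c1 = 1 - (1 + ln y) / y"
  define c2 where "c2 = ln y - 1 + 1 / y"
  have "ln y < y - 1" using ln_eq_minus_one[of y] ln_le_minus_one[of y] assms by fastforce
  then have c1: "c1 > 0" using assms by (simp add: c1_def field_simps)
  have "ln (1 / y) < 1 / y - 1" using ln_eq_minus_one[of "1 / y"] ln_le_minus_one[of "1 / y"] assms by fastforce
  then have c2: "c2 > 0" using assms by (simp add: c2_def ln_div)
  define c where "c = min c1 c2 / 2"
  have "x - 1 - ln x \<ge> c * (1 + x)" if x: "x > 0" "x \<ge> y \<or> x \<le> 1 / y" for x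
    using x(2)
  proof
    assume xy: "x \<ge> y"
    have "ln x = ln y + ln (x / y)" using x(1) assms by (simp add: ln_div)
    also have "\<dots> \<le> ln y + (x / y - 1)" using x(1) assms ln_le_minus_one[of "x / y"] by simp
    finally have 1: "ln x \<le> ln y + x / y - 1" by simp
    have "ln y * 1 \<le> ln y * (x / y)" using xy assms by (intro mult_left_mono) (auto simp: le_divide_eq)
    moreover have "x * c1 = x - x / y - ln y * (x / y)" using assms by (simp add: c1_def field_simps)
    ultimately have "x * c1 \<le> x - 1 - ln x" using 1 by linarith
    moreover have "c * (1 + x) \<le> c1 / 2 * (2 * x)"
      using xy assms c1 c2 by (intro mult_mono) (auto simp: c_def)
    ultimately show ?thesis by (simp add: mult.commute)
  next
    assume xy: "x \<le> 1 / y"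
    have "ln x = ln (x * y) - ln y" using x(1) assms by (simp add: ln_mult)
    also have "\<dots> \<le> x * y - 1 - ln y" using x(1) assms ln_le_minus_one[of "x * y"] by simp
    finally have 1: "ln x \<le> x * y - 1 - ln y" .
    have "x * (y - 1) \<le> 1 / y * (y - 1)" using xy assms by (intro mult_right_mono) auto
    also have "\<dots> = 1 - 1 / y" using assms by (simp add: field_simps)
    finally have "c2 \<le> x - 1 - ln x" using 1 by (simp add: c2_def algebra_simps)
    moreover have "x \<le> 1" using xy assms by (smt (verit) divide_le_eq_1_pos)
    then have "c * (1 + x) \<le> c2 / 2 * 2"
      using x(1) c1 c2 by (intro mult_mono) (auto simp: c_def)
    ultimately show ?thesis by simp
  qed
  then show ?thesis using c1 c2 by (intro exI[of _ c]) (auto simp: c_def)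
qed

lemma higher_deriv_exp_sum:
  "(deriv ^^ m) (\<lambda>u. \<Sum>k\<in>S. a k * exp (c k * u)) = (\<lambda>u::complex. \<Sum>k\<in>S. a k * c k ^ m * exp (c k * u))"
proof (induction m)
  case (Suc m)
  have "deriv (\<lambda>u. \<Sum>k\<in>S. a k * c k ^ m * exp (c k * u)) z = (\<Sum>k\<in>S. a k * c k ^ Suc m * exp (c k * z))" for z
    by (rule DERIV_imp_deriv) (auto intro!: derivative_eq_intros sum.cong)
  then show ?case unfolding funpow.simps o_apply Suc by (rule ext)
qed simp

text \<open>The partial sums converge uniformly on the half-plane Re u > l, so derivatives of every
  order may be taken termwise.\<close>

lemma exp_series_higher_deriv:
  fixes \<mu> :: "nat \<Rightarrow> real" and b :: "nat \<Rightarrow> complex"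
  assumes summ: "summable (\<lambda>k. norm (b k) * exp (-\<mu> k * l))" and l: "l < r" and \<mu>: "\<And>k. \<mu> k \<ge> 0"
    and f: "\<And>u. Re u > l \<Longrightarrow> f u = (\<Sum>k. b k * exp (-of_real (\<mu> k) * u))"
  shows "(\<lambda>k. b k * (-of_real (\<mu> k)) ^ m * exp (-of_real (\<mu> k) * of_real r)) sums (deriv ^^ m) f (of_real r)"
proof -
  let ?A = "{u::complex. Re u > l}"
  have le: "norm (b k * exp (-of_real (\<mu> k) * u)) \<le> norm (b k) * exp (-\<mu> k * l)" if "u \<in> ?A" for u k
    using that \<mu>[of k] by (auto simp: norm_mult intro!: mult_left_mono)
  have "uniform_limit ?A (\<lambda>n u. \<Sum>k<n. b k * exp (-of_real (\<mu> k) * u)) (\<lambda>u. \<Sum>k. b k * exp (-of_real (\<mu> k) * u)) sequentially"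
    by (rule Weierstrass_m_test[OF le summ])
  then have ul: "uniform_limit ?A (\<lambda>n u. \<Sum>k<n. b k * exp (-of_real (\<mu> k) * u)) f sequentially"
    by (rule uniform_limit_cong'[THEN iffD1, rotated 2]) (auto simp: f)
  have "(\<lambda>n. (deriv ^^ m) (\<lambda>u. \<Sum>k<n. b k * exp (-of_real (\<mu> k) * u)) (of_real r)) \<longlonglongrightarrow> (deriv ^^ m) f (of_real r)"
    by (rule higher_deriv_complex_uniform_limit[OF ul])
       (use l in \<open>auto intro!: holomorphic_intros always_eventually open_halfspace_Re_gt\<close>)
  then show ?thesis unfolding higher_deriv_exp_sum sums_def .
qed

text \<open>
  At the point \<open>1\<close>, the Taylor coefficient of order \<open>n = \<lfloor>\<mu>\<^sub>N\<rfloor>\<close> of a lacunary series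
  \<open>\<Sum> b\<^sub>k e\<^bsup>-\<mu>\<^sub>k u\<^esup>\<close> is dominated by its term \<open>k = N\<close>, because \<open>\<mu>\<^sup>n e\<^bsup>-\<mu>\<^esup>\<close> has a sharp peak at
  \<open>\<mu> = n\<close>. This contradicts Cauchy's estimate on a disc of radius larger than \<open>1\<close>.
\<close>

lemma lacunary_no_continuation:
  fixes \<mu> :: "nat \<Rightarrow> real" and b :: "nat \<Rightarrow> complex" and I :: "nat set"
  assumes \<delta>: "\<delta> > 0" and gap: "\<And>i j. i \<in> I \<Longrightarrow> j \<in> I \<Longrightarrow> i < j \<Longrightarrow> \<mu> j \<ge> (1 + \<delta>) * \<mu> i"
    and m0: "m0 > 0" "\<And>k. k \<in> I \<Longrightarrow> \<mu> k \<ge> m0" and \<mu>0: "\<And>k. \<mu> k \<ge> 0"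
    and summ: "\<And>\<eta>. \<eta> > 0 \<Longrightarrow> summable (\<lambda>k. exp (-\<eta> * \<mu> k))"
    and inf: "filterlim \<mu> at_top sequentially"
    and b0: "\<And>k. k \<notin> I \<Longrightarrow> b k = 0"
    and up: "\<And>\<epsilon>. \<epsilon> > 0 \<Longrightarrow> \<exists>C. \<forall>k\<in>I. norm (b k) \<le> C * exp (\<epsilon> * \<mu> k)"
    and low: "\<And>\<epsilon>. \<epsilon> > 0 \<Longrightarrow> \<exists>\<^sub>F k in sequentially. k \<in> I \<and> norm (b k) \<ge> exp (-\<epsilon> * \<mu> k)"
    and R0: "R0 > 0" and holo: "f holomorphic_on ({u. Re u > 0} \<union> ball 0 R0)"
    and f: "\<And>u. Re u > 0 \<Longrightarrow> f u = (\<Sum>k. b k * exp (-of_real (\<mu> k) * u))"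
  shows False
proof -
  \<comment> \<open>For Re u \<le> 0 the square of |u - 1| is at least 1 + |u|^2, so the part of the
    disc about 1 of this radius outside the right half-plane satisfies |u|^2 \<le> R0^2 / 2 and lies
    in the disc of holomorphy about 0.\<close>
  define R where "R = sqrt (1 + R0\<^sup>2 / 2)"
  have R: "R > 1" "R\<^sup>2 = 1 + R0\<^sup>2 / 2" using R0 by (auto simp: R_def)
  have sub: "cball 1 R \<subseteq> {u. Re u > 0} \<union> ball 0 R0"
  proof
    fix u :: complex assume u: "u \<in> cball 1 R"
    show "u \<in> {u. Re u > 0} \<union> ball 0 R0"
    proof (cases "Re u > 0")
      case False
      have "norm (u - 1) ^ 2 \<le> R\<^sup>2" using u R(1) by (intro power_mono) (auto simp: dist_norm norm_minus_commute)
      moreover have "norm (u - 1) ^ 2 = norm u ^ 2 - 2 * Re u + 1"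
        unfolding cmod_power2 by (simp add: power2_eq_square algebra_simps)
      ultimately have "norm u ^ 2 \<le> R0\<^sup>2 / 2" using R(2) False by linarith
      also have "\<dots> < R0\<^sup>2" using R0 by simp
      finally have "norm u < R0" using R0 by (simp add: power_less_imp_less_base)
      then show ?thesis by simp
    qed simp
  qed
  have cont: "continuous_on (cball 1 R) f"
    by (rule holomorphic_on_imp_continuous_on[OF holomorphic_on_subset[OF holo sub]])
  then have "bounded (f ` cball 1 R)" by (intro compact_imp_bounded compact_continuous_image) auto
  then obtain M' where M': "\<forall>y\<in>f ` cball 1 R. norm y \<le> M'" unfolding bounded_iff by blast
  define M where "M = max M' 1"
  have M: "norm (f u) \<le> M" if "u \<in> cball 1 R" for u using M' that by (auto simp: M_def le_max_iff_disj)
  have M0: "M > 0" by (simp add: M_def)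
  have Cauchy: "norm ((deriv ^^ n) f 1) \<le> fact n * M / R ^ n" for n
  proof (rule Cauchy_inequality[OF _ cont])
    show "f holomorphic_on ball 1 R"
      by (rule holomorphic_on_subset[OF holo]) (use sub ball_subset_cball in blast)
    show "norm (f x) \<le> M" if "norm (1 - x) = R" for x
      using that by (intro M) (auto simp: dist_norm)
  qed (use R in auto)
  obtain c where c: "c > 0" "\<And>x. x > 0 \<Longrightarrow> x \<ge> 1 + \<delta> \<or> x \<le> 1 / (1 + \<delta>) \<Longrightarrow> x - 1 - ln x \<ge> c * (1 + x)"
    using entropy_gap[of "1 + \<delta>"] \<delta> by auto
  \<comment> \<open>The first bound leaves half of the gap c for the decay of the terms k \<noteq>
    N; the second leaves a factor sqrt R ^ n of the gain R ^ n in Cauchy's estimate.\<close>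
  define \<epsilon> where "\<epsilon> = min (c / 2) (ln R / 2)"
  have \<epsilon>: "\<epsilon> > 0" "\<epsilon> \<le> c / 2" "\<epsilon> \<le> ln R / 2" using c R by (auto simp: \<epsilon>_def)
  obtain C' where C': "\<forall>k\<in>I. norm (b k) \<le> C' * exp (\<epsilon> * \<mu> k)" using up[OF \<epsilon>(1)] by blast
  define C where "C = max C' 1"
  have C: "norm (b k) \<le> C * exp (\<epsilon> * \<mu> k)" for k
  proof (cases "k \<in> I")
    case True
    then have "norm (b k) \<le> C' * exp (\<epsilon> * \<mu> k)" using C' by blast
    also have "\<dots> \<le> C * exp (\<epsilon> * \<mu> k)" by (intro mult_right_mono) (auto simp: C_def)
    finally show ?thesis .
  qed (auto simp: b0 C_def)
  have C0: "C > 0" by (simp add: C_def)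
  define \<eta> where "\<eta> = c / 2"
  define S where "S = (\<Sum>k. exp (-\<eta> * \<mu> k))"
  have S: "summable (\<lambda>k. exp (-\<eta> * \<mu> k))" using c by (intro summ) (auto simp: \<eta>_def)
  have S0: "S \<ge> 0" unfolding S_def by (intro suminf_nonneg S) auto
  have \<eta>0: "\<eta> > 0" using c by (simp add: \<eta>_def)

  \<comment> \<open>The comparison is made with the real exponent \<mu>_N, where
    \<open>entropy_gap\<close> applies to x = \<mu>_k / \<mu>_N. Passing to the integer n costs
    x^(-t) with 0 \<le> t \<le> 1, which is at most 1 + \<mu>_N / m0.\<close>
  have peak: "\<mu> k ^ n * exp (-\<mu> k) \<le> (\<mu> N ^ n * exp (-\<mu> N)) * ((1 + \<mu> N / m0) * exp (-c * (\<mu> N + \<mu> k)))"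
    if kN: "k \<in> I" "N \<in> I" "k \<noteq> N" and n: "n = nat \<lfloor>\<mu> N\<rfloor>" for k N n
  proof -
    have pos: "\<mu> k > 0" "\<mu> N > 0" using m0 kN by (auto intro: less_le_trans)
    define x where "x = \<mu> k / \<mu> N"
    define t where "t = \<mu> N - real n"
    have t: "0 \<le> t" "t \<le> 1" using pos unfolding t_def n by linarith+
    have x: "x > 0" using pos by (simp add: x_def)
    have "x \<ge> 1 + \<delta> \<or> x \<le> 1 / (1 + \<delta>)"
    proof (cases "k < N")
      case True
      then have "(1 + \<delta>) * \<mu> k \<le> \<mu> N" using gap kN by blast
      then show ?thesis using pos \<delta> by (simp add: x_def field_simps)
    next
      case False
      then have "(1 + \<delta>) * \<mu> N \<le> \<mu> k" using gap kN by (meson linorder_neqE_nat)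
      then show ?thesis using pos by (simp add: x_def field_simps)
    qed
    from mult_left_mono[OF c(2)[OF x this], of "\<mu> N"] pos
    have "\<mu> N * (c * (1 + x)) \<le> \<mu> N * (x - 1 - ln x)" by simp
    moreover have "\<mu> N * (c * (1 + x)) = c * (\<mu> N + \<mu> k)" "\<mu> N * (x - 1 - ln x) = \<mu> k - \<mu> N - \<mu> N * ln x"
      using pos by (auto simp: x_def field_simps)
    ultimately have 1: "\<mu> N * ln x - \<mu> k \<le> - \<mu> N - c * (\<mu> N + \<mu> k)" by linarith
    have "exp (- t * ln x) \<le> 1 + \<mu> N / m0"
    proof (cases "ln x \<ge> 0")
      case True
      then have "exp (- t * ln x) \<le> exp 0" using t by (subst exp_le_cancel_iff) (simp add: mult_nonneg_nonneg)
      moreover have "0 \<le> \<mu> N / m0" using pos m0 by simp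
      ultimately show ?thesis unfolding exp_zero by linarith
    next
      case False
      then have "- t * ln x \<le> - ln x" using t by (simp add: mult_left_le_one_le)
      then have "exp (- t * ln x) \<le> exp (- ln x)" by simp
      also have "\<dots> = \<mu> N / \<mu> k" using x by (simp add: exp_minus x_def)
      also have "\<dots> \<le> \<mu> N / m0" using pos m0 kN by (intro divide_left_mono) auto
      finally show ?thesis by simp
    qed
    then have "exp (- t * ln x) * exp (\<mu> N * ln x - \<mu> k) \<le> (1 + \<mu> N / m0) * exp (- \<mu> N - c * (\<mu> N + \<mu> k))"
      using 1 pos m0 by (intro mult_mono) auto
    moreover have "\<mu> k ^ n * exp (-\<mu> k) = \<mu> N ^ n * (exp (- t * ln x) * exp (\<mu> N * ln x - \<mu> k))"
    proof -
      have "x ^ n = exp (real n * ln x)" using x by (simp add: exp_of_nat_mult)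
      then have "x ^ n * exp (-\<mu> k) = exp (- t * ln x) * exp (\<mu> N * ln x - \<mu> k)"
        by (simp add: t_def algebra_simps flip: exp_add)
      moreover have "\<mu> k ^ n = \<mu> N ^ n * x ^ n" using pos by (simp add: x_def power_divide)
      ultimately show ?thesis by simp
    qed
    ultimately have "\<mu> k ^ n * exp (-\<mu> k) \<le> \<mu> N ^ n * ((1 + \<mu> N / m0) * exp (- \<mu> N - c * (\<mu> N + \<mu> k)))"
      using pos by (simp add: mult_left_mono)
    also have "exp (- \<mu> N - c * (\<mu> N + \<mu> k)) = exp (- \<mu> N) * exp (-c * (\<mu> N + \<mu> k))"
      by (simp flip: exp_add)
    finally show ?thesis by (simp add: mult_ac)
  qed

  \<comment> \<open>For large \<mu>_N all other terms together amount to less than half of the term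
    N.\<close>
  have "\<forall>\<^sub>F x in at_top. C * (1 + x / m0) * exp (-\<eta> * x) * S < 1 / 2"
  proof (rule order_tendstoD)
    have "((\<lambda>x. C * (exp (-\<eta> * x) + (1 / m0) * (x * exp (-\<eta> * x))) * S) \<longlongrightarrow> C * (0 + (1 / m0) * 0) * S) at_top"
    proof (intro tendsto_intros)
      show "((\<lambda>x. exp (-\<eta> * x)) \<longlongrightarrow> 0) at_top"
        using \<eta>0 by (intro filterlim_compose[OF exp_at_bot] filterlim_tendsto_neg_mult_at_bot[OF tendsto_const]) (auto simp: filterlim_ident)
      have "((\<lambda>x. (1 / \<eta>) * ((\<eta> * x) ^ 1 / exp (\<eta> * x))) \<longlongrightarrow> (1 / \<eta>) * 0) at_top"
        using \<eta>0 by (intro tendsto_mult_left filterlim_compose[OF tendsto_power_div_exp_0]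
             filterlim_tendsto_pos_mult_at_top[OF tendsto_const]) (auto simp: filterlim_ident)
      moreover have "(\<lambda>x. (1 / \<eta>) * ((\<eta> * x) ^ 1 / exp (\<eta> * x))) = (\<lambda>x. x * exp (-\<eta> * x))"
        using \<eta>0 by (simp add: fun_eq_iff exp_minus field_simps)
      ultimately show "((\<lambda>x. x * exp (-\<eta> * x)) \<longlongrightarrow> 0) at_top"
        by simp
    qed
    then show "((\<lambda>x. C * (1 + x / m0) * exp (-\<eta> * x) * S) \<longlongrightarrow> 0) at_top"
      by (simp add: algebra_simps)
  qed simp
  then have ev1: "\<forall>\<^sub>F k in sequentially. C * (1 + \<mu> k / m0) * exp (-\<eta> * \<mu> k) * S < 1 / 2"
    using inf by (auto simp: filterlim_iff)

  \<comment> \<open>The constants of the final comparison: 2 from halving the main term, M from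
    Cauchy's estimate, one factor e from Stirling's bound, another e and exp \<epsilon> from
    replacing \<mu>_N by n + 1.\<close>
  define K where "K = 2 * M * exp (\<epsilon> + 2)"
  have "(\<lambda>n. K * real n * (1 / sqrt R) ^ n) \<longlonglongrightarrow> K * 0"
  proof -
    have "norm (1 / sqrt R) < 1" using R by simp
    from powser_times_n_limit_0[OF this] have "(\<lambda>n. real n * (1 / sqrt R) ^ n) \<longlonglongrightarrow> 0" by simp
    from tendsto_mult_left[OF this, of K] show ?thesis by (simp add: mult.assoc)
  qed
  then have "\<forall>\<^sub>F n in sequentially. K * real n * (1 / sqrt R) ^ n < 1"
    by (intro order_tendstoD(2)) auto
  moreover have "filterlim (\<lambda>k. nat \<lfloor>\<mu> k\<rfloor>) sequentially sequentially"
    by (rule filterlim_compose[OF filterlim_nat_sequentially filterlim_compose[OF filterlim_floor_sequentially inf]])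
  ultimately have ev2: "\<forall>\<^sub>F k in sequentially. K * real (nat \<lfloor>\<mu> k\<rfloor>) * (1 / sqrt R) ^ nat \<lfloor>\<mu> k\<rfloor> < 1"
    by (auto simp: filterlim_iff)
  have ev3: "\<forall>\<^sub>F k in sequentially. \<mu> k \<ge> 1" using inf by (simp add: filterlim_at_top)
  obtain N where N: "N \<in> I" "norm (b N) \<ge> exp (-\<epsilon> * \<mu> N)" "C * (1 + \<mu> N / m0) * exp (-\<eta> * \<mu> N) * S < 1 / 2"
      "K * real (nat \<lfloor>\<mu> N\<rfloor>) * (1 / sqrt R) ^ nat \<lfloor>\<mu> N\<rfloor> < 1" "\<mu> N \<ge> 1"
    using frequently_ex[OF frequently_eventually_frequently[OF low[OF \<epsilon>(1)] eventually_conj[OF ev1 eventually_conj[OF ev2 ev3]]]]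
    by blast
  define n where "n = nat \<lfloor>\<mu> N\<rfloor>"
  have n: "n \<ge> 1" "real n \<le> \<mu> N" "\<mu> N \<le> real n + 1" using N(5) unfolding n_def by linarith+
  define T where "T k = norm (b k) * (\<mu> k ^ n * exp (-\<mu> k))" for k
  have T0: "T k \<ge> 0" for k using \<mu>0 by (simp add: T_def)
  have sums: "(\<lambda>k. b k * (-of_real (\<mu> k)) ^ n * exp (-of_real (\<mu> k))) sums (deriv ^^ n) f 1"
  proof -
    have "\<exists>C. \<forall>k\<in>I. norm (b k) \<le> C * exp (1/4 * \<mu> k)" by (rule up) simp
    then obtain D where D: "\<forall>k\<in>I. norm (b k) \<le> D * exp (1/4 * \<mu> k)" by blast
    have summ_b: "summable (\<lambda>k. norm (b k) * exp (-\<mu> k * (1/2)))"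
    proof (rule summable_comparison_test'[OF summable_mult[OF summ[of "1/4"], of "\<bar>D\<bar>"]])
      fix k
      show "norm (norm (b k) * exp (-\<mu> k * (1/2))) \<le> \<bar>D\<bar> * exp (-(1/4) * \<mu> k)"
      proof (cases "k \<in> I")
        case True
        then have "norm (b k) \<le> D * exp (1/4 * \<mu> k)" using D by blast
        also have "\<dots> \<le> \<bar>D\<bar> * exp (1/4 * \<mu> k)" by (intro mult_right_mono) auto
        finally have "norm (b k) * exp (-\<mu> k * (1/2)) \<le> \<bar>D\<bar> * exp (1/4 * \<mu> k) * exp (-\<mu> k * (1/2))"
          by (intro mult_right_mono) auto
        also have "\<dots> = \<bar>D\<bar> * exp (-(1/4) * \<mu> k)" by (simp add: mult.assoc flip: exp_add)
        finally show ?thesis by simp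
      qed (simp add: b0)
    qed simp
    show ?thesis
      using exp_series_higher_deriv[OF summ_b _ \<mu>0 f, of 1 n] by simp
  qed
  have T_le: "T k \<le> T N * (C * (1 + \<mu> N / m0) * exp (-\<eta> * \<mu> N) * exp (-\<eta> * \<mu> k))" if "k \<noteq> N" for k
  proof (cases "k \<in> I")
    case True
    have "T k \<le> C * exp (\<epsilon> * \<mu> k) * ((\<mu> N ^ n * exp (-\<mu> N)) * ((1 + \<mu> N / m0) * exp (-c * (\<mu> N + \<mu> k))))"
      unfolding T_def using C0 \<mu>0[of k] by (intro mult_mono C peak True N(1) that n_def) auto
    also have "\<dots> = (exp (-\<epsilon> * \<mu> N) * (\<mu> N ^ n * exp (-\<mu> N))) * (C * (1 + \<mu> N / m0) * exp ((\<epsilon> - c) * \<mu> N) * exp ((\<epsilon> - c) * \<mu> k))"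
      by (simp add: algebra_simps exp_add exp_diff exp_minus field_simps)
    also have "\<dots> \<le> T N * (C * (1 + \<mu> N / m0) * exp (-\<eta> * \<mu> N) * exp (-\<eta> * \<mu> k))"
    proof (intro mult_mono)
      show "exp (-\<epsilon> * \<mu> N) * (\<mu> N ^ n * exp (-\<mu> N)) \<le> T N"
        unfolding T_def using N(2) \<mu>0[of N] by (intro mult_right_mono) auto
      have "\<epsilon> - c \<le> -\<eta>" using \<epsilon>(2) by (simp add: \<eta>_def)
      then show "exp ((\<epsilon> - c) * \<mu> N) \<le> exp (-\<eta> * \<mu> N)" "exp ((\<epsilon> - c) * \<mu> k) \<le> exp (-\<eta> * \<mu> k)"
        by (simp_all only: exp_le_cancel_iff mult_right_mono \<mu>0)
    qed (use C0 m0 \<mu>0[of N] T0 in auto)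
    finally show ?thesis .
  next
    case False
    then show ?thesis using b0 C0 m0 \<mu>0[of N] T0[of N] by (simp add: T_def)
  qed
  define g where "g k = b k * (-of_real (\<mu> k)) ^ n * exp (-of_real (\<mu> k))" for k
  have ng: "norm (g k) = T k" for k using \<mu>0[of k] by (simp add: g_def T_def norm_mult norm_power)
  have "(\<lambda>k. g k - (if k = N then g N else 0)) sums ((deriv ^^ n) f 1 - g N)"
    using sums by (intro sums_diff sums_single[of N "\<lambda>_. g N"]) (simp add: g_def)
  then have "norm ((deriv ^^ n) f 1 - g N) \<le> (\<Sum>k. T N * (C * (1 + \<mu> N / m0) * exp (-\<eta> * \<mu> N)) * exp (-\<eta> * \<mu> k))"
    unfolding sums_iff
  proof (elim conjE, goal_cases)
    case 1
    have "norm (\<Sum>k. g k - (if k = N then g N else 0)) \<le> (\<Sum>k. T N * (C * (1 + \<mu> N / m0) * exp (-\<eta> * \<mu> N)) * exp (-\<eta> * \<mu> k))"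
    proof (rule norm_suminf_le)
      show "norm (g k - (if k = N then g N else 0)) \<le> T N * (C * (1 + \<mu> N / m0) * exp (-\<eta> * \<mu> N)) * exp (-\<eta> * \<mu> k)" for k
        using T_le[of k] C0 m0 \<mu>0[of N] T0[of N] by (auto simp: ng mult.assoc)
      show "summable (\<lambda>k. T N * (C * (1 + \<mu> N / m0) * exp (-\<eta> * \<mu> N)) * exp (-\<eta> * \<mu> k))"
        by (rule summable_mult[OF S])
    qed
    then show ?case using 1 by simp
  qed
  also have "\<dots> = T N * (C * (1 + \<mu> N / m0) * exp (-\<eta> * \<mu> N) * S)"
    unfolding S_def by (subst suminf_mult[OF S]) (simp add: mult_ac)
  also have "\<dots> \<le> T N * (1 / 2)" using N(3) T0[of N] by (intro mult_left_mono) auto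
  finally have "T N / 2 \<le> norm ((deriv ^^ n) f 1)"
    using norm_triangle_ineq2[of "g N" "g N - (deriv ^^ n) f 1"] ng[of N] by (simp add: norm_minus_commute)
  also have "\<dots> \<le> fact n * M / R ^ n" by (rule Cauchy)
  also have "\<dots> \<le> exp 1 * real n * (real n ^ n * exp (- real n)) * M / R ^ n"
    using M0 R n by (intro divide_right_mono mult_right_mono fact_le_Stirling) auto
  finally have 1: "T N \<le> 2 * (exp 1 * real n * (real n ^ n * exp (- real n)) * M / R ^ n)" by linarith
  have "exp (-\<epsilon> * (real n + 1)) * (real n ^ n * exp (- (real n + 1))) \<le> T N"
    unfolding T_def
  proof (intro mult_mono)
    have "exp (-\<epsilon> * (real n + 1)) \<le> exp (-\<epsilon> * \<mu> N)" using n \<epsilon> by simp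
    then show "exp (-\<epsilon> * (real n + 1)) \<le> norm (b N)" using N(2) by linarith
    show "real n ^ n \<le> \<mu> N ^ n" using n by (intro power_mono) auto
  qed (use n \<mu>0[of N] in auto)
  with 1 have "exp (-\<epsilon> * (real n + 1)) * (real n ^ n * exp (- (real n + 1))) \<le>
      2 * (exp 1 * real n * (real n ^ n * exp (- real n)) * M / R ^ n)" by linarith
  then have "(real n ^ n * exp (- real n)) * (exp (-\<epsilon> * (real n + 1)) * exp (-1)) \<le>
      (real n ^ n * exp (- real n)) * (2 * exp 1 * real n * M / R ^ n)"
    by (simp add: mult_ac exp_add exp_diff exp_minus divide_inverse)
  then have "exp (-\<epsilon> * (real n + 1)) * exp (-1) \<le> 2 * exp 1 * real n * M / R ^ n"
    using n(1) by (subst (asm) mult_le_cancel_left_pos) auto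
  then have "exp (-\<epsilon> * (real n + 1)) * exp (-1) * R ^ n \<le> 2 * exp 1 * real n * M"
    using R by (simp add: le_divide_eq)
  then have "exp (-\<epsilon> * (real n + 1)) * exp (-1) * R ^ n * (exp (\<epsilon> * (real n + 1)) * exp 1) \<le>
      2 * exp 1 * real n * M * (exp (\<epsilon> * (real n + 1)) * exp 1)"
    by (intro mult_right_mono) auto
  also have "exp (-\<epsilon> * (real n + 1)) * exp (-1) * R ^ n * (exp (\<epsilon> * (real n + 1)) * exp 1) =
      R ^ n * (exp (-\<epsilon> * (real n + 1)) * exp (\<epsilon> * (real n + 1)) * (exp (-1) * exp 1))"
    by (simp only: mult_ac)
  also have "\<dots> = R ^ n" by (simp flip: exp_add)
  also have "2 * exp 1 * real n * M * (exp (\<epsilon> * (real n + 1)) * exp 1) =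
      2 * M * (exp 1 * exp 1 * exp (\<epsilon> * (real n + 1))) * real n" by (simp only: mult_ac)
  also have "exp 1 * exp 1 * exp (\<epsilon> * (real n + 1)) = exp (\<epsilon> + 2) * exp (real n * \<epsilon>)"
    by (simp add: algebra_simps flip: exp_add)
  also have "2 * M * (exp (\<epsilon> + 2) * exp (real n * \<epsilon>)) * real n = K * real n * exp \<epsilon> ^ n"
    by (simp add: K_def exp_of_nat_mult)
  also have "\<dots> \<le> K * real n * sqrt R ^ n"
  proof -
    have "exp \<epsilon> \<le> exp (ln R / 2)" using \<epsilon> by simp
    also have "\<dots> = sqrt R" using R by (simp add: powr_half_sqrt[symmetric] powr_def)
    finally show ?thesis using M0 by (intro mult_left_mono power_mono) (auto simp: K_def)
  qed
  finally have "sqrt R ^ n * sqrt R ^ n \<le> K * real n * sqrt R ^ n"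
    using R by (simp flip: power_mult_distrib)
  then have "sqrt R ^ n \<le> K * real n" using R by simp
  then have "1 \<le> K * real n * (1 / sqrt R) ^ n" using R by (simp add: power_divide le_divide_eq)
  with N(4) show False by (simp add: n_def)
qed

lemma holomorphic_on_shift:
  assumes "f holomorphic_on S" "\<And>u. u \<in> T \<Longrightarrow> a + u \<in> S"
  shows "(\<lambda>u. f (a + u)) holomorphic_on T"
proof -
  have "(\<lambda>u. a + u) holomorphic_on T" by (intro holomorphic_intros)
  from holomorphic_on_compose_gen[OF this assms(1)] assms(2) show ?thesis
    unfolding comp_def by blast
qed

lemma cosparse_zero_imp_zero:
  fixes f :: "complex \<Rightarrow> complex"
  assumes "eventually (\<lambda>z. f z = 0) (cosparse A)" "z \<in> A" "isCont f z"
  shows "f z = 0"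
proof -
  have "eventually (\<lambda>z. f z = 0) (at z)"
    by (rule eventually_cosparse_imp_eventually_at[OF assms(1,2)])
  then have "(f \<longlongrightarrow> 0) (at z)" by (rule tendsto_eventually)
  from LIM_unique[OF assms(3)[unfolded isCont_def] this] show ?thesis .
qed

lemma connected_halfspace_Re_gt: "connected {s::complex. Re s > x}"
  by (rule convex_connected[OF convex_halfspace_Re_gt])

text \<open>The function is entire and takes the value 1 at s = 1, so it does not vanish
  identically.\<close>

lemma zeta_reg_nonzero_cosparse: "eventually (\<lambda>s. zeta_reg (s - 1) \<noteq> 0) (cosparse UNIV)"
proof (rule disjE[OF meromorphic_imp_constant_or_avoid[of "\<lambda>s. zeta_reg (s - 1)" UNIV 0]])
  have h: "(\<lambda>s. zeta_reg (s - 1)) holomorphic_on UNIV" by (intro holomorphic_intros)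
  then show "(\<lambda>s. zeta_reg (s - 1)) meromorphic_on UNIV"
    by (intro analytic_on_imp_meromorphic_on) (simp add: analytic_on_open)
  assume "eventually (\<lambda>s. zeta_reg (s - 1) = 0) (cosparse UNIV)"
  then have "zeta_reg (1 - 1) = 0"
    by (rule cosparse_zero_imp_zero) (use h in \<open>auto intro!: continuous_on_interior[OF holomorphic_on_imp_continuous_on[OF h]]\<close>)
  then show ?thesis by (simp add: zeta_reg_0)
qed auto

context beatty begin

text \<open>
  Let \<open>I\<close> be the set of indices where \<open>Q\<close> jumps by a large power. A continuation beyond the edge could be
  solved for \<open>lead_sum UNIV\<close> off the zeros of the zeta factor, so \<open>lead_sum I\<close> would extend
  holomorphically across a point of the edge, against \<open>lacunary_no_continuation\<close>.
\<close>

lemma continuation_edge: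
  assumes w: "0 \<le> w" "w \<le> 1" and f: "\<And>s. Re s > 1 \<Longrightarrow> f s = c + shifted_zeta w s"
    and tau: "tau \<alpha> > 1" and g: "merom_continuation f x g"
  shows "x \<ge> edge"
proof (rule ccontr)
  assume x: "\<not> x \<ge> edge"
  obtain g0 A B where g0: "\<And>s. Re s > 1 \<Longrightarrow> g0 s = f s"
    and A: "A holomorphic_on {s. Re s > -1}" and B: "B holomorphic_on {s. Re s > -1}"
    and g0_eq: "\<And>s. g0 s = lead_sum UNIV s * (zeta_reg (s - 1) / (s - 1)) + A s * zeta_reg s + B s"
    using continuation_half_plane[OF w f] by metis
  obtain c0 where c0: "\<And>s. Re s > c0 \<Longrightarrow> g s = f s" and gmero: "g meromorphic_on {s. Re s > x}"
    using g by (auto simp: merom_continuation_def)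
  obtain T0 where T0: "1 < T0" "ereal T0 < tau \<alpha>"
    using ereal_dense2[of 1 "tau \<alpha>"] tau by (auto simp: one_ereal_def)
  \<comment> \<open>T1 > 1 places -1 / T1 to the right of -1, where A and B are still available; T1
    < T0 < \<open>tau \<alpha>\<close> places it to the left of the edge. The complementary terms
    converge up to -1 / T1.\<close>
  define T1 where "T1 = (1 + T0) / 2"
  have T1: "1 < T1" "T1 < T0" using T0 by (auto simp: T1_def)
  have edge_T0: "edge \<ge> - 1 / T0"
  proof (rule ccontr)
    assume "\<not> ?thesis"
    then have "tau \<alpha> < ereal (- 1 / (- 1 / T0))" using T0 by (intro tau_less_of_edge_less) auto
    then show False using T0 by simp
  qed
  have "1 / T0 < 1 / T1" using T1 by (intro divide_strict_left_mono) auto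
  then have T1_edge: "- 1 / T1 < edge" using edge_T0 by simp
  have T1_m1: "- 1 / T1 > -1" using T1 by simp
  \<comment> \<open>For i < j in I the jump at j gives ln \<open>Q (Suc j)\<close> > T1 ln
    \<open>Q j\<close> \<ge> T1 ln \<open>Q (Suc i)\<close>, the Hadamard gap. The condition
    \<open>Q k \<ge> 2\<close> keeps the frequencies away from 0.\<close>
  define I where "I = {k. ln (Q (Suc k)) > T1 * ln (Q k) \<and> Q k \<ge> 2}"
  define x1 where "x1 = max x (- 1 / T1)"
  have x1: "x1 < edge" "x \<le> x1" "x1 > -1" "x1 \<ge> - 1 / T1" using x T1_edge T1_m1 by (auto simp: x1_def)
  let ?D = "{s. Re s > x1}" and ?D' = "{s. Re s > edge}"
  have evQ2: "\<forall>\<^sub>F k in sequentially. Q k \<ge> 2" using Q_at_top by (simp add: filterlim_at_top)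
  have compl: "lead_bound (-I) \<sigma>" if \<sigma>: "\<sigma> > - 1 / T1" for \<sigma>
  proof (cases "\<sigma> \<ge> 0")
    case True
    then show ?thesis by (rule lead_bound_pos)
  next
    case False
    show ?thesis
    proof (rule lead_boundI[of _ T1])
      show "\<forall>\<^sub>F k in sequentially. k \<in> -I \<longrightarrow> ln (Q (Suc k)) \<le> T1 * ln (Q k)"
        using evQ2 by eventually_elim (auto simp: I_def)
    qed (use T1 \<sigma> False in auto)
  qed
  have hol_compl: "lead_sum (-I) holomorphic_on ?D"
  proof (rule lead_sum_holomorphic[OF open_halfspace_Re_gt])
    fix s assume "s \<in> ?D"
    then have "x1 < Re s" by simp
    then obtain l where "x1 < l" "l < Re s" using dense by blast
    then show "\<exists>l<Re s. lead_bound (-I) l" using compl[of l] x1 by (intro exI[of _ l]) auto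
  qed
  have hol_I: "lead_sum I holomorphic_on ?D'" by (rule lead_sum_holomorphic_edge)
  have split: "lead_sum UNIV s = lead_sum I s + lead_sum (-I) s" if "s \<in> ?D'" for s
  proof -
    have "edge < Re s" using that by simp
    then obtain l where l: "edge < l" "l < Re s" using dense by blast
    have "summable (\<lambda>k. if k \<in> J then (-1) ^ k * of_real (Q (Suc k)) powr (-s) / of_real (Q k) else 0 :: complex)" for J
      using l by (intro lead_sum_summable[OF lead_bound_edge[OF l(1)]]) auto
    from suminf_add[OF this[of I] this[of "-I"]] show ?thesis
      unfolding lead_sum_def by (auto intro!: arg_cong[where f = suminf] simp: fun_eq_iff)
  qed
  have A': "A holomorphic_on ?D" and B': "B holomorphic_on ?D"
    using x1(3) by (auto intro!: holomorphic_on_subset[OF A] holomorphic_on_subset[OF B])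
  \<comment> \<open>The expansion solved for \<open>zeta_reg (s - 1) * lead_sum UNIV s\<close>. The
    discrepancy P vanishes far to the right and hence, being meromorphic, off a sparse subset of the
    half-plane Re s > \<open>edge\<close>.\<close>
  define G where "G s = (g s - A s * zeta_reg s - B s) * (s - 1)" for s
  define P where "P s = G s - zeta_reg (s - 1) * (lead_sum (-I) s + lead_sum I s)" for s
  have mero_of_holo: "h meromorphic_on {s. Re s > y}" if "h holomorphic_on {s. Re s > y}" for h y
    using that by (intro analytic_on_imp_meromorphic_on) (simp add: analytic_on_open open_halfspace_Re_gt)
  have g_mero: "g meromorphic_on ?D" using x1(2) by (intro meromorphic_on_subset[OF gmero]) auto
  then have G_mero: "G meromorphic_on ?D" unfolding G_def
    by (intro g_mero meromorphic_intros mero_of_holo A' B' zeta_reg_holomorphic)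
  have sub: "?D' \<subseteq> ?D" using x1(1) by auto
  have "P meromorphic_on ?D'" unfolding P_def
    by (intro meromorphic_on_subset[OF G_mero sub] meromorphic_intros mero_of_holo hol_I
          holomorphic_on_subset[OF hol_compl sub] holomorphic_intros)
  from meromorphic_imp_constant_or_avoid[OF this open_halfspace_Re_gt connected_halfspace_Re_gt, of 0]
  have P0: "eventually (\<lambda>s. P s = 0) (cosparse ?D')"
  proof
    assume ev: "eventually (\<lambda>s. P s \<noteq> 0) (cosparse ?D')"
    define p where "p = complex_of_real (max 1 c0 + 1)"
    have "p \<in> ?D'" using edge(3) by (simp add: p_def)
    from eventually_cosparse_imp_eventually_at[OF ev this]
    have "eventually (\<lambda>s. P s \<noteq> 0) (at p)" .
    moreover have "eventually (\<lambda>s. s \<in> {s. Re s > max 1 c0} - {p}) (at p)"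
      by (rule eventually_at_in_open[OF open_halfspace_Re_gt]) (simp add: p_def, linarith)
    then have "eventually (\<lambda>s. P s = 0) (at p)"
    proof eventually_elim
      case (elim s)
      then have s: "Re s > 1" "Re s > c0" by auto
      then have "s \<in> ?D'" "s \<noteq> 1" using edge(3) by auto
      have "g s = lead_sum UNIV s * (zeta_reg (s - 1) / (s - 1)) + A s * zeta_reg s + B s"
        using c0[OF s(2)] g0[OF s(1)] g0_eq[of s] by simp
      then have "G s = zeta_reg (s - 1) * lead_sum UNIV s" using \<open>s \<noteq> 1\<close> by (simp add: G_def field_simps)
      then show ?case by (simp add: P_def split[OF \<open>s \<in> ?D'\<close>] algebra_simps)
    qed
    ultimately have "eventually (\<lambda>s. False) (at p)" by eventually_elim auto
    then show ?thesis by simp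
  qed
  define p0 where "p0 = complex_of_real edge"
  have p0: "p0 \<in> ?D" using x1(1) by (simp add: p0_def)
  have "eventually (\<lambda>s. G analytic_on {s} \<and> zeta_reg (s - 1) \<noteq> 0) (at p0)"
    using eventually_cosparse_imp_eventually_at[OF meromorphic_on_imp_analytic_cosparse[OF G_mero] p0]
      eventually_cosparse_imp_eventually_at[OF zeta_reg_nonzero_cosparse, of p0] by (auto intro: eventually_conj)
  then obtain d where d: "d > 0" "\<And>s. s \<noteq> p0 \<Longrightarrow> dist s p0 < d \<Longrightarrow> G analytic_on {s} \<and> zeta_reg (s - 1) \<noteq> 0"
    unfolding eventually_at by auto
  \<comment> \<open>Poles of G and zeros of the zeta factor are isolated, so a point of the boundary
    line slightly above p0 avoids both.\<close>
  define s0 where "s0 = p0 + \<i> * of_real (d / 2)"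
  have s0: "Re s0 = edge" by (simp add: s0_def p0_def)
  have "s0 \<noteq> p0" "dist s0 p0 < d" using d(1) by (auto simp: s0_def dist_norm norm_mult)
  from d(2)[OF this] have G_an: "G analytic_on {s0}" and z_nz: "zeta_reg (s0 - 1) \<noteq> 0" by auto
  obtain r1 where r1: "r1 > 0" "G holomorphic_on ball s0 r1" using G_an by (auto simp: analytic_on_def)
  have "isCont (\<lambda>s. zeta_reg (s - 1)) s0"
    by (rule continuous_on_interior[OF holomorphic_on_imp_continuous_on[of _ UNIV]]) (auto intro!: holomorphic_intros)
  then obtain r2 where r2: "r2 > 0" "\<And>s. dist s0 s < r2 \<Longrightarrow> zeta_reg (s - 1) \<noteq> 0"
    using continuous_at_avoid[of s0 "\<lambda>s. zeta_reg (s - 1)" 0] z_nz by auto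
  define R0 where "R0 = min (min r1 r2) (edge - x1)"
  have R0: "R0 > 0" using r1 r2 x1 by (simp add: R0_def)
  have ballD: "ball s0 R0 \<subseteq> ?D"
  proof
    fix s assume "s \<in> ball s0 R0"
    then have "norm (s - s0) < edge - x1" by (simp add: R0_def dist_norm norm_minus_commute)
    then show "s \<in> ?D" using abs_Re_le_cmod[of "s - s0"] s0 by simp
  qed
  define h where "h s = G s / zeta_reg (s - 1) - lead_sum (-I) s" for s
  have h_hol: "h holomorphic_on ball s0 R0" unfolding h_def
    by (intro holomorphic_intros holomorphic_on_subset[OF r1(2)] holomorphic_on_subset[OF hol_compl] ballD)
       (use r2(2) in \<open>auto simp: R0_def\<close>)
  have agree: "h s = lead_sum I s" if s: "s \<in> ball s0 R0" "Re s > edge" for s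
  proof -
    let ?U = "ball s0 R0 \<inter> ?D'"
    have U: "open ?U" "s \<in> ?U" using s by (auto intro!: open_Int open_halfspace_Re_gt)
    have "P holomorphic_on ?U" unfolding P_def
      by (intro holomorphic_intros holomorphic_on_subset[OF r1(2)] holomorphic_on_subset[OF hol_compl] holomorphic_on_subset[OF hol_I])
         (use ballD in \<open>auto simp: R0_def\<close>)
    then have "isCont P s"
      using holomorphic_on_imp_continuous_on continuous_on_eq_continuous_at[OF U(1)] U(2) by blast
    then have "P s = 0" using s(2) by (intro cosparse_zero_imp_zero[OF P0]) auto
    moreover have "zeta_reg (s - 1) \<noteq> 0" using s r2(2) by (simp add: R0_def)
    ultimately show ?thesis by (simp add: h_def P_def field_simps)
  qed

  \<comment> \<open>With s = s0 + u the lacunary part becomes an exponential series in u with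
    frequencies \<mu>_k, and the boundary line becomes the imaginary axis.\<close>
  define \<mu> where "\<mu> k = ln (Q (Suc k))" for k
  define b where "b k = (if k \<in> I then (-1) ^ k * of_real (Q (Suc k)) powr (-s0) / of_real (Q k) else 0 :: complex)" for k
  define F where "F u = (if u \<in> {u. Re u > 0} then lead_sum I (s0 + u) else h (s0 + u))" for u
  have F_hol: "F holomorphic_on ({u. Re u > 0} \<union> ball 0 R0)"
    unfolding F_def
  proof (rule holomorphic_on_If_Un[OF _ _ open_halfspace_Re_gt open_ball])
    show "(\<lambda>u. lead_sum I (s0 + u)) holomorphic_on {u. Re u > 0}"
      by (rule holomorphic_on_shift[OF hol_I]) (simp add: s0)
    show "(\<lambda>u. h (s0 + u)) holomorphic_on ball 0 R0"
      by (rule holomorphic_on_shift[OF h_hol]) (simp add: dist_norm)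
    show "lead_sum I (s0 + u) = h (s0 + u)" if "u \<in> {u. Re u > 0}" "u \<in> ball 0 R0" for u
      using that s0 by (intro agree[symmetric]) (auto simp: dist_norm)
  qed
  have norm_b: "norm (b k) = exp (- edge * \<mu> k) / Q k" if "k \<in> I" for k
    using that s0 Q_pos[of "Suc k"] Q_pos[of k]
    by (simp add: b_def norm_mult norm_divide norm_power norm_of_real_powr powr_def \<mu>_def less_imp_neq[THEN not_sym] del: Q_pos)
  show False
  proof (rule lacunary_no_continuation[of "T1 - 1" I \<mu> "ln 2" b R0 F])
    show "T1 - 1 > 0" using T1 by simp
    show "(1 + (T1 - 1)) * \<mu> i \<le> \<mu> j" if ij: "i \<in> I" "j \<in> I" "i < j" for i j
    proof -
      have "ln (Q (Suc i)) \<le> ln (Q j)" using ij Q_mono[of "Suc i" j] by (simp add: Suc_le_eq)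
      then have "T1 * ln (Q (Suc i)) \<le> T1 * ln (Q j)" using T1 by (intro mult_left_mono) auto
      also have "\<dots> \<le> ln (Q (Suc j))" using ij by (simp add: I_def)
      finally show ?thesis by (simp add: \<mu>_def)
    qed
    show "ln 2 > (0::real)" by simp
    show "\<mu> k \<ge> ln 2" if "k \<in> I" for k
      using that Q_mono_Suc[of k] by (auto simp: \<mu>_def I_def)
    show "\<mu> k \<ge> 0" for k using Q_ge1[of "Suc k"] by (simp add: \<mu>_def)
    show "summable (\<lambda>k. exp (-\<eta> * \<mu> k))" if "\<eta> > 0" for \<eta>
      using summable_Q_Suc_powr[OF that] by (simp add: powr_def \<mu>_def less_imp_neq[THEN not_sym])
    show "filterlim \<mu> at_top sequentially"
      unfolding \<mu>_def using ln_Q_at_top by (subst filterlim_sequentially_Suc)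
    show "b k = 0" if "k \<notin> I" for k using that by (simp add: b_def)
    show "\<exists>C. \<forall>k\<in>I. norm (b k) \<le> C * exp (\<epsilon> * \<mu> k)" if \<epsilon>: "\<epsilon> > 0" for \<epsilon>
    proof -
      have "lead_bound I (edge + \<epsilon>)" using \<epsilon> by (intro lead_bound_edge) auto
      then have "Bseq (\<lambda>k. if k \<in> I then Q (Suc k) powr (- (edge + \<epsilon>)) / Q k else 0)"
        unfolding lead_bound_def by (rule convergent_imp_Bseq[OF convergentI[OF summable_LIMSEQ_zero]])
      then obtain C where C: "\<And>k. norm (if k \<in> I then Q (Suc k) powr (- (edge + \<epsilon>)) / Q k else 0) \<le> C"
        by (auto simp: Bseq_def)
      have "norm (b k) \<le> C * exp (\<epsilon> * \<mu> k)" if k: "k \<in> I" for k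
      proof -
        have "Q (Suc k) powr (- (edge + \<epsilon>)) / Q k \<le> C" using C[of k] k by simp
        then have "Q (Suc k) powr (- (edge + \<epsilon>)) / Q k * exp (\<epsilon> * \<mu> k) \<le> C * exp (\<epsilon> * \<mu> k)"
          by (intro mult_right_mono) auto
        moreover have "Q (Suc k) powr (- (edge + \<epsilon>)) / Q k * exp (\<epsilon> * \<mu> k) = norm (b k)"
          unfolding norm_b[OF k] by (simp add: powr_def \<mu>_def less_imp_neq[THEN not_sym] algebra_simps flip: exp_add)
        ultimately show ?thesis by simp
      qed
      then show ?thesis by blast
    qed
    show "\<exists>\<^sub>F k in sequentially. k \<in> I \<and> norm (b k) \<ge> exp (-\<epsilon> * \<mu> k)" if \<epsilon>: "\<epsilon> > 0" for \<epsilon>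
    proof -
      define e where "e = \<epsilon> - edge"
      have e: "e > 0" using \<epsilon> edge(3) by (simp add: e_def)
      have "ereal (1 / e) < tau \<alpha>"
      proof (cases "tau \<alpha>")
        case (real r)
        then have r: "r \<ge> 1" using tau_ge1 by simp
        have "edge = - (1 / r)" using real r by (simp add: edge_def one_ereal_def)
        then have "1 / r < e" using \<epsilon> by (simp add: e_def)
        then show ?thesis using real r e by (simp add: field_simps)
      qed (use tau_ge1 in auto)
      \<comment> \<open>T \<ge> T1 puts the large jumps into I, and T \<ge> 1 / e gives ln
        \<open>Q k\<close> \<le> e \<mu>_k, which is the lower bound for the coefficient. Both lie
        below \<open>tau \<alpha>\<close>, so such jumps recur infinitely often.\<close>
      define T where "T = max (1 / e) T1"
      have T: "ereal T < tau \<alpha>" using \<open>ereal (1 / e) < tau \<alpha>\<close> T0(2) T1(2)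
        by (auto simp: T_def max_def intro: less_trans[of _ "ereal T0"])
      have "T > 0" using T1 by (simp add: T_def)
      from frequently_eventually_frequently[OF tau_lower[OF T this] evQ2] show ?thesis
      proof (rule frequently_elim1, elim conjE)
        fix k assume k: "T * ln (Q k) < ln (Q (Suc k))" "2 \<le> Q k"
        have ln0: "ln (Q k) \<ge> 0" using Q_ge1[of k] by simp
        have le: "T1 * ln (Q k) \<le> T * ln (Q k)" "(1 / e) * ln (Q k) \<le> T * ln (Q k)"
        proof -
          have "T1 \<le> T" "1 / e \<le> T" by (simp_all add: T_def)
          then show "T1 * ln (Q k) \<le> T * ln (Q k)" "(1 / e) * ln (Q k) \<le> T * ln (Q k)"
            using ln0 by (blast intro: mult_right_mono)+
        qed
        have I: "k \<in> I" using le_less_trans[OF le(1) k(1)] k(2) by (simp add: I_def)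
        have "(1 / e) * ln (Q k) \<le> \<mu> k" using le(2) k(1) unfolding \<mu>_def by linarith
        then have "ln (Q k) \<le> e * \<mu> k" using e by (simp add: field_simps)
        then have "exp (-\<epsilon> * \<mu> k) \<le> exp (- edge * \<mu> k - ln (Q k))" by (simp add: e_def algebra_simps)
        also have "\<dots> = norm (b k)" unfolding norm_b[OF I] by (simp add: exp_diff)
        finally show "k \<in> I \<and> norm (b k) \<ge> exp (-\<epsilon> * \<mu> k)" using I by simp
      qed
    qed
    show "R0 > 0" by (rule R0)
    show "F holomorphic_on ({u. Re u > 0} \<union> ball 0 R0)" by (rule F_hol)
    show "F u = (\<Sum>k. b k * exp (-of_real (\<mu> k) * u))" if "Re u > 0" for u
    proof -
      have "(if k \<in> I then (-1) ^ k * of_real (Q (Suc k)) powr (-(s0 + u)) / of_real (Q k) else 0) =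
          b k * exp (-of_real (\<mu> k) * u)" for k
        using Q_pos[of "Suc k"]
        by (simp add: b_def powr_def Ln_of_real \<mu>_def algebra_simps exp_diff exp_add exp_minus divide_inverse del: Q_pos)
      then show ?thesis using that by (simp add: F_def lead_sum_def)
    qed
  qed
qed

lemma natural_boundary_edge:
  assumes w: "0 \<le> w" "w \<le> 1" and f: "\<And>s. Re s > 1 \<Longrightarrow> f s = c + shifted_zeta w s" and tau: "tau \<alpha> > 1"
  shows "natural_boundary f {s. Re s = edge}"
proof -
  obtain g A B where g: "\<And>s. Re s > 1 \<Longrightarrow> g s = f s" "g holomorphic_on {s. Re s > edge} - {1}" "simple_pole g 1"
    using continuation_half_plane[OF w f] by metis
  have "g meromorphic_on {s. Re s > edge}"
  proof (rule meromorphic_onI_open[where pts = "{1}"])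
    show "open {s. Re s > edge}" by (rule open_halfspace_Re_gt)
    show "g analytic_on {s. Re s > edge} - {1}"
      using g(2) by (subst analytic_on_open) (auto intro!: open_Diff open_halfspace_Re_gt)
    show "\<And>z. z \<in> {1} \<Longrightarrow> not_essential g z" using g(3) by (auto simp: simple_pole_def intro: is_pole_imp_not_essential)
  qed (auto simp: islimpt_finite)
  then have "merom_continuation f edge g"
    unfolding merom_continuation_def using g(1) by (intro conjI exI[of _ 1]) auto
  then have "sigma_mu f = ereal edge"
    unfolding sigma_mu_def using continuation_edge[OF w f tau]
    by (intro antisym Inf_lower Inf_greatest) auto
  then show ?thesis unfolding natural_boundary_def by blast
qed

section \<open>Quadratic irrationals\<close>

text \<open>
  Lagrange's argument: the complete quotients are roots of integer quadratic polynomials of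
  constant discriminant whose outer coefficients stay bounded, hence one of them repeats.
\<close>

lemma theta_root:
  assumes quad: "of_int a * \<alpha>\<^sup>2 + of_int b * \<alpha> + of_int c = 0"
  defines "f \<equiv> \<lambda>k. a * (conv_num \<alpha> k)\<^sup>2 + b * conv_num \<alpha> k * conv_denom \<alpha> k + c * (conv_denom \<alpha> k)\<^sup>2"
  shows "\<exists>B. poly (map_poly of_int [:f k, B, f (Suc k):]) (\<theta> (Suc (Suc k))) = 0 \<and> B\<^sup>2 = b\<^sup>2 - 4 * a * c + 4 * f k * f (Suc k)"
proof -
  define p p' r r' where "p = conv_num \<alpha> k" "p' = conv_num \<alpha> (Suc k)" "r = conv_denom \<alpha> k" "r' = conv_denom \<alpha> (Suc k)"
  note pr = p_p'_r_r'_def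
  define B where "B = 2 * a * p * p' + b * (p * r' + p' * r) + 2 * c * r * r'"
  let ?t = "\<theta> (Suc (Suc k))"
  have det: "(p' * r - p * r')\<^sup>2 = 1" unfolding pr conv_det by (simp flip: power_mult)
  have "B\<^sup>2 - 4 * f k * f (Suc k) = (b\<^sup>2 - 4 * a * c) * (p' * r - p * r')\<^sup>2"
    unfolding B_def f_def pr[symmetric] by (simp add: power2_eq_square algebra_simps)
  then have 1: "B\<^sup>2 = b\<^sup>2 - 4 * a * c + 4 * f k * f (Suc k)" by (simp add: det)
  define u v where "u = ?t * of_int p' + of_int p" "v = ?t * of_int r' + of_int r"
  have uv: "\<alpha> * v = u" using alpha_eq[of k] by (simp add: u_v_def pr num_seq_Suc)
  have "of_int a * u\<^sup>2 + of_int b * u * v + of_int c * v\<^sup>2 = (of_int a * \<alpha>\<^sup>2 + of_int b * \<alpha> + of_int c) * v\<^sup>2"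
    unfolding uv[symmetric] by (simp add: power2_eq_square algebra_simps)
  also have "\<dots> = 0" by (simp add: quad)
  also have "of_int a * u\<^sup>2 + of_int b * u * v + of_int c * v\<^sup>2 =
     of_int (f k) + ?t * (of_int B + ?t * of_int (f (Suc k)))"
    unfolding u_v_def f_def B_def pr[symmetric] by (simp add: power2_eq_square algebra_simps)
  finally have "poly (map_poly of_int [:f k, B, f (Suc k):]) ?t = 0"
    by (simp add: map_poly_pCons algebra_simps)
  with 1 show ?thesis by blast
qed

lemma theta_repeats:
  assumes "quadratic_irrational \<alpha>"
  shows "\<exists>i j. i < j \<and> \<theta> i = \<theta> j"
proof -
  obtain a b c :: int where quad: "of_int a * \<alpha>\<^sup>2 + of_int b * \<alpha> + of_int c = 0" and a: "a \<noteq> 0"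
    using assms by (auto simp: quadratic_irrational_def)
  define f where "f k = a * (conv_num \<alpha> k)\<^sup>2 + b * conv_num \<alpha> k * conv_denom \<alpha> k + c * (conv_denom \<alpha> k)\<^sup>2" for k
  define D where "D = b\<^sup>2 - 4 * a * c"
  have D: "D \<noteq> 0"
  proof
    assume "D = 0"
    then have "(real_of_int b)\<^sup>2 = 4 * of_int a * of_int c"
      unfolding D_def by (metis eq_iff_diff_eq_0 of_int_mult of_int_numeral of_int_power)
    then have "(2 * of_int a * \<alpha> + of_int b)\<^sup>2 = 4 * of_int a * (of_int a * \<alpha>\<^sup>2 + of_int b * \<alpha> + of_int c)"
      by (simp add: power2_eq_square algebra_simps)
    then have "2 * of_int a * \<alpha> + of_int b = 0" by (simp add: quad)
    then have "\<alpha> = - of_int b / (2 * of_int a)" using a by (simp add: field_simps)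
    then show False using irrational by (simp add: Rats_divide)
  qed
  \<comment> \<open>With \<epsilon> = p - \<alpha> q the form at (p, q) is (2 a \<alpha> + b)
    \<epsilon> q + a \<epsilon>^2, because the q^2 term vanishes; both |\<epsilon> q| and
    |\<epsilon>| are at most 1.\<close>
  define M where "M = \<lceil>\<bar>2 * of_int a * \<alpha> + of_int b\<bar> + \<bar>of_int a\<bar>\<rceil>"
  have f_le: "\<bar>f (Suc k)\<bar> \<le> M" for k
  proof -
    define e where "e = Q (Suc (Suc k)) - \<alpha> * q (Suc k)"
    have e: "\<bar>e\<bar> \<le> 1 / q (Suc k)" using conv_error_bound[of k] by (simp add: e_def abs_minus_commute)
    have q: "q (Suc k) \<ge> 1" by (rule q_ge1)
    have "\<bar>e\<bar> * q (Suc k) \<le> 1 / q (Suc k) * q (Suc k)" using e q by (intro mult_right_mono) auto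
    then have eq: "\<bar>e * q (Suc k)\<bar> \<le> 1" using q by (simp add: abs_mult)
    have "1 / q (Suc k) \<le> 1" using q by simp
    then have "\<bar>e\<bar> \<le> 1" using e by linarith
    then have ee: "\<bar>e * e\<bar> \<le> 1 * 1" unfolding abs_mult by (intro mult_mono) auto
    have "of_int (f (Suc k)) = of_int a * (\<alpha> * q (Suc k) + e)\<^sup>2 + of_int b * (\<alpha> * q (Suc k) + e) * q (Suc k) + of_int c * (q (Suc k))\<^sup>2"
      unfolding f_def e_def num_seq_Suc by simp
    also have "\<dots> = (of_int a * \<alpha>\<^sup>2 + of_int b * \<alpha> + of_int c) * (q (Suc k))\<^sup>2 + (2 * of_int a * \<alpha> + of_int b) * (e * q (Suc k)) + of_int a * (e * e)"
      by (simp add: power2_eq_square algebra_simps)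
    also have "\<dots> = (2 * of_int a * \<alpha> + of_int b) * (e * q (Suc k)) + of_int a * (e * e)" by (simp add: quad)
    finally have "\<bar>of_int (f (Suc k))\<bar> \<le> \<bar>2 * of_int a * \<alpha> + of_int b\<bar> * \<bar>e * q (Suc k)\<bar> + \<bar>of_int a\<bar> * \<bar>e * e\<bar>"
      using abs_triangle_ineq[of "(2 * of_int a * \<alpha> + of_int b) * (e * q (Suc k))" "of_int a * (e * e)"] by (simp add: abs_mult)
    also have "\<dots> \<le> \<bar>2 * of_int a * \<alpha> + of_int b\<bar> * 1 + \<bar>of_int a\<bar> * 1"
      using eq ee by (intro add_mono mult_left_mono) auto
    finally have "real_of_int \<bar>f (Suc k)\<bar> \<le> \<bar>2 * of_int a * \<alpha> + of_int b\<bar> + \<bar>of_int a\<bar>" by simp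
    then show ?thesis unfolding M_def by linarith
  qed
  define N where "N = \<bar>D\<bar> + 4 * M * M"
  \<comment> \<open>Without the zero triple all polynomials are nonzero and have finitely many
    roots. A zero triple would force the discriminant D to vanish.\<close>
  define box where "box = ({-M..M} \<times> {-N..N} \<times> {-M..M}) - {(0, 0, 0)}"
  define \<Theta> where "\<Theta> = (\<Union>(C, B, A)\<in>box. {x::real. poly (map_poly of_int [:C, B, A:]) x = 0})"
  have "finite \<Theta>"
    unfolding \<Theta>_def
  proof (rule finite_UN_I)
    show "finite box" by (simp add: box_def)
    fix t assume "t \<in> box"
    then obtain C B A where t: "t = (C, B, A)" "(C, B, A) \<noteq> (0, 0, 0)" by (auto simp: box_def)
    then have "map_poly of_int [:C, B, A:] \<noteq> (0 :: real poly)" by (auto simp: map_poly_pCons)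
    then show "finite (case t of (C, B, A) \<Rightarrow> {x::real. poly (map_poly of_int [:C, B, A:]) x = 0})"
      unfolding t prod.case by (rule poly_roots_finite)
  qed
  moreover have "\<theta> (Suc (Suc (Suc k))) \<in> \<Theta>" for k
  proof -
    obtain B where B: "poly (map_poly of_int [:f (Suc k), B, f (Suc (Suc k)):]) (\<theta> (Suc (Suc (Suc k)))) = 0"
        "B\<^sup>2 = D + 4 * f (Suc k) * f (Suc (Suc k))"
      using theta_root[OF quad, of "Suc k"] unfolding D_def f_def by blast
    have "\<bar>f (Suc k) * f (Suc (Suc k))\<bar> \<le> M * M" unfolding abs_mult by (intro mult_mono f_le) (use f_le[of k] in auto)
    then have "\<bar>4 * f (Suc k) * f (Suc (Suc k))\<bar> \<le> 4 * M * M" by (simp add: abs_mult mult.assoc)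
    then have "B\<^sup>2 \<le> N" unfolding B(2) N_def by linarith
    moreover have "\<bar>B\<bar> \<le> B\<^sup>2"
    proof (cases "B = 0")
      case False
      then have "1 * \<bar>B\<bar> \<le> \<bar>B\<bar> * \<bar>B\<bar>" by (intro mult_right_mono) auto
      then show ?thesis by (simp add: power2_eq_square)
    qed simp
    ultimately have "\<bar>B\<bar> \<le> N" by simp
    moreover have "(f (Suc k), B, f (Suc (Suc k))) \<noteq> (0, 0, 0)" using B(2) D by auto
    ultimately have "(f (Suc k), B, f (Suc (Suc k))) \<in> box"
      using f_le[of k] f_le[of "Suc k"] by (auto simp: box_def abs_le_iff)
    then show ?thesis unfolding \<Theta>_def using B(1) by (intro UN_I[of "(f (Suc k), B, f (Suc (Suc k)))"]) auto
  qed
  ultimately have "finite (range (\<lambda>k. \<theta> (Suc (Suc (Suc k)))))" by (meson finite_subset image_subsetI)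
  then have "\<not> inj (\<lambda>k. \<theta> (Suc (Suc (Suc k))))" using finite_imageD by blast
  then obtain i j where "i \<noteq> j" "\<theta> (Suc (Suc (Suc i))) = \<theta> (Suc (Suc (Suc j)))" by (auto simp: inj_def)
  then have "i < j \<or> j < i" by auto
  then show ?thesis
    using \<open>\<theta> (Suc (Suc (Suc i))) = \<theta> (Suc (Suc (Suc j)))\<close> by (metis Suc_less_eq)
qed

lemma cf_period_props:
  assumes "quadratic_irrational \<alpha>"
  shows "even (cf_period \<alpha>)" "cf_period \<alpha> > 0" "\<And>i. i \<ge> cf_preperiod \<alpha> \<Longrightarrow> cf_digit \<alpha> (i + cf_period \<alpha>) = cf_digit \<alpha> i"
proof -
  obtain i j where ij: "i < j" "\<theta> i = \<theta> j" using theta_repeats[OF assms] by blast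
  have shift: "\<theta> (i + m) = \<theta> (j + m)" for m
    by (induction m) (use ij in \<open>simp_all add: complete_quotient.simps\<close>)
  have period: "\<theta> (n + (j - i)) = \<theta> n" if "n \<ge> i" for n
    using shift[of "n - i"] that ij by (simp add: add.commute)
  \<comment> \<open>Doubling the distance between two equal quotients yields an even period, so that
    the least even one exists.\<close>
  have "cf_digit \<alpha> (n + 2 * (j - i)) = cf_digit \<alpha> n" if "n \<ge> i" for n
    using period[OF that] period[of "n + (j - i)"] that by (simp add: cf_digit_def mult_2 flip: add.assoc)
  then have "even (2 * (j - i)) \<and> (\<exists>p. cf_periodic_part \<alpha> p (2 * (j - i)))"
    using ij by (auto simp: cf_periodic_part_def)
  then have *: "even (cf_period \<alpha>) \<and> (\<exists>p. cf_periodic_part \<alpha> p (cf_period \<alpha>))"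
    unfolding cf_period_def by (rule LeastI)
  then have "cf_periodic_part \<alpha> (cf_preperiod \<alpha>) (cf_period \<alpha>)"
    unfolding cf_preperiod_def by (meson LeastI)
  then show "even (cf_period \<alpha>)" "cf_period \<alpha> > 0" "\<And>i. i \<ge> cf_preperiod \<alpha> \<Longrightarrow> cf_digit \<alpha> (i + cf_period \<alpha>) = cf_digit \<alpha> i"
    using * by (auto simp: cf_periodic_part_def)
qed

lemma theta_mult_ge2: "\<theta> i * \<theta> (Suc i) \<ge> 2"
proof -
  have "\<theta> i * \<theta> (Suc i) = of_int (cf_digit \<alpha> i) * \<theta> (Suc i) + 1"
    using theta_gt1[of "Suc i"] by (subst theta_eq[of i]) (simp add: field_simps)
  moreover have "1 * 1 \<le> of_int (cf_digit \<alpha> i) * \<theta> (Suc i)"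
    using theta_gt1[of "Suc i"] digit_ge1[of i] by (intro mult_mono) auto
  ultimately show ?thesis by linarith
qed

text \<open>Periodic digits force periodic quotients. Undoing a continued fraction step multiplies
  the distance of two quotients with equal digit by the product of their successors, hence by at
  least 4 in two steps; but equal floors keep it at most 1, so it is 0.\<close>

lemma theta_periodic:
  assumes per: "\<And>i. i \<ge> p \<Longrightarrow> cf_digit \<alpha> (i + l) = cf_digit \<alpha> i" and "i \<ge> p"
  shows "\<theta> (i + l) = \<theta> i"
proof -
  define d where "d i = \<bar>\<theta> (i + l) - \<theta> i\<bar>" for i
  have step: "d i * (\<theta> (Suc i + l) * \<theta> (Suc i)) = d (Suc i)" if "i \<ge> p" for i
  proof -
    have t: "\<theta> (Suc i + l) > 0" "\<theta> (Suc i) > 0" using theta_gt1[of "Suc i + l"] theta_gt1[of "Suc i"] by linarith+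
    have "\<theta> (i + l) - \<theta> i = 1 / \<theta> (Suc i + l) - 1 / \<theta> (Suc i)"
      using theta_eq[of "i + l"] theta_eq[of i] per[OF that] by simp
    also have "\<dots> = (\<theta> (Suc i) - \<theta> (Suc i + l)) / (\<theta> (Suc i + l) * \<theta> (Suc i))"
      using t by (simp add: field_simps)
    finally show ?thesis using t by (simp add: d_def abs_minus_commute abs_mult)
  qed
  have step2: "4 * d i \<le> d (Suc (Suc i))" if "i \<ge> p" for i
  proof -
    have "d (Suc (Suc i)) = d i * ((\<theta> (Suc i + l) * \<theta> (Suc (Suc i) + l)) * (\<theta> (Suc i) * \<theta> (Suc (Suc i))))"
    proof -
      have "d (Suc (Suc i)) = d i * (\<theta> (Suc i + l) * \<theta> (Suc i)) * (\<theta> (Suc (Suc i) + l) * \<theta> (Suc (Suc i)))"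
        unfolding step[OF that] using step[of "Suc i"] that by simp
      then show ?thesis by (simp only: mult_ac)
    qed
    moreover have "4 \<le> (\<theta> (Suc i + l) * \<theta> (Suc (Suc i) + l)) * (\<theta> (Suc i) * \<theta> (Suc (Suc i)))"
      using mult_mono[OF theta_mult_ge2[of "Suc i + l"] theta_mult_ge2[of "Suc i"]]
        mult_pos_pos[of "\<theta> (Suc i + l)" "\<theta> (Suc (Suc i) + l)"] theta_gt1[of "Suc i + l"] theta_gt1[of "Suc (Suc i) + l"]
      by simp
    then have "d i * 4 \<le> d i * ((\<theta> (Suc i + l) * \<theta> (Suc (Suc i) + l)) * (\<theta> (Suc i) * \<theta> (Suc (Suc i))))"
      by (rule mult_left_mono) (simp add: d_def)
    ultimately show ?thesis by linarith
  qed
  have "4 ^ m * d i \<le> d (i + 2 * m)" for m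
  proof (induction m)
    case (Suc m)
    have "4 ^ Suc m * d i \<le> 4 * d (i + 2 * m)" using Suc by simp
    also have "\<dots> \<le> d (i + 2 * Suc m)" using step2[of "i + 2 * m"] assms(2) by simp
    finally show ?case .
  qed simp
  moreover have "d j \<le> 1" if "j \<ge> p" for j
  proof -
    have "\<lfloor>\<theta> (j + l)\<rfloor> = \<lfloor>\<theta> j\<rfloor>" using per[OF that] by (simp add: cf_digit_def)
    then show ?thesis unfolding d_def by linarith
  qed
  ultimately have le: "4 ^ m * d i \<le> 1" for m using assms(2) by (meson order_trans trans_le_add1)
  have "d i = 0"
  proof (rule ccontr)
    assume "d i \<noteq> 0"
    then have "d i > 0" by (simp add: d_def)
    then obtain m where "1 / d i < 4 ^ m" using real_arch_pow[of 4 "1 / d i"] by auto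
    then show False using le[of m] \<open>d i > 0\<close> by (simp add: field_simps)
  qed
  then show ?thesis by (simp add: d_def)
qed

text \<open>The product \<delta>_k of the numbers -1 / \<theta>_i is the recessive solution of the
  recursion for \<open>Q\<close>. An even period multiplies it by exactly 1 / lam, while the
  complementary solution A is multiplied by lam. The margin 8 (1 + |B|) is the one
  \<open>cone_psi_family\<close> asks for; it holds for large k because \<delta> is bounded and
  \<open>Q\<close> is not.\<close>

lemma quadratic_num_seq:
  assumes "quadratic_irrational \<alpha>"
  obtains lam l K A B where "lam > 1" "ln (eta \<alpha>) = - ln lam" "l > 0" "even l"
    "\<And>k. k \<ge> K \<Longrightarrow> A k \<ge> 8 * (1 + \<bar>B k\<bar>)" "\<And>k j. k \<ge> K \<Longrightarrow> Q (k + l * j) = A k * lam ^ j + B k / lam ^ j"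
proof -
  define l p where "l = cf_period \<alpha>" "p = cf_preperiod \<alpha>"
  have l: "l > 0" "even l" and per: "\<And>i. i \<ge> p \<Longrightarrow> cf_digit \<alpha> (i + l) = cf_digit \<alpha> i"
    using cf_period_props[OF assms] by (auto simp: l_p_def)
  have thper: "\<theta> (i + l) = \<theta> i" if "i \<ge> p" for i using theta_periodic[OF per that] .
  define L where "L k = (\<Prod>i=1..l. \<theta> (k + i))" for k
  define lam where "lam = L p"
  have eta: "eta \<alpha> = inverse lam" by (simp add: eta_def lam_def L_def l_p_def)
  have thpos: "\<theta> i > 0" for i using theta_gt1[of i] by linarith
  have L_Suc: "L (Suc k) = L k" if "k \<ge> p" for k
  proof -
    have L_alt: "L k = (\<Prod>i<l. \<theta> (Suc k + i))" for k
      unfolding L_def by (rule prod.reindex_bij_witness[of _ Suc "\<lambda>i. i - 1"]) auto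
    have "\<theta> (Suc k) * L (Suc k) = (\<Prod>i<Suc l. \<theta> (Suc k + i))"
      unfolding L_alt prod.lessThan_Suc_shift by simp
    also have "\<dots> = \<theta> (Suc k) * L k" using thper[of "Suc k"] that by (simp add: L_alt)
    finally show ?thesis using thpos[of "Suc k"] by simp
  qed
  have L_eq: "L k = lam" if "k \<ge> p" for k
    using that by (induction k rule: dec_induct) (auto simp: lam_def L_Suc)
  have lam: "lam > 1"
    unfolding lam_def L_def using l by (intro less_1_prod) (auto simp: theta_gt1)
  define \<delta> where "\<delta> k = (\<Prod>i=1..k. - 1 / \<theta> i)" for k
  have \<delta>_Suc: "\<delta> (Suc k) = \<delta> k * (- 1 / \<theta> (Suc k))" for k by (simp add: \<delta>_def)
  have \<delta>_nz: "\<delta> k \<noteq> 0" for k using thpos by (auto simp: \<delta>_def less_imp_neq[THEN not_sym])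
  have \<delta>_le: "\<bar>\<delta> k\<bar> \<le> 1" for k
    unfolding \<delta>_def abs_prod
  proof (rule prod_le_1)
    show "0 \<le> \<bar>- 1 / \<theta> i\<bar> \<and> \<bar>- 1 / \<theta> i\<bar> \<le> 1" for i
      using theta_gt1[of i] by (simp add: abs_divide divide_le_eq abs_of_pos)
  qed
  have \<delta>_rec: "\<delta> (Suc (Suc k)) = of_int (cf_digit \<alpha> (Suc k)) * \<delta> (Suc k) + \<delta> k" for k
  proof -
    have "\<delta> k = - \<theta> (Suc k) * \<delta> (Suc k)" using thpos[of "Suc k"] by (simp add: \<delta>_Suc)
    then show ?thesis using \<delta>_Suc[of "Suc k"] theta_eq[of "Suc k"] by (simp add: algebra_simps)
  qed
  have \<delta>_per: "\<delta> (k + l) = \<delta> k / lam" if "k \<ge> p" for k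
  proof -
    have "\<delta> (k + m) = \<delta> k * (\<Prod>i=1..m. - 1 / \<theta> (k + i))" for m
      by (induction m) (auto simp: \<delta>_Suc)
    also have "(\<Prod>i=1..l. - 1 / \<theta> (k + i)) = (- 1) ^ l / L k"
      unfolding prod_dividef L_def by simp
    finally show ?thesis using l(2) L_eq[OF that] by simp
  qed
  \<comment> \<open>The Casoratian with \<delta>, which only changes sign at each step. Its
    vanishing on X below shows that Q(k + l) - lam Q(k) is a constant multiple of
    \<delta>_k.\<close>
  define W where "W x k = x (Suc k) * \<delta> k - x k * \<delta> (Suc k)" for x :: "nat \<Rightarrow> real" and k
  have W_Suc: "W x (Suc k) = - W x k" if "x (Suc (Suc k)) = of_int (cf_digit \<alpha> (Suc k)) * x (Suc k) + x k" for x k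
    unfolding W_def that \<delta>_rec by (simp add: algebra_simps)
  have W_Q: "W Q (k + m) = (-1) ^ m * W Q k" for k m
    by (induction m) (simp_all add: W_Suc num_seq_Suc_Suc)
  define X where "X k = Q (k + l) - lam * Q k" for k
  have "W X k = 0" if "k \<ge> p" for k
  proof -
    have "W X k = (Q (Suc k + l) * \<delta> k - Q (k + l) * \<delta> (Suc k)) - lam * W Q k"
      by (simp add: W_def X_def algebra_simps)
    also have "Q (Suc k + l) * \<delta> k - Q (k + l) * \<delta> (Suc k) = lam * W Q (k + l)"
    proof -
      have e: "\<delta> k = lam * \<delta> (k + l)" "\<delta> (Suc k) = lam * \<delta> (Suc (k + l))"
        using \<delta>_per[OF that] \<delta>_per[of "Suc k"] that lam by simp_all
      show ?thesis by (simp only: W_def e add_Suc) (simp only: algebra_simps)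
    qed
    also have "W Q (k + l) = W Q k" using W_Q[of k l] l(2) by simp
    finally show ?thesis by simp
  qed
  then have X_step: "X (Suc k) / \<delta> (Suc k) = X k / \<delta> k" if "k \<ge> p" for k
    using that \<delta>_nz[of k] \<delta>_nz[of "Suc k"] by (simp add: W_def field_simps)
  define \<mu> where "\<mu> = X p / \<delta> p"
  have X_eq: "X k / \<delta> k = \<mu>" if "k \<ge> p" for k
    using that by (induction k rule: dec_induct) (auto simp: \<mu>_def X_step)
  have Q_per: "Q (k + l) = lam * Q k + \<mu> * \<delta> k" if "k \<ge> p" for k
    using X_eq[OF that] \<delta>_nz[of k] by (simp add: X_def field_simps)
  \<comment> \<open>Chosen so that adding \<nu> \<delta> to \<open>Q\<close> removes the
    inhomogeneous term \<mu> \<delta>: it solves \<mu> = lam \<nu> - \<nu> / lam.\<close>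
  define \<nu> where "\<nu> = \<mu> / (lam - 1 / lam)"
  have "1 / lam < 1" using lam by simp
  then have "lam - 1 / lam \<noteq> 0" using lam by linarith
  then have "\<nu> * (lam - 1 / lam) = \<mu>" by (simp add: \<nu>_def)
  then have \<nu>: "\<mu> = lam * \<nu> - \<nu> / lam" by (simp add: algebra_simps)
  define A B where "A k = Q k + \<nu> * \<delta> k" and "B k = - \<nu> * \<delta> k" for k
  have A_per: "A (k + l) = lam * A k" if "k \<ge> p" for k
    using Q_per[OF that] \<delta>_per[OF that] by (simp add: A_def \<nu> algebra_simps)
  have B_per: "B (k + l) = B k / lam" if "k \<ge> p" for k
    using \<delta>_per[OF that] by (simp add: B_def)
  have AB: "A (k + l * j) = A k * lam ^ j \<and> B (k + l * j) = B k / lam ^ j" if "k \<ge> p" for k j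
  proof (induction j)
    case (Suc j)
    have "k + l * Suc j = (k + l * j) + l" by simp
    then show ?case using Suc A_per[of "k + l * j"] B_per[of "k + l * j"] that by (simp only:) simp
  qed simp
  have "\<forall>\<^sub>F k in sequentially. Q k \<ge> 8 * (1 + \<bar>\<nu>\<bar>) + \<bar>\<nu>\<bar>" using Q_at_top by (simp add: filterlim_at_top)
  then obtain K0 where K0: "\<And>k. k \<ge> K0 \<Longrightarrow> Q k \<ge> 8 * (1 + \<bar>\<nu>\<bar>) + \<bar>\<nu>\<bar>" by (auto simp: eventually_sequentially)
  have eta': "ln (eta \<alpha>) = - ln lam" using lam by (simp add: eta ln_inverse)
  have Q_eq: "Q (k + l * j) = A k * lam ^ j + B k / lam ^ j" if "k \<ge> max p K0" for k j
  proof -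
    have "Q (k + l * j) = A (k + l * j) + B (k + l * j)" by (simp add: A_def B_def)
    then show ?thesis using AB[of k j] that by simp
  qed
  have A_ge: "A k \<ge> 8 * (1 + \<bar>B k\<bar>)" if "k \<ge> max p K0" for k
  proof -
    have "\<bar>\<nu> * \<delta> k\<bar> \<le> \<bar>\<nu>\<bar> * 1" unfolding abs_mult by (intro mult_left_mono \<delta>_le) auto
    then have "A k \<ge> Q k - \<bar>\<nu>\<bar>" "\<bar>B k\<bar> \<le> \<bar>\<nu>\<bar>" by (simp_all add: A_def B_def abs_le_iff)
    then show ?thesis using K0[of k] that by simp
  qed
  show ?thesis by (rule that[OF lam eta' l A_ge Q_eq])
qed

end

section \<open>Continuation of series with geometrically scaled parameters\<close>

text \<open>
  \<open>scale_diff r P\<close> annihilates the powers \<open>z, \<dots>, z\<^sup>P\<close>; it turns a series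
  \<open>\<Sum>\<^sub>j r\<^bsup>js\<^esup> h(r\<^sup>j)\<close> into one converging in a half-plane which is larger by \<open>P\<close>.
\<close>

primrec scale_diff :: "complex \<Rightarrow> (complex \<Rightarrow> complex) \<Rightarrow> nat \<Rightarrow> complex \<Rightarrow> complex" where
  "scale_diff r h 0 z = h z"
| "scale_diff r h (Suc P) z = scale_diff r h P (r * z) - r ^ Suc P * scale_diff r h P z"

lemma scale_diff_sum:
  "scale_diff r (\<lambda>z. \<Sum>i\<in>I. c i * h i z) P z = (\<Sum>i\<in>I. c i * scale_diff r (h i) P z)"
  by (induction P arbitrary: z) (simp_all add: sum_subtractf sum_distrib_left algebra_simps)

text \<open>On Taylor coefficients the p-th step multiplies the m-th one by r^m - r^p. This kills m
  = p and has modulus at most 1; as h vanishes at 0, the first surviving power is P + 1.\<close>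

lemma scale_diff_le:
  fixes r :: real and h :: "complex \<Rightarrow> complex"
  assumes r: "0 < r" "r < 1" and h: "h holomorphic_on ball 0 2" "\<And>z. z \<in> ball 0 2 \<Longrightarrow> norm (h z) \<le> B" "h 0 = 0"
    and z: "norm z \<le> 1"
  shows "norm (scale_diff (of_real r) h P z) \<le> 3 * B * norm z ^ (P + 1)"
proof -
  define c where "c m = (deriv ^^ m) h 0 / fact m" for m
  have series: "(\<lambda>m. c m * (\<Prod>p=1..P. of_real r ^ m - of_real r ^ p) * z ^ m) sums scale_diff (of_real r) h P z"
    if "z \<in> ball 0 2" for z
    using that
  proof (induction P arbitrary: z)
    case 0
    then show ?case using holomorphic_power_series[OF h(1) 0] by (simp add: c_def)
  next
    case (Suc P)
    have "norm (of_real r * z) \<le> 1 * norm z" unfolding norm_mult using r by (intro mult_right_mono) auto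
    then have "of_real r * z \<in> ball 0 2" using Suc.prems by simp
    from sums_diff[OF Suc.IH[OF this] sums_mult[OF Suc.IH[OF Suc.prems], of "of_real r ^ Suc P"]]
    show ?case by (simp add: algebra_simps power_mult_distrib)
  qed
  have B: "B \<ge> 0" using h(2)[of 0] by (simp add: h(3))
  have c_le: "norm (c m) \<le> B * (2/3) ^ m" for m
  proof -
    have sub: "cball 0 (3/2) \<subseteq> ball (0::complex) 2" by auto
    have "norm ((deriv ^^ m) h 0) \<le> fact m * B / (3/2) ^ m"
    proof (rule Cauchy_inequality)
      show "h holomorphic_on ball 0 (3/2)"
        by (rule holomorphic_on_subset[OF h(1)]) auto
      show "continuous_on (cball 0 (3/2)) h"
        by (rule holomorphic_on_imp_continuous_on[OF holomorphic_on_subset[OF h(1) sub]])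
      show "norm (h x) \<le> B" if "norm (0 - x) = 3/2" for x using that by (intro h(2)) auto
    qed auto
    from divide_right_mono[OF this, of "fact m"] show ?thesis
      by (simp add: c_def norm_divide power_divide field_simps)
  qed
  let ?t = "\<lambda>m. c m * (\<Prod>p=1..P. of_real r ^ m - of_real r ^ p) * z ^ m"
  have t_le: "norm (?t m) \<le> B * norm z ^ (P + 1) * (2/3) ^ m" for m
  proof (cases "m \<le> P")
    case True
    then have "c m = 0 \<or> (\<Prod>p=1..P. complex_of_real r ^ m - of_real r ^ p) = 0"
    proof (cases "m = 0")
      case False
      then have "(\<Prod>p=1..P. complex_of_real r ^ m - of_real r ^ p) = 0"
        using True by (intro prod_zero) (auto intro!: bexI[of _ m])
      then show ?thesis ..
    qed (simp add: c_def h(3))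
    then have "?t m = 0" by (elim disjE) (simp_all only: mult_zero_left mult_zero_right)
    then show ?thesis using B by (simp only: norm_zero) simp
  next
    case False
    have "norm (\<Prod>p=1..P. complex_of_real r ^ m - of_real r ^ p) \<le> 1"
      unfolding prod_norm[symmetric]
    proof (rule prod_le_1)
      fix p
      have "norm (complex_of_real r ^ m - of_real r ^ p) = \<bar>r ^ m - r ^ p\<bar>"
        by (simp flip: of_real_power of_real_diff)
      moreover have "0 \<le> r ^ m" "r ^ m \<le> 1" "0 \<le> r ^ p" "r ^ p \<le> 1" using r by (auto intro: power_le_one)
      ultimately show "0 \<le> norm (complex_of_real r ^ m - of_real r ^ p) \<and> norm (complex_of_real r ^ m - of_real r ^ p) \<le> 1"
        by linarith
    qed
    then have "norm (?t m) \<le> B * (2/3) ^ m * 1 * norm z ^ (P + 1)"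
      unfolding norm_mult norm_power using False z B by (intro mult_mono c_le power_decreasing) auto
    then show ?thesis by (simp add: mult_ac)
  qed
  have "scale_diff (of_real r) h P z = suminf ?t" using series[of z] z by (simp add: sums_iff)
  also have "norm \<dots> \<le> (\<Sum>m. B * norm z ^ (P + 1) * (2/3) ^ m)"
    by (intro norm_suminf_le t_le summable_mult summable_geometric) auto
  also have "\<dots> = 3 * B * norm z ^ (P + 1)"
    by (subst suminf_mult) (auto simp: suminf_geometric intro: summable_geometric)
  finally show ?thesis .
qed

text \<open>Summation by parts: passing from P to P + 1 multiplies the series by 1 - r^(s + P + 1),
  up to its initial term, which is entire in s. N P is the P-th series with all these initial terms
  restored, that is, the continuation of the original series times the first P such factors.\<close>

lemma scale_series_continuation:
  fixes r :: real and m :: "complex \<Rightarrow> complex \<Rightarrow> complex"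
  assumes r: "0 < r" "r < 1"
    and holo: "\<And>j. (\<lambda>s. m s (of_real r ^ j)) holomorphic_on UNIV"
    and bound: "\<And>P R. \<exists>C. \<forall>s j. norm s \<le> R \<longrightarrow> norm (scale_diff (of_real r) (m s) P (of_real r ^ j)) \<le> C * (r ^ j) ^ (P + 1)"
  obtains N where "\<And>P. N P holomorphic_on {s. Re s > - (real P + 1)}"
    "\<And>P s. Re s > - (real P + 1) \<Longrightarrow> N (Suc P) s = (1 - of_real r powr s * of_real r ^ Suc P) * N P s"
    "\<And>s. Re s > -1 \<Longrightarrow> (\<lambda>j. (of_real r powr s) ^ j * m s (of_real r ^ j)) sums N 0 s"
proof -
  define x where "x s = complex_of_real r powr s" for s
  \<comment> \<open>The exponent j + P, rather than j, makes the shift from j to j + 1 fit the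
    recursion of \<open>scale_diff\<close>.\<close>
  define d where "d P j s = x s ^ (j + P) * scale_diff (of_real r) (m s) P (of_real r ^ j)" for P j s
  have x_holo: "x holomorphic_on A" for A unfolding x_def using r by (intro holomorphic_intros) auto
  have nx: "norm (x s) = r powr Re s" for s unfolding x_def using r by (simp add: norm_of_real_powr)
  have sd_holo: "(\<lambda>s. scale_diff (of_real r) (m s) P (of_real r ^ j)) holomorphic_on UNIV" for P j
  proof (induction P arbitrary: j)
    case (Suc P)
    then show ?case using Suc[of "Suc j"] Suc[of j] by (auto intro!: holomorphic_intros)
  qed (use holo in simp)
  have d_holo: "d P j holomorphic_on A" for P j A
    unfolding d_def by (intro holomorphic_intros x_holo holomorphic_on_subset[OF sd_holo]) auto
  have d_bound: "\<exists>g. summable g \<and> (\<forall>s. norm s \<le> R \<longrightarrow> l \<le> Re s \<longrightarrow> (\<forall>j. norm (d P j s) \<le> g j))"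
    if l: "l > - (real P + 1)" for P R l
  proof -
    obtain C where C: "\<And>s j. norm s \<le> R \<Longrightarrow> norm (scale_diff (of_real r) (m s) P (of_real r ^ j)) \<le> C * (r ^ j) ^ (P + 1)"
      using bound by blast
    define y where "y = r powr (l + real P + 1)"
    have y: "0 < y" "y < 1" using r l powr_less_mono2[of "l + real P + 1" r 1] unfolding y_def by auto
    have "norm (d P j s) \<le> \<bar>C\<bar> * (r powr l) ^ P * y ^ j" if s: "norm s \<le> R" "l \<le> Re s" for s j
    proof -
      have "norm (x s) \<le> r powr l" unfolding nx using s(2) r by (intro powr_mono') auto
      then have 1: "norm (x s ^ (j + P)) \<le> (r powr l) ^ (j + P)" unfolding norm_power by (intro power_mono) auto
      have "norm (d P j s) \<le> (r powr l) ^ (j + P) * (C * (r ^ j) ^ (P + 1))"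
        unfolding d_def norm_mult by (intro mult_mono 1 C s) auto
      also have "\<dots> \<le> (r powr l) ^ (j + P) * (\<bar>C\<bar> * (r ^ j) ^ (P + 1))"
        using r by (intro mult_left_mono mult_right_mono) auto
      also have "\<dots> = \<bar>C\<bar> * (r powr l) ^ P * ((r powr l) * r ^ (P + 1)) ^ j"
        by (simp add: power_add power_mult_distrib power_mult[symmetric] mult_ac)
      also have "(r powr l) * r ^ (P + 1) = y"
        unfolding y_def using r by (simp add: powr_add powr_realpow mult_ac)
      finally show ?thesis .
    qed
    moreover have "summable (\<lambda>j. \<bar>C\<bar> * (r powr l) ^ P * y ^ j)"
      using y by (intro summable_mult summable_geometric) auto
    ultimately show ?thesis by blast
  qed
  define S where "S P s = (\<Sum>j. d P j s)" for P s
  have d_summable: "summable (\<lambda>j. d P j s)" if s: "Re s > - (real P + 1)" for P s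
  proof -
    obtain g where g: "summable g" "\<And>j. norm (d P j s) \<le> g j"
      using d_bound[OF s, of "norm s"] by blast
    show ?thesis by (rule summable_comparison_test'[OF g(1)]) (rule g(2))
  qed
  have S_holo: "S P holomorphic_on {s. Re s > - (real P + 1)}" for P
    unfolding S_def
  proof (rule holomorphic_on_suminf[OF open_halfspace_Re_gt d_holo])
    fix s assume s: "s \<in> {s. Re s > - (real P + 1)}"
    define e where "e = (Re s + (real P + 1)) / 2"
    have e: "e > 0" "Re s - e > - (real P + 1)" using s by (auto simp: e_def field_simps)
    obtain g where g: "summable g" "\<And>w j. norm w \<le> norm s + e \<Longrightarrow> Re s - e \<le> Re w \<Longrightarrow> norm (d P j w) \<le> g j"
      using d_bound[OF e(2), of "norm s + e"] by blast
    have "norm w \<le> norm s + e \<and> Re s - e \<le> Re w" if "w \<in> ball s e" for w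
      using that norm_triangle_ineq2[of w s] abs_Re_le_cmod[of "w - s"]
      by (simp add: dist_norm norm_minus_commute)
    then show "\<exists>e>0. \<exists>g. summable g \<and> (\<forall>w\<in>ball s e \<inter> {s. Re s > - (real P + 1)}. \<forall>j. norm (d P j w) \<le> g j)"
      using e(1) g by (intro exI[of _ e] conjI exI[of _ g]) auto
  qed
  have S_Suc: "S (Suc P) s = (1 - x s * of_real r ^ Suc P) * S P s - d P 0 s" if s: "Re s > - (real P + 1)" for P s
  proof -
    have 1: "(\<lambda>j. d P (Suc j) s) sums (S P s - d P 0 s)"
      using summable_sums[OF d_summable[OF s]] by (subst sums_Suc_iff) (simp add: S_def)
    have 2: "(\<lambda>j. (x s * of_real r ^ Suc P) * d P j s) sums ((x s * of_real r ^ Suc P) * S P s)"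
      unfolding S_def by (rule sums_mult[OF summable_sums[OF d_summable[OF s]]])
    have "(\<lambda>j. d P (Suc j) s - (x s * of_real r ^ Suc P) * d P j s) = (\<lambda>j. d (Suc P) j s)"
      by (simp add: d_def fun_eq_iff algebra_simps)
    with sums_diff[OF 1 2] have "(\<lambda>j. d (Suc P) j s) sums (S P s - d P 0 s - (x s * of_real r ^ Suc P) * S P s)" by simp
    then show ?thesis by (simp add: S_def sums_iff algebra_simps)
  qed
  define Rm where "Rm = rec_nat (\<lambda>s. 0) (\<lambda>P R s. (1 - x s * of_real r ^ Suc P) * R s + d P 0 s)"
  have Rm_0: "Rm 0 = (\<lambda>s. 0)" and Rm_Suc: "Rm (Suc P) = (\<lambda>s. (1 - x s * of_real r ^ Suc P) * Rm P s + d P 0 s)" for P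
    by (simp_all add: Rm_def)
  have Rm_holo: "Rm P holomorphic_on A" for P A
    by (induction P) (auto simp: Rm_0 Rm_Suc intro!: holomorphic_intros x_holo d_holo)
  show ?thesis
  proof (rule that[of "\<lambda>P s. S P s + Rm P s"])
    show "(\<lambda>s. S P s + Rm P s) holomorphic_on {s. Re s > - (real P + 1)}" for P
      by (intro holomorphic_intros S_holo Rm_holo)
    show "S (Suc P) s + Rm (Suc P) s = (1 - of_real r powr s * of_real r ^ Suc P) * (S P s + Rm P s)"
      if "Re s > - (real P + 1)" for P s
      unfolding S_Suc[OF that] Rm_Suc x_def by (simp add: algebra_simps)
    show "(\<lambda>j. (of_real r powr s) ^ j * m s (of_real r ^ j)) sums (S 0 s + Rm 0 s)" if "Re s > -1" for s
      using summable_sums[OF d_summable[of 0 s]] that by (simp add: S_def Rm_0 d_def x_def)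
  qed
qed

text \<open>\<open>reg_mellin\<close> is linear, so the scaled differences in z can be taken inside
  the transform. There \<open>scale_diff_le\<close> applies for each fixed \<tau> and yields an
  admissibility constant of order |z|^(P + 1), which \<open>reg_mellin_bound\<close> passes on to
  the transform.\<close>

lemma scale_diff_reg_mellin:
  fixes r :: real and \<psi> :: "complex \<Rightarrow> complex \<Rightarrow> complex"
  assumes r: "0 < r" "r < 1" and \<rho>: "\<rho> > 0"
    and adm: "\<And>z. z \<in> ball 0 2 \<Longrightarrow> reg_adm \<rho> B (\<psi> z)"
    and holo: "\<And>\<tau>. \<tau> \<in> ball 0 (2 * \<rho>) \<or> (\<exists>t>\<rho>. \<tau> = of_real t) \<Longrightarrow> (\<lambda>z. \<psi> z \<tau>) holomorphic_on ball 0 2"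
    and zero: "\<And>\<tau>. \<psi> 0 \<tau> = 0"
  shows "\<exists>C. \<forall>s j. norm s \<le> R \<longrightarrow>
    norm (scale_diff (of_real r) (\<lambda>z. reg_mellin \<rho> (\<psi> z) (s - 1)) P (of_real r ^ j)) \<le> C * (r ^ j) ^ (P + 1)"
proof -
  let ?D = "\<lambda>z \<tau>. scale_diff (of_real r) (\<lambda>z. \<psi> z \<tau>) P z"
  have nz: "norm (complex_of_real r * z) \<le> norm z" for z
    unfolding norm_mult using r by (auto intro!: mult_left_le_one_le)
  have lin: "(\<exists>B'. reg_adm \<rho> B' (\<lambda>\<tau>. scale_diff (of_real r) (\<lambda>z. \<psi> z \<tau>) P z)) \<and>
      scale_diff (of_real r) (\<lambda>z. reg_mellin \<rho> (\<psi> z) s) P z = reg_mellin \<rho> (\<lambda>\<tau>. scale_diff (of_real r) (\<lambda>z. \<psi> z \<tau>) P z) s"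
    if "norm z \<le> 1" for z s P
    using that
  proof (induction P arbitrary: z)
    case 0
    then have "reg_adm \<rho> B (\<psi> z)" by (intro adm) auto
    then show ?case by auto
  next
    case (Suc P)
    have z': "norm (of_real r * z) \<le> 1" using nz[of z] Suc.prems by linarith
    obtain B1 where B1: "reg_adm \<rho> B1 (\<lambda>\<tau>. scale_diff (of_real r) (\<lambda>z. \<psi> z \<tau>) P (of_real r * z))"
      using Suc.IH[OF z'] by blast
    obtain B2 where B2: "reg_adm \<rho> B2 (\<lambda>\<tau>. scale_diff (of_real r) (\<lambda>z. \<psi> z \<tau>) P z)"
      using Suc.IH[OF Suc.prems] by blast
    show ?case
      using reg_adm_diff_cmult[OF B1 B2 \<rho>, of "of_real r ^ Suc P"] Suc.IH[OF z'] Suc.IH[OF Suc.prems] by auto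
  qed
  have adm': "reg_adm \<rho> (3 * B * norm z ^ (P + 1)) (?D z)" if z: "norm z \<le> 1" for z
  proof -
    obtain B' where B': "reg_adm \<rho> B' (?D z)" using lin[OF z] by blast
    have "norm (?D z \<tau>) \<le> 3 * (B * K) * norm z ^ (P + 1)"
      if "(\<lambda>z. \<psi> z \<tau>) holomorphic_on ball 0 2" "\<And>z. z \<in> ball 0 2 \<Longrightarrow> norm (\<psi> z \<tau>) \<le> B * K" for \<tau> K
      by (rule scale_diff_le[OF r that zero z])
    note le = this
    show ?thesis
      unfolding reg_adm_def
    proof (intro conjI ballI allI impI)
      show "?D z holomorphic_on ball 0 (2 * \<rho>)" "(\<lambda>t. ?D z (of_real t)) \<in> borel_measurable pos_lborel"
        using B' by (simp_all add: reg_adm_def)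
      show "norm (?D z \<tau>) \<le> 3 * B * norm z ^ (P + 1)" if "\<tau> \<in> ball 0 (2 * \<rho>)" for \<tau>
        using le[of \<tau> 1] holo that adm by (simp add: reg_adm_def)
      show "norm (?D z (of_real t)) \<le> 3 * B * norm z ^ (P + 1) * exp (-t/2)" if t: "t > \<rho>" for t
      proof -
        have "norm (?D z (of_real t)) \<le> 3 * (B * exp (-t/2)) * norm z ^ (P + 1)"
        proof (rule le)
          show "(\<lambda>z. \<psi> z (of_real t)) holomorphic_on ball 0 2" using t by (intro holo) auto
          show "norm (\<psi> z (of_real t)) \<le> B * exp (-t/2)" if "z \<in> ball 0 2" for z
            using adm[OF that] t by (simp add: reg_adm_def)
        qed
        then show ?thesis by (simp add: mult_ac)
      qed
    qed
  qed
  obtain C where C: "\<And>\<psi> B s. reg_adm \<rho> B \<psi> \<Longrightarrow> norm s \<le> R + 1 \<Longrightarrow> norm (reg_mellin \<rho> \<psi> s) \<le> C * B"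
    using reg_mellin_bound[OF \<rho>, of "R + 1"] by blast
  have "norm (scale_diff (of_real r) (\<lambda>z. reg_mellin \<rho> (\<psi> z) (s - 1)) P (of_real r ^ j)) \<le> C * (3 * B) * (r ^ j) ^ (P + 1)"
    if s: "norm s \<le> R" for s j
  proof -
    have z: "norm (complex_of_real r ^ j) = r ^ j" using r by (simp add: norm_power)
    have z1: "norm (complex_of_real r ^ j) \<le> 1" unfolding z using r by (intro power_le_one) auto
    have "scale_diff (of_real r) (\<lambda>z. reg_mellin \<rho> (\<psi> z) (s - 1)) P (of_real r ^ j) = reg_mellin \<rho> (?D (of_real r ^ j)) (s - 1)"
      using lin[OF z1] by blast
    also have "norm \<dots> \<le> C * (3 * B * norm (complex_of_real r ^ j) ^ (P + 1))"
      by (rule C[OF adm'[OF z1]]) (use s norm_triangle_ineq4[of s 1] in simp)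
    finally show ?thesis unfolding z by (simp add: mult_ac)
  qed
  then show ?thesis by blast
qed

text \<open>
  The kernel \<open>\<tau> \<mapsto> \<tau> e\<^bsup>-wz\<tau>\<^esup> (e\<^bsup>z\<tau>\<^esup> - 1) / ((e\<^bsup>x\<tau>\<^esup> - 1) (e\<^bsup>y\<tau>\<^esup> - 1))\<close>, with the removable
  singularity at the origin removed.
\<close>

definition cone_psi :: "real \<Rightarrow> complex \<Rightarrow> complex \<Rightarrow> complex \<Rightarrow> complex \<Rightarrow> complex" where
  "cone_psi w x y z \<tau> = z * exp (- (of_real w * z * \<tau>)) * expm1_quot (z * \<tau>) *
     inverse (x * y * expm1_quot (x * \<tau>) * expm1_quot (y * \<tau>))"

lemma measurable_expm1_quot: "(\<lambda>t. expm1_quot (x * complex_of_real t)) \<in> borel_measurable pos_lborel"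
proof (rule measurable_restrict_space1)
  have "continuous_on UNIV (\<lambda>t. expm1_quot (x * complex_of_real t))"
    by (rule continuous_on_compose2[OF holomorphic_on_imp_continuous_on[OF holomorphic_expm1_quot], of _ "\<lambda>t. x * complex_of_real t"])
       (auto intro!: continuous_intros)
  then show "(\<lambda>t. expm1_quot (x * complex_of_real t)) \<in> borel_measurable lborel"
    by (simp add: borel_measurable_continuous_onI)
qed

lemma cone_psi_measurable: "(\<lambda>t. cone_psi w x y z (of_real t)) \<in> borel_measurable pos_lborel"
proof -
  note [measurable] = measurable_expm1_quot
  have [measurable]: "(\<lambda>t. exp (- (complex_of_real w * z * of_real t))) \<in> borel_measurable pos_lborel"
    by (rule measurable_restrict_space1) measurable
  show ?thesis unfolding cone_psi_def by measurable
qed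

text \<open>K is uniform in all parameters: every argument of \<open>expm1_quot\<close> lies in the
  unit disc, where that function is bounded and bounded away from 0.\<close>

lemma cone_psi_local:
  obtains K where "K > 0" "\<And>w x y z \<tau>. \<lbrakk>0 \<le> w; w \<le> 1; norm x \<ge> 1; norm y \<ge> 1; norm z \<le> 2;
     norm (x * \<tau>) \<le> 1; norm (y * \<tau>) \<le> 1; norm (z * \<tau>) \<le> 1\<rbrakk> \<Longrightarrow> norm (cone_psi w x y z \<tau>) \<le> K"
proof -
  obtain c C where c: "c > 0" "\<And>u. norm u \<le> 1 \<Longrightarrow> c \<le> norm (expm1_quot u)" "\<And>u. norm u \<le> 1 \<Longrightarrow> norm (expm1_quot u) \<le> C"
    using expm1_quot_bounds by blast
  have C: "C > 0" using c(1) c(2)[of 0] c(3)[of 0] by simp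
  show ?thesis
  proof (rule that[of "2 * exp 1 * C * inverse (1 * 1 * c * c)"])
    show "2 * exp 1 * C * inverse (1 * 1 * c * c) > 0" using c(1) C by simp
    fix w :: real and x y z \<tau> :: complex
    assume *: "0 \<le> w" "w \<le> 1" "norm x \<ge> 1" "norm y \<ge> 1" "norm z \<le> 2"
     "norm (x * \<tau>) \<le> 1" "norm (y * \<tau>) \<le> 1" "norm (z * \<tau>) \<le> 1"
    have "norm (exp (- (of_real w * z * \<tau>))) \<le> exp (norm (- (of_real w * z * \<tau>)))"
      by (rule norm_exp)
    also have "norm (- (of_real w * z * \<tau>)) \<le> 1 * 1"
      unfolding norm_minus_cancel mult.assoc norm_mult[of "of_real w"] using * by (intro mult_mono) auto
    finally have e: "norm (exp (- (of_real w * z * \<tau>))) \<le> exp 1" by simp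
    have d: "1 * 1 * c * c \<le> norm (x * y * expm1_quot (x * \<tau>) * expm1_quot (y * \<tau>))"
      unfolding norm_mult using * c by (intro mult_mono) (auto simp: norm_mult)
    have "norm (inverse (x * y * expm1_quot (x * \<tau>) * expm1_quot (y * \<tau>))) \<le> inverse (1 * 1 * c * c)"
      unfolding norm_inverse using c(1) by (intro le_imp_inverse_le[OF d]) simp
    then show "norm (cone_psi w x y z \<tau>) \<le> 2 * exp 1 * C * inverse (1 * 1 * c * c)"
      unfolding cone_psi_def norm_mult[of "_ * _" "inverse _"] norm_mult[of "_ * _" "expm1_quot _"] norm_mult[of z]
      using * e C c(3)[of "z * \<tau>"] by (intro mult_mono) auto
  qed
qed

lemma expm1_quot_nonzero_unit_disc: "norm u \<le> 1 \<Longrightarrow> expm1_quot u \<noteq> 0"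
  by (rule expm1_quot_nonzero) (use pi_gt3 in auto)

lemma cone_psi_eq:
  assumes "Re x > 0" "Re y > 0" "t > 0"
  shows "cone_psi w x y z (of_real t) = of_real t * (exp (- (of_real w * z * of_real t)) * (exp (z * of_real t) - 1)) /
     ((exp (x * of_real t) - 1) * (exp (y * of_real t) - 1))"
proof -
  have nz: "x \<noteq> 0" "y \<noteq> 0" "complex_of_real t \<noteq> 0" using assms by auto
  have "expm1_quot (x * of_real t) \<noteq> 0" "expm1_quot (y * of_real t) \<noteq> 0"
    using assms by (auto intro!: expm1_quot_nonzero)
  then show ?thesis
    unfolding expm1_quot_mult[symmetric] cone_psi_def using nz by (simp add: field_simps)
qed

text \<open>The variable z replaces r^j, and A + B z^2 replaces r^j times the numerator of index k +
  l j. For |z| < 2 the margin 8 keeps the real parts of x and y at least 4, so the two denominators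
  together grow like exp (4 t) and outweigh a numerator of order exp (2 t).\<close>

lemma cone_psi_family:
  fixes A A' B B' w :: real
  assumes w: "0 \<le> w" "w \<le> 1" and A: "A \<ge> 8 * (1 + \<bar>B\<bar>)" and A': "A' \<ge> 8 * (1 + \<bar>B'\<bar>)"
  defines "\<psi> \<equiv> \<lambda>z. cone_psi w (of_real A + of_real B * z\<^sup>2) (of_real A' + of_real B' * z\<^sup>2) z"
  obtains \<rho> K where "\<rho> > 0" "\<And>z. z \<in> ball 0 2 \<Longrightarrow> reg_adm \<rho> K (\<psi> z)"
    "\<And>\<tau>. \<tau> \<in> ball 0 (2 * \<rho>) \<or> (\<exists>t>\<rho>. \<tau> = of_real t) \<Longrightarrow> (\<lambda>z. \<psi> z \<tau>) holomorphic_on ball 0 2"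
    "\<And>\<tau>. \<psi> 0 \<tau> = 0"
proof -
  define x y where "x z = complex_of_real A + of_real B * z\<^sup>2" and "y z = complex_of_real A' + of_real B' * z\<^sup>2" for z
  have \<psi>_def': "\<psi> z = cone_psi w (x z) (y z) z" for z by (simp add: \<psi>_def x_def y_def)
  have bounds: "Re (of_real a + of_real b * z\<^sup>2) \<ge> 4" "norm (of_real a + of_real b * z\<^sup>2 :: complex) \<le> 2 * a"
    if ab: "a \<ge> 8 * (1 + \<bar>b\<bar>)" and z: "z \<in> ball 0 2" for a b :: real and z :: complex
  proof -
    have "norm z ^ 2 \<le> 2 ^ 2" using z by (intro power_mono) auto
    then have "\<bar>b\<bar> * norm z ^ 2 \<le> \<bar>b\<bar> * 4" by (intro mult_left_mono) auto
    then have n: "norm (of_real b * z\<^sup>2 :: complex) \<le> 4 * \<bar>b\<bar>" by (simp add: norm_mult norm_power)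
    have "\<bar>Re (of_real b * z\<^sup>2)\<bar> \<le> 4 * \<bar>b\<bar>" using abs_Re_le_cmod n by (rule order_trans)
    moreover have "Re (of_real a + of_real b * z\<^sup>2) = a + Re (of_real b * z\<^sup>2)" by simp
    moreover have "a + v \<ge> 4" if "\<bar>v\<bar> \<le> 4 * \<bar>b\<bar>" for v :: real
      using abs_le_D2[OF that] ab abs_ge_zero[of b] by (simp add: distrib_left)
    ultimately show "Re (of_real a + of_real b * z\<^sup>2) \<ge> 4" by simp
    have "norm (of_real a + of_real b * z\<^sup>2 :: complex) \<le> \<bar>a\<bar> + 4 * \<bar>b\<bar>"
      using norm_triangle_ineq[of "complex_of_real a" "of_real b * z\<^sup>2"] n by simp
    then show "norm (of_real a + of_real b * z\<^sup>2 :: complex) \<le> 2 * a"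
      using ab abs_ge_zero[of b] by (simp add: distrib_left)
  qed
  have x: "Re (x z) \<ge> 4" "norm (x z) \<le> 2 * A" and y: "Re (y z) \<ge> 4" "norm (y z) \<le> 2 * A'" if "z \<in> ball 0 2" for z
    using bounds[OF A that] bounds[OF A' that] by (auto simp: x_def y_def)
  \<comment> \<open>The moduli of x, y and z are at most 2 (A + A'), so |\<tau>| < 2 \<rho> keeps
    their products with \<tau> in the unit disc.\<close>
  define \<rho> where "\<rho> = 1 / (4 * (A + A'))"
  have AA: "A \<ge> 8" "A' \<ge> 8" using A A' abs_ge_zero[of B] abs_ge_zero[of B'] by (simp_all add: distrib_left)
  then have \<rho>: "\<rho> > 0" by (simp add: \<rho>_def)
  have small: "norm (x z * \<tau>) \<le> 1" "norm (y z * \<tau>) \<le> 1" "norm (z * \<tau>) \<le> 1"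
    if "z \<in> ball 0 2" "\<tau> \<in> ball 0 (2 * \<rho>)" for z \<tau>
  proof -
    have "norm (u * \<tau>) \<le> 1" if "norm u \<le> 2 * (A + A')" for u
    proof -
      have "norm (u * \<tau>) \<le> 2 * (A + A') * (2 * \<rho>)"
        unfolding norm_mult using that \<open>\<tau> \<in> ball 0 (2 * \<rho>)\<close> AA by (intro mult_mono) auto
      also have "\<dots> = 1" using AA by (simp add: \<rho>_def)
      finally show ?thesis .
    qed
    then show "norm (x z * \<tau>) \<le> 1" "norm (y z * \<tau>) \<le> 1" "norm (z * \<tau>) \<le> 1"
      using x[OF that(1)] y[OF that(1)] that(1) AA by auto
  qed
  have nz: "x z \<noteq> 0" "y z \<noteq> 0" "norm (x z) \<ge> 1" "norm (y z) \<ge> 1" if "z \<in> ball 0 2" for z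
    using x[OF that] y[OF that] complex_Re_le_cmod[of "x z"] complex_Re_le_cmod[of "y z"] by auto
  have Enz: "expm1_quot (x z * \<tau>) \<noteq> 0 \<and> expm1_quot (y z * \<tau>) \<noteq> 0"
    if "z \<in> ball 0 2" "\<tau> \<in> ball 0 (2 * \<rho>) \<or> (\<exists>t>\<rho>. \<tau> = of_real t)" for z \<tau>
    using that(2)
  proof
    assume "\<tau> \<in> ball 0 (2 * \<rho>)"
    then show "expm1_quot (x z * \<tau>) \<noteq> 0 \<and> expm1_quot (y z * \<tau>) \<noteq> 0"
      using small[OF that(1)] by (auto intro!: expm1_quot_nonzero_unit_disc)
  next
    assume "\<exists>t>\<rho>. \<tau> = of_real t"
    then obtain t where t: "t > \<rho>" "\<tau> = of_real t" by blast
    have "Re (x z * \<tau>) > 0" "Re (y z * \<tau>) > 0"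
      unfolding t(2) using x[OF that(1)] y[OF that(1)] t(1) \<rho> by auto
    then show "expm1_quot (x z * \<tau>) \<noteq> 0 \<and> expm1_quot (y z * \<tau>) \<noteq> 0"
      by (auto intro!: expm1_quot_nonzero)
  qed
  obtain K where K: "K > 0" "\<And>w x y z \<tau>. \<lbrakk>0 \<le> w; w \<le> 1; norm x \<ge> 1; norm y \<ge> 1; norm z \<le> 2;
     norm (x * \<tau>) \<le> 1; norm (y * \<tau>) \<le> 1; norm (z * \<tau>) \<le> 1\<rbrakk> \<Longrightarrow> norm (cone_psi w x y z \<tau>) \<le> K"
    using cone_psi_local by metis
  have decay: "norm (\<psi> z (of_real t)) \<le> 1 / \<rho> * exp (-t/2)" if z: "z \<in> ball 0 2" and t: "t > \<rho>" for z t
  proof -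
    have t0: "t > 0" using t \<rho> by linarith
    have den: "4 * t * exp (2 * t) \<le> norm (exp (u * of_real t) - 1)" if u: "Re u \<ge> 4" for u :: complex
    proof -
      have "4 * t * exp (2 * t) \<le> (Re u * t) * exp (Re u * t / 2)"
        using u t0 by (intro mult_mono mult_right_mono) (auto simp: mult_right_mono)
      also have "\<dots> \<le> exp (Re u * t) - 1" using u t0 by (intro exp_minus_one_ge) auto
      also have "\<dots> \<le> norm (exp (u * of_real t) - 1)" using norm_triangle_ineq2[of "exp (u * of_real t)" 1] by simp
      finally show ?thesis .
    qed
    have num: "norm (exp (- (of_real w * z * of_real t)) * (exp (z * of_real t) - 1)) \<le> 2 * exp (2 * t)"
    proof -
      have le: "norm (exp (of_real v * z * of_real t)) \<le> exp (2 * t)" if "\<bar>v\<bar> \<le> 1" for v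
      proof -
        have "norm (exp (of_real v * z * of_real t)) \<le> exp (norm (of_real v * z * of_real t))" by (rule norm_exp)
        also have "norm (of_real v * z * of_real t) \<le> 1 * 2 * t"
          unfolding norm_mult using that z t0 by (intro mult_mono) auto
        finally show ?thesis by simp
      qed
      have "exp (- (of_real w * z * of_real t)) * (exp (z * of_real t) - 1) =
          exp (of_real (1 - w) * z * of_real t) - exp (of_real (-w) * z * of_real t)"
        by (simp add: algebra_simps flip: exp_add)
      also have "norm \<dots> \<le> exp (2 * t) + exp (2 * t)"
        using w by (intro order_trans[OF norm_triangle_ineq4] add_mono le) auto
      finally show ?thesis by simp
    qed
    have "norm (\<psi> z (of_real t)) = t * norm (exp (- (of_real w * z * of_real t)) * (exp (z * of_real t) - 1)) /
       (norm (exp (x z * of_real t) - 1) * norm (exp (y z * of_real t) - 1))"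
      unfolding \<psi>_def' using x[OF z] y[OF z] t0 by (subst cone_psi_eq) (auto simp: norm_mult norm_divide)
    also have "\<dots> \<le> t * (2 * exp (2 * t)) / ((4 * t * exp (2 * t)) * (4 * t * exp (2 * t)))"
      using t0 num den[OF x(1)[OF z]] den[OF y(1)[OF z]] by (intro frac_le mult_mono mult_left_mono mult_pos_pos) auto
    also have "\<dots> = 1 / (8 * t) * exp (- (2 * t))" using t0 by (simp add: exp_minus field_simps)
    also have "\<dots> \<le> 1 / \<rho> * exp (-t/2)"
      using t t0 \<rho> by (intro mult_mono divide_left_mono) auto
    finally show ?thesis .
  qed
  show ?thesis
  proof (rule that[OF \<rho>, of "max K (1 / \<rho>)"])
    show "reg_adm \<rho> (max K (1 / \<rho>)) (\<psi> z)" if z: "z \<in> ball 0 2" for z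
      unfolding reg_adm_def
    proof (intro conjI ballI allI impI)
      show "\<psi> z holomorphic_on ball 0 (2 * \<rho>)"
        unfolding \<psi>_def' cone_psi_def using nz[OF z] Enz[OF z] by (intro holomorphic_intros) auto
      show "norm (\<psi> z \<tau>) \<le> max K (1 / \<rho>)" if "\<tau> \<in> ball 0 (2 * \<rho>)" for \<tau>
        unfolding \<psi>_def' using z small[OF z that] nz[OF z] w by (intro max.coboundedI1 K) auto
      show "(\<lambda>t. \<psi> z (of_real t)) \<in> borel_measurable pos_lborel"
        unfolding \<psi>_def' by (rule cone_psi_measurable)
      show "norm (\<psi> z (of_real t)) \<le> max K (1 / \<rho>) * exp (-t/2)" if "t > \<rho>" for t
        by (rule order_trans[OF decay[OF z that]]) (intro mult_right_mono, auto)
    qed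
    show "(\<lambda>z. \<psi> z \<tau>) holomorphic_on ball 0 2" if "\<tau> \<in> ball 0 (2 * \<rho>) \<or> (\<exists>t>\<rho>. \<tau> = of_real t)" for \<tau>
      unfolding \<psi>_def' cone_psi_def using nz Enz[OF _ that] unfolding x_def y_def by (intro holomorphic_intros) auto
    show "\<psi> 0 \<tau> = 0" for \<tau> by (simp add: \<psi>_def' cone_psi_def)
  qed
qed

text \<open>For the finitely many initial indices, where x and y need not exceed 1. Decay then comes
  from letting one denominator absorb the numerator as in \<open>damped_bose_le_1\<close>, the other
  denominator giving exp (-t / 2).\<close>

lemma cone_psi_single:
  assumes w: "0 \<le> w" "w \<le> 1" and x: "x \<ge> 1" and y: "y \<ge> (1::real)"
  obtains \<rho> K where "\<rho> > 0" "reg_adm \<rho> K (cone_psi w (of_real x) (of_real y) 1)"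
proof -
  define \<rho> where "\<rho> = 1 / (4 * (x + y))"
  have \<rho>: "\<rho> > 0" using x y by (simp add: \<rho>_def)
  have small: "norm (of_real u * \<tau>) \<le> 1" if "0 \<le> u" "u \<le> x + y" "\<tau> \<in> ball 0 (2 * \<rho>)" for u and \<tau> :: complex
  proof -
    have "norm (of_real u * \<tau>) \<le> (x + y) * (2 * \<rho>)"
      unfolding norm_mult using that x y by (intro mult_mono) auto
    also have "\<dots> \<le> 1" using x y by (simp add: \<rho>_def)
    finally show ?thesis .
  qed
  obtain K where K: "K > 0" "\<And>w x y z \<tau>. \<lbrakk>0 \<le> w; w \<le> 1; norm x \<ge> 1; norm y \<ge> 1; norm z \<le> 2;
     norm (x * \<tau>) \<le> 1; norm (y * \<tau>) \<le> 1; norm (z * \<tau>) \<le> 1\<rbrakk> \<Longrightarrow> norm (cone_psi w x y z \<tau>) \<le> K"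
    using cone_psi_local by metis
  have decay: "norm (cone_psi w (of_real x) (of_real y) 1 (of_real t)) \<le> 1 * exp (-t/2)" if t: "t > \<rho>" for t
  proof -
    have t0: "t > 0" using t \<rho> by linarith
    have "cone_psi w (of_real x) (of_real y) 1 (of_real t) =
        of_real t * ((of_real (exp (-(w * t)) * (exp t - 1)) * bose (x * t)) * bose (y * t))"
      using x y t0 by (subst cone_psi_eq) (auto simp: bose_def exp_of_real[symmetric])
    then have "norm (cone_psi w (of_real x) (of_real y) 1 (of_real t)) =
        t * (norm (of_real (exp (-(w * t)) * (exp t - 1)) * bose (x * t)) * norm (bose (y * t)))"
      using t0 by (simp add: norm_mult)
    also have "\<dots> \<le> t * (1 * (exp (-(y*t)/2) / (y * t)))"
      using t0 x y w by (intro mult_left_mono mult_mono damped_bose_le_1 norm_bose_le) auto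
    also have "\<dots> = exp (-(y*t)/2) / y" using t0 y by simp
    also have "\<dots> \<le> exp (-t/2) / 1"
      using t0 y by (intro frac_le) auto
    finally show ?thesis by simp
  qed
  have "reg_adm \<rho> (max K 1) (cone_psi w (of_real x) (of_real y) 1)"
    unfolding reg_adm_def
  proof (intro conjI ballI allI impI)
    show "cone_psi w (of_real x) (of_real y) 1 holomorphic_on ball 0 (2 * \<rho>)"
      unfolding cone_psi_def using x y small[of x] small[of y]
      by (intro holomorphic_intros) (auto intro!: expm1_quot_nonzero_unit_disc simp del: norm_mult)
    show "norm (cone_psi w (of_real x) (of_real y) 1 \<tau>) \<le> max K 1" if "\<tau> \<in> ball 0 (2 * \<rho>)" for \<tau>
      using x y w small[of x \<tau>] small[of y \<tau>] small[of 1 \<tau>] that by (intro max.coboundedI1 K) auto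
    show "(\<lambda>t. cone_psi w (of_real x) (of_real y) 1 (of_real t)) \<in> borel_measurable pos_lborel"
      by (rule cone_psi_measurable)
    show "norm (cone_psi w (of_real x) (of_real y) 1 (of_real t)) \<le> max K 1 * exp (-t/2)" if "t > \<rho>" for t
      by (rule order_trans[OF decay[OF that]]) (intro mult_right_mono, auto)
  qed
  with \<rho> show ?thesis by (rule that)
qed

text \<open>The substitution of t / z for t releases the power z^s. The factor \<tau> built into
  \<open>cone_psi\<close> moves the argument to s - 1, and the functional equation of
  \<open>rGamma\<close> then accounts for the factor s - 1 on the left.\<close>

lemma cone_zeta_eq_reg_mellin:
  fixes x y z w :: real
  assumes x: "x > 0" and y: "y > 0" and z: "z > 0"
    and adm: "\<rho> > 0" "reg_adm \<rho> K (cone_psi w (of_real x) (of_real y) (of_real z))" and s: "Re s > 1"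
  shows "(s - 1) * cone_zeta w (x / z) (y / z) s = of_real z powr s * reg_mellin \<rho> (cone_psi w (of_real x) (of_real y) (of_real z)) (s - 1)"
proof -
  define \<phi> where "\<phi> t = of_real (exp (-(w * z * t)) * (exp (z * t) - 1)) * (bose (x * t) * bose (y * t))" for t
  have "cone_kernel w (x / z) (y / z) = (\<lambda>t. \<phi> (1 / z * t))"
    using z by (simp add: fun_eq_iff cone_kernel_def \<phi>_def)
  then have "mellin (cone_kernel w (x / z) (y / z)) s = mellin (\<lambda>t. \<phi> (1 / z * t)) s" by (rule arg_cong)
  also have "\<dots> = of_real (1 / z) powr (-s) * mellin \<phi> s" using z by (intro mellin_scale) simp
  also have "complex_of_real (1 / z) powr (-s) = of_real z powr s"
    using z by (simp add: powr_def Ln_divide_of_real ln_div exp_minus Ln_inverse divide_inverse ln_inverse Ln_of_real flip: of_real_inverse)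
  finally have 1: "mellin (cone_kernel w (x / z) (y / z)) s = of_real z powr s * mellin \<phi> s" .
  have "mellin (\<lambda>t. cone_psi w (of_real x) (of_real y) (of_real z) (of_real t)) (s - 1) = mellin (\<lambda>t. of_real t * \<phi> t) (s - 1)"
  proof (rule mellin_cong)
    fix t :: real assume "t > 0"
    then show "cone_psi w (of_real x) (of_real y) (of_real z) (of_real t) = of_real t * \<phi> t"
      using x y by (subst cone_psi_eq) (auto simp: \<phi>_def bose_def exp_of_real[symmetric])
  qed
  then have 2: "reg_mellin \<rho> (cone_psi w (of_real x) (of_real y) (of_real z)) (s - 1) = rGamma (s - 1) * mellin \<phi> s"
    using reg_mellin_eq(2)[OF adm(2,1), of "s - 1"] s by (simp add: mellin_times)
  have "rGamma (s - 1) = (s - 1) * rGamma s" using rGamma_plus1[of "s - 1"] by simp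
  then show ?thesis unfolding cone_zeta_def 1 2 by simp
qed

section \<open>Gluing the continuations on growing half-planes\<close>

lemma remove_sings_simple_quotient:
  assumes S: "open S" "z \<in> S" and F: "F holomorphic_on S" and g: "\<And>w. w \<in> S - {z} \<Longrightarrow> g w = F w / (w - z)"
  shows "g meromorphic_on {z}" "remove_sings g analytic_on {z} \<or> simple_pole (remove_sings g) z"
    "F z \<noteq> 0 \<Longrightarrow> simple_pole (remove_sings g) z"
proof -
  have ev: "\<forall>\<^sub>F w in at z. g w = F w / (w - z)"
    using eventually_at_in_open[OF S] by eventually_elim (rule g)
  have Fan: "F analytic_on {z}" using S F by (auto simp: analytic_at)
  have "(\<lambda>w. F w / (w - z)) meromorphic_on {z}"
    by (intro meromorphic_intros analytic_on_imp_meromorphic_on Fan)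
  then show mero: "g meromorphic_on {z}"
    by (subst meromorphic_on_cong[OF _ refl]) (use ev in auto)
  show pole: "simple_pole (remove_sings g) z" if nz: "F z \<noteq> 0"
  proof -
    have ev': "\<forall>\<^sub>F w in at z. remove_sings g w = F w / (w - z)"
      using eventually_remove_sings_eq_at[OF meromorphic_on_isolated_singularity[OF mero]] ev
      by eventually_elim simp
    have "is_pole (\<lambda>w. F w / (w - z) ^ 1) z"
      by (rule is_pole_basic[OF F S nz]) simp
    then have "is_pole (remove_sings g) z" using is_pole_cong[OF ev' refl] by simp
    moreover have "zorder (remove_sings g) z = zorder (\<lambda>w. F w / (w - z)) z"
      by (rule zorder_cong[OF ev' refl])
    moreover have "zorder (\<lambda>w. F w / (w - z)) z = -1"
      by (rule zorder_eqI[OF S F nz]) (auto simp: field_simps power_int_minus)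
    ultimately show ?thesis by (simp add: simple_pole_def)
  qed
  show "remove_sings g analytic_on {z} \<or> simple_pole (remove_sings g) z"
  proof (cases "F z = 0")
    case True
    have "(F has_field_derivative deriv F z) (at z)" using holomorphic_derivI[OF F S] .
    then have "((\<lambda>w. F w / (w - z)) \<longlongrightarrow> deriv F z) (at z)"
      using True by (simp add: has_field_derivative_iff)
    then have "(g \<longlongrightarrow> deriv F z) (at z)" using ev by (simp cong: tendsto_cong)
    then show ?thesis
      using remove_sings_analytic_at[OF meromorphic_on_isolated_singularity[OF mero]] by blast
  qed (use pole in blast)
qed

text \<open>On its half-plane G P continues s - 1 times f times the product V P of the factors 1 -
  r^(s + p) with p \<le> P, so the quotients for different P agree and glue. The factor with index p
  has zeros only on the line Re s = -p; hence at a point of X exactly one factor vanishes, and it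
  does so simply.\<close>

lemma global_continuation:
  fixes r :: real and G :: "nat \<Rightarrow> complex \<Rightarrow> complex"
  assumes r: "0 < r" "r < 1"
    and G_holo: "\<And>P. G P holomorphic_on {s. Re s > - (real P + 1)}"
    and G_Suc: "\<And>P s. Re s > - (real P + 1) \<Longrightarrow> G (Suc P) s = (1 - of_real r powr s * of_real r ^ Suc P) * G P s"
    and f: "\<And>s. Re s > 1 \<Longrightarrow> G 0 s = (s - 1) * f s" and G1: "G 0 1 \<noteq> 0"
  defines "X \<equiv> {s. \<exists>p\<ge>1. complex_of_real r powr s * of_real r ^ p = 1}"
  shows "\<exists>g. (\<forall>s. Re s > 1 \<longrightarrow> g s = f s) \<and> g meromorphic_on UNIV \<and> g holomorphic_on (UNIV - ({1} \<union> X)) \<and>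
           simple_pole g 1 \<and> (\<forall>z\<in>X. g analytic_on {z} \<or> simple_pole g z)"
proof -
  define e where "e p s = 1 - complex_of_real r powr s * of_real r ^ p" for p s
  define V where "V P s = (\<Prod>p=1..P. e p s)" for P s
  have e_holo: "e p holomorphic_on A" for p A
    unfolding e_def using r by (intro holomorphic_intros) auto
  have V_holo: "V P holomorphic_on A" for P A unfolding V_def by (intro holomorphic_intros e_holo)
  have e0_Re: "Re s = - real p" if "e p s = 0" for p s
  proof -
    have "1 = norm (complex_of_real r powr s * of_real r ^ p)" using that by (simp add: e_def)
    also have "\<dots> = r powr (Re s + real p)" using r by (simp add: norm_mult norm_power norm_of_real_powr powr_add powr_realpow)
    finally have "ln (r powr (Re s + real p)) = 0" by simp
    then have "(Re s + real p) * ln r = 0" using r by (simp add: ln_powr)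
    then show ?thesis using r by simp
  qed
  have V_nz: "V P s \<noteq> 0" if "s \<notin> X" for P s
    using that by (auto simp: V_def X_def e_def)
  have not_X: "s \<notin> X" if "Re s > - (real P + 1)" "V P s \<noteq> 0" for P s
  proof
    assume "s \<in> X"
    then obtain p where p: "p \<ge> 1" "e p s = 0" by (auto simp: X_def e_def)
    have "p \<le> P" using e0_Re[OF p(2)] that(1) by simp
    then have "V P s = 0" using p unfolding V_def by (intro prod_zero) auto
    with that(2) show False by simp
  qed
  have G_V: "G Q s * V P s = G P s * V Q s" if "P \<le> Q" "Re s > - (real P + 1)" for P Q s
    using that(1)
  proof (induction Q rule: dec_induct)
    case (step Q)
    have "Re s > - (real Q + 1)" using that(2) step(1) by simp
    from G_Suc[OF this] have "G (Suc Q) s = e (Suc Q) s * G Q s" by (simp add: e_def)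
    moreover have "V (Suc Q) s = V Q s * e (Suc Q) s" by (simp add: V_def)
    ultimately show ?case using step(3) by (simp add: mult_ac)
  qed simp
  \<comment> \<open>An index large enough for s to lie in the domain of G.\<close>
  define Pn where "Pn s = nat \<lceil>\<bar>Re s\<bar>\<rceil>" for s
  have Pn: "Re s > - (real (Pn s) + 1)" for s unfolding Pn_def by linarith
  define g0 where "g0 s = G (Pn s) s / (V (Pn s) s * (s - 1))" for s
  have g0_eq: "g0 s = G Q s / (V Q s * (s - 1))" if "Re s > - (real Q + 1)" "s \<notin> X" for Q s
  proof -
    have "G Q s * V (Pn s) s = G (Pn s) s * V Q s"
      using G_V[of "Pn s" Q s] G_V[of Q "Pn s" s] Pn[of s] that(1) by (cases "Pn s \<le> Q") auto
    then show ?thesis using V_nz[OF that(2), of Q] V_nz[OF that(2), of "Pn s"]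
      by (cases "s = 1") (simp_all add: g0_def field_simps)
  qed
  have open_nz: "open {s. h s \<noteq> 0}" if "h holomorphic_on UNIV" for h :: "complex \<Rightarrow> complex"
    using holomorphic_on_imp_continuous_on[OF that] by (intro open_Collect_neq continuous_intros) auto
  have regular: "g0 analytic_on {z}" if z: "z \<notin> X" "z \<noteq> 1" for z
  proof -
    define S where "S = {s. Re s > - (real (Pn z) + 1)} \<inter> {s. V (Pn z) s * (s - 1) \<noteq> 0}"
    have S: "open S" unfolding S_def
      by (intro open_Int open_halfspace_Re_gt open_nz holomorphic_intros V_holo)
    have "z \<in> S" unfolding S_def using Pn[of z] V_nz[OF z(1)] z(2) by auto
    note S = S this
    have "(\<lambda>s. G (Pn z) s / (V (Pn z) s * (s - 1))) holomorphic_on S"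
      by (intro holomorphic_intros holomorphic_on_subset[OF G_holo] V_holo) (auto simp: S_def)
    then have "g0 holomorphic_on S"
    proof (rule holomorphic_transform)
      fix s assume "s \<in> S"
      then have s: "Re s > - (real (Pn z) + 1)" "V (Pn z) s \<noteq> 0" by (auto simp: S_def)
      show "G (Pn z) s / (V (Pn z) s * (s - 1)) = g0 s"
        using g0_eq[OF s(1) not_X[OF s]] by simp
    qed
    then show ?thesis using S analytic_at by blast
  qed
  have local: "\<exists>S F. open S \<and> z \<in> S \<and> F holomorphic_on S \<and> (\<forall>s\<in>S - {z}. g0 s = F s / (s - z))" if z: "z \<in> X" for z
  proof -
    define Q where "Q = Pn z"
    obtain p where p: "p \<ge> 1" "e p z = 0" using z by (auto simp: X_def e_def)
    have Rez: "Re z = - real p" by (rule e0_Re[OF p(2)])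
    have pQ: "p \<in> {1..Q}" using Pn[of z] Rez p(1) by (simp add: Q_def)
    define V' where "V' s = (\<Prod>i\<in>{1..Q} - {p}. e i s)" for s
    \<comment> \<open>The vanishing factor divided by s - z. Since r^(z + p) = 1, that factor is 1 -
      exp ((s - z) ln r), and k is nonzero at z.\<close>
    define k where "k s = - (of_real (ln r) * expm1_quot ((s - z) * of_real (ln r)))" for s
    have V_eq: "V Q s = V' s * (k s * (s - z))" for s
    proof -
      have "complex_of_real r powr s * of_real r ^ p = exp ((s - z) * of_real (ln r)) * (complex_of_real r powr z * of_real r ^ p)"
        using r by (simp add: powr_def Ln_of_real algebra_simps flip: exp_add)
      also have "complex_of_real r powr z * of_real r ^ p = 1" using p(2) by (simp add: e_def)
      finally have "e p s = k s * (s - z)"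
        using expm1_quot_mult[of "(s - z) * of_real (ln r)"] by (simp add: e_def k_def algebra_simps)
      then show ?thesis unfolding V_def V'_def by (subst prod.remove[OF _ pQ]) (auto simp: mult.commute)
    qed
    define h where "h s = V' s * k s * (s - 1)" for s
    have h_holo: "h holomorphic_on A" for A
      unfolding h_def V'_def k_def by (intro holomorphic_intros e_holo)
    have "V' z \<noteq> 0" unfolding V'_def using e0_Re[of _ z] Rez by auto
    moreover have "k z \<noteq> 0" using r by (simp add: k_def)
    moreover have "z \<noteq> 1" using Rez p(1) by auto
    ultimately have hz: "h z \<noteq> 0" by (simp add: h_def)
    define S where "S = {s. Re s > - (real Q + 1)} \<inter> {s. h s \<noteq> 0}"
    have S: "open S" unfolding S_def by (intro open_Int open_halfspace_Re_gt open_nz h_holo)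
    have "z \<in> S" unfolding S_def using Pn[of z] hz by (simp add: Q_def)
    note S = S this
    have "(\<lambda>s. G Q s / h s) holomorphic_on S"
      by (intro holomorphic_intros holomorphic_on_subset[OF G_holo] h_holo) (auto simp: S_def)
    moreover have "g0 s = (G Q s / h s) / (s - z)" if s: "s \<in> S - {z}" for s
    proof -
      have "V Q s \<noteq> 0" using s by (auto simp: V_eq S_def h_def)
      then have "g0 s = G Q s / (V Q s * (s - 1))" using s by (intro g0_eq not_X[of Q]) (auto simp: S_def)
      then show ?thesis by (simp add: V_eq h_def mult_ac)
    qed
    ultimately show ?thesis using S by blast
  qed
  have one: "1 \<notin> X"
  proof
    assume "1 \<in> X"
    then obtain p where p: "p \<ge> 1" "e p 1 = 0" by (auto simp: X_def e_def)
    show False using e0_Re[OF p(2)] by simp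
  qed
  have at_1: "open {s. Re s > -1}" "(1::complex) \<in> {s. Re s > -1}" "G 0 holomorphic_on {s. Re s > -1}"
    "\<And>s. s \<in> {s. Re s > -1} - {1} \<Longrightarrow> g0 s = G 0 s / (s - 1)"
  proof -
    show "open {s. Re s > -1}" by (rule open_halfspace_Re_gt)
    show "G 0 holomorphic_on {s. Re s > -1}" using G_holo[of 0] by simp
    show "g0 s = G 0 s / (s - 1)" if "s \<in> {s. Re s > -1} - {1}" for s
      using that g0_eq[of 0 s] not_X[of 0 s] by (simp add: V_def)
  qed simp
  \<comment> \<open>At a point of X the denominator of g0 is 0 and division returns 0. Where the
    numerator vanishes too, the singularity is removable and the value has to be corrected.\<close>
  define g where "g = remove_sings g0"
  have "g meromorphic_on UNIV"
    unfolding g_def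
  proof (rule remove_sings_meromorphic)
    have "g0 meromorphic_on {z}" for z
    proof (cases "z \<in> X")
      case True
      then show ?thesis using local[OF True] remove_sings_simple_quotient(1) by blast
    next
      case False
      show ?thesis
      proof (cases "z = 1")
        case True
        show ?thesis unfolding True by (rule remove_sings_simple_quotient(1)[OF at_1])
      qed (use False in \<open>intro analytic_on_imp_meromorphic_on regular\<close>)
    qed
    then show "g0 meromorphic_on UNIV" by (subst meromorphic_on_meromorphic_at) blast
  qed
  moreover have g_an: "g analytic_on {z}" if "z \<notin> X" "z \<noteq> 1" for z
    unfolding g_def by (rule remove_sings_analytic_on[OF regular[OF that]])
  then have "g analytic_on (UNIV - ({1} \<union> X))" by (subst analytic_on_analytic_at) auto
  then have "g holomorphic_on (UNIV - ({1} \<union> X))" by (rule analytic_imp_holomorphic)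
  moreover have "simple_pole g 1" unfolding g_def by (rule remove_sings_simple_quotient(3)[OF at_1 G1])
  moreover have "g s = f s" if s: "Re s > 1" for s
  proof -
    have "s \<noteq> 1" "s \<notin> X" using s not_X[of 0 s] by (auto simp: V_def)
    then have "g s = g0 s" unfolding g_def by (intro remove_sings_at_analytic regular)
    also have "\<dots> = f s" using at_1(4)[of s] s f[OF s] \<open>s \<noteq> 1\<close> by simp
    finally show ?thesis .
  qed
  moreover have "g analytic_on {z} \<or> simple_pole g z" if "z \<in> X" for z
    unfolding g_def using local[OF that] remove_sings_simple_quotient(2) by blast
  ultimately show ?thesis by blast
qed

context beatty begin

text \<open>From the index K on, the expansion is cut into blocks of one period. After rescaling,
  block j is (r^s)^j times the value at z = r^j of one function of z, and
  \<open>scale_series_continuation\<close> takes over. The finitely many terms before K and the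
  constant c are entire after multiplication by s - 1.\<close>

lemma quadratic_structure:
  assumes quad: "quadratic_irrational \<alpha>" and w: "0 \<le> w" "w \<le> 1"
  obtains r :: real and G :: "nat \<Rightarrow> complex \<Rightarrow> complex" where "0 < r" "r < 1" "ln (eta \<alpha>) = ln r"
    "\<And>P. G P holomorphic_on {s. Re s > - (real P + 1)}"
    "\<And>P s. Re s > - (real P + 1) \<Longrightarrow> G (Suc P) s = (1 - of_real r powr s * of_real r ^ Suc P) * G P s"
    "\<And>s. Re s > 1 \<Longrightarrow> G 0 s = (s - 1) * (c + shifted_zeta w s)"
proof -
  obtain lam l K A B where lam: "lam > 1" "ln (eta \<alpha>) = - ln lam" and l: "l > 0" "even l"
    and A: "\<And>k. k \<ge> K \<Longrightarrow> A k \<ge> 8 * (1 + \<bar>B k\<bar>)"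
    and Q_eq: "\<And>k j. k \<ge> K \<Longrightarrow> Q (k + l * j) = A k * lam ^ j + B k / lam ^ j"
    using quadratic_num_seq[OF quad] by metis
  define r where "r = 1 / lam"
  have r: "0 < r" "r < 1" "ln (eta \<alpha>) = ln r" using lam by (auto simp: r_def ln_div)
  define \<psi> where "\<psi> k z = cone_psi w (of_real (A k) + of_real (B k) * z\<^sup>2) (of_real (A (Suc k)) + of_real (B (Suc k)) * z\<^sup>2) z" for k z
  have "\<exists>\<rho> M. \<rho> > 0 \<and> (\<forall>z\<in>ball 0 2. reg_adm \<rho> M (\<psi> (K + i) z)) \<and>
    (\<forall>\<tau>. \<tau> \<in> ball 0 (2 * \<rho>) \<or> (\<exists>t>\<rho>. \<tau> = of_real t) \<longrightarrow> (\<lambda>z. \<psi> (K + i) z \<tau>) holomorphic_on ball 0 2)" for i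
  proof -
    have le: "K \<le> K + i" "K \<le> Suc (K + i)" by auto
    show ?thesis unfolding \<psi>_def
    proof (rule cone_psi_family[OF w A[OF le(1)] A[OF le(2)]], goal_cases)
      case (1 \<rho> M)
      show ?case by (intro exI[of _ \<rho>] exI[of _ M] conjI ballI allI impI 1)
    qed
  qed
  then obtain \<rho> M where \<rho>: "\<And>i. \<rho> i > 0" "\<And>i z. z \<in> ball 0 2 \<Longrightarrow> reg_adm (\<rho> i) (M i) (\<psi> (K + i) z)"
    "\<And>i \<tau>. \<tau> \<in> ball 0 (2 * \<rho> i) \<or> (\<exists>t>\<rho> i. \<tau> = of_real t) \<Longrightarrow> (\<lambda>z. \<psi> (K + i) z \<tau>) holomorphic_on ball 0 2"
    by metis
  have \<psi>0: "\<psi> k 0 \<tau> = 0" for k \<tau> by (simp add: \<psi>_def cone_psi_def)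
  define m where "m s z = (\<Sum>i<l. (-1) ^ (K + i) * reg_mellin (\<rho> i) (\<psi> (K + i) z) (s - 1))" for s z
  have rj: "norm (complex_of_real r ^ j) \<le> 1" "complex_of_real r ^ j \<in> ball 0 2" for j
  proof -
    show "norm (complex_of_real r ^ j) \<le> 1" using r by (simp add: norm_power power_le_one)
    then show "complex_of_real r ^ j \<in> ball 0 2" by simp
  qed
  have shift: "(\<lambda>s. h (s - 1)) holomorphic_on UNIV" if "h holomorphic_on UNIV" for h :: "complex \<Rightarrow> complex"
  proof -
    have "(\<lambda>s. s - 1) holomorphic_on (UNIV :: complex set)" by (intro holomorphic_intros)
    from holomorphic_on_compose_gen[OF this that] show ?thesis by (simp add: comp_def)
  qed
  have m_holo: "(\<lambda>s. m s (of_real r ^ j)) holomorphic_on UNIV" for j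
    unfolding m_def by (intro holomorphic_intros shift reg_mellin_holomorphic[OF \<rho>(2)[OF rj(2)] \<rho>(1)])
  have m_bound: "\<exists>C. \<forall>s j. norm s \<le> R \<longrightarrow> norm (scale_diff (of_real r) (m s) P (of_real r ^ j)) \<le> C * (r ^ j) ^ (P + 1)" for P R
  proof -
    have "\<exists>C. \<forall>s j. norm s \<le> R \<longrightarrow> norm (scale_diff (of_real r) (\<lambda>z. reg_mellin (\<rho> i) (\<psi> (K + i) z) (s - 1)) P (of_real r ^ j)) \<le> C * (r ^ j) ^ (P + 1)" for i
      by (rule scale_diff_reg_mellin[OF r(1,2) \<rho>(1) \<rho>(2) \<rho>(3) \<psi>0])
    then obtain C where C: "\<And>i s j. norm s \<le> R \<Longrightarrow>
        norm (scale_diff (of_real r) (\<lambda>z. reg_mellin (\<rho> i) (\<psi> (K + i) z) (s - 1)) P (of_real r ^ j)) \<le> C i * (r ^ j) ^ (P + 1)"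
      by metis
    have "norm (scale_diff (of_real r) (m s) P (of_real r ^ j)) \<le> (\<Sum>i<l. C i) * (r ^ j) ^ (P + 1)" if s: "norm s \<le> R" for s j
    proof -
      have "norm (scale_diff (of_real r) (m s) P (of_real r ^ j)) \<le> (\<Sum>i<l. C i * (r ^ j) ^ (P + 1))"
        unfolding m_def scale_diff_sum
        by (rule sum_norm_le) (use C[OF s] in \<open>auto simp: norm_mult norm_power\<close>)
      then show ?thesis by (simp only: sum_distrib_right)
    qed
    then show ?thesis by blast
  qed
  obtain N where N: "\<And>P. N P holomorphic_on {s. Re s > - (real P + 1)}"
    "\<And>P s. Re s > - (real P + 1) \<Longrightarrow> N (Suc P) s = (1 - of_real r powr s * of_real r ^ Suc P) * N P s"
    "\<And>s. Re s > -1 \<Longrightarrow> (\<lambda>j. (of_real r powr s) ^ j * m s (of_real r ^ j)) sums N 0 s"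
  proof (rule scale_series_continuation[of r m, OF r(1,2) m_holo m_bound], goal_cases)
    case (1 N)
    show ?case by (rule 1(1)[of N]) (fact 1)+
  qed
  have "\<exists>\<rho> M. \<rho> > 0 \<and> reg_adm \<rho> M (cone_psi w (of_real (Q k)) (of_real (Q (Suc k))) 1)" for k
    by (rule cone_psi_single[OF w Q_ge1[of k] Q_ge1[of "Suc k"]]) blast
  then obtain \<rho>' M' where \<rho>': "\<And>k. \<rho>' k > 0" "\<And>k. reg_adm (\<rho>' k) (M' k) (cone_psi w (of_real (Q k)) (of_real (Q (Suc k))) 1)"
    by metis
  define head where "head s = (s - 1) * c + (\<Sum>k<K. (-1) ^ k * reg_mellin (\<rho>' k) (cone_psi w (of_real (Q k)) (of_real (Q (Suc k))) 1) (s - 1))" for s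
  have head_holo: "head holomorphic_on UNIV"
    unfolding head_def by (intro holomorphic_intros shift reg_mellin_holomorphic[OF \<rho>'(2,1)])
  \<comment> \<open>The entire head receives the same product of factors, so that the sum satisfies
    the recursion of N.\<close>
  define G where "G P s = N P s + (\<Prod>p=1..P. 1 - complex_of_real r powr s * of_real r ^ p) * head s" for P s
  show ?thesis
  proof (rule that[OF r])
    show "G P holomorphic_on {s. Re s > - (real P + 1)}" for P
      unfolding G_def using r by (intro holomorphic_intros N(1) holomorphic_on_subset[OF head_holo]) auto
    show "G (Suc P) s = (1 - of_real r powr s * of_real r ^ Suc P) * G P s" if "Re s > - (real P + 1)" for P s
      unfolding G_def N(2)[OF that] by (simp add: algebra_simps)
    fix s assume s: "Re s > 1"
    let ?z = "\<lambda>k. (-1) ^ k * cone_zeta w (Q k) (Q (Suc k)) s"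
    have head_eq: "head s = (s - 1) * c + (s - 1) * (\<Sum>k<K. ?z k)"
    proof -
      have eq: "(s - 1) * cone_zeta w (Q k) (Q (Suc k)) s = reg_mellin (\<rho>' k) (cone_psi w (of_real (Q k)) (of_real (Q (Suc k))) 1) (s - 1)" for k
        using cone_zeta_eq_reg_mellin[of "Q k" "Q (Suc k)" 1 "\<rho>' k" "M' k" w s] \<rho>' s by simp
      then show ?thesis by (simp add: head_def sum_distrib_left mult.left_commute flip: eq)
    qed
    have block: "(s - 1) * (\<Sum>k = j * l..<j * l + l. ?z (k + K)) = (of_real r powr s) ^ j * m s (of_real r ^ j)" for j
    proof -
      have zj: "r ^ j > 0" using r by simp
      have Qz: "Q (k + l * j) = (A k + B k * (r ^ j)\<^sup>2) / r ^ j" if "k \<ge> K" for k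
        using Q_eq[OF that, of j] lam by (simp add: r_def power_divide power2_eq_square field_simps)
      have pos: "A k + B k * (r ^ j)\<^sup>2 > 0" if "k \<ge> K" for k
        using Qz[OF that] Q_pos[of "k + l * j"] zj r by (simp add: zero_less_divide_iff)
      have summand: "(s - 1) * ?z (j * l + i + K) =
          (of_real r powr s) ^ j * ((-1) ^ (K + i) * reg_mellin (\<rho> i) (\<psi> (K + i) (of_real r ^ j)) (s - 1))" for i
      proof -
        let ?k = "K + i"
        have le: "K \<le> ?k" "K \<le> Suc ?k" by auto
        have idx: "j * l + i + K = ?k + l * j" "Suc (?k + l * j) = Suc ?k + l * j" by (simp_all add: mult.commute)
        \<comment> \<open>Evenness of the period makes the sign independent of the block.\<close>
        have "(-1 :: complex) ^ (?k + l * j) = (-1) ^ ?k" using l(2) by (simp add: power_add power_mult)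
        moreover have \<psi>_eq: "\<psi> ?k (of_real r ^ j) = cone_psi w (of_real (A ?k + B ?k * (r ^ j)\<^sup>2)) (of_real (A (Suc ?k) + B (Suc ?k) * (r ^ j)\<^sup>2)) (of_real (r ^ j))"
          by (simp add: \<psi>_def)
        have "(s - 1) * cone_zeta w (Q (?k + l * j)) (Q (Suc ?k + l * j)) s =
            of_real (r ^ j) powr s * reg_mellin (\<rho> i) (\<psi> ?k (of_real r ^ j)) (s - 1)"
          unfolding \<psi>_eq Qz[OF le(1)] Qz[OF le(2)]
        proof (rule cone_zeta_eq_reg_mellin[OF pos[OF le(1)] pos[OF le(2)] zj \<rho>(1) _ s])
          show "reg_adm (\<rho> i) (M i) (cone_psi w (of_real (A ?k + B ?k * (r ^ j)\<^sup>2)) (of_real (A (Suc ?k) + B (Suc ?k) * (r ^ j)\<^sup>2)) (of_real (r ^ j)))"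
            unfolding \<psi>_eq[symmetric] by (rule \<rho>(2)[OF rj(2)])
        qed
        moreover have "complex_of_real (r ^ j) powr s = (of_real r powr s) ^ j"
          using r zj by (simp add: powr_def Ln_of_real ln_realpow exp_of_nat_mult[symmetric] algebra_simps del: of_real_power)
        ultimately show ?thesis unfolding idx by (simp add: mult_ac)
      qed
      have "(\<Sum>k = j * l..<j * l + l. ?z (k + K)) = (\<Sum>i<l. ?z (j * l + i + K))"
        by (rule sum.reindex_bij_witness[of _ "\<lambda>i. j * l + i" "\<lambda>k. k - j * l"]) auto
      then show ?thesis unfolding m_def by (simp only: sum_distrib_left summand)
    qed
    have "(\<lambda>k. ?z (k + K)) sums (shifted_zeta w s - (\<Sum>k<K. ?z k))"
      by (rule sums_split_initial_segment[OF shifted_zeta_sums[OF s w(1)]])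
    from sums_mult[OF sums_group[OF this l(1)], of "s - 1"]
    have "(\<lambda>j. (of_real r powr s) ^ j * m s (of_real r ^ j)) sums ((s - 1) * (shifted_zeta w s - (\<Sum>k<K. ?z k)))"
      unfolding block .
    moreover have "(\<lambda>j. (of_real r powr s) ^ j * m s (of_real r ^ j)) sums N 0 s" using s by (intro N(3)) simp
    ultimately have "N 0 s = (s - 1) * (shifted_zeta w s - (\<Sum>k<K. ?z k))" by (rule sums_unique2[symmetric])
    then show "G 0 s = (s - 1) * (c + shifted_zeta w s)" by (simp add: G_def head_eq algebra_simps)
  qed
qed

lemma quadratic_poles_eq:
  assumes "0 < r" "r < 1" "ln (eta \<alpha>) = ln r"
  shows "quadratic_poles \<alpha> = {s. \<exists>p\<ge>1. complex_of_real r powr s * of_real r ^ p = 1}"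
proof (intro set_eqI)
  fix s
  have ln: "ln r \<noteq> 0" using assms by simp
  have "s \<in> quadratic_poles \<alpha> \<longleftrightarrow> (\<exists>p\<ge>1. \<exists>n::int. s = - of_nat p + 2 * of_real pi * \<i> * of_int n / of_real (ln r))"
  proof
    assume "s \<in> quadratic_poles \<alpha>"
    then obtain k n e where "s = - of_nat k + e * (2 * of_real pi * \<i> * of_nat n / of_real (ln r))" "k \<ge> 1" "e \<in> {1, -1}"
      by (auto simp: quadratic_poles_def assms(3))
    then show "\<exists>p\<ge>1. \<exists>n::int. s = - of_nat p + 2 * of_real pi * \<i> * of_int n / of_real (ln r)"
      by (intro exI[of _ k] conjI exI[of _ "if e = 1 then int n else - int n"]) auto
  next
    assume "\<exists>p\<ge>1. \<exists>n::int. s = - of_nat p + 2 * of_real pi * \<i> * of_int n / of_real (ln r)"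
    then obtain p and n :: int where p: "p \<ge> 1" "s = - of_nat p + 2 * of_real pi * \<i> * of_int n / of_real (ln r)" by blast
    define e :: complex where "e = (if n \<ge> 0 then 1 else -1)"
    have n: "of_int n = e * of_nat (nat \<bar>n\<bar>)" by (auto simp: e_def)
    have "s = - of_nat p + e * (2 * of_real pi * \<i> * of_nat (nat \<bar>n\<bar>) / of_real (ln (eta \<alpha>)))"
      unfolding p(2) n assms(3) by simp
    moreover have "e \<in> {1, -1}" by (simp add: e_def)
    ultimately show "s \<in> quadratic_poles \<alpha>" unfolding quadratic_poles_def using p(1) by blast
  qed
  also have "\<dots> \<longleftrightarrow> (\<exists>p\<ge>1. complex_of_real r powr s * of_real r ^ p = 1)"
  proof -
    have "complex_of_real r powr s * of_real r ^ p = 1 \<longleftrightarrow> (\<exists>n::int. s = - of_nat p + 2 * of_real pi * \<i> * of_int n / of_real (ln r))" for p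
    proof -
      have "complex_of_real r ^ p = exp (of_nat p * of_real (ln r))"
        using assms by (simp add: exp_of_nat_mult exp_of_real)
      then have "complex_of_real r powr s * of_real r ^ p = exp ((s + of_nat p) * of_real (ln r))"
        using assms by (simp add: powr_def Ln_of_real ring_distribs exp_add)
      also have "\<dots> = 1 \<longleftrightarrow> (\<exists>n::int. (s + of_nat p) * of_real (ln r) = 2 * of_int n * of_real pi * \<i>)"
        using exp_eq[of "(s + of_nat p) * of_real (ln r)" 0] by (simp add: mult_ac)
      also have "\<dots> \<longleftrightarrow> (\<exists>n::int. s = - of_nat p + 2 * of_real pi * \<i> * of_int n / of_real (ln r))"
        using ln by (intro ex_cong1) (auto simp: field_simps)
      finally show ?thesis .
    qed
    then show ?thesis by simp
  qed
  finally show "s \<in> quadratic_poles \<alpha> \<longleftrightarrow> s \<in> {s. \<exists>p\<ge>1. complex_of_real r powr s * of_real r ^ p = 1}" by simp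
qed

text \<open>The pole at 1 is genuine because G 0 takes there the residue 1 / \<alpha> of the
  half-plane continuation: both descriptions are holomorphic for Re s > 0 after multiplication by s
  - 1, and they agree for Re s > 1.\<close>

lemma quadratic_continuation:
  assumes quad: "quadratic_irrational \<alpha>" and w: "0 \<le> w" "w \<le> 1" and f: "\<And>s. Re s > 1 \<Longrightarrow> f s = c + shifted_zeta w s"
  shows "\<exists>g. (\<forall>s. Re s > 1 \<longrightarrow> g s = f s) \<and> g meromorphic_on UNIV \<and> g holomorphic_on (UNIV - ({1} \<union> quadratic_poles \<alpha>)) \<and>
           simple_pole g 1 \<and> (\<forall>z\<in>quadratic_poles \<alpha>. g analytic_on {z} \<or> simple_pole g z)"
proof -
  obtain r G where r: "0 < r" "r < 1" "ln (eta \<alpha>) = ln r"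
    and G: "\<And>P. G P holomorphic_on {s. Re s > - (real P + 1)}"
    "\<And>P s. Re s > - (real P + 1) \<Longrightarrow> G (Suc P) s = (1 - of_real r powr s * of_real r ^ Suc P) * G P s"
    "\<And>s. Re s > 1 \<Longrightarrow> G 0 s = (s - 1) * (c + shifted_zeta w s)"
  proof (rule quadratic_structure[OF quad w, where c = c], goal_cases)
    case (1 r G)
    show ?case by (rule 1(1)[of r G]) (fact 1)+
  qed
  obtain g A B where g: "\<And>s. Re s > 1 \<Longrightarrow> g s = f s" and AB: "A holomorphic_on {s. Re s > -1}" "B holomorphic_on {s. Re s > -1}"
    "\<And>s. g s = lead_sum UNIV s * (zeta_reg (s - 1) / (s - 1)) + A s * zeta_reg s + B s"
    using continuation_half_plane[OF w f] by metis
  define F where "F s = lead_sum UNIV s * zeta_reg (s - 1) + (s - 1) * (A s * zeta_reg s + B s)" for s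
  have "G 0 1 = F 1"
  proof (rule analytic_continuation_open[where f = "G 0" and g = F and z = 1 and s = "{s. Re s > 1}" and s' = "{s. Re s > 0}"])
    show "connected {s. Re s > (0::real)}" by (rule connected_halfspace_Re_gt)
    show "{s. Re s > 1} \<noteq> {}" by (auto intro: exI[of _ 2])
    show "G 0 holomorphic_on {s. Re s > 0}" by (rule holomorphic_on_subset[OF G(1)]) auto
    show "F holomorphic_on {s. Re s > 0}"
      unfolding F_def using edge(3)
      by (intro holomorphic_intros holomorphic_on_subset[OF lead_sum_holomorphic_edge]
            holomorphic_on_subset[OF AB(1)] holomorphic_on_subset[OF AB(2)]) auto
    fix s assume "s \<in> {s. Re s > 1}"
    then have s: "Re s > 1" "s \<noteq> 1" by auto
    have "G 0 s = (s - 1) * g s" using G(3)[OF s(1)] g[OF s(1)] f[OF s(1)] by simp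
    also have "\<dots> = F s" using s(2) by (simp add: AB(3) F_def field_simps)
    finally show "G 0 s = F s" .
  qed (auto simp: open_halfspace_Re_gt)
  also have "F 1 = of_real (1 / \<alpha>)" by (simp add: F_def zeta_reg_0 lead_sum_1)
  finally have "G 0 1 \<noteq> 0" using gt1 by simp
  then show ?thesis
    unfolding quadratic_poles_eq[OF r] using f by (intro global_continuation[OF r(1,2) G(1,2)]) (auto simp: G(3))
qed

lemma continuation_and_boundary:
  assumes w: "0 \<le> w" "w \<le> 1" and f: "\<And>s. Re s > 1 \<Longrightarrow> f s = c + shifted_zeta w s"
  shows "(\<exists>g. (\<forall>s. Re s > 1 \<longrightarrow> g s = f s) \<and>
             g holomorphic_on ({s. ereal (Re s) > - (1 / tau \<alpha>)} - {1}) \<and>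
             simple_pole g 1 \<and> residue g 1 = of_real (1 / \<alpha>)) \<and>
        (tau \<alpha> > 1 \<longrightarrow> natural_boundary f {s. ereal (Re s) = - (1 / tau \<alpha>)}) \<and>
        (quadratic_irrational \<alpha> \<longrightarrow>
          (\<exists>g. (\<forall>s. Re s > 1 \<longrightarrow> g s = f s) \<and>
               g meromorphic_on UNIV \<and>
               g holomorphic_on (UNIV - ({1} \<union> quadratic_poles \<alpha>)) \<and>
               simple_pole g 1 \<and>
               (\<forall>z \<in> quadratic_poles \<alpha>. g analytic_on {z} \<or> simple_pole g z)))"
proof (intro conjI impI)
  show "\<exists>g. (\<forall>s. Re s > 1 \<longrightarrow> g s = f s) \<and> g holomorphic_on ({s. ereal (Re s) > - (1 / tau \<alpha>)} - {1}) \<and>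
             simple_pole g 1 \<and> residue g 1 = of_real (1 / \<alpha>)"
    unfolding edge(1) using continuation_half_plane[OF w f] by (metis (no_types, lifting) Collect_cong less_ereal.simps(1))
  show "natural_boundary f {s. ereal (Re s) = - (1 / tau \<alpha>)}" if "tau \<alpha> > 1"
    unfolding edge(1) using natural_boundary_edge[OF w f that] by simp
qed (rule quadratic_continuation[OF _ w f])

end

theorem theorem2:
  fixes \<alpha> \<beta> :: real
  assumes "\<alpha> > 1" and "\<alpha> \<notin> \<rat>" and "\<beta> = 1 / \<alpha>"
  shows
    "(\<forall>f \<in> {beatty_zeta \<alpha>, sturmian_series \<beta>}.
        (\<exists>g. (\<forall>s. Re s > 1 \<longrightarrow> g s = f s) \<and>
             g holomorphic_on ({s. ereal (Re s) > - (1 / tau \<alpha>)} - {1}) \<and>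
             simple_pole g 1 \<and> residue g 1 = of_real \<beta>) \<and>
        (tau \<alpha> > 1 \<longrightarrow> natural_boundary f {s. ereal (Re s) = - (1 / tau \<alpha>)}) \<and>
        (quadratic_irrational \<alpha> \<longrightarrow>
          (\<exists>g. (\<forall>s. Re s > 1 \<longrightarrow> g s = f s) \<and>
               g meromorphic_on UNIV \<and>
               g holomorphic_on (UNIV - ({1} \<union> quadratic_poles \<alpha>)) \<and>
               simple_pole g 1 \<and>
               (\<forall>z \<in> quadratic_poles \<alpha>. g analytic_on {z} \<or> simple_pole g z))))"
proof -
  interpret beatty \<alpha> by unfold_locales (use assms in auto)
  have "beatty_zeta \<alpha> s = 0 + shifted_zeta 0 s" for s by (simp add: beatty_zeta_eq)
  moreover have "sturmian_series \<beta> s = 1 + shifted_zeta 1 s" if "Re s > 1" for s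
    using sturmian_series_eq[OF that] by (simp add: assms(3))
  ultimately show ?thesis
    unfolding assms(3) using continuation_and_boundary[of 0 "beatty_zeta \<alpha>" 0] continuation_and_boundary[of 1 "sturmian_series (1 / \<alpha>)" 1] assms(3)
    by (simp del: of_real_divide)
qed

end
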